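(* Let $\Omega\subset\mathbb{R}^N$ ($N\ge 1$) be a bounded and smooth domain and let $p\in(1,\infty)$. Let $h:[0,\infty)\to[0,\infty)$ be continuous, bounded and nondecreasing, with $h>0$ in $(0,\infty)$. Let $g:\Omega\times\mathbb{R}\to\mathbb{R}$ be a Carath\'eodory function such that: (i) there are $C,\sigma>0$ with $\sigma(N-p)\le (p-1)N+p$ such that $|g(x,t)|\le C(1+|t|^{\sigma})$ for all $(x,t)\in\Omega\times\mathbb{R}$; (ii) there exists $q\in(1,p)$ such that for a.e. $x\in\Omega$ the map $t\mapsto \frac{g(x,t)}{t^{q-1}}$ is nonincreasing in $(0,\infty)$. Let $X=W_0^{1,p}(\Omega)$ or $X=W^{1,p}(\Omega)$, and let $I:X\to\mathbb{R}$ be given by $$I(u)=\int_\Omega\left(\frac1p H(|\nabla u|^p)-G(x,u)\right)dx,\qquad H(t)=\int_0^t h(s)\,ds,\quad G(x,t)=\int_0^t g(x,s)\,ds.$$ Let $A$ be the set of nontrivial nonnegative critical points of $I$ in $X$, let $B$ be the set of nonnegative global minimizers of $I$ over $X$, and let $\mathcal{P}^{\circ}$ be the set of strongly positive functions associated with $X$ (defined in the context). Then: (1) If $X=W_0^{1,p}(\Omega)$, then $A\cap\mathcal{P}^{\circ}$ has at most one element, and $B$ has at most one element. (2) If $X=W^{1,p}(\Omega)$ and $A\cap\mathcal{P}^{\circ}$ contains a nonconstant element, then $A\cap\mathcal{P}^{\circ}$ is a singleton. Likewise, if $X=W^{1,p}(\Omega)$ and $B$ contains a nonconstant element, then $B$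 is a singleton.
   Context: The set $\mathcal{P}^{\circ}$ is defined as follows, with $\nu$ the outward unit normal to $\partial\Omega$: if $X=W_0^{1,p}(\Omega)$, then $\mathcal{P}^{\circ}=\{u\in C_0^1(\overline\Omega): u>0 \text{ in }\Omega,\ \partial_\nu u<0\text{ on }\partial\Omega\}$, where $C_0^1(\overline\Omega)$ denotes the $C^1(\overline\Omega)$ functions vanishing on $\partial\Omega$; if $X=W^{1,p}(\Omega)$, then $\mathcal{P}^{\circ}=\{u\in C^1(\overline\Omega): u>0\text{ on }\overline\Omega\}$. Under the stated assumptions $I$ is a $C^1$ functional on $X$; a critical point of $I$ is $u\in X$ with $I'(u)=0$ in the dual of $X$. A critical point is nontrivial if it is not identically zero. Inequalities between measurable functions (e.g. nonnegativity $u\ge0$) are understood almost everywhere. "Nondecreasing" means $f(t)\le f(s)$ whenever $t<s$; "nonincreasing" means $f(t)\ge f(s)$ whenever $t<s$. *)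

theory Defs
  imports "HOL-Analysis.Analysis"
begin

section \<open>Smooth functions and smooth domains\<close>

text \<open>The definition of \<open>C\<^sup>k\<close> by iterated partial derivatives; it is meant for open sets.\<close>

fun Ck_on :: "nat \<Rightarrow> 'a::euclidean_space set \<Rightarrow> ('a \<Rightarrow> real) \<Rightarrow> bool" where
  "Ck_on 0 U f \<longleftrightarrow> continuous_on U f"
| "Ck_on (Suc k) U f \<longleftrightarrow>
     f differentiable_on U \<and> (\<forall>i\<in>Basis. Ck_on k U (\<lambda>x. frechet_derivative f (at x) i))"

definition smooth_on :: "'a::euclidean_space set \<Rightarrow> ('a \<Rightarrow> real) \<Rightarrow> bool" where
  "smooth_on U f \<longleftrightarrow> (\<forall>k. Ck_on k U f)"

definition local_defining_function ::
  "'a::euclidean_space set \<Rightarrow> 'a set \<Rightarrow> ('a \<Rightarrow> real) \<Rightarrow> bool" where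
  "local_defining_function \<Omega> U \<rho> \<longleftrightarrow>
     open U \<and> smooth_on U \<rho> \<and> (\<forall>y\<in>U. \<not> GDERIV \<rho> y :> 0) \<and> \<Omega> \<inter> U = {y\<in>U. \<rho> y < 0}"

text \<open>A nonempty open connected set which, near each of its boundary points, lies on one side of
  its smooth boundary.\<close>

definition smooth_domain :: "'a::euclidean_space set \<Rightarrow> bool" where
  "smooth_domain \<Omega> \<longleftrightarrow>
     \<Omega> \<noteq> {} \<and> open \<Omega> \<and> connected \<Omega> \<and>
     (\<forall>x\<in>frontier \<Omega>. \<exists>U \<rho>. x \<in> U \<and> local_defining_function \<Omega> U \<rho>)"

text \<open>At a boundary point of a smooth domain the normalized gradient of a local defining function
  does not depend on that function, so the choice below is the only possible one.\<close>

definition outward_normal :: "'a::euclidean_space set \<Rightarrow> 'a \<Rightarrow> 'a" where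
  "outward_normal \<Omega> x =
     (SOME n. \<exists>U \<rho> D. x \<in> U \<and> local_defining_function \<Omega> U \<rho> \<and> GDERIV \<rho> x :> D \<and> n = D /\<^sub>R norm D)"


section \<open>Sobolev spaces\<close>

text \<open>Elements of the Sobolev spaces are represented by functions on the whole space. The values
  outside \<open>\<Omega>\<close> play no role, and two functions stand for the same element iff they agree almost
  everywhere on \<open>\<Omega>\<close>.\<close>

definition same_class :: "'a::euclidean_space set \<Rightarrow> ('a \<Rightarrow> real) \<Rightarrow> ('a \<Rightarrow> real) \<Rightarrow> bool" where
  "same_class \<Omega> u v \<longleftrightarrow> (AE x in lebesgue_on \<Omega>. u x = v x)"

definition Lp_fun ::
  "'a::euclidean_space set \<Rightarrow> real \<Rightarrow> ('a \<Rightarrow> 'b::euclidean_space) \<Rightarrow> bool" where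
  "Lp_fun \<Omega> p f \<longleftrightarrow>
     f \<in> borel_measurable (lebesgue_on \<Omega>) \<and> integrable (lebesgue_on \<Omega>) (\<lambda>x. norm (f x) powr p)"

definition locally_integrable ::
  "'a::euclidean_space set \<Rightarrow> ('a \<Rightarrow> 'b::euclidean_space) \<Rightarrow> bool" where
  "locally_integrable \<Omega> f \<longleftrightarrow> (\<forall>K. compact K \<and> K \<subseteq> \<Omega> \<longrightarrow> integrable (lebesgue_on K) f)"

definition test_function :: "'a::euclidean_space set \<Rightarrow> ('a \<Rightarrow> real) \<Rightarrow> bool" where
  "test_function \<Omega> \<phi> \<longleftrightarrow>
     smooth_on UNIV \<phi> \<and> compact (closure {x. \<phi> x \<noteq> 0}) \<and> closure {x. \<phi> x \<noteq> 0} \<subseteq> \<Omega>"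

definition is_weak_gradient ::
  "'a::euclidean_space set \<Rightarrow> ('a \<Rightarrow> real) \<Rightarrow> ('a \<Rightarrow> 'a) \<Rightarrow> bool" where
  "is_weak_gradient \<Omega> u V \<longleftrightarrow>
     locally_integrable \<Omega> u \<and> locally_integrable \<Omega> V \<and>
     (\<forall>\<phi>. test_function \<Omega> \<phi> \<longrightarrow> (\<forall>i\<in>Basis.
        (LINT x|lebesgue_on \<Omega>. u x * frechet_derivative \<phi> (at x) i)
          = - (LINT x|lebesgue_on \<Omega>. (V x \<bullet> i) * \<phi> x)))"

text \<open>Weak gradients are unique almost everywhere on \<open>\<Omega>\<close>.\<close>

definition weak_gradient :: "'a::euclidean_space set \<Rightarrow> ('a \<Rightarrow> real) \<Rightarrow> 'a \<Rightarrow> 'a" where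
  "weak_gradient \<Omega> u = (SOME V. is_weak_gradient \<Omega> u V)"

definition W1p :: "'a::euclidean_space set \<Rightarrow> real \<Rightarrow> ('a \<Rightarrow> real) set" where
  "W1p \<Omega> p = {u. Lp_fun \<Omega> p u \<and> (\<exists>V. is_weak_gradient \<Omega> u V \<and> Lp_fun \<Omega> p V)}"

definition W1p_norm :: "'a::euclidean_space set \<Rightarrow> real \<Rightarrow> ('a \<Rightarrow> real) \<Rightarrow> real" where
  "W1p_norm \<Omega> p u =
     ((LINT x|lebesgue_on \<Omega>. \<bar>u x\<bar> powr p)
       + (LINT x|lebesgue_on \<Omega>. norm (weak_gradient \<Omega> u x) powr p)) powr (1 / p)"

text \<open>The closure of the test functions in \<open>W1p \<Omega> p\<close>.\<close>

definition W01p :: "'a::euclidean_space set \<Rightarrow> real \<Rightarrow> ('a \<Rightarrow> real) set" where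
  "W01p \<Omega> p =
     {u \<in> W1p \<Omega> p. \<forall>\<epsilon>>0. \<exists>\<phi>. test_function \<Omega> \<phi> \<and> W1p_norm \<Omega> p (\<lambda>x. u x - \<phi> x) < \<epsilon>}"


section \<open>The functional and its critical points\<close>

definition caratheodory :: "'a::euclidean_space set \<Rightarrow> ('a \<Rightarrow> real \<Rightarrow> real) \<Rightarrow> bool" where
  "caratheodory \<Omega> g \<longleftrightarrow>
     (\<forall>t. (\<lambda>x. g x t) \<in> borel_measurable (lebesgue_on \<Omega>)) \<and>
     (AE x in lebesgue_on \<Omega>. continuous_on UNIV (g x))"

text \<open>The integral is oriented, i.e. for \<open>t < 0\<close> it is minus the integral over \<open>[t, 0]\<close>.\<close>

definition primitive :: "(real \<Rightarrow> real) \<Rightarrow> real \<Rightarrow> real" where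
  "primitive f t = (LBINT s=ereal 0..ereal t. f s)"

definition energy ::
  "'a::euclidean_space set \<Rightarrow> real \<Rightarrow> (real \<Rightarrow> real) \<Rightarrow> ('a \<Rightarrow> real \<Rightarrow> real) \<Rightarrow> ('a \<Rightarrow> real) \<Rightarrow> real" where
  "energy \<Omega> p h g u =
     (LINT x|lebesgue_on \<Omega>.
        (1 / p) * primitive h (norm (weak_gradient \<Omega> u x) powr p) - primitive (g x) (u x))"

text \<open>The Frechet derivative at \<open>u\<close> of a functional \<open>J\<close> on a space \<open>X\<close> of functions, seminormed
  by \<open>N\<close>; the derivative \<open>L\<close> is an element of the dual of \<open>X\<close>.\<close>

definition has_frechet_derivative_on ::
  "('a \<Rightarrow> real) set \<Rightarrow> (('a \<Rightarrow> real) \<Rightarrow> real) \<Rightarrow> (('a \<Rightarrow> real) \<Rightarrow> real) \<Rightarrow>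
   ('a \<Rightarrow> real) \<Rightarrow> (('a \<Rightarrow> real) \<Rightarrow> real) \<Rightarrow> bool" where
  "has_frechet_derivative_on X N J u L \<longleftrightarrow>
     (\<forall>v\<in>X. \<forall>w\<in>X. L (\<lambda>x. v x + w x) = L v + L w) \<and>
     (\<forall>v\<in>X. \<forall>c. L (\<lambda>x. c * v x) = c * L v) \<and>
     (\<exists>K. \<forall>v\<in>X. \<bar>L v\<bar> \<le> K * N v) \<and>
     (\<forall>\<epsilon>>0. \<exists>\<delta>>0. \<forall>v\<in>X. N v < \<delta> \<longrightarrow> \<bar>J (\<lambda>x. u x + v x) - J u - L v\<bar> \<le> \<epsilon> * N v)"

definition critical_point ::
  "('a \<Rightarrow> real) set \<Rightarrow> (('a \<Rightarrow> real) \<Rightarrow> real) \<Rightarrow> (('a \<Rightarrow> real) \<Rightarrow> real) \<Rightarrow> ('a \<Rightarrow> real) \<Rightarrow> bool" where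
  "critical_point X N J u \<longleftrightarrow> u \<in> X \<and> has_frechet_derivative_on X N J u (\<lambda>v. 0)"

definition nonneg_critical_points ::
  "'a::euclidean_space set \<Rightarrow> real \<Rightarrow> (real \<Rightarrow> real) \<Rightarrow> ('a \<Rightarrow> real \<Rightarrow> real) \<Rightarrow>
   ('a \<Rightarrow> real) set \<Rightarrow> ('a \<Rightarrow> real) set" where
  "nonneg_critical_points \<Omega> p h g X =
     {u. critical_point X (W1p_norm \<Omega> p) (energy \<Omega> p h g) u \<and>
         \<not> same_class \<Omega> u (\<lambda>x. 0) \<and> (AE x in lebesgue_on \<Omega>. 0 \<le> u x)}"

definition nonneg_global_minimizers ::
  "'a::euclidean_space set \<Rightarrow> real \<Rightarrow> (real \<Rightarrow> real) \<Rightarrow> ('a \<Rightarrow> real \<Rightarrow> real) \<Rightarrow>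
   ('a \<Rightarrow> real) set \<Rightarrow> ('a \<Rightarrow> real) set" where
  "nonneg_global_minimizers \<Omega> p h g X =
     {u\<in>X. (\<forall>v\<in>X. energy \<Omega> p h g u \<le> energy \<Omega> p h g v) \<and> (AE x in lebesgue_on \<Omega>. 0 \<le> u x)}"


section \<open>Strongly positive functions\<close>

text \<open>\<open>u\<close> is in \<open>C\<^sup>1\<close> of the closure of \<open>\<Omega>\<close>, and \<open>D\<close> is the continuous extension of its gradient
  to the closure, which is unique there.\<close>

definition C1_closure :: "'a::euclidean_space set \<Rightarrow> ('a \<Rightarrow> real) \<Rightarrow> ('a \<Rightarrow> 'a) \<Rightarrow> bool" where
  "C1_closure \<Omega> u D \<longleftrightarrow>
     continuous_on (closure \<Omega>) u \<and> continuous_on (closure \<Omega>) D \<and> (\<forall>x\<in>\<Omega>. GDERIV u x :> D x)"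

definition strongly_positive_W01p :: "'a::euclidean_space set \<Rightarrow> ('a \<Rightarrow> real) set" where
  "strongly_positive_W01p \<Omega> =
     {u. \<exists>D. C1_closure \<Omega> u D \<and> (\<forall>x\<in>frontier \<Omega>. u x = 0) \<and> (\<forall>x\<in>\<Omega>. 0 < u x) \<and>
             (\<forall>x\<in>frontier \<Omega>. D x \<bullet> outward_normal \<Omega> x < 0)}"

definition strongly_positive_W1p :: "'a::euclidean_space set \<Rightarrow> ('a \<Rightarrow> real) set" where
  "strongly_positive_W1p \<Omega> = {u. \<exists>D. C1_closure \<Omega> u D \<and> (\<forall>x\<in>closure \<Omega>. 0 < u x)}"


section \<open>Counting elements up to equality almost everywhere\<close>

definition at_most_one_class :: "'a::euclidean_space set \<Rightarrow> ('a \<Rightarrow> real) set \<Rightarrow> bool" where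
  "at_most_one_class \<Omega> S \<longleftrightarrow> (\<forall>u\<in>S. \<forall>v\<in>S. same_class \<Omega> u v)"

definition singleton_class :: "'a::euclidean_space set \<Rightarrow> ('a \<Rightarrow> real) set \<Rightarrow> bool" where
  "singleton_class \<Omega> S \<longleftrightarrow> (\<exists>u\<in>S. \<forall>v\<in>S. same_class \<Omega> u v)"

definition nonconstant :: "'a::euclidean_space set \<Rightarrow> ('a \<Rightarrow> real) \<Rightarrow> bool" where
  "nonconstant \<Omega> u \<longleftrightarrow> \<not> (\<exists>c. same_class \<Omega> u (\<lambda>x. c))"

end

theory Submission
  imports Defs
begin

text \<open>For nonnegative \<open>u\<close> and \<open>v\<close> let \<open>w = ((1 - t) u\<^sup>q + t v\<^sup>q)\<^bsup>1/q\<^esup>\<close>. Then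
  \<open>|\<nabla>w|\<^sup>q \<le> (1 - t) |\<nabla>u|\<^sup>q + t |\<nabla>v|\<^sup>q\<close>. Since \<open>q < p\<close>, the function \<open>s \<mapsto> H (s\<^bsup>p/q\<^esup>)\<close> is strictly
  convex and increasing, and \<open>s \<mapsto> G (x, s\<^bsup>1/q\<^esup>)\<close> is concave by the monotonicity of \<open>g (x, t) / t\<^bsup>q-1\<^esup>\<close>.
  So the energy is convex along the path, and equality at \<open>t = 1/2\<close> forces \<open>\<nabla>u = \<nabla>v\<close>, together with
  \<open>\<nabla>u = 0\<close> wherever \<open>u \<noteq> v\<close>. Hence either \<open>u = v\<close> or both functions are constant, and the only constant in
  \<open>W\<^sub>0\<^sup>1\<^sup>p\<close> is zero.

  For global minimizers equality is immediate. Two strongly positive functions are bounded by multiples of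
  each other (in the Dirichlet case by their normal derivatives), so the path starts with
  finite speed in the Sobolev norm, and a critical point cannot have larger energy than another point
  of the path.

  The subcritical growth of \<open>g\<close> enters through the Sobolev inequality: it makes \<open>G (x, u)\<close> integrable, without
  which the integral defining the energy would have the junk value zero.\<close>

section \<open>Test functions and mollifiers\<close>

text \<open>The derivative of the energy is never computed. Criticality enters only as an energy
  change of smaller order than the distance, which is weighed against the linear drop that convexity
  along the path would force if some point of it had smaller energy. Two critical points are both
  compared with their midpoint on the path, so that they and minimizers lead to the same equality
  case. The growth condition admits the critical Sobolev exponent, so the inequality is needed at
  the exponent itself: a weak-type bound, obtained by duality from an explicit vector field, is
  upgraded by dyadic truncation. The vector field needs only cones of directions that point into
  \<open>\<Omega>\<close> locally, hence neither an extension operator nor a flattening of the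
  boundary. The root in the path is not C^1 at the origin, so the chain rule is first proved for C^1
  functions of two variables with bounded derivatives and then carried over to pointwise
  limits.\<close>

lemma smooth_on_coinduct:
  assumes "f \<in> S"
    and "\<And>f. f \<in> S \<Longrightarrow> f differentiable_on U"
    and "\<And>f i. f \<in> S \<Longrightarrow> i \<in> Basis \<Longrightarrow> (\<lambda>x. frechet_derivative f (at x) i) \<in> S"
  shows "smooth_on U f"
proof -
  have "Ck_on k U f" if "f \<in> S" for k f
    using that
  proof (induction k arbitrary: f)
    case 0
    then show ?case using assms(2) by (auto intro: differentiable_imp_continuous_on)
  next
    case (Suc k)
    then show ?case using assms(2,3) by auto
  qed
  then show ?thesis using assms(1) by (auto simp: smooth_on_def)
qed

lemma smooth_on_partial:
  assumes "smooth_on U f" "i \<in> Basis"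
  shows "smooth_on U (\<lambda>x. frechet_derivative f (at x) i)"
  using assms by (metis Ck_on.simps(2) smooth_on_def)

lemma smooth_on_differentiable: "smooth_on U f \<Longrightarrow> f differentiable_on U"
  by (metis Ck_on.simps(2) smooth_on_def)

lemma smooth_on_continuous: "smooth_on U f \<Longrightarrow> continuous_on U f"
  by (metis Ck_on.simps(1) smooth_on_def)

text \<open>A total counterpart of the relation \<open>GDERIV\<close>, so that gradients of test
  functions can be written inside integrals. The value means something only where \<open>f\<close>
  is differentiable, as \<open>GDERIV_grad\<close> shows.\<close>

definition grad :: "('a::euclidean_space \<Rightarrow> real) \<Rightarrow> 'a \<Rightarrow> 'a" where
  "grad f x = (\<Sum>i\<in>Basis. frechet_derivative f (at x) i *\<^sub>R i)"

lemma grad_inner: "i \<in> Basis \<Longrightarrow> grad f x \<bullet> i = frechet_derivative f (at x) i"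
  by (simp add: grad_def)

lemma GDERIV_grad:
  assumes "f differentiable (at x)"
  shows "GDERIV f x :> grad f x"
proof -
  have d: "(f has_derivative frechet_derivative f (at x)) (at x)"
    using assms frechet_derivative_works by blast
  interpret bounded_linear "frechet_derivative f (at x)" using d by (rule has_derivative_bounded_linear)
  have "frechet_derivative f (at x) h = h \<bullet> grad f x" for h
  proof -
    have "frechet_derivative f (at x) h = frechet_derivative f (at x) (\<Sum>i\<in>Basis. (h \<bullet> i) *\<^sub>R i)"
      by (simp add: euclidean_representation)
    also have "\<dots> = h \<bullet> grad f x"
      by (simp add: sum scaleR grad_def inner_sum_right mult.commute)
    finally show ?thesis .
  qed
  then show ?thesis using d unfolding gderiv_def by presburger
qed

lemma GDERIV_unique:
  assumes "GDERIV f x :> D" "GDERIV f x :> E"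
  shows "D = E"
proof -
  have *: "(\<lambda>h. h \<bullet> D) = (\<lambda>h. h \<bullet> E)"
    using assms unfolding gderiv_def by (rule has_derivative_unique)
  have "h \<bullet> D = h \<bullet> E" for h using fun_cong[OF *, of h] .
  then show ?thesis using vector_eq_ldot by blast
qed

lemma GDERIV_frechet: "GDERIV f x :> D \<Longrightarrow> frechet_derivative f (at x) i = D \<bullet> i"
  unfolding gderiv_def using frechet_derivative_at by (metis inner_commute)

lemma smooth_on_GDERIV:
  assumes "smooth_on U f" "open U" "x \<in> U"
  shows "GDERIV f x :> grad f x"
  using assms smooth_on_differentiable differentiable_on_eq_differentiable_at GDERIV_grad by blast

lemma smooth_on_grad_continuous:
  assumes "smooth_on U f"
  shows "continuous_on U (grad f)"
  unfolding grad_def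
  by (intro continuous_intros smooth_on_continuous smooth_on_partial assms)

text \<open>The gradient is an argument, since the functions that occur are products and
  compositions whose gradients have closed forms. Vanishing is asked outside a given compact
  \<open>K\<close>, so that products and unions of supports can be handled without closures of
  nonzero sets.\<close>

definition C1c :: "'a::euclidean_space set \<Rightarrow> ('a \<Rightarrow> real) \<Rightarrow> ('a \<Rightarrow> 'a) \<Rightarrow> bool" where
  "C1c K f D \<longleftrightarrow> compact K \<and> (\<forall>x. GDERIV f x :> D x) \<and> continuous_on UNIV D \<and> (\<forall>x. x \<notin> K \<longrightarrow> f x = 0)"

lemma GDERIV_continuous: "GDERIV f x :> D \<Longrightarrow> isCont f x"
  unfolding gderiv_def by (rule has_derivative_continuous)

lemma C1c_continuous: "C1c K f D \<Longrightarrow> continuous_on UNIV f"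
  unfolding C1c_def using GDERIV_continuous by (metis continuous_at_imp_continuous_on)

lemma GDERIV_local_const:
  assumes "open A" "x \<in> A" "\<And>y. y \<in> A \<Longrightarrow> f y = c"
  shows "GDERIV f x :> 0"
proof -
  have "((\<lambda>_. c) has_derivative (\<lambda>h. h \<bullet> 0)) (at x)" by simp
  then show ?thesis unfolding gderiv_def
    by (rule has_derivative_transform_within_open[OF _ assms(1,2)]) (simp add: assms(3))
qed

lemma C1c_grad_support:
  assumes "C1c K f D" "x \<notin> K" shows "D x = 0"
  using assms GDERIV_local_const[of "-K" x f 0] GDERIV_unique
  unfolding C1c_def by (metis ComplD ComplI compact_imp_closed open_Compl)

lemma continuous_compact_support_uniform:
  fixes f :: "'a::euclidean_space \<Rightarrow> 'b::euclidean_space"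
  assumes "continuous_on UNIV f" "compact K" "\<And>x. x \<notin> K \<Longrightarrow> f x = 0"
  shows "uniformly_continuous_on UNIV f"
proof -
  obtain r where r: "K \<subseteq> ball 0 r" "r > 0"
    using assms(2) compact_imp_bounded bounded_subset_ballD by blast
  \<comment> \<open>The margin 1 makes the case split work: two points at distance less than 1
    either both lie in \<open>K'\<close> or both have norm at least \<open>r\<close>, where
    \<open>f\<close> vanishes.\<close>
  define K' where "K' = cball (0::'a) (r + 1)"
  have uc: "uniformly_continuous_on K' f"
    unfolding K'_def by (intro compact_uniformly_continuous continuous_on_subset[OF assms(1)]) auto
  show ?thesis unfolding uniformly_continuous_on_def
  proof (intro allI impI)
    fix e :: real assume "e > 0"
    then obtain d where d: "d > 0" "\<And>x x'. x \<in> K' \<Longrightarrow> x' \<in> K' \<Longrightarrow> dist x' x < d \<Longrightarrow> dist (f x') (f x) < e"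
      using uc unfolding uniformly_continuous_on_def by metis
    have "dist (f x') (f x) < e" if "dist x' x < min d 1" for x x'
    proof (cases "x \<in> K' \<and> x' \<in> K'")
      case True then show ?thesis using d that by auto
    next
      case False
      have "\<bar>norm x - norm x'\<bar> \<le> dist x' x" by (metis dist_norm norm_triangle_ineq3 dist_commute)
      then have "norm x \<ge> r" "norm x' \<ge> r"
        using False that unfolding K'_def by auto
      then have "x \<notin> K" "x' \<notin> K" using r by auto
      then show ?thesis using assms(3) \<open>e > 0\<close> by simp
    qed
    then show "\<exists>d>0. \<forall>x\<in>UNIV. \<forall>x'\<in>UNIV. dist x' x < d \<longrightarrow> dist (f x') (f x) < e"
      using d(1) by (intro exI[of _ "min d 1"]) auto
  qed
qed

lemma continuous_compact_support_bounded:
  fixes f :: "'a::euclidean_space \<Rightarrow> 'b::euclidean_space"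
  assumes "continuous_on UNIV f" "compact K" "\<And>x. x \<notin> K \<Longrightarrow> f x = 0"
  obtains B where "B > 0" "\<And>x. norm (f x) \<le> B"
proof -
  have "bounded (f ` K)"
    using assms by (meson compact_continuous_image compact_imp_bounded continuous_on_subset subset_UNIV)
  then obtain B where B: "\<And>x. x \<in> K \<Longrightarrow> norm (f x) \<le> B" "B > 0"
    by (metis (no_types, lifting) bounded_pos image_eqI)
  then have "norm (f x) \<le> B" for x using assms(3) by (cases "x \<in> K") auto
  then show ?thesis using that B by auto
qed

lemma continuous_compact_support_integrable:
  fixes f :: "'a::euclidean_space \<Rightarrow> 'b::euclidean_space"
  assumes "continuous_on UNIV f" "compact K" "\<And>x. x \<notin> K \<Longrightarrow> f x = 0"
  shows "integrable lborel f"
proof -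
  have "integrable lborel (\<lambda>x. indicator K x *\<^sub>R f x)"
    using assms by (intro borel_integrable_compact) (auto intro: continuous_on_subset)
  also have "(\<lambda>x. indicator K x *\<^sub>R f x) = f" using assms(3) by (auto simp: indicator_def)
  finally show ?thesis .
qed

text \<open>The radius \<open>d\<close> does not depend on \<open>x\<close> because \<open>D\<close>
  is uniformly continuous. This uniformity lets the first-order expansion be integrated, which is
  how derivatives are taken under the integral sign.\<close>

lemma C1c_linearization:
  assumes "C1c K f D" "e > 0"
  obtains d where "d > 0" "\<And>x h. norm h < d \<Longrightarrow> \<bar>f (x + h) - f x - h \<bullet> D x\<bar> \<le> e * norm h"
proof -
  have "uniformly_continuous_on UNIV D"
    using assms C1c_grad_support by (intro continuous_compact_support_uniform[of D K]) (auto simp: C1c_def)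
  then obtain d where d: "d > 0" "\<And>x x'. dist x' x < d \<Longrightarrow> dist (D x') (D x) < e"
    using \<open>e > 0\<close> unfolding uniformly_continuous_on_def by (metis UNIV_I)
  have "\<bar>f (x + h) - f x - h \<bullet> D x\<bar> \<le> e * norm h" if h: "norm h < d" for x h
  proof -
    have "norm (f (x + h) - f x - (x + h - x) \<bullet> D x) \<le> norm (x + h - x) * e"
    proof (rule differentiable_bound_linearization[where S = "ball x d" and f' = "\<lambda>y h. h \<bullet> D y"])
      show "x + t *\<^sub>R (x + h - x) \<in> ball x d" if "t \<in> {0..1}" for t
      proof -
        have "norm (t *\<^sub>R h) \<le> norm h" using that mult_right_mono[of t 1 "norm h"] by auto
        then show ?thesis using h by (auto simp: dist_norm norm_minus_commute)
      qed
      show "(f has_derivative (\<lambda>h. h \<bullet> D y)) (at y within ball x d)" if "y \<in> ball x d" for y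
        using assms unfolding C1c_def gderiv_def by (blast intro: has_derivative_at_withinI)
      show "onorm ((\<lambda>h. h \<bullet> D y) - (\<lambda>h. h \<bullet> D x)) \<le> e" if "y \<in> ball x d" for y
      proof (rule onorm_le)
        fix z
        have "norm (z \<bullet> (D y - D x)) \<le> norm z * norm (D y - D x)" using Cauchy_Schwarz_ineq2 by auto
        also have "\<dots> \<le> norm z * e"
          using d(2)[of y x] that by (intro mult_left_mono) (auto simp: dist_norm norm_minus_commute)
        finally show "norm (((\<lambda>h. h \<bullet> D y) - (\<lambda>h. h \<bullet> D x)) z) \<le> e * norm z"
          by (simp add: inner_diff_right mult.commute)
      qed
      show "x \<in> ball x d" using d by simp
    qed
    then show ?thesis by (simp add: mult.commute)
  qed
  then show ?thesis using that d(1) by blast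
qed

section \<open>Integrals of gradients and superpositions of translates\<close>

lemma integral_translate:
  fixes f :: "'a::euclidean_space \<Rightarrow> 'b::{banach, second_countable_topology}"
  assumes [measurable]: "f \<in> borel_measurable borel"
  shows "(LINT x|lborel. f (c + x)) = (LINT x|lborel. f x)"
proof -
  have "(LINT x|lborel. f x) = (LINT x|distr lborel borel ((+) c). f x)"
    by (simp add: lborel_distr_plus)
  also have "\<dots> = (LINT x|lborel. f (c + x))" by (rule integral_distr) auto
  finally show ?thesis by simp
qed

lemma integrable_translate:
  fixes f :: "'a::euclidean_space \<Rightarrow> 'b::{banach, second_countable_topology}"
  assumes "integrable lborel f"
  shows "integrable lborel (\<lambda>x. f (c + x))"
proof -
  have "integrable (distr lborel borel ((+) c)) f" using assms by (simp add: lborel_distr_plus)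
  then show ?thesis by (rule integrable_distr[rotated]) simp
qed

lemma integral_reflect:
  fixes f :: "'a::euclidean_space \<Rightarrow> 'b::{banach, second_countable_topology}"
  assumes [measurable]: "f \<in> borel_measurable borel"
  shows "(LINT x|lborel. f (c - x)) = (LINT x|lborel. f x)"
    and "integrable lborel (\<lambda>x. f (c - x)) \<longleftrightarrow> integrable lborel f"
proof -
  have *: "lborel = distr lborel borel (\<lambda>x. c - x)"
    using lborel_affine[of "-1" c] by (simp add: density_1)
  show "(LINT x|lborel. f (c - x)) = (LINT x|lborel. f x)"
    by (subst (2) *) (rule integral_distr[symmetric], auto)
  show "integrable lborel (\<lambda>x. f (c - x)) \<longleftrightarrow> integrable lborel f"
    by (subst (2) *) (rule integrable_distr_eq[symmetric], auto)
qed

text \<open>By translation invariance the integral of \<open>f (t *\<^sub>R i + x) - f x\<close> is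
  zero. By the uniform linearization it is also \<open>t\<close> times the integral of the partial
  derivative, up to \<open>e * t\<close> times the measure of a fixed ball. Dividing by
  \<open>t\<close> and letting \<open>e\<close> shrink gives the claim.\<close>

lemma C1c_integral_grad:
  assumes "C1c K f D"
  shows "(LINT x|lborel. D x) = 0"
proof -
  have cf: "continuous_on UNIV f" using assms by (rule C1c_continuous)
  have cD: "continuous_on UNIV D" and K: "compact K" "\<And>x. x \<notin> K \<Longrightarrow> f x = 0"
    using assms by (auto simp: C1c_def)
  have intf: "integrable lborel f" using continuous_compact_support_integrable[OF cf K] .
  have intD: "integrable lborel D"
    using continuous_compact_support_integrable[OF cD K(1) C1c_grad_support[OF assms]] .
  obtain r where r: "K \<subseteq> ball 0 r" "r > 0"
    using K(1) compact_imp_bounded bounded_subset_ballD by blast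
  \<comment> \<open>One unit larger than the support, so that the ball contains the supports of all
    translates by \<open>t < 1\<close> at once.\<close>
  define B where "B = cball (0::'a) (r + 1)"
  have bm: "emeasure lborel B < \<infinity>" unfolding B_def using emeasure_bounded_finite bounded_cball by blast
  define m where "m = measure lborel B"
  have bound: "\<bar>(LINT x|lborel. D x) \<bullet> i\<bar> \<le> e * m" if "i \<in> Basis" "e > 0" for i e
  proof -
    obtain d where d: "d > 0" "\<And>x h. norm h < d \<Longrightarrow> \<bar>f (x + h) - f x - h \<bullet> D x\<bar> \<le> e * norm h"
      using C1c_linearization[OF assms \<open>e > 0\<close>] by metis
    define t where "t = min (d/2) (1/2)"
    have t: "t > 0" "t < d" "t < 1" using d by (auto simp: t_def)
    define g where "g = (\<lambda>x. f (t *\<^sub>R i + x) - f x - t * (D x \<bullet> i))"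
    have intg: "integrable lborel g" unfolding g_def
      by (intro Bochner_Integration.integrable_diff integrable_translate intf integrable_mult_right
          integrable_inner_left intD)
    have "(LINT x|lborel. g x) = - t * ((LINT x|lborel. D x) \<bullet> i)"
      unfolding g_def using intf intD cf
      by (simp add: Bochner_Integration.integral_diff integrable_translate integral_translate
          borel_measurable_continuous_onI)
    moreover have "\<bar>LINT x|lborel. g x\<bar> \<le> (LINT x|lborel. e * t * indicator B x)"
    proof -
      have "\<bar>g x\<bar> \<le> e * t * indicator B x" for x
      proof (cases "x \<in> B")
        case True
        then show ?thesis using d(2)[of "t *\<^sub>R i" x] t that by (simp add: g_def add.commute inner_commute)
      next
        case False
        have "norm (t *\<^sub>R i + x) \<ge> norm x - norm (t *\<^sub>R i)" by (metis add.commute norm_diff_ineq)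
        then have "x \<notin> K" "t *\<^sub>R i + x \<notin> K"
          using False r t that unfolding B_def by auto
        then show ?thesis using False K C1c_grad_support[OF assms] by (simp add: g_def)
      qed
      then have "(LINT x|lborel. \<bar>g x\<bar>) \<le> (LINT x|lborel. e * t * indicator B x)"
        using intg bm B_def by (intro integral_mono integrable_mult_right integrable_real_indicator) auto
      then show ?thesis using integral_abs_bound[of lborel g] by linarith
    qed
    ultimately have "t * \<bar>(LINT x|lborel. D x) \<bullet> i\<bar> \<le> e * t * m"
      using bm t by (simp add: m_def B_def abs_mult)
    then have "t * \<bar>(LINT x|lborel. D x) \<bullet> i\<bar> \<le> t * (e * m)" by (simp add: mult_ac)
    then show ?thesis using t(1) by (meson mult_le_cancel_left_pos)
  qed
  have "(LINT x|lborel. D x) \<bullet> i = 0" if "i \<in> Basis" for i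
  proof (rule ccontr)
    assume ne: "(LINT x|lborel. D x) \<bullet> i \<noteq> 0"
    define c where "c = \<bar>(LINT x|lborel. D x) \<bullet> i\<bar>"
    have c: "c > 0" using ne by (simp add: c_def)
    have m: "m \<ge> 0" by (simp add: m_def)
    have "c \<le> c / (2 * (m + 1)) * m" using bound[OF that, of "c / (2 * (m + 1))"] c m unfolding c_def by simp
    also have "\<dots> = c * (m / (2 * (m + 1)))" by simp
    also have "\<dots> < c * 1" using c m by (intro mult_strict_left_mono) (auto simp: field_simps)
    finally show False by simp
  qed
  then show ?thesis by (metis euclidean_eqI inner_zero_left)
qed

text \<open>One statement for two uses: \<open>T y = y\<close> gives a convolution, and
  \<open>T z = fst z *\<^sub>R snd z\<close> with a weight on a cone gives the vector field of the
  Sobolev inequality. The derivative passes under the integral because the error in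
  \<open>C1c_linearization\<close> is uniform and \<open>w\<close> is integrable.\<close>

lemma superposition_GDERIV:
  fixes w :: "'b \<Rightarrow> real" and T :: "'b \<Rightarrow> 'a::euclidean_space"
  assumes "C1c K f D" and w: "integrable M w" and [measurable]: "T \<in> borel_measurable M"
  shows "GDERIV (\<lambda>x. LINT y|M. w y * f (x - T y)) x :> (LINT y|M. w y *\<^sub>R D (x - T y))"
    and "integrable M (\<lambda>y. w y * f (x - T y))"
    and "integrable M (\<lambda>y. w y *\<^sub>R D (x - T y))"
proof -
  have cf: "continuous_on UNIV f" using assms by (intro C1c_continuous)
  have cD: "continuous_on UNIV D" and K: "compact K" "\<And>x. x \<notin> K \<Longrightarrow> f x = 0"
    using assms by (auto simp: C1c_def)
  have [measurable]: "f \<in> borel_measurable borel" "D \<in> borel_measurable borel"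
    using cf cD by (auto intro: borel_measurable_continuous_onI)
  obtain Bf where Bf: "\<And>x. norm (f x) \<le> Bf" "Bf > 0" using continuous_compact_support_bounded[OF cf K] by auto
  obtain BD where BD: "\<And>x. norm (D x) \<le> BD" "BD > 0"
    using continuous_compact_support_bounded[OF cD K(1) C1c_grad_support[OF assms(1)]] by auto
  have [measurable]: "w \<in> borel_measurable M" using w by auto
  show i1: "integrable M (\<lambda>y. w y * f (x - T y))" for x
    by (rule Bochner_Integration.integrable_bound[OF integrable_mult_left[OF w, of Bf]])
      (auto simp: abs_mult intro!: mult_left_mono order_trans[OF Bf(1)[simplified]])
  show i2: "integrable M (\<lambda>y. w y *\<^sub>R D (x - T y))" for x
    by (rule Bochner_Integration.integrable_bound[OF integrable_mult_left[OF w, of BD]])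
      (auto simp: abs_mult intro!: mult_left_mono order_trans[OF BD(1)])
  show "GDERIV (\<lambda>x. LINT y|M. w y * f (x - T y)) x :> (LINT y|M. w y *\<^sub>R D (x - T y))"
    unfolding gderiv_def has_derivative_at_alt
  proof (intro conjI allI impI)
    show "bounded_linear (\<lambda>h. h \<bullet> (LINT y|M. w y *\<^sub>R D (x - T y)))" by (rule bounded_linear_inner_left)
    fix e :: real assume e: "e > 0"
    define m where "m = (LINT y|M. \<bar>w y\<bar>)"
    have m: "m \<ge> 0" unfolding m_def by simp
    define e' where "e' = e / (m + 1)"
    have e': "e' > 0" "e' * m \<le> e" using e m by (auto simp: e'_def field_simps)
    obtain d where d: "d > 0" "\<And>x h. norm h < d \<Longrightarrow> \<bar>f (x + h) - f x - h \<bullet> D x\<bar> \<le> e' * norm h"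
      using C1c_linearization[OF assms(1) e'(1)] by metis
    have "norm ((LINT y|M. w y * f (z - T y)) - (LINT y|M. w y * f (x - T y)) -
         (z - x) \<bullet> (LINT y|M. w y *\<^sub>R D (x - T y))) \<le> e * norm (z - x)" if "norm (z - x) < d" for z
    proof -
      have "(LINT y|M. w y * f (z - T y)) - (LINT y|M. w y * f (x - T y)) -
         (z - x) \<bullet> (LINT y|M. w y *\<^sub>R D (x - T y)) =
         (LINT y|M. w y * f (z - T y) - w y * f (x - T y) - (z - x) \<bullet> (w y *\<^sub>R D (x - T y)))"
        using i1 i2 by (simp add: Bochner_Integration.integral_diff del: inner_scaleR_right)
      also have "norm \<dots> \<le> (LINT y|M. (e' * norm (z - x)) * \<bar>w y\<bar>)"
      proof (rule order_trans[OF integral_norm_bound], rule integral_mono)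
        show "integrable M (\<lambda>y. norm (w y * f (z - T y) - w y * f (x - T y) - (z - x) \<bullet> (w y *\<^sub>R D (x - T y))))"
          using i1 i2 by (intro integrable_norm Bochner_Integration.integrable_diff integrable_inner_right)
        show "integrable M (\<lambda>y. (e' * norm (z - x)) * \<bar>w y\<bar>)" using w by simp
        fix y
        have "w y * f (z - T y) - w y * f (x - T y) - (z - x) \<bullet> (w y *\<^sub>R D (x - T y)) =
           w y * (f ((x - T y) + (z - x)) - f (x - T y) - (z - x) \<bullet> D (x - T y))"
          by (simp add: algebra_simps)
        also have "norm \<dots> \<le> \<bar>w y\<bar> * (e' * norm (z - x))"
          using d(2)[OF that, of "x - T y"] by (simp add: abs_mult mult_left_mono)
        finally show "norm (w y * f (z - T y) - w y * f (x - T y) - (z - x) \<bullet> (w y *\<^sub>R D (x - T y)))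
          \<le> (e' * norm (z - x)) * \<bar>w y\<bar>" by (simp add: mult_ac)
      qed
      also have "\<dots> = (e' * m) * norm (z - x)" by (simp add: m_def mult_ac)
      also have "\<dots> \<le> e * norm (z - x)" using e' by (intro mult_right_mono) auto
      finally show ?thesis .
    qed
    then show "\<exists>d>0. \<forall>z. norm (z - x) < d \<longrightarrow> norm ((LINT y|M. w y * f (z - T y)) - (LINT y|M. w y * f (x - T y)) -
         (z - x) \<bullet> (LINT y|M. w y *\<^sub>R D (x - T y))) \<le> e * norm (z - x)"
      using d(1) by blast
  qed
qed

lemma smooth_C1c:
  assumes "smooth_on UNIV f" "compact K" "\<And>x. x \<notin> K \<Longrightarrow> f x = 0"
  shows "C1c K f (grad f)"
  using assms smooth_on_GDERIV smooth_on_grad_continuous unfolding C1c_def by blast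

text \<open>Every partial derivative of a superposition is again a superposition, of a partial
  derivative of \<open>f\<close>, which is smooth and vanishes outside the same \<open>K\<close>.
  The set of these superpositions is the invariant for \<open>smooth_on_coinduct\<close>.\<close>

lemma superposition_smooth:
  fixes w :: "'b \<Rightarrow> real" and T :: "'b \<Rightarrow> 'a::euclidean_space"
  assumes "smooth_on UNIV f" "compact K" "\<And>x. x \<notin> K \<Longrightarrow> f x = 0"
    and w: "integrable M w" and T: "T \<in> borel_measurable M"
  shows "smooth_on UNIV (\<lambda>x. LINT y|M. w y * f (x - T y))"
proof (rule smooth_on_coinduct[where S = "{\<lambda>x. LINT y|M. w y * f (x - T y) |f. smooth_on UNIV f \<and> (\<forall>x. x \<notin> K \<longrightarrow> f x = 0)}"])
  show "(\<lambda>x. LINT y|M. w y * f (x - T y)) \<in> {\<lambda>x. LINT y|M. w y * f (x - T y) |f. smooth_on UNIV f \<and> (\<forall>x. x \<notin> K \<longrightarrow> f x = 0)}"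
    using assms by blast
next
  fix F assume "F \<in> {\<lambda>x. LINT y|M. w y * f (x - T y) |f. smooth_on UNIV f \<and> (\<forall>x. x \<notin> K \<longrightarrow> f x = 0)}"
  then obtain f where f: "F = (\<lambda>x. LINT y|M. w y * f (x - T y))" "smooth_on UNIV f" "\<And>x. x \<notin> K \<Longrightarrow> f x = 0"
    by auto
  have c: "C1c K f (grad f)" using smooth_C1c f assms(2) by blast
  note gd = superposition_GDERIV[OF c w T]
  show "F differentiable_on UNIV"
    unfolding f(1) using gd(1) unfolding gderiv_def differentiable_on_def differentiable_def by blast
  fix i :: 'a assume i: "i \<in> Basis"
  have "(\<lambda>x. frechet_derivative F (at x) i) = (\<lambda>x. LINT y|M. w y * frechet_derivative f (at (x - T y)) i)"
  proof
    fix x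
    have "frechet_derivative F (at x) i = (LINT y|M. w y *\<^sub>R grad f (x - T y)) \<bullet> i"
      using GDERIV_frechet[OF gd(1)] f(1) by simp
    also have "\<dots> = (LINT y|M. (w y *\<^sub>R grad f (x - T y)) \<bullet> i)"
      by (intro integral_inner_left[symmetric] gd(3))
    finally show "frechet_derivative F (at x) i = (LINT y|M. w y * frechet_derivative f (at (x - T y)) i)"
      using i by (simp add: grad_inner)
  qed
  moreover have "frechet_derivative f (at x) i = 0" if "x \<notin> K" for x
    using C1c_grad_support[OF c that] i by (metis grad_inner inner_zero_left)
  ultimately show "(\<lambda>x. frechet_derivative F (at x) i) \<in> {\<lambda>x. LINT y|M. w y * f (x - T y) |f. smooth_on UNIV f \<and> (\<forall>x. x \<notin> K \<longrightarrow> f x = 0)}"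
    using smooth_on_partial[OF f(2) i]
    by (intro CollectI exI[of _ "\<lambda>x. frechet_derivative f (at x) i"]) auto
qed

text \<open>The functions \<open>t \<mapsto> t\<^sup>-\<^sup>k exp(-1/t)\<close>, extended by zero; their linear span is closed under
  differentiation.\<close>

definition flat_exp :: "nat \<Rightarrow> real \<Rightarrow> real" where
  "flat_exp k t = (if t > 0 then exp (- 1 / t) / t ^ k else 0)"

text \<open>The term of order \<open>k + 2\<close> of the exponential series at \<open>1 / t\<close>
  alone gives the bound. The two spare powers of \<open>t\<close> make the difference quotient at
  the origin tend to zero.\<close>

lemma flat_exp_bound: "\<bar>flat_exp k t\<bar> \<le> fact (k + 2) * t\<^sup>2"
proof (cases "t > 0")
  case True
  have "(1 / t) ^ (k + 2) / fact (k + 2) \<le> exp (1 / t)"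
  proof -
    have "(\<Sum>n\<in>{k + 2}. (1 / t) ^ n /\<^sub>R fact n) \<le> (\<Sum>n. (1 / t) ^ n /\<^sub>R fact n)"
      using True by (intro sum_le_suminf summable_exp_generic) auto
    then show ?thesis by (simp add: exp_def divide_inverse mult.commute)
  qed
  moreover define F :: real where "F = fact (k + 2)"
  moreover define s where "s = t ^ (k + 2)"
  ultimately have "1 / (s * F) \<le> exp (1 / t)" "s > 0" "F > 0" using True by (auto simp: power_divide)
  then have "1 \<le> exp (1 / t) * (s * F)" by (simp add: divide_le_eq)
  then have "exp (- (1 / t)) \<le> F * s" by (simp add: exp_minus field_simps)
  then have "exp (- 1 / t) \<le> fact (k + 2) * t ^ (k + 2)" unfolding s_def F_def by simp
  then show ?thesis using True by (simp add: flat_exp_def divide_le_eq power_add power2_eq_square mult_ac)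
qed (simp add: flat_exp_def)

lemma DERIV_flat_exp: "DERIV (flat_exp k) t :> flat_exp (k + 2) t - real k * flat_exp (k + 1) t"
proof -
  consider "t > 0" | "t < 0" | "t = 0" by linarith
  then show ?thesis
  proof cases
    case 1
    have "DERIV (\<lambda>t. exp (- 1 / t) / t ^ k) t :> flat_exp (k + 2) t - real k * flat_exp (k + 1) t"
    proof -
      have "DERIV (\<lambda>t. exp (- 1 / t) / t ^ k) t :>
          (exp (- 1 / t) * (1 / t\<^sup>2) * t ^ k - exp (- 1 / t) * (real k * t ^ (k - 1))) / (t ^ k * t ^ k)"
        by (rule derivative_eq_intros refl | use 1 in \<open>simp add: power2_eq_square\<close>)+
      also have "(exp (- 1 / t) * (1 / t\<^sup>2) * t ^ k - exp (- 1 / t) * (real k * t ^ (k - 1))) / (t ^ k * t ^ k)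
          = flat_exp (k + 2) t - real k * flat_exp (k + 1) t"
        using 1 by (cases k) (auto simp: flat_exp_def field_simps power2_eq_square)
      finally show ?thesis .
    qed
    then show ?thesis
      by (rule has_field_derivative_transform_within_open[where S = "{0<..}"])
        (use 1 in \<open>auto simp: flat_exp_def\<close>)
  next
    case 2
    have "DERIV (\<lambda>t. 0) t :> flat_exp (k + 2) t - real k * flat_exp (k + 1) t"
      using 2 by (simp add: flat_exp_def)
    then show ?thesis
      by (rule has_field_derivative_transform_within_open[where S = "{..<0}"])
        (use 2 in \<open>auto simp: flat_exp_def\<close>)
  next
    case 3
    have "((\<lambda>h. flat_exp k h / h) \<longlongrightarrow> 0) (at 0)"
    proof (rule tendsto_0_le[where K = "fact (k + 2)" and f = "\<lambda>h. h"])
      show "((\<lambda>h. h) \<longlongrightarrow> 0) (at (0::real))" by (rule tendsto_ident_at)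
      have "norm (flat_exp k h / h) \<le> norm h * fact (k + 2)" if "h \<noteq> 0" for h
      proof -
        have "\<bar>flat_exp k h\<bar> \<le> (\<bar>h\<bar> * fact (k + 2)) * \<bar>h\<bar>"
          using flat_exp_bound[of k h] by (simp add: power2_eq_square mult_ac del: fact_Suc add_2_eq_Suc')
        then have "\<bar>flat_exp k h\<bar> / \<bar>h\<bar> \<le> \<bar>h\<bar> * fact (k + 2)" using that by (subst pos_divide_le_eq) auto
        then show ?thesis by simp
      qed
      then show "\<forall>\<^sub>F h in at 0. norm (flat_exp k h / h) \<le> norm h * fact (k + 2)"
        by (simp add: eventually_at_filter)
    qed
    then show ?thesis using 3 by (simp add: DERIV_def flat_exp_def)
  qed
qed

text \<open>An algebra that is closed under partial derivatives and contains products of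
  one-dimensional bumps. Its members are smooth by coinduction, with no formula for higher
  derivatives.\<close>

inductive_set bump_alg :: "('a::euclidean_space \<Rightarrow> real) set" where
  const: "(\<lambda>x. c) \<in> bump_alg"
| flat: "(\<lambda>x. flat_exp k (c + x \<bullet> a)) \<in> bump_alg"
| add: "f \<in> bump_alg \<Longrightarrow> g \<in> bump_alg \<Longrightarrow> (\<lambda>x. f x + g x) \<in> bump_alg"
| mult: "f \<in> bump_alg \<Longrightarrow> g \<in> bump_alg \<Longrightarrow> (\<lambda>x. f x * g x) \<in> bump_alg"

lemma bump_alg_prod:
  "finite I \<Longrightarrow> (\<And>i. i \<in> I \<Longrightarrow> f i \<in> bump_alg) \<Longrightarrow> (\<lambda>x. \<Prod>i\<in>I. f i x) \<in> bump_alg"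
proof (induction I rule: finite_induct)
  case empty
  then show ?case using bump_alg.const[of 1] by simp
next
  case (insert i I)
  then show ?case using bump_alg.mult[of "f i" "\<lambda>x. \<Prod>i\<in>I. f i x"] by simp
qed

lemma bump_alg_derivative:
  "f \<in> bump_alg \<Longrightarrow> \<exists>D. \<forall>x. (f has_derivative D x) (at x) \<and> (\<forall>i. (\<lambda>x. D x i) \<in> bump_alg)"
proof (induction rule: bump_alg.induct)
  case (const c)
  then show ?case using bump_alg.const[of 0] by (intro exI[of _ "\<lambda>x h. 0"]) auto
next
  case (flat k c a)
  have "((\<lambda>x. flat_exp k (c + x \<bullet> a)) has_derivative
      (\<lambda>h. (h \<bullet> a) * (flat_exp (k + 2) (c + x \<bullet> a) - real k * flat_exp (k + 1) (c + x \<bullet> a)))) (at x)" for x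
    by (rule has_derivative_eq_rhs[OF has_derivative_compose[OF _ DERIV_flat_exp[unfolded has_field_derivative_def]]])
      (auto intro!: derivative_eq_intros)
  moreover have "(\<lambda>x. (h \<bullet> a) * (flat_exp (k + 2) (c + x \<bullet> a) - real k * flat_exp (k + 1) (c + x \<bullet> a))) \<in> bump_alg" for h
    using bump_alg.mult[OF bump_alg.const[of "h \<bullet> a"] bump_alg.add[OF bump_alg.flat[of "k+2" c a]
        bump_alg.mult[OF bump_alg.const[of "- real k"] bump_alg.flat[of "k+1" c a]]]] by simp
  ultimately show ?case
    by (intro exI[of _ "\<lambda>x h. (h \<bullet> a) * (flat_exp (k + 2) (c + x \<bullet> a) - real k * flat_exp (k + 1) (c + x \<bullet> a))"]) auto
next
  case (add f g)
  then obtain D E where "\<forall>x. (f has_derivative D x) (at x) \<and> (\<forall>i. (\<lambda>x. D x i) \<in> bump_alg)"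
    "\<forall>x. (g has_derivative E x) (at x) \<and> (\<forall>i. (\<lambda>x. E x i) \<in> bump_alg)" by blast
  then show ?case
    by (intro exI[of _ "\<lambda>x h. D x h + E x h"]) (auto intro: has_derivative_add bump_alg.add)
next
  case (mult f g)
  then obtain D E where "\<forall>x. (f has_derivative D x) (at x) \<and> (\<forall>i. (\<lambda>x. D x i) \<in> bump_alg)"
    "\<forall>x. (g has_derivative E x) (at x) \<and> (\<forall>i. (\<lambda>x. E x i) \<in> bump_alg)" by blast
  then show ?case using mult.hyps
    by (intro exI[of _ "\<lambda>x h. f x * E x h + D x h * g x"]) (auto intro!: has_derivative_mult bump_alg.add bump_alg.mult)
qed

lemma bump_alg_smooth:
  assumes "f \<in> bump_alg" shows "smooth_on UNIV f"
proof (rule smooth_on_coinduct[of f bump_alg])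
  fix f :: "'a \<Rightarrow> real" assume "f \<in> bump_alg"
  then obtain D where D: "\<forall>x. (f has_derivative D x) (at x) \<and> (\<forall>i. (\<lambda>x. D x i) \<in> bump_alg)"
    using bump_alg_derivative by blast
  then show "f differentiable_on UNIV" by (auto simp: differentiable_on_def differentiable_def)
  have "frechet_derivative f (at x) = D x" for x using D frechet_derivative_at by metis
  then show "(\<lambda>x. frechet_derivative f (at x) i) \<in> bump_alg" for i using D by simp
qed fact

lemma continuous_nonneg_integral_pos:
  fixes f :: "'a::euclidean_space \<Rightarrow> real"
  assumes "continuous_on UNIV f" "integrable lborel f" "\<And>x. 0 \<le> f x" "f a \<noteq> 0"
  shows "0 < (LINT x|lborel. f x)"
proof (rule ccontr)
  assume "\<not> 0 < (LINT x|lborel. f x)"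
  then have "(LINT x|lborel. f x) = 0" using assms(3) Bochner_Integration.integral_nonneg[of lborel f] by fastforce
  then have "AE x in lborel. f x = 0" using integral_nonneg_eq_0_iff_AE[OF assms(2)] assms(3) by simp
  then have "AE x in lebesgue. f x = 0" by (rule AE_completion)
  then have "{x. f x \<noteq> 0} \<in> null_sets lebesgue" by (simp add: completion.AE_iff_null_sets)
  then have "negligible {x. f x \<noteq> 0}" by (simp add: negligible_iff_null_sets)
  moreover have "open {x. f x \<noteq> 0}"
    by (intro open_Collect_neq assms(1) continuous_on_const)
  ultimately show False using open_not_negligible assms(4) by blast
qed

text \<open>Evenness is included because \<open>moll n (x - y)\<close> serves both as a kernel in
  \<open>x\<close> and, for fixed \<open>x\<close>, as a test function of \<open>y\<close>.\<close>

definition mollifier :: "real \<Rightarrow> ('a::euclidean_space \<Rightarrow> real) \<Rightarrow> bool" where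
  "mollifier e f \<longleftrightarrow> smooth_on UNIV f \<and> (\<forall>x. 0 \<le> f x) \<and> (\<forall>x. f (- x) = f x) \<and>
     (\<forall>x. norm x > e \<longrightarrow> f x = 0) \<and> (LINT x|lborel. f x) = 1"

lemma mollifier_exists:
  assumes "e > 0"
  shows "\<exists>f::'a::euclidean_space \<Rightarrow> real. mollifier e f"
proof -
  \<comment> \<open>A product of coordinate bumps is supported in a cube of half side
    \<open>d\<close>. The norm is at most the sum of the absolute coordinates, so this
    \<open>d\<close> puts the cube inside the ball of radius \<open>e\<close>.\<close>
  define d where "d = e / real DIM('a)"
  have d: "d > 0" using assms by (simp add: d_def)
  define b where "b = (\<lambda>x::'a. \<Prod>i\<in>Basis. flat_exp 0 (d + x \<bullet> i) * flat_exp 0 (d + x \<bullet> (- i)))"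
  have balg: "b \<in> bump_alg" unfolding b_def
    by (intro bump_alg_prod bump_alg.mult bump_alg.flat) auto
  have bn: "b x \<ge> 0" for x unfolding b_def by (intro prod_nonneg) (auto simp: flat_exp_def)
  have bs: "b x = 0" if "norm x > e" for x
  proof -
    have "\<exists>i\<in>Basis. \<bar>x \<bullet> i\<bar> > d"
    proof (rule ccontr)
      assume "\<not> ?thesis"
      then have "(\<Sum>i\<in>Basis. \<bar>x \<bullet> i\<bar>) \<le> (\<Sum>i\<in>(Basis::'a set). d)" by (intro sum_mono) (auto simp: not_less)
      also have "\<dots> = e" by (simp add: d_def)
      finally show False using norm_le_l1[of x] that by linarith
    qed
    then obtain i where "i \<in> Basis" "\<bar>x \<bullet> i\<bar> > d" by blast
    then show ?thesis unfolding b_def by (intro prod_zero bexI[of _ i]) (auto simp: flat_exp_def)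
  qed
  have be: "b (- x) = b x" for x by (simp add: b_def mult.commute)
  have b0: "b 0 \<noteq> 0" using d by (auto simp: b_def flat_exp_def)
  have sm: "smooth_on UNIV b" using balg by (rule bump_alg_smooth)
  have c: "continuous_on UNIV b" using sm by (rule smooth_on_continuous)
  have int: "integrable lborel b"
    by (rule continuous_compact_support_integrable[OF c compact_cball[of 0 e]]) (use bs in auto)
  have pos: "0 < (LINT x|lborel. b x)" using continuous_nonneg_integral_pos[OF c int bn b0] .
  define f where "f = (\<lambda>x. (1 / (LINT x|lborel. b x)) * b x)"
  have "f \<in> bump_alg" unfolding f_def by (intro bump_alg.mult bump_alg.const balg)
  then have "mollifier e f"
    unfolding mollifier_def using bump_alg_smooth bn bs be pos int
    by (auto simp: f_def)
  then show ?thesis by blast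
qed

definition moll :: "nat \<Rightarrow> 'a::euclidean_space \<Rightarrow> real" where
  "moll n = (SOME f. mollifier (1 / Suc n) f)"

lemma mollifier_moll: "mollifier (1 / Suc n) (moll n)"
  unfolding moll_def by (rule someI_ex[OF mollifier_exists]) simp

lemma moll_nonneg: "0 \<le> moll n x"
  and moll_integral: "(LINT x|lborel. moll n x) = 1"
  and moll_smooth: "smooth_on UNIV (moll n)"
  and moll_support: "x \<notin> cball 0 (1 / Suc n) \<Longrightarrow> moll n x = 0"
  using mollifier_moll[of n] by (auto simp: mollifier_def not_le simp del: of_nat_Suc)

lemma moll_minus: "moll n (- x) = moll n x"
  using mollifier_moll[of n] unfolding mollifier_def by blast

lemma moll_diff_commute: "moll n (x - y) = moll n (y - x)"
  using moll_minus[of n "x - y"] by simp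

lemma moll_C1c: "C1c (cball 0 (1 / Suc n)) (moll n) (grad (moll n))"
  using moll_smooth moll_support by (intro smooth_C1c) auto

lemma moll_continuous: "continuous_on UNIV (moll n)"
  using moll_C1c C1c_continuous by blast

lemma moll_measurable [measurable]: "moll n \<in> borel_measurable borel"
  using moll_continuous by (rule borel_measurable_continuous_onI)

lemma moll_integrable: "integrable lborel (moll n)"
  using continuous_compact_support_integrable[OF moll_continuous compact_cball moll_support] .

section \<open>Mollification of integrable functions\<close>

lemma inner_regular_compact:
  fixes A :: "'a::euclidean_space set"
  assumes A: "A \<in> sets borel" "emeasure lborel A < \<infinity>" and e: "e > 0"
  obtains K where "compact K" "K \<subseteq> A" "measure lborel A < measure lborel K + e"
proof (cases "measure lborel A = 0")
  case True
  then show ?thesis using that[of "{}"] e by auto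
next
  case False
  \<comment> \<open>Inner regularity is applied to a finite measure, namely Lebesgue measure
    restricted to \<open>A\<close> in the form of a density.\<close>
  define M where "M = density lborel (indicator A)"
  have [measurable]: "A \<in> sets borel" by fact
  have M: "emeasure M B = emeasure lborel (A \<inter> B)" if "B \<in> sets borel" for B
    unfolding M_def using that A
    by (subst emeasure_density) (auto simp: indicator_inter_arith[symmetric])
  have "emeasure M A = (SUP K\<in>{K. K \<subseteq> A \<and> compact K}. emeasure M K)"
    by (rule inner_regular) (use A M in \<open>auto simp: M_def\<close>)
  moreover have "emeasure M A > ennreal (measure lborel A - e)"
  proof -
    have "emeasure M A = ennreal (measure lborel A)"
      using M[OF A(1)] A(2) emeasure_eq_ennreal_measure[of lborel A] by auto
    moreover have "measure lborel A > 0" using False by (simp add: zero_less_measure_iff)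
    ultimately show ?thesis using e by (simp add: ennreal_lessI)
  qed
  ultimately obtain K where K: "K \<subseteq> A" "compact K" "ennreal (measure lborel A - e) < emeasure M K"
    by (auto simp: less_SUP_iff)
  have "emeasure M K = emeasure lborel K" using M[of K] K by (simp add: compact_imp_closed Int_absorb1)
  also have "\<dots> = ennreal (measure lborel K)"
    using emeasure_compact_finite[OF K(2)] by (intro emeasure_eq_ennreal_measure) auto
  finally have "measure lborel A - e < measure lborel K"
    using K(3) by (cases "measure lborel A - e \<ge> 0")
      (auto simp: ennreal_less_iff intro: less_le_trans[OF _ measure_nonneg])
  then show ?thesis using K that by auto
qed

text \<open>Take \<open>K\<close> compact and \<open>U\<close> open with
  \<open>K \<subseteq> A \<subseteq> U\<close>. A shift shorter than the distance from
  \<open>K\<close> to the complement of \<open>U\<close> changes membership in \<open>A\<close> only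
  if \<open>x\<close> or \<open>z + x\<close> lies in \<open>U - K\<close>, a set of small
  measure.\<close>

lemma translation_L1_indicator:
  fixes A :: "'a::euclidean_space set" and c :: "'b::euclidean_space"
  assumes A: "A \<in> sets borel" "emeasure lborel A < \<infinity>" and e: "e > 0"
  shows "\<exists>d>0. \<forall>z. norm z < d \<longrightarrow>
    (LINT x|lborel. norm (indicator A (z + x) *\<^sub>R c - indicator A x *\<^sub>R c)) \<le> e"
proof -
  \<comment> \<open>\<open>W\<close> has measure at most \<open>2 * e'\<close> and is counted twice,
    for \<open>x\<close> and for \<open>z + x\<close>, hence the 4. Adding 1 to
    \<open>norm c\<close> avoids a division by zero.\<close>
  define e' where "e' = e / (norm c + 1) / 4"
  have e': "e' > 0" unfolding e'_def using e by (intro divide_pos_pos add_nonneg_pos) auto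
  obtain K where K: "compact K" "K \<subseteq> A" "measure lborel A < measure lborel K + e'"
    using inner_regular_compact[OF A e'] by blast
  obtain U where U: "open U" "A \<subseteq> U" "emeasure lborel (U - A) < e'"
    using outer_regular_lborel[OF A(1) e'] by blast
  define W where "W = U - K"
  have Kb: "K \<in> sets lborel" "emeasure lborel K < \<infinity>" using K emeasure_compact_finite[OF K(1)] by (auto simp: compact_imp_closed)
  have [measurable]: "W \<in> sets borel" "A \<in> sets borel" using U K A by (auto simp: W_def compact_imp_closed)
  have "measure lborel (A - K) = measure lborel A - measure lborel K"
    using A K Kb by (intro measure_Diff) auto
  then have mAK: "measure lborel (A - K) < e'" using K by simp
  have eAK: "emeasure lborel (A - K) < \<infinity>"
    using A emeasure_mono[of "A - K" A lborel] by (auto intro: le_less_trans)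
  have W: "W = (U - A) \<union> (A - K)" using U K by (auto simp: W_def)
  have "emeasure lborel W \<le> emeasure lborel (U - A) + emeasure lborel (A - K)"
    unfolding W using U A Kb by (intro emeasure_subadditive) auto
  also have "\<dots> \<le> ennreal e' + ennreal e'"
  proof (rule add_mono)
    have "emeasure lborel (A - K) = ennreal (measure lborel (A - K))"
      using eAK by (intro emeasure_eq_ennreal_measure) auto
    also have "\<dots> \<le> ennreal e'" using mAK by (intro ennreal_leI) simp
    finally show "emeasure lborel (A - K) \<le> ennreal e'" .
  qed (use U in auto)
  finally have eW: "emeasure lborel W \<le> ennreal (2 * e')" using e' by (simp flip: ennreal_plus)
  then have fW: "emeasure lborel W < \<infinity>" using ennreal_less_top le_less_trans by (metis infinity_ennreal_def)
  have mW: "measure lborel W \<le> 2 * e'" unfolding measure_def using eW e' by (intro enn2real_leI) auto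
  have iW: "integrable lborel (indicat_real W)" using fW by (intro integrable_real_indicator) auto
  obtain d where d: "d > 0" "\<And>x y. x \<in> K \<Longrightarrow> dist x y < d \<Longrightarrow> y \<in> U"
  proof (cases "K = {} \<or> U = UNIV")
    case True then show ?thesis using that[of 1] by auto
  next
    case False
    then have "setdist K (- U) > 0"
      using K U by (subst setdist_gt_0_compact_closed) auto
    then show ?thesis using that[of "setdist K (- U)"] setdist_le_dist[of _ K _ "- U"]
      by (metis ComplI not_less)
  qed
  have "(LINT x|lborel. norm (indicator A (z + x) *\<^sub>R c - indicator A x *\<^sub>R c)) \<le> e" if z: "norm z < d" for z
  proof -
    have "norm (indicator A (z + x) *\<^sub>R c - indicator A x *\<^sub>R c) \<le> norm c * (indicator W x + indicator W (z + x))" for x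
    proof (cases "z + x \<in> A \<longleftrightarrow> x \<in> A")
      case True then show ?thesis by (auto simp: indicator_def)
    next
      case False
      have "x \<in> W \<or> z + x \<in> W"
        using False d(2)[of x "z + x"] d(2)[of "z + x" x] z U K unfolding W_def by (auto simp: dist_norm)
      then show ?thesis using False by (auto simp: indicator_def)
    qed
    then have "(LINT x|lborel. norm (indicator A (z + x) *\<^sub>R c - indicator A x *\<^sub>R c)) \<le>
       (LINT x|lborel. norm c * (indicator W x + indicator W (z + x)))"
      using A(2) by (intro integral_mono integrable_norm Bochner_Integration.integrable_diff integrable_mult_right
          Bochner_Integration.integrable_add iW integrable_translate[OF iW]
          integrable_scaleR_left integrable_translate[of "indicat_real A"] integrable_real_indicator) auto
    also have "\<dots> = norm c * (2 * measure lborel W)"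
      using iW integrable_translate[OF iW, of z] integral_translate[of "indicat_real W" z] by simp
    also have "\<dots> \<le> norm c * (4 * e')" using mW by (intro mult_left_mono) auto
    also have "\<dots> = e * (norm c / (norm c + 1))"
    proof -
      have "4 * (a / 4) = a" for a :: real by simp
      then have "4 * e' = e / (norm c + 1)" unfolding e'_def by blast
      then show ?thesis by simp
    qed
    also have "\<dots> \<le> e * 1" using e by (intro mult_left_mono divide_le_eq_1[THEN iffD2]) (auto intro: add_nonneg_pos)
    finally show ?thesis by simp
  qed
  then show ?thesis using d(1) by blast
qed

text \<open>Continuity of translations in L^1 by approximation: it holds for indicators and is
  stable under sums and dominated pointwise limits.\<close>

lemma translation_L1:
  fixes w :: "'a::euclidean_space \<Rightarrow> 'b::euclidean_space"
  assumes "integrable lborel w" and "e > 0"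
  shows "\<exists>d>0. \<forall>z. norm z < d \<longrightarrow> (LINT x|lborel. norm (w (z + x) - w x)) \<le> e"
  using assms
proof (induction arbitrary: e rule: integrable_induct)
  case (base A c)
  then show ?case using translation_L1_indicator by auto
next
  case (add f g)
  obtain d1 where d1: "d1 > 0" "\<And>z. norm z < d1 \<Longrightarrow> (LINT x|lborel. norm (f (z + x) - f x)) \<le> e / 2"
    using add.IH(1)[of "e/2"] add.prems by auto
  obtain d2 where d2: "d2 > 0" "\<And>z. norm z < d2 \<Longrightarrow> (LINT x|lborel. norm (g (z + x) - g x)) \<le> e / 2"
    using add.IH(2)[of "e/2"] add.prems by auto
  have i: "integrable lborel (\<lambda>x. norm (f (z + x) - f x))" "integrable lborel (\<lambda>x. norm (g (z + x) - g x))"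
     "integrable lborel (\<lambda>x. norm (f (z + x) + g (z + x) - (f x + g x)))" for z
    using add.hyps integrable_translate[of f z] integrable_translate[of g z] by auto
  have "(LINT x|lborel. norm (f (z + x) + g (z + x) - (f x + g x))) \<le> e" if "norm z < min d1 d2" for z
  proof -
    have "(LINT x|lborel. norm (f (z + x) + g (z + x) - (f x + g x)))
      \<le> (LINT x|lborel. norm (f (z + x) - f x) + norm (g (z + x) - g x))"
      using i by (intro integral_mono) (auto simp: norm_diff_triangle_ineq)
    also have "\<dots> \<le> e/2 + e/2" using i d1(2)[of z] d2(2)[of z] that by (simp add: add_mono)
    finally show ?thesis by simp
  qed
  then show ?case using d1(1) d2(1) by (intro exI[of _ "min d1 d2"]) auto
next
  case (lim f s)
  have "(\<lambda>i. LINT x|lborel. norm (s i x - f x)) \<longlonglongrightarrow> (LINT x|(lborel::'a measure). (0::real))"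
  proof (rule integral_dominated_convergence[where w = "\<lambda>x. 3 * norm (f x)"])
    show "AE x in lborel. norm (norm (s i x - f x)) \<le> 3 * norm (f x)" for i
    proof (rule AE_I2)
      fix x
      have "norm (s i x - f x) \<le> norm (s i x) + norm (f x)" by (rule norm_triangle_ineq4)
      also have "\<dots> \<le> 3 * norm (f x)" using lim.hyps(3)[of x i] by simp
      finally show "norm (norm (s i x - f x)) \<le> 3 * norm (f x)" by simp
    qed
    show "AE x in lborel. (\<lambda>i. norm (s i x - f x)) \<longlonglongrightarrow> 0"
      using lim.hyps(2) by (intro AE_I2 tendsto_norm_zero) (auto simp: LIM_zero)
  qed (use lim.hyps in auto)
  then have "eventually (\<lambda>i. (LINT x|lborel. norm (s i x - f x)) < e / 3) sequentially"
    using lim.prems by (intro order_tendstoD(2)) auto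
  then obtain i where i: "(LINT x|lborel. norm (s i x - f x)) < e / 3"
    using eventually_happens' sequentially_bot by blast
  obtain d where d: "d > 0" "\<And>z. norm z < d \<Longrightarrow> (LINT x|lborel. norm (s i (z + x) - s i x)) \<le> e / 3"
    using lim.IH[of "e/3" i] lim.prems by auto
  have I: "integrable lborel (\<lambda>x. norm (s i x - f x))" "integrable lborel (\<lambda>x. norm (s i (z + x) - f (z + x)))"
     "integrable lborel (\<lambda>x. norm (s i (z + x) - s i x))" "integrable lborel (\<lambda>x. norm (f (z + x) - f x))" for z
    using lim.hyps(1)[of i] lim.hyps(4) integrable_translate[of f z] integrable_translate[of "s i" z] by auto
  have "(LINT x|lborel. norm (f (z + x) - f x)) \<le> e" if z: "norm z < d" for z
  proof -
    have "(LINT x|lborel. norm (f (z + x) - f x)) \<le>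
      (LINT x|lborel. norm (s i (z + x) - f (z + x)) + norm (s i (z + x) - s i x) + norm (s i x - f x))"
    proof (intro integral_mono)
      fix x
      have "f (z + x) - f x = - (s i (z + x) - f (z + x)) + (s i (z + x) - s i x) + (s i x - f x)" by simp
      also have "norm \<dots> \<le> norm (s i (z + x) - f (z + x)) + norm (s i (z + x) - s i x) + norm (s i x - f x)"
        by (intro order_trans[OF norm_triangle_ineq] add_mono) (auto simp: norm_minus_commute intro: order_trans[OF norm_triangle_ineq])
      finally show "norm (f (z + x) - f x) \<le> norm (s i (z + x) - f (z + x)) + norm (s i (z + x) - s i x) + norm (s i x - f x)" .
    qed (use I in auto)
    also have "\<dots> = (LINT x|lborel. norm (s i x - f x)) + (LINT x|lborel. norm (s i (z + x) - s i x)) + (LINT x|lborel. norm (s i x - f x))"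
      using I integral_translate[of "\<lambda>x. norm (s i x - f x)" z] by auto
    also have "\<dots> \<le> e" using i d(2)[OF z] by linarith
    finally show ?thesis .
  qed
  then show ?case using d(1) by blast
qed

definition mollify :: "nat \<Rightarrow> ('a::euclidean_space \<Rightarrow> 'b::euclidean_space) \<Rightarrow> 'a \<Rightarrow> 'b" where
  "mollify n w x = (LINT y|lborel. moll n (x - y) *\<^sub>R w y)"

lemma mollify_integrable:
  fixes w :: "'a::euclidean_space \<Rightarrow> 'b::euclidean_space"
  assumes "integrable lborel w"
  shows "integrable lborel (\<lambda>y. moll n (x - y) *\<^sub>R w y)"
proof -
  obtain B where B: "\<And>x::'a. norm (moll n x) \<le> B" "B > 0"
    using continuous_compact_support_bounded[OF moll_continuous compact_cball moll_support] by metis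
  have [measurable]: "w \<in> borel_measurable borel" using assms by auto
  show ?thesis
    by (rule Bochner_Integration.integrable_bound[OF integrable_scaleR_right[OF assms, of B]])
      (use B in \<open>auto intro!: mult_right_mono simp: order_trans[OF B(1)[simplified]]\<close>)
qed

lemma mollify_alt:
  fixes w :: "'a::euclidean_space \<Rightarrow> 'b::euclidean_space"
  assumes [measurable]: "w \<in> borel_measurable borel"
  shows "mollify n w x = (LINT z|lborel. moll n z *\<^sub>R w (x - z))"
  unfolding mollify_def
  by (subst integral_reflect(1)[of "\<lambda>y. moll n (x - y) *\<^sub>R w y" x, symmetric]) auto

text \<open>The difference \<open>mollify n w x - w x\<close> is an average of
  \<open>w (x - z) - w x\<close> over \<open>norm z \<le> 1 / Suc n\<close>, so by Fubini its L^1
  norm is at most an average of L^1 norms of translation differences.\<close>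

lemma mollify_L1:
  fixes w :: "'a::euclidean_space \<Rightarrow> 'b::euclidean_space"
  assumes w: "integrable lborel w"
  shows "integrable lborel (mollify n w)"
    and "(\<lambda>n. LINT x|lborel. norm (mollify n w x - w x)) \<longlonglongrightarrow> 0"
proof -
  have [measurable]: "w \<in> borel_measurable borel" using assms by auto
  define F where "F n z x = moll n z *\<^sub>R (w (x - z) - w x)" for n z x
  have [measurable]: "(\<lambda>(z, x). F n z x) \<in> borel_measurable (lborel \<Otimes>\<^sub>M lborel)" for n
    unfolding F_def by measurable
  have i1: "integrable lborel (\<lambda>x. norm (w (x - z) - w x))" for z
    using integrable_translate[OF w, of "- z"] w by (intro integrable_norm Bochner_Integration.integrable_diff) auto
  have nF: "(LINT x|lborel. norm (F n z x)) = moll n z * (LINT x|lborel. norm (w (x - z) - w x))" for n z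
    unfolding F_def using moll_nonneg[of n z] by simp
  define m where "m = (LINT x|lborel. norm (w x))"
  \<comment> \<open>A crude bound, uniform in \<open>z\<close>, is enough for integrability on the
    product space; smallness comes from \<open>translation_L1\<close> afterwards.\<close>
  have le2m: "(LINT x|lborel. norm (w (x - z) - w x)) \<le> 2 * m" for z
  proof -
    have "(LINT x|lborel. norm (w (x - z) - w x)) \<le> (LINT x|lborel. norm (w (- z + x)) + norm (w x))"
      using i1[of z] w integrable_translate[OF w, of "-z"]
      by (intro integral_mono) (auto simp: norm_triangle_ineq4)
    also have "\<dots> = 2 * m"
      using w integrable_translate[OF w, of "-z"] integral_translate[of "\<lambda>x. norm (w x)" "-z"]
      by (simp add: m_def)
    finally show ?thesis .
  qed
  have [measurable]: "(\<lambda>z. LINT x|lborel. norm (F n z x)) \<in> borel_measurable lborel" for n by measurable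
  have iF: "integrable (lborel \<Otimes>\<^sub>M lborel) (\<lambda>(z, x). F n z x)" for n
  proof (rule lborel_pair.Fubini_integrable)
    show "integrable lborel (\<lambda>z. LINT x|lborel. norm (case (z, x) of (z, x) \<Rightarrow> F n z x))"
    proof (rule Bochner_Integration.integrable_bound)
      show "integrable lborel (\<lambda>z. moll n z * (2 * m))" by (intro integrable_mult_left moll_integrable)
      show "AE z in lborel. norm (LINT x|lborel. norm (case (z, x) of (z, x) \<Rightarrow> F n z x)) \<le> norm (moll n z * (2 * m))"
      proof (rule AE_I2)
        fix z :: 'a
        have "0 \<le> (LINT x|lborel. norm (w (x - z) - w x))" by simp
        then show "norm (LINT x|lborel. norm (case (z, x) of (z, x) \<Rightarrow> F n z x)) \<le> norm (moll n z * (2 * m))"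
          using le2m[of z] moll_nonneg[of n z] by (simp add: nF abs_mult mult_left_mono)
      qed
    qed measurable
    show "AE z in lborel. integrable lborel (\<lambda>x. case (z, x) of (z, x) \<Rightarrow> F n z x)"
      using integrable_translate[OF w, of "- _"] w unfolding F_def by auto
  qed measurable
  have im: "integrable lborel (\<lambda>z. moll n z *\<^sub>R w (x - z))" for n x
    using mollify_integrable[OF w, of n x] integral_reflect(2)[of "\<lambda>y. moll n (x - y) *\<^sub>R w y" x] by simp
  have eq: "mollify n w x - w x = (LINT z|lborel. F n z x)" for n x
  proof -
    have "(LINT z|lborel. F n z x) = (LINT z|lborel. moll n z *\<^sub>R w (x - z)) - (LINT (z::'a)|lborel. moll n z *\<^sub>R w x)"
      unfolding F_def scaleR_diff_right
      using Bochner_Integration.integral_diff[OF im[of n x] integrable_scaleR_left[OF moll_integrable, of n "w x"]] by simp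
    then show ?thesis by (simp add: mollify_alt moll_integrable moll_integral)
  qed
  have ieq: "integrable lborel (\<lambda>x. mollify n w x - w x)" for n
    unfolding eq by (rule lborel_pair.integrable_snd[OF iF])
  from Bochner_Integration.integrable_add[OF this[of n] w] show "integrable lborel (mollify n w)" by simp
  show "(\<lambda>n. LINT x|lborel. norm (mollify n w x - w x)) \<longlonglongrightarrow> 0"
  proof (rule LIMSEQ_I)
    fix r :: real assume "r > 0"
    obtain d where d: "d > 0" "\<And>z. norm z < d \<Longrightarrow> (LINT x|lborel. norm (w (z + x) - w x)) \<le> r / 2"
      using translation_L1[OF w, of "r/2"] \<open>r > 0\<close> by auto
    obtain N where N: "1 / real (Suc N) < d" using d(1) nat_approx_posE by blast
    have "norm ((LINT x|lborel. norm (mollify n w x - w x)) - 0) < r" if "n \<ge> N" for n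
    proof -
      have iFn: "integrable (lborel \<Otimes>\<^sub>M lborel) (\<lambda>(z, x). norm (F n z x))"
        using integrable_norm[OF iF[of n]] by (simp add: case_prod_unfold)
      have "(LINT x|lborel. norm (mollify n w x - w x)) \<le> (LINT x|lborel. (LINT z|lborel. norm (F n z x)))"
        unfolding eq
        by (intro integral_mono integrable_norm lborel_pair.integrable_snd[OF iF] lborel_pair.integrable_snd[OF iFn] integral_norm_bound)
      also have "\<dots> = (LINT z|lborel. (LINT x|lborel. norm (F n z x)))"
        using lborel_pair.Fubini_integral[OF iFn] by simp
      also have "\<dots> \<le> (LINT (z::'a)|lborel. moll n z * (r / 2))"
      proof (rule integral_mono)
        show "integrable lborel (\<lambda>z. LINT x|lborel. norm (F n z x))"
          using lborel_pair.integrable_fst[OF iFn] .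
        show "integrable lborel (\<lambda>z::'a. moll n z * (r / 2))" by (intro integrable_mult_left moll_integrable)
        fix z :: 'a
        show "(LINT x|lborel. norm (F n z x)) \<le> moll n z * (r / 2)"
        proof (cases "moll n z = 0")
          case True then show ?thesis by (simp add: nF)
        next
          case False
          then have "norm z \<le> 1 / Suc n" using moll_support[of z n] by (auto simp: dist_norm)
          also have "\<dots> \<le> 1 / Suc N" using that by (simp add: frac_le)
          finally have "norm (- z) < d" using N by simp
          from mult_left_mono[OF d(2)[OF this] moll_nonneg[of n z]] show ?thesis by (simp add: nF)
        qed
      qed
      also have "\<dots> = r / 2" by (simp add: moll_integral)
      finally have "(LINT x|lborel. norm (mollify n w x - w x)) \<le> r / 2" .
      moreover have "(LINT x|lborel. norm (mollify n w x - w x)) \<ge> 0" by simp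
      ultimately show ?thesis using \<open>r > 0\<close> by simp
    qed
    then show "\<exists>no. \<forall>n\<ge>no. norm ((LINT x|lborel. norm (mollify n w x - w x)) - 0) < r" by blast
  qed
qed

section \<open>Weak gradients\<close>

text \<open>Fubini's theorem is applied on products of Borel measures, whereas Sobolev functions are
  only Lebesgue measurable. Each component agrees almost everywhere with a Borel function.\<close>

lemma borel_representative:
  fixes f :: "'a::euclidean_space \<Rightarrow> 'b::euclidean_space"
  assumes K: "K \<in> sets borel" and f: "integrable (lebesgue_on K) f"
  obtains f' where "integrable lborel f'" "\<And>x. x \<notin> K \<Longrightarrow> f' x = 0"
    "AE x in lebesgue. x \<in> K \<longrightarrow> f' x = f x"
proof -
  define g where "g x = indicator K x *\<^sub>R f x" for x
  have g: "integrable lebesgue g"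
    using f K unfolding g_def by (subst (asm) integrable_restrict_space) auto
  have "\<exists>h\<in>borel_measurable lborel. AE x in lborel. g x \<bullet> i = h x" for i
    by (rule completion_ex_borel_measurable_real) (use g in \<open>auto intro!: borel_measurable_inner\<close>)
  then have ex: "\<exists>h. h \<in> borel_measurable borel \<and> (AE x in lborel. g x \<bullet> i = h x)" for i by (auto simp: Bex_def)
  define h where "h i = (SOME h. h \<in> borel_measurable borel \<and> (AE x in lborel. g x \<bullet> i = h x))" for i
  have h: "h i \<in> borel_measurable borel" "AE x in lborel. g x \<bullet> i = h i x" for i
    using someI_ex[OF ex[of i]] unfolding h_def by blast+
  note [measurable] = h(1) K
  define f' where "f' x = indicator K x *\<^sub>R (\<Sum>i\<in>Basis. h i x *\<^sub>R i)" for x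
  have [measurable]: "f' \<in> borel_measurable borel" unfolding f'_def by measurable
  have "AE x in lebesgue. \<forall>i\<in>Basis. g x \<bullet> i = h i x"
    using h(2) by (intro AE_finite_allI) (auto intro: AE_completion)
  then have ae: "AE x in lebesgue. f' x = g x"
  proof eventually_elim
    case (elim x)
    then have "(\<Sum>i\<in>Basis. h i x *\<^sub>R i) = (\<Sum>i\<in>Basis. (g x \<bullet> i) *\<^sub>R i)" by (intro sum.cong) auto
    then show ?case by (auto simp: f'_def euclidean_representation g_def indicator_def)
  qed
  have "f' \<in> borel_measurable lebesgue" by (rule measurable_completion) simp
  then have "integrable lebesgue f'" using g ae integrable_cong_AE[of f' lebesgue g] by auto
  then have "integrable lborel f'" by (subst (asm) integrable_completion) auto
  moreover have "AE x in lebesgue. x \<in> K \<longrightarrow> f' x = f x"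
    using ae by eventually_elim (auto simp: g_def)
  ultimately show ?thesis using that[of f'] by (auto simp: f'_def)
qed

lemma integral_representative:
  fixes f f' :: "'a::euclidean_space \<Rightarrow> 'b::euclidean_space" and \<psi> :: "'a \<Rightarrow> real"
  assumes K: "K \<in> sets borel" "K \<subseteq> \<Omega>" "\<Omega> \<in> sets borel"
    and f: "f \<in> borel_measurable (lebesgue_on K)" and f': "f' \<in> borel_measurable borel"
    and ae: "AE x in lebesgue. x \<in> K \<longrightarrow> f' x = f x"
    and \<psi>: "\<psi> \<in> borel_measurable borel" "\<And>x. x \<notin> K \<Longrightarrow> \<psi> x = 0"
  shows "(LINT x|lebesgue_on \<Omega>. \<psi> x *\<^sub>R f x) = (LINT x|lborel. \<psi> x *\<^sub>R f' x)"
proof -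
  have m: "(\<lambda>x. indicator K x *\<^sub>R f x) \<in> borel_measurable lebesgue"
    using f K(1) by (subst (asm) borel_measurable_restrict_space_iff) auto
  have [measurable]: "\<psi> \<in> borel_measurable borel" "f' \<in> borel_measurable borel" by fact+
  have \<psi>l: "\<psi> \<in> borel_measurable lebesgue" by (rule measurable_completion) simp
  have "(LINT x|lebesgue_on \<Omega>. \<psi> x *\<^sub>R f x) = (LINT x|lebesgue. indicator \<Omega> x *\<^sub>R (\<psi> x *\<^sub>R f x))"
    using K by (intro integral_restrict_space) auto
  also have "\<dots> = (LINT x|lebesgue. \<psi> x *\<^sub>R (indicator K x *\<^sub>R f x))"
    using K \<psi>(2) by (intro Bochner_Integration.integral_cong) (auto simp: indicator_def)
  also have "\<dots> = (LINT x|lebesgue. \<psi> x *\<^sub>R f' x)"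
  proof (rule integral_cong_AE)
    show "(\<lambda>x. \<psi> x *\<^sub>R (indicator K x *\<^sub>R f x)) \<in> borel_measurable lebesgue"
      using m \<psi>l by (rule borel_measurable_scaleR[rotated])
    show "(\<lambda>x. \<psi> x *\<^sub>R f' x) \<in> borel_measurable lebesgue" by (rule measurable_completion) simp
    show "AE x in lebesgue. \<psi> x *\<^sub>R (indicator K x *\<^sub>R f x) = \<psi> x *\<^sub>R f' x"
      using ae by eventually_elim (use \<psi>(2) in \<open>auto simp: indicator_def\<close>)
  qed
  also have "\<dots> = (LINT x|lborel. \<psi> x *\<^sub>R f' x)" by (rule integral_completion) simp
  finally show ?thesis .
qed

lemma test_function_C1c:
  assumes "test_function \<Omega> \<phi>"
  shows "C1c (closure {x. \<phi> x \<noteq> 0}) \<phi> (grad \<phi>)"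
proof (rule smooth_C1c)
  show "\<phi> x = 0" if "x \<notin> closure {x. \<phi> x \<noteq> 0}" for x
    using that closure_subset[of "{x. \<phi> x \<noteq> 0}"] by auto
qed (use assms in \<open>auto simp: test_function_def\<close>)

lemma test_functionI:
  assumes "smooth_on UNIV \<phi>" "compact K" "K \<subseteq> \<Omega>" "\<And>x. x \<notin> K \<Longrightarrow> \<phi> x = 0"
  shows "test_function \<Omega> \<phi>"
proof -
  have "closure {x. \<phi> x \<noteq> 0} \<subseteq> K"
    using assms by (intro closure_minimal) (auto simp: compact_imp_closed)
  moreover from this have "compact (closure {x. \<phi> x \<noteq> 0})"
    using compact_Int_closed[OF assms(2) closed_closure, of "{x. \<phi> x \<noteq> 0}"] by (simp add: Int_absorb1)
  ultimately show ?thesis unfolding test_function_def using assms by blast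
qed

text \<open>On a compact subset of \<open>\<Omega>\<close> a Sobolev function and its weak gradient are represented by
  globally defined Borel functions, to which Fubini's theorem applies.\<close>

definition weak_gradient_rep :: "'a::euclidean_space set \<Rightarrow> ('a \<Rightarrow> real) \<Rightarrow> ('a \<Rightarrow> 'a) \<Rightarrow> bool" where
  "weak_gradient_rep K u V \<longleftrightarrow> integrable lborel u \<and> integrable lborel V \<and>
     (\<forall>x. x \<notin> K \<longrightarrow> u x = 0 \<and> V x = 0) \<and>
     (\<forall>\<phi>. smooth_on UNIV \<phi> \<and> (\<forall>x. x \<notin> K \<longrightarrow> \<phi> x = 0) \<longrightarrow>
        (LINT x|lborel. u x *\<^sub>R grad \<phi> x) = - (LINT x|lborel. \<phi> x *\<^sub>R V x))"

lemma weak_gradient_representative: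
  assumes \<Omega>: "open \<Omega>" and K: "compact K" "K \<subseteq> \<Omega>" and wg: "is_weak_gradient \<Omega> u V"
  obtains u' V' where "weak_gradient_rep K u' V'"
    "AE x in lebesgue. x \<in> K \<longrightarrow> u' x = u x" "AE x in lebesgue. x \<in> K \<longrightarrow> V' x = V x"
proof -
  have Kb: "K \<in> sets borel" "\<Omega> \<in> sets borel" using K \<Omega> by (auto simp: compact_imp_closed)
  have iu: "integrable (lebesgue_on K) u" and iV: "integrable (lebesgue_on K) V"
    using wg K by (auto simp: is_weak_gradient_def locally_integrable_def)
  obtain u' where u': "integrable lborel u'" "\<And>x. x \<notin> K \<Longrightarrow> u' x = 0" "AE x in lebesgue. x \<in> K \<longrightarrow> u' x = u x"
    using borel_representative[OF Kb(1) iu] by blast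
  obtain V' where V': "integrable lborel V'" "\<And>x. x \<notin> K \<Longrightarrow> V' x = 0" "AE x in lebesgue. x \<in> K \<longrightarrow> V' x = V x"
    using borel_representative[OF Kb(1) iV] by blast
  have [measurable]: "u' \<in> borel_measurable borel" "V' \<in> borel_measurable borel" using u' V' by auto
  have "(LINT x|lborel. u' x *\<^sub>R grad \<phi> x) = - (LINT x|lborel. \<phi> x *\<^sub>R V' x)"
    if s: "smooth_on UNIV \<phi>" "\<And>x. x \<notin> K \<Longrightarrow> \<phi> x = 0" for \<phi>
  proof -
    have c: "C1c K \<phi> (grad \<phi>)" using s K smooth_C1c by blast
    have [measurable]: "\<phi> \<in> borel_measurable borel" "grad \<phi> \<in> borel_measurable borel"
      using c C1c_continuous by (auto simp: C1c_def intro!: borel_measurable_continuous_onI)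
    obtain B1 where B1: "\<And>x. norm (\<phi> x) \<le> B1"
      using continuous_compact_support_bounded[OF C1c_continuous[OF c] K(1) s(2)] by metis
    obtain B2 where B2: "\<And>x. norm (grad \<phi> x) \<le> B2"
      using continuous_compact_support_bounded[of "grad \<phi>" K] c C1c_grad_support[OF c] K(1) unfolding C1c_def by metis
    have i1: "integrable lborel (\<lambda>x. u' x *\<^sub>R grad \<phi> x)"
      by (rule Bochner_Integration.integrable_bound[OF integrable_mult_left[OF u'(1), of B2]])
         (auto simp: abs_mult intro!: mult_left_mono order_trans[OF B2])
    have i2: "integrable lborel (\<lambda>x. \<phi> x *\<^sub>R V' x)"
      by (rule Bochner_Integration.integrable_bound[OF integrable_scaleR_right[OF V'(1), of B1]])
         (auto simp: abs_mult intro!: mult_right_mono order_trans[OF B1[simplified]])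
    have t: "test_function \<Omega> \<phi>" using s K by (intro test_functionI)
    show ?thesis
    proof (rule euclidean_eqI)
      fix i :: 'a assume i: "i \<in> Basis"
      have "(LINT x|lebesgue_on \<Omega>. (grad \<phi> x \<bullet> i) *\<^sub>R u x) = (LINT x|lborel. (grad \<phi> x \<bullet> i) *\<^sub>R u' x)"
        by (rule integral_representative[OF Kb(1) K(2) Kb(2)]) (use iu u' C1c_grad_support[OF c] in auto)
      moreover have "(LINT x|lebesgue_on \<Omega>. \<phi> x *\<^sub>R (V x \<bullet> i)) = (LINT x|lborel. \<phi> x *\<^sub>R (V' x \<bullet> i))"
        by (rule integral_representative[OF Kb(1) K(2) Kb(2)]) (use iV V' s in \<open>auto intro!: borel_measurable_inner\<close>)
      moreover have "(LINT x|lebesgue_on \<Omega>. u x * (grad \<phi> x \<bullet> i)) = - (LINT x|lebesgue_on \<Omega>. (V x \<bullet> i) * \<phi> x)"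
        using wg t i unfolding is_weak_gradient_def by (simp add: grad_inner)
      moreover have "(LINT x|lborel. u' x *\<^sub>R grad \<phi> x) \<bullet> i = (LINT x|lborel. (grad \<phi> x \<bullet> i) *\<^sub>R u' x)"
        using i1 by (subst integral_inner_left[symmetric]) (auto simp: mult.commute)
      moreover have "(LINT x|lborel. \<phi> x *\<^sub>R V' x) \<bullet> i = (LINT x|lborel. \<phi> x *\<^sub>R (V' x \<bullet> i))"
        using i2 by (subst integral_inner_left[symmetric]) auto
      ultimately show "(LINT x|lborel. u' x *\<^sub>R grad \<phi> x) \<bullet> i = - (LINT x|lborel. \<phi> x *\<^sub>R V' x) \<bullet> i"
        by (simp add: mult.commute)
    qed
  qed
  then have "weak_gradient_rep K u' V'" using u' V' unfolding weak_gradient_rep_def by blast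
  then show ?thesis using that u' V' by blast
qed

lemma GDERIV_mollify:
  fixes u :: "'a::euclidean_space \<Rightarrow> real"
  assumes "integrable lborel u"
  shows "GDERIV (mollify n u) x :> (LINT y|lborel. u y *\<^sub>R grad (moll n) (x - y))"
proof -
  have "mollify n u = (\<lambda>x. LINT y|lborel. u y * moll n (x - y))"
    by (intro ext) (simp add: mollify_def mult.commute)
  then show ?thesis using superposition_GDERIV(1)[OF moll_C1c assms, of "\<lambda>y. y" n x] by simp
qed

lemma mollify_continuous:
  fixes w :: "'a::euclidean_space \<Rightarrow> 'b::euclidean_space"
  assumes "integrable lborel w"
  shows "continuous_on UNIV (mollify n w)"
proof -
  have "continuous_on UNIV (\<lambda>x. mollify n w x \<bullet> i)" for i
  proof -
    have "(\<lambda>x. mollify n w x \<bullet> i) = mollify n (\<lambda>y. w y \<bullet> i)"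
    proof
      fix x
      show "mollify n w x \<bullet> i = mollify n (\<lambda>y. w y \<bullet> i) x"
        unfolding mollify_def by (simp flip: integral_inner_left[OF mollify_integrable[OF assms]])
    qed
    moreover have "isCont (mollify n (\<lambda>y. w y \<bullet> i)) x" for x
      by (rule GDERIV_continuous[OF GDERIV_mollify]) (intro integrable_inner_left assms)
    ultimately show ?thesis by (simp add: continuous_at_imp_continuous_on)
  qed
  then show ?thesis by (subst continuous_on_componentwise) blast
qed

lemma smooth_moll_shift: "smooth_on UNIV (\<lambda>y. moll n (x - y))"
proof -
  \<comment> \<open>A superposition over a one-point measure, which makes a single translate an
    instance of \<open>superposition_smooth\<close>; evenness allows \<open>moll n (y - x)\<close>
    here.\<close>
  have "smooth_on UNIV (\<lambda>y. LINT z|count_space {()}. 1 * moll n (y - x))"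
    by (rule superposition_smooth[where K = "cball 0 (1 / Suc n)"])
      (use moll_smooth moll_support in \<open>auto intro!: integrable_count_space\<close>)
  then show ?thesis by (simp add: lebesgue_integral_count_space_finite moll_diff_commute)
qed

lemma GDERIV_moll_shift: "GDERIV (\<lambda>y. moll n (x - y)) y :> - grad (moll n) (x - y)"
proof -
  have "(moll n has_derivative (\<lambda>h. h \<bullet> grad (moll n) (x - y))) (at (x - y))"
    using moll_C1c[of n] unfolding C1c_def gderiv_def by blast
  moreover have "((\<lambda>y. x - y) has_derivative (\<lambda>h. - h)) (at y)"
    using has_derivative_diff[OF has_derivative_const has_derivative_ident] by simp
  ultimately have "((\<lambda>y. moll n (x - y)) has_derivative (\<lambda>h. (- h) \<bullet> grad (moll n) (x - y))) (at y)"
    using has_derivative_compose[of "\<lambda>y. x - y" "\<lambda>h. - h" y UNIV "moll n" "\<lambda>h. h \<bullet> grad (moll n) (x - y)"] by simp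
  then show ?thesis by (simp add: gderiv_def)
qed

text \<open>If the ball of radius \<open>1 / Suc n\<close> about \<open>x\<close> lies in
  \<open>K\<close>, then \<open>moll n (x - y)\<close> is an admissible test function of
  \<open>y\<close>. Testing with it moves the derivative from the kernel to
  \<open>V\<close>.\<close>

lemma GDERIV_mollify_weak:
  assumes rep: "weak_gradient_rep K u V" and x: "cball x (1 / Suc n) \<subseteq> K"
  shows "GDERIV (mollify n u) x :> mollify n V x"
proof -
  have u: "integrable lborel u" using rep by (simp add: weak_gradient_rep_def)
  have "moll n (x - y) = 0" if "y \<notin> K" for y
    using that x by (intro moll_support) (auto simp: subset_iff dist_norm norm_minus_commute)
  then have "(LINT y|lborel. u y *\<^sub>R grad (\<lambda>y. moll n (x - y)) y) = - mollify n V x"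
    using rep smooth_moll_shift[of n x] unfolding mollify_def weak_gradient_rep_def by blast
  moreover have "grad (\<lambda>y. moll n (x - y)) y = - grad (moll n) (x - y)" for y
    using GDERIV_moll_shift smooth_on_GDERIV[OF smooth_moll_shift] GDERIV_unique by blast
  ultimately show ?thesis using GDERIV_mollify[OF u, of n x] by simp
qed

section \<open>The chain rule for functions of two Sobolev functions\<close>

lemma C1c_product:
  assumes \<Omega>: "open \<Omega>" "\<And>x. x \<in> \<Omega> \<Longrightarrow> GDERIV u x :> D x" "continuous_on \<Omega> D"
    and c: "C1c K \<phi> G" and K: "K \<subseteq> \<Omega>"
  shows "C1c K (\<lambda>x. u x * \<phi> x) (\<lambda>x. u x *\<^sub>R G x + \<phi> x *\<^sub>R D x)"
  unfolding C1c_def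
proof (intro conjI allI impI)
  show cK: "compact K" using c by (simp add: C1c_def)
  then have oK: "open (- K)" by (simp add: compact_imp_closed open_Compl)
  have \<phi>0: "\<phi> x = 0" "G x = 0" if "x \<notin> K" for x
    using c C1c_grad_support[OF c that] that by (auto simp: C1c_def)
  show "u x * \<phi> x = 0" if "x \<notin> K" for x using \<phi>0 that by simp
  show "GDERIV (\<lambda>x. u x * \<phi> x) x :> u x *\<^sub>R G x + \<phi> x *\<^sub>R D x" for x
  proof (cases "x \<in> K")
    case True
    then have "GDERIV \<phi> x :> G x" "GDERIV u x :> D x" using c \<Omega> K by (auto simp: C1c_def)
    then show ?thesis by (intro GDERIV_mult)
  next
    case False
    then have "GDERIV (\<lambda>x. u x * \<phi> x) x :> 0"
      by (intro GDERIV_local_const[OF oK, of x _ 0]) (auto simp: \<phi>0)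
    then show ?thesis using False \<phi>0 by simp
  qed
  have "continuous_on (\<Omega> \<union> - K) (\<lambda>x. u x *\<^sub>R G x + \<phi> x *\<^sub>R D x)"
  proof (rule continuous_on_open_Un[OF \<Omega>(1) oK])
    have "continuous_on \<Omega> u" using \<Omega>(2) GDERIV_continuous by (metis continuous_at_imp_continuous_on)
    then show "continuous_on \<Omega> (\<lambda>x. u x *\<^sub>R G x + \<phi> x *\<^sub>R D x)"
      using c C1c_continuous[OF c] \<Omega>(3) unfolding C1c_def
      by (intro continuous_intros) (auto intro: continuous_on_subset)
    have "continuous_on (- K) (\<lambda>x. 0::'a)" by simp
    then show "continuous_on (- K) (\<lambda>x. u x *\<^sub>R G x + \<phi> x *\<^sub>R D x)"
      by (rule continuous_on_eq) (auto simp: \<phi>0)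
  qed
  moreover have "\<Omega> \<union> - K = UNIV" using K by auto
  ultimately show "continuous_on UNIV (\<lambda>x. u x *\<^sub>R G x + \<phi> x *\<^sub>R D x)" by simp
qed

lemma compact_neighbourhood:
  fixes K :: "'a::euclidean_space set"
  assumes "compact K" "open \<Omega>" "K \<subseteq> \<Omega>"
  obtains d where "d > 0" "compact (\<Union>x\<in>K. cball x d)" "(\<Union>x\<in>K. cball x d) \<subseteq> \<Omega>"
proof -
  obtain d where d: "d > 0" "(\<Union>x\<in>K. cball x d) \<subseteq> \<Omega>"
    using compact_subset_open_imp_cball_epsilon_subset[OF assms] by blast
  have "(\<Union>x\<in>K. cball x d) = {x + y |x y. x \<in> K \<and> y \<in> cball 0 d}"
  proof (safe)
    fix x y assume "x \<in> K" "y \<in> cball x d"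
    then show "\<exists>x' y'. y = x' + y' \<and> x' \<in> K \<and> y' \<in> cball 0 d"
      by (intro exI[of _ x] exI[of _ "y - x"]) (auto simp: dist_norm norm_minus_commute)
  next
    fix x y assume "x \<in> K" "y \<in> cball (0::'a) d"
    then show "x + y \<in> (\<Union>x\<in>K. cball x d)" by (intro UN_I[of x]) (auto simp: dist_norm)
  qed
  then show ?thesis using that d compact_sums[OF assms(1) compact_cball[of 0 d]] by simp
qed

lemma AE_lebesgue_on: "\<Omega> \<in> sets borel \<Longrightarrow> (AE x in lebesgue_on \<Omega>. P x) \<longleftrightarrow> (AE x in lborel. x \<in> \<Omega> \<longrightarrow> P x)"
  by (subst AE_restrict_space_iff) (auto simp: AE_completion_iff)

lemma integrable_lebesgue_on_compact:
  fixes f :: "'a::euclidean_space \<Rightarrow> 'b::euclidean_space"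
  assumes "compact K" "continuous_on K f"
  shows "integrable (lebesgue_on K) f"
proof -
  have i: "integrable lborel (\<lambda>x. indicator K x *\<^sub>R f x)" using assms by (rule borel_integrable_compact)
  then have "integrable lebesgue (\<lambda>x. indicator K x *\<^sub>R f x)"
    by (subst integrable_completion) auto
  then show ?thesis using assms(1) by (subst integrable_restrict_space) (auto simp: compact_imp_closed)
qed

lemma integrable_lebesgue_on_const: "compact K \<Longrightarrow> integrable (lebesgue_on K) (\<lambda>x. c::real)"
  by (intro integrable_lebesgue_on_compact) auto

lemma integral_lebesgue_on_support:
  fixes f :: "'a::euclidean_space \<Rightarrow> 'b::euclidean_space"
  assumes "\<Omega> \<in> sets borel" "f \<in> borel_measurable borel" "\<And>x. x \<notin> \<Omega> \<Longrightarrow> f x = 0"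
  shows "(LINT x|lebesgue_on \<Omega>. f x) = (LINT x|lborel. f x)"
proof -
  have "(LINT x|lebesgue_on \<Omega>. f x) = (LINT x|lebesgue. indicator \<Omega> x *\<^sub>R f x)"
    using assms by (intro integral_restrict_space) auto
  also have "(\<lambda>x. indicator \<Omega> x *\<^sub>R f x) = f" using assms(3) by (auto simp: indicator_def)
  also have "(LINT x|lebesgue. f x) = (LINT x|lborel. f x)" using assms(2) by (intro integral_completion) simp
  finally show ?thesis .
qed

text \<open>The class for the chain rule: C^1 on the plane with both partial derivatives bounded by
  \<open>L\<close>, hence Lipschitz. There are two arguments because the path combines two
  functions; truncations are the case \<open>B = 0\<close>.\<close>

definition C1_two :: "(real \<Rightarrow> real \<Rightarrow> real) \<Rightarrow> (real \<Rightarrow> real \<Rightarrow> real) \<Rightarrow> (real \<Rightarrow> real \<Rightarrow> real) \<Rightarrow> real \<Rightarrow> bool" where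
  "C1_two F A B L \<longleftrightarrow>
    (\<forall>a b. ((\<lambda>(x, y). F x y) has_derivative (\<lambda>(h, k). A a b * h + B a b * k)) (at (a, b))) \<and>
    continuous_on UNIV (\<lambda>(a, b). A a b) \<and> continuous_on UNIV (\<lambda>(a, b). B a b) \<and>
    (\<forall>a b. \<bar>A a b\<bar> \<le> L \<and> \<bar>B a b\<bar> \<le> L)"

lemma C1_two_lipschitz:
  assumes "C1_two F A B L"
  shows "\<bar>F a b - F c d\<bar> \<le> 2 * L * (\<bar>a - c\<bar> + \<bar>b - d\<bar>)"
proof -
  have "\<bar>A 0 0\<bar> \<le> L" using assms by (auto simp: C1_two_def)
  then have L: "L \<ge> 0" by linarith
  have "norm ((\<lambda>(x, y). F x y) (a, b) - (\<lambda>(x, y). F x y) (c, d)) \<le> 2 * L * norm ((a, b) - (c, d))"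
  proof (rule differentiable_bound[where S = UNIV and f' = "\<lambda>z (h, k). A (fst z) (snd z) * h + B (fst z) (snd z) * k"])
    show "((\<lambda>(x, y). F x y) has_derivative (\<lambda>(h, k). A (fst z) (snd z) * h + B (fst z) (snd z) * k)) (at z within UNIV)" for z
      using assms by (cases z) (auto simp: C1_two_def)
    show "onorm (\<lambda>(h, k). A (fst z) (snd z) * h + B (fst z) (snd z) * k) \<le> 2 * L" for z
    proof (rule onorm_le)
      fix x :: "real \<times> real"
      obtain h k where x: "x = (h, k)" by force
      have "\<bar>A (fst z) (snd z) * h + B (fst z) (snd z) * k\<bar> \<le> L * \<bar>h\<bar> + L * \<bar>k\<bar>"
        using assms unfolding C1_two_def
        by (intro order_trans[OF abs_triangle_ineq] add_mono) (auto simp: abs_mult intro!: mult_right_mono)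
      also have "\<dots> \<le> L * norm x + L * norm x"
        using L norm_fst_le[of h k] norm_snd_le[of k h] unfolding x by (intro add_mono mult_left_mono) auto
      finally show "norm (case x of (h, k) \<Rightarrow> A (fst z) (snd z) * h + B (fst z) (snd z) * k) \<le> 2 * L * norm x"
        using x by simp
    qed
  qed auto
  also have "\<dots> \<le> 2 * L * (norm (a - c) + norm (b - d))"
    using L norm_Pair_le[of "a - c" "b - d"] by (intro mult_left_mono) auto
  finally show ?thesis by simp
qed

lemma C1_two_GDERIV:
  assumes "C1_two F A B L" "GDERIV u x :> U" "GDERIV v x :> V"
  shows "GDERIV (\<lambda>x. F (u x) (v x)) x :> A (u x) (v x) *\<^sub>R U + B (u x) (v x) *\<^sub>R V"
proof -
  have "((\<lambda>x. (u x, v x)) has_derivative (\<lambda>h. (h \<bullet> U, h \<bullet> V))) (at x)"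
    using assms(2,3) unfolding gderiv_def by (rule has_derivative_Pair)
  moreover have "((\<lambda>(x, y). F x y) has_derivative (\<lambda>(h, k). A (u x) (v x) * h + B (u x) (v x) * k)) (at (u x, v x))"
    using assms(1) unfolding C1_two_def by blast
  ultimately have "((\<lambda>x. (\<lambda>(x, y). F x y) (u x, v x)) has_derivative
      (\<lambda>h. (\<lambda>(h, k). A (u x) (v x) * h + B (u x) (v x) * k) (h \<bullet> U, h \<bullet> V))) (at x)"
    by (rule has_derivative_compose)
  then show ?thesis unfolding gderiv_def by (simp add: inner_add_right)
qed

lemma C1_two_continuous:
  assumes "C1_two F A B L"
  shows "continuous_on UNIV (\<lambda>(a, b). F a b)"
proof -
  have "isCont (\<lambda>(a, b). F a b) z" for z
  proof (cases z)
    case (Pair a b)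
    then show ?thesis using assms has_derivative_continuous unfolding C1_two_def by blast
  qed
  then show ?thesis by (simp add: continuous_at_imp_continuous_on)
qed

lemma continuous_two_measurable:
  fixes F :: "real \<Rightarrow> real \<Rightarrow> real"
  assumes "continuous_on UNIV (\<lambda>(a, b). F a b)" "u \<in> borel_measurable M" "v \<in> borel_measurable M"
  shows "(\<lambda>x. F (u x) (v x) :: real) \<in> borel_measurable M"
proof -
  have "(\<lambda>x. (u x :: real, v x :: real)) \<in> borel_measurable M" using assms(2,3) by (rule borel_measurable_Pair)
  from measurable_compose[OF this borel_measurable_continuous_onI[OF assms(1)]] show ?thesis by simp
qed

lemma continuous_on_two:
  fixes F :: "real \<Rightarrow> real \<Rightarrow> real"
  assumes "continuous_on UNIV (\<lambda>(a, b). F a b)" "continuous_on S u" "continuous_on S v"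
  shows "continuous_on S (\<lambda>x. F (u x) (v x) :: real)"
proof -
  have "continuous_on S (\<lambda>x. (\<lambda>(a, b). F a b) (u x, v x))"
    using assms by (intro continuous_on_compose2[OF assms(1)] continuous_intros) auto
  then show ?thesis by simp
qed

lemma tendsto_two:
  fixes F :: "real \<Rightarrow> real \<Rightarrow> real"
  assumes "continuous_on UNIV (\<lambda>(a, b). F a b)" "(u \<longlongrightarrow> a) G" "(v \<longlongrightarrow> b) G"
  shows "((\<lambda>x. F (u x) (v x) :: real) \<longlongrightarrow> F a b) G"
proof -
  have "isCont (\<lambda>(a, b). F a b) (a, b)" using assms(1) by (simp add: continuous_on_eq_continuous_at)
  from isCont_tendsto_compose[OF this tendsto_Pair[OF assms(2,3)]] show ?thesis by simp
qed

text \<open>The extraction is applied to the sum of the absolute values, so that both sequences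
  converge along the same indices.\<close>

lemma L1_pair_subseq:
  fixes f :: "nat \<Rightarrow> 'a \<Rightarrow> real" and g :: "nat \<Rightarrow> 'a \<Rightarrow> real"
  assumes "\<And>n. integrable M (f n)" "\<And>n. integrable M (g n)"
    "(\<lambda>n. LINT x|M. \<bar>f n x\<bar>) \<longlonglongrightarrow> 0" "(\<lambda>n. LINT x|M. \<bar>g n x\<bar>) \<longlonglongrightarrow> 0"
  obtains r :: "nat \<Rightarrow> nat" where "strict_mono r"
    "AE x in M. (\<lambda>n. f (r n) x) \<longlonglongrightarrow> 0 \<and> (\<lambda>n. g (r n) x) \<longlonglongrightarrow> 0"
proof -
  have "(\<lambda>n. LINT x|M. norm (\<bar>f n x\<bar> + \<bar>g n x\<bar>)) \<longlonglongrightarrow> 0"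
    using tendsto_add[OF assms(3,4)] assms(1,2) by simp
  then obtain r where r: "strict_mono r" "AE x in M. (\<lambda>n. \<bar>f (r n) x\<bar> + \<bar>g (r n) x\<bar>) \<longlonglongrightarrow> 0"
    using tendsto_L1_AE_subseq[of M "\<lambda>n x. \<bar>f n x\<bar> + \<bar>g n x\<bar>"] assms(1,2) by auto
  have "AE x in M. (\<lambda>n. f (r n) x) \<longlonglongrightarrow> 0 \<and> (\<lambda>n. g (r n) x) \<longlonglongrightarrow> 0"
    using r(2)
  proof eventually_elim
    case (elim x)
    then show ?case
      by (auto intro!: Lim_null_comparison[OF _ elim] always_eventually)
  qed
  then show ?thesis using that r(1) by blast
qed

lemma locally_integrable_C1_two:
  assumes "C1_two F A B L" "locally_integrable \<Omega> u" "locally_integrable \<Omega> v"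
  shows "locally_integrable \<Omega> (\<lambda>x. F (u x) (v x))"
  unfolding locally_integrable_def
proof (intro allI impI)
  fix K assume K: "compact K \<and> K \<subseteq> \<Omega>"
  have i: "integrable (lebesgue_on K) u" "integrable (lebesgue_on K) v"
    using K assms by (auto simp: locally_integrable_def)
  have m: "(\<lambda>x. F (u x) (v x)) \<in> borel_measurable (lebesgue_on K)"
    by (rule continuous_two_measurable[OF C1_two_continuous[OF assms(1)] borel_measurable_integrable[OF i(1)] borel_measurable_integrable[OF i(2)]])
  have "integrable (lebesgue_on K) (\<lambda>x. \<bar>F 0 0\<bar> + 2 * L * (\<bar>u x\<bar> + \<bar>v x\<bar>))"
    using i K integrable_lebesgue_on_const[of K "\<bar>F 0 0\<bar>"] by auto
  then show "integrable (lebesgue_on K) (\<lambda>x. F (u x) (v x))"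
  proof (rule Bochner_Integration.integrable_bound[OF _ m], intro AE_I2)
    fix x
    have "\<bar>F (u x) (v x)\<bar> \<le> \<bar>F 0 0\<bar> + 2 * L * (\<bar>u x\<bar> + \<bar>v x\<bar>)"
      using C1_two_lipschitz[OF assms(1), of "u x" "v x" 0 0] by simp
    then show "norm (F (u x) (v x)) \<le> norm (\<bar>F 0 0\<bar> + 2 * L * (\<bar>u x\<bar> + \<bar>v x\<bar>))" by simp
  qed
qed

lemma bounded_mult_integrable:
  fixes f :: "'a \<Rightarrow> 'b::{banach, second_countable_topology}"
  assumes "integrable M f" "a \<in> borel_measurable M" "\<And>x. \<bar>a x\<bar> \<le> (L::real)"
  shows "integrable M (\<lambda>x. a x *\<^sub>R f x)"
proof (rule Bochner_Integration.integrable_bound[OF integrable_scaleR_right[OF assms(1), of L]])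
  show "AE x in M. norm (a x *\<^sub>R f x) \<le> norm (L *\<^sub>R f x)"
  proof (rule AE_I2)
    fix x
    have "\<bar>a x\<bar> \<le> \<bar>L\<bar>" using assms(3)[of x] by linarith
    then show "norm (a x *\<^sub>R f x) \<le> norm (L *\<^sub>R f x)" by (simp add: mult_right_mono)
  qed
qed (use assms in auto)

text \<open>For mollified \<open>u\<close> and \<open>v\<close> the function
  \<open>F (un n x) (vn n x) * \<phi> x\<close> is C^1 with compact support, so its gradient
  \<open>Dn n\<close> integrates to zero. The claim is the limit of this identity, since
  \<open>Dn (r n)\<close> converges to \<open>D\<close> in L^1.\<close>

lemma weak_gradient_chain:
  assumes \<Omega>: "open \<Omega>" and F: "C1_two F A B L"
    and u: "is_weak_gradient \<Omega> u U" and v: "is_weak_gradient \<Omega> v V"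
  shows "is_weak_gradient \<Omega> (\<lambda>x. F (u x) (v x)) (\<lambda>x. A (u x) (v x) *\<^sub>R U x + B (u x) (v x) *\<^sub>R V x)"
  unfolding is_weak_gradient_def
proof (intro conjI allI impI ballI)
  have lu: "locally_integrable \<Omega> u" "locally_integrable \<Omega> v" and lU: "locally_integrable \<Omega> U" "locally_integrable \<Omega> V"
    using u v by (auto simp: is_weak_gradient_def)
  have cA: "continuous_on UNIV (\<lambda>(a, b). A a b)" and cB: "continuous_on UNIV (\<lambda>(a, b). B a b)"
    and AL: "\<And>a b. \<bar>A a b\<bar> \<le> L" and BL: "\<And>a b. \<bar>B a b\<bar> \<le> L" using F by (auto simp: C1_two_def)
  have L: "L \<ge> 0" using AL[of 0 0] by linarith
  note cF = C1_two_continuous[OF F]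
  show "locally_integrable \<Omega> (\<lambda>x. F (u x) (v x))" using F lu by (rule locally_integrable_C1_two)
  have lW: "integrable (lebesgue_on K) (\<lambda>x. A (u x) (v x) *\<^sub>R U x + B (u x) (v x) *\<^sub>R V x)" if "compact K" "K \<subseteq> \<Omega>" for K
  proof -
    have i: "integrable (lebesgue_on K) u" "integrable (lebesgue_on K) v" "integrable (lebesgue_on K) U" "integrable (lebesgue_on K) V"
      using lu lU that unfolding locally_integrable_def by blast+
    note m = borel_measurable_integrable[OF i(1)] borel_measurable_integrable[OF i(2)]
    show ?thesis
      by (intro Bochner_Integration.integrable_add bounded_mult_integrable[OF i(3) continuous_two_measurable[OF cA m] AL]
          bounded_mult_integrable[OF i(4) continuous_two_measurable[OF cB m] BL])
  qed
  then show "locally_integrable \<Omega> (\<lambda>x. A (u x) (v x) *\<^sub>R U x + B (u x) (v x) *\<^sub>R V x)"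
    by (simp add: locally_integrable_def)
  fix \<phi> and i :: 'a assume t: "test_function \<Omega> \<phi>" and i: "i \<in> Basis"
  define K where "K = closure {x. \<phi> x \<noteq> 0}"
  have K: "compact K" "K \<subseteq> \<Omega>" using t by (auto simp: test_function_def K_def)
  have c\<phi>: "C1c K \<phi> (grad \<phi>)" unfolding K_def using t by (rule test_function_C1c)
  obtain d where d: "d > 0" "compact (\<Union>x\<in>K. cball x d)" "(\<Union>x\<in>K. cball x d) \<subseteq> \<Omega>"
    using compact_neighbourhood[OF K(1) \<Omega> K(2)] by blast
  \<comment> \<open>The representatives live on the \<open>d\<close>-neighbourhood
    \<open>K'\<close>. Mollification with radius below \<open>d / 2\<close> sees only
    \<open>K'\<close> at points of the \<open>d / 2\<close>-neighbourhood \<open>Q\<close>, so there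
    the gradients of the mollifications are \<open>Gn n\<close> and \<open>Hn n\<close>.\<close>
  define K' where "K' = (\<Union>x\<in>K. cball x d)"
  define Q where "Q = (\<Union>x\<in>K. ball x (d/2))"
  have K': "compact K'" "K' \<subseteq> \<Omega>" "K \<subseteq> K'" using d by (auto simp: K'_def intro!: bexI)
  have Q: "open Q" "K \<subseteq> Q" using d by (auto simp: Q_def intro!: bexI)
  obtain u' U' where repu: "weak_gradient_rep K' u' U'"
    and u'': "AE x in lebesgue. x \<in> K' \<longrightarrow> u' x = u x" "AE x in lebesgue. x \<in> K' \<longrightarrow> U' x = U x"
    using weak_gradient_representative[OF \<Omega> K'(1,2) u] by blast
  then have u': "integrable lborel u'" "integrable lborel U'" by (auto simp: weak_gradient_rep_def)
  obtain v' V' where repv: "weak_gradient_rep K' v' V'"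
    and v'': "AE x in lebesgue. x \<in> K' \<longrightarrow> v' x = v x" "AE x in lebesgue. x \<in> K' \<longrightarrow> V' x = V x"
    using weak_gradient_representative[OF \<Omega> K'(1,2) v] by blast
  then have v': "integrable lborel v'" "integrable lborel V'" by (auto simp: weak_gradient_rep_def)
  have [measurable]: "u' \<in> borel_measurable borel" "v' \<in> borel_measurable borel"
    "U' \<in> borel_measurable borel" "V' \<in> borel_measurable borel" using u' v' by auto
  define un where "un n = mollify n u'" for n
  define vn where "vn n = mollify n v'" for n
  define Gn where "Gn n = mollify n U'" for n
  define Hn where "Hn n = mollify n V'" for n
  have cn: "continuous_on UNIV (un n)" "continuous_on UNIV (vn n)" "continuous_on UNIV (Gn n)" "continuous_on UNIV (Hn n)" for n
    unfolding un_def vn_def Gn_def Hn_def using u' v' mollify_continuous by auto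
  have [measurable]: "un n \<in> borel_measurable borel" "vn n \<in> borel_measurable borel"
    "Gn n \<in> borel_measurable borel" "Hn n \<in> borel_measurable borel" for n
    using cn by (auto intro: borel_measurable_continuous_onI)
  have in': "integrable lborel (un n)" "integrable lborel (vn n)" "integrable lborel (Gn n)" "integrable lborel (Hn n)" for n
    unfolding un_def vn_def Gn_def Hn_def using u' v' mollify_L1(1) by auto
  have lim: "(\<lambda>n. LINT x|lborel. norm (un n x - u' x)) \<longlonglongrightarrow> 0" "(\<lambda>n. LINT x|lborel. norm (vn n x - v' x)) \<longlonglongrightarrow> 0"
    "(\<lambda>n. LINT x|lborel. norm (Gn n x - U' x)) \<longlonglongrightarrow> 0" "(\<lambda>n. LINT x|lborel. norm (Hn n x - V' x)) \<longlonglongrightarrow> 0"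
    unfolding un_def vn_def Gn_def Hn_def by (rule mollify_L1(2)[OF u'(1)] mollify_L1(2)[OF v'(1)] mollify_L1(2)[OF u'(2)] mollify_L1(2)[OF v'(2)])+
  obtain r where r: "strict_mono r" and rlim: "AE x in lborel. (\<lambda>n. un (r n) x - u' x) \<longlonglongrightarrow> 0 \<and> (\<lambda>n. vn (r n) x - v' x) \<longlonglongrightarrow> 0"
  proof (rule L1_pair_subseq[of lborel "\<lambda>n x. un n x - u' x" "\<lambda>n x. vn n x - v' x"])
  qed (use lim in' u' v' in auto)
  obtain N where N: "1 / real (Suc N) < d / 2" using d(1) nat_approx_posE[of "d/2"] by auto
  have ball: "cball x (1 / Suc n) \<subseteq> K'" if "n \<ge> N" "x \<in> Q" for x n
  proof
    fix y assume y: "y \<in> cball x (1 / Suc n)"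
    obtain z where z: "z \<in> K" "dist z x < d/2" using \<open>x \<in> Q\<close> by (auto simp: Q_def)
    have "1 / real (Suc n) \<le> 1 / real (Suc N)" using \<open>n \<ge> N\<close> by (simp add: frac_le)
    then have "dist x y < d/2" using y N by auto
    then have "dist z y \<le> d" using z dist_triangle[of z y x] by linarith
    then show "y \<in> K'" using z by (auto simp: K'_def)
  qed
  have gd: "GDERIV (un n) x :> Gn n x" "GDERIV (vn n) x :> Hn n x" if "n \<ge> N" "x \<in> Q" for n x
    unfolding un_def Gn_def vn_def Hn_def
    using GDERIV_mollify_weak[OF repu ball[OF that]] GDERIV_mollify_weak[OF repv ball[OF that]] by auto
  define Dn where "Dn n x = F (un n x) (vn n x) *\<^sub>R grad \<phi> x + \<phi> x *\<^sub>R (A (un n x) (vn n x) *\<^sub>R Gn n x + B (un n x) (vn n x) *\<^sub>R Hn n x)" for n x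
  define D where "D x = F (u' x) (v' x) *\<^sub>R grad \<phi> x + \<phi> x *\<^sub>R (A (u' x) (v' x) *\<^sub>R U' x + B (u' x) (v' x) *\<^sub>R V' x)" for x
  have C1cn: "C1c K (\<lambda>x. F (un n x) (vn n x) * \<phi> x) (Dn n)" if "n \<ge> N" for n
    unfolding Dn_def
  proof (rule C1c_product[OF Q(1) _ _ c\<phi> Q(2)])
    show "GDERIV (\<lambda>x. F (un n x) (vn n x)) x :> A (un n x) (vn n x) *\<^sub>R Gn n x + B (un n x) (vn n x) *\<^sub>R Hn n x" if "x \<in> Q" for x
      by (intro C1_two_GDERIV[OF F] gd \<open>n \<ge> N\<close> that)
    have "continuous_on UNIV (\<lambda>x. A (un n x) (vn n x) *\<^sub>R Gn n x + B (un n x) (vn n x) *\<^sub>R Hn n x)"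
      by (intro continuous_intros continuous_on_two[OF cA] continuous_on_two[OF cB] cn)
    then show "continuous_on Q (\<lambda>x. A (un n x) (vn n x) *\<^sub>R Gn n x + B (un n x) (vn n x) *\<^sub>R Hn n x)"
      by (rule continuous_on_subset) auto
  qed
  have Dn0: "(LINT x|lborel. Dn n x) = 0" if "n \<ge> N" for n
    using C1c_integral_grad[OF C1cn[OF that]] .
  have [measurable]: "\<phi> \<in> borel_measurable borel" "grad \<phi> \<in> borel_measurable borel"
    using c\<phi> C1c_continuous[OF c\<phi>] by (auto simp: C1c_def intro!: borel_measurable_continuous_onI)
  obtain C1 where C1: "\<And>x. norm (\<phi> x) \<le> C1"
    using continuous_compact_support_bounded[OF C1c_continuous[OF c\<phi>] K(1)] c\<phi> unfolding C1c_def by metis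
  obtain C2 where C2: "\<And>x. norm (grad \<phi> x) \<le> C2"
    using continuous_compact_support_bounded[of "grad \<phi>" K] c\<phi> C1c_grad_support[OF c\<phi>] K(1) unfolding C1c_def by metis
  define C where "C = max C1 C2"
  have C: "\<bar>\<phi> x\<bar> \<le> C" "norm (grad \<phi> x) \<le> C" for x using C1[of x] C2[of x] by (auto simp: C_def)
  have C0: "C \<ge> 0" using C(1)[of 0] by linarith
  have [measurable]: "(\<lambda>x. F (u' x) (v' x)) \<in> borel_measurable borel" "(\<lambda>x. A (u' x) (v' x)) \<in> borel_measurable borel" "(\<lambda>x. B (u' x) (v' x)) \<in> borel_measurable borel"
    "(\<lambda>x. A (un n x) (vn n x)) \<in> borel_measurable borel" "(\<lambda>x. B (un n x) (vn n x)) \<in> borel_measurable borel"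
    "(\<lambda>x. F (un n x) (vn n x)) \<in> borel_measurable borel" for n
    by (intro continuous_two_measurable[OF cF] continuous_two_measurable[OF cA] continuous_two_measurable[OF cB]; measurable)+
  have iF: "integrable lborel (\<lambda>x. F (u' x) (v' x) *\<^sub>R grad \<phi> x)"
  proof (rule Bochner_Integration.integrable_bound)
    show "integrable lborel (\<lambda>x. \<bar>F 0 0\<bar> * norm (grad \<phi> x) + 2 * L * C * (\<bar>u' x\<bar> + \<bar>v' x\<bar>))"
      using continuous_compact_support_integrable[of "grad \<phi>" K] c\<phi> C1c_grad_support[OF c\<phi>] u' v'
      unfolding C1c_def by (intro Bochner_Integration.integrable_add integrable_mult_right integrable_norm integrable_abs) auto
    show "AE x in lborel. norm (F (u' x) (v' x) *\<^sub>R grad \<phi> x) \<le> norm (\<bar>F 0 0\<bar> * norm (grad \<phi> x) + 2 * L * C * (\<bar>u' x\<bar> + \<bar>v' x\<bar>))"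
    proof (rule AE_I2)
      fix x
      have "\<bar>F (u' x) (v' x)\<bar> \<le> \<bar>F 0 0\<bar> + 2 * L * (\<bar>u' x\<bar> + \<bar>v' x\<bar>)"
        using C1_two_lipschitz[OF F, of "u' x" "v' x" 0 0] by simp
      then have "norm (F (u' x) (v' x) *\<^sub>R grad \<phi> x) \<le> (\<bar>F 0 0\<bar> + 2 * L * (\<bar>u' x\<bar> + \<bar>v' x\<bar>)) * norm (grad \<phi> x)"
        by (simp add: mult_right_mono)
      also have "\<dots> \<le> \<bar>F 0 0\<bar> * norm (grad \<phi> x) + (2 * L * (\<bar>u' x\<bar> + \<bar>v' x\<bar>)) * C"
        unfolding distrib_right using L by (intro add_mono mult_left_mono C) auto
      also have "\<dots> \<le> norm (\<bar>F 0 0\<bar> * norm (grad \<phi> x) + 2 * L * C * (\<bar>u' x\<bar> + \<bar>v' x\<bar>))"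
        by (simp add: mult_ac)
      finally show "norm (F (u' x) (v' x) *\<^sub>R grad \<phi> x) \<le> norm (\<bar>F 0 0\<bar> * norm (grad \<phi> x) + 2 * L * C * (\<bar>u' x\<bar> + \<bar>v' x\<bar>))" .
    qed
  qed simp
  have iW: "integrable lborel (\<lambda>x. \<phi> x *\<^sub>R (A (u' x) (v' x) *\<^sub>R U' x + B (u' x) (v' x) *\<^sub>R V' x))"
    using u' v' AL BL C by (intro bounded_mult_integrable[of _ _ \<phi> C] Bochner_Integration.integrable_add
      bounded_mult_integrable[of _ _ _ L]) auto
  have iD: "integrable lborel D" unfolding D_def using iF iW by (rule Bochner_Integration.integrable_add)
  have iDn: "integrable lborel (Dn n)" if "n \<ge> N" for n
    using C1cn[OF that] C1c_grad_support[OF C1cn[OF that]] unfolding C1c_def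
    by (intro continuous_compact_support_integrable[of _ K]) auto
  \<comment> \<open>The error splits into the Lipschitz error of \<open>F\<close>, the L^1 errors of
    the mollified gradients with bounded coefficients, and the errors of the coefficients
    \<open>A\<close> and \<open>B\<close>. Only the last ones need the almost everywhere convergent
    subsequence and dominated convergence.\<close>
  define b where "b n x = C * (2 * L * (norm (un n x - u' x) + norm (vn n x - v' x))) + C * (L * norm (Gn n x - U' x) + L * norm (Hn n x - V' x)
      + norm (\<bar>A (un n x) (vn n x) - A (u' x) (v' x)\<bar> * norm (U' x)) + norm (\<bar>B (un n x) (vn n x) - B (u' x) (v' x)\<bar> * norm (V' x)))" for n x
  have A2: "\<bar>A a b - A a' b'\<bar> \<le> 2 * L" "\<bar>B a b - B a' b'\<bar> \<le> 2 * L" for a b a' b'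
    using AL[of a b] AL[of a' b'] BL[of a b] BL[of a' b'] by linarith+
  have iA: "integrable lborel (\<lambda>x. \<bar>A (un n x) (vn n x) - A (u' x) (v' x)\<bar> * norm (U' x))"
       "integrable lborel (\<lambda>x. \<bar>B (un n x) (vn n x) - B (u' x) (v' x)\<bar> * norm (V' x))" for n
    using bounded_mult_integrable[OF integrable_norm[OF u'(2)], of "\<lambda>x. \<bar>A (un n x) (vn n x) - A (u' x) (v' x)\<bar>" "2*L"]
      bounded_mult_integrable[OF integrable_norm[OF v'(2)], of "\<lambda>x. \<bar>B (un n x) (vn n x) - B (u' x) (v' x)\<bar>" "2*L"] A2 by auto
  have bound: "norm (Dn n x - D x) \<le> b n x" for n x
  proof -
    have eq: "Dn n x - D x = (F (un n x) (vn n x) - F (u' x) (v' x)) *\<^sub>R grad \<phi> x + \<phi> x *\<^sub>R (A (un n x) (vn n x) *\<^sub>R (Gn n x - U' x)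
       + B (un n x) (vn n x) *\<^sub>R (Hn n x - V' x) + (A (un n x) (vn n x) - A (u' x) (v' x)) *\<^sub>R U' x + (B (un n x) (vn n x) - B (u' x) (v' x)) *\<^sub>R V' x)"
      by (simp add: Dn_def D_def algebra_simps)
    have t1: "norm ((F (un n x) (vn n x) - F (u' x) (v' x)) *\<^sub>R grad \<phi> x) \<le> C * (2 * L * (norm (un n x - u' x) + norm (vn n x - v' x)))"
    proof -
      have "norm (grad \<phi> x) * \<bar>F (un n x) (vn n x) - F (u' x) (v' x)\<bar> \<le> C * (2 * L * (norm (un n x - u' x) + norm (vn n x - v' x)))"
        using C0 C1_two_lipschitz[OF F] by (intro mult_mono C) auto
      then show ?thesis by (simp add: mult.commute)
    qed
    have t2: "norm (\<phi> x *\<^sub>R (A (un n x) (vn n x) *\<^sub>R (Gn n x - U' x)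
       + B (un n x) (vn n x) *\<^sub>R (Hn n x - V' x) + (A (un n x) (vn n x) - A (u' x) (v' x)) *\<^sub>R U' x + (B (un n x) (vn n x) - B (u' x) (v' x)) *\<^sub>R V' x))
       \<le> C * (L * norm (Gn n x - U' x) + L * norm (Hn n x - V' x)
      + norm (\<bar>A (un n x) (vn n x) - A (u' x) (v' x)\<bar> * norm (U' x)) + norm (\<bar>B (un n x) (vn n x) - B (u' x) (v' x)\<bar> * norm (V' x)))"
      unfolding norm_scaleR
    proof (intro mult_mono C)
      show "norm (A (un n x) (vn n x) *\<^sub>R (Gn n x - U' x)
       + B (un n x) (vn n x) *\<^sub>R (Hn n x - V' x) + (A (un n x) (vn n x) - A (u' x) (v' x)) *\<^sub>R U' x + (B (un n x) (vn n x) - B (u' x) (v' x)) *\<^sub>R V' x)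
        \<le> L * norm (Gn n x - U' x) + L * norm (Hn n x - V' x)
      + norm (\<bar>A (un n x) (vn n x) - A (u' x) (v' x)\<bar> * norm (U' x)) + norm (\<bar>B (un n x) (vn n x) - B (u' x) (v' x)\<bar> * norm (V' x))"
        by (intro norm_triangle_le add_mono) (auto intro!: mult_right_mono AL BL simp: abs_mult)
    qed (use C0 in auto)
    show ?thesis unfolding b_def eq by (rule order_trans[OF norm_triangle_ineq add_mono[OF t1 t2]])
  qed
  have ib: "integrable lborel (b n)" for n unfolding b_def
    by (intro Bochner_Integration.integrable_add integrable_mult_right integrable_norm iA Bochner_Integration.integrable_diff in' u' v')
  have limA: "(\<lambda>n. LINT x|lborel. norm (\<bar>A (un (r n) x) (vn (r n) x) - A (u' x) (v' x)\<bar> * norm (U' x))) \<longlonglongrightarrow> (LINT x|(lborel::'a measure). 0)"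
    and limB: "(\<lambda>n. LINT x|lborel. norm (\<bar>B (un (r n) x) (vn (r n) x) - B (u' x) (v' x)\<bar> * norm (V' x))) \<longlonglongrightarrow> (LINT x|(lborel::'a measure). 0)"
  proof -
    have t0: "AE x in lborel. (\<lambda>n. un (r n) x) \<longlonglongrightarrow> u' x \<and> (\<lambda>n. vn (r n) x) \<longlonglongrightarrow> v' x"
      using rlim by eventually_elim (auto simp: LIM_zero_iff)
    show "(\<lambda>n. LINT x|lborel. norm (\<bar>A (un (r n) x) (vn (r n) x) - A (u' x) (v' x)\<bar> * norm (U' x))) \<longlonglongrightarrow> (LINT x|(lborel::'a measure). 0)"
    proof (rule integral_dominated_convergence[where w = "\<lambda>x. 2 * L * norm (U' x)"])
      show "AE x in lborel. (\<lambda>n. norm (\<bar>A (un (r n) x) (vn (r n) x) - A (u' x) (v' x)\<bar> * norm (U' x))) \<longlonglongrightarrow> 0"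
        using t0
      proof eventually_elim
        case (elim x)
        then have "(\<lambda>n. A (un (r n) x) (vn (r n) x)) \<longlonglongrightarrow> A (u' x) (v' x)" using tendsto_two[OF cA] by blast
        then show ?case by (auto intro!: tendsto_eq_intros)
      qed
    qed (use u' A2 in \<open>auto intro!: mult_right_mono\<close>)
    show "(\<lambda>n. LINT x|lborel. norm (\<bar>B (un (r n) x) (vn (r n) x) - B (u' x) (v' x)\<bar> * norm (V' x))) \<longlonglongrightarrow> (LINT x|(lborel::'a measure). 0)"
    proof (rule integral_dominated_convergence[where w = "\<lambda>x. 2 * L * norm (V' x)"])
      show "AE x in lborel. (\<lambda>n. norm (\<bar>B (un (r n) x) (vn (r n) x) - B (u' x) (v' x)\<bar> * norm (V' x))) \<longlonglongrightarrow> 0"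
        using t0
      proof eventually_elim
        case (elim x)
        then have "(\<lambda>n. B (un (r n) x) (vn (r n) x)) \<longlonglongrightarrow> B (u' x) (v' x)" using tendsto_two[OF cB] by blast
        then show ?case by (auto intro!: tendsto_eq_intros)
      qed
    qed (use v' A2 in \<open>auto intro!: mult_right_mono\<close>)
  qed
  have "(\<lambda>n. LINT x|lborel. b (r n) x) \<longlonglongrightarrow> C * (2 * L * (0 + 0)) + C * (L * 0 + L * 0 + (LINT x|(lborel::'a measure). 0) + (LINT x|(lborel::'a measure). 0))"
  proof -
    have "(LINT x|lborel. b n x) = C * (2 * L * ((LINT x|lborel. norm (un n x - u' x)) + (LINT x|lborel. norm (vn n x - v' x)))) +
       C * (L * (LINT x|lborel. norm (Gn n x - U' x)) + L * (LINT x|lborel. norm (Hn n x - V' x))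
      + (LINT x|lborel. norm (\<bar>A (un n x) (vn n x) - A (u' x) (v' x)\<bar> * norm (U' x))) + (LINT x|lborel. norm (\<bar>B (un n x) (vn n x) - B (u' x) (v' x)\<bar> * norm (V' x))))" for n
      unfolding b_def
      using integrable_norm[OF Bochner_Integration.integrable_diff[OF in'(1)[of n] u'(1)]] integrable_norm[OF Bochner_Integration.integrable_diff[OF in'(2)[of n] v'(1)]]
       integrable_norm[OF Bochner_Integration.integrable_diff[OF in'(3)[of n] u'(2)]] integrable_norm[OF Bochner_Integration.integrable_diff[OF in'(4)[of n] v'(2)]]
       integrable_norm[OF iA(1)[of n]] integrable_norm[OF iA(2)[of n]]
      by (simp del: real_norm_def norm_mult)
    note eq = this
    show ?thesis unfolding eq
      by (intro tendsto_intros limA limB LIMSEQ_subseq_LIMSEQ[OF lim(1) r, unfolded comp_def] LIMSEQ_subseq_LIMSEQ[OF lim(2) r, unfolded comp_def]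
         LIMSEQ_subseq_LIMSEQ[OF lim(3) r, unfolded comp_def] LIMSEQ_subseq_LIMSEQ[OF lim(4) r, unfolded comp_def])
  qed
  then have blim: "(\<lambda>n. LINT x|lborel. b (r n) x) \<longlonglongrightarrow> 0" by simp
  have "norm (LINT x|lborel. D x) \<le> (LINT x|lborel. b (r n) x)" if "n \<ge> N" for n
  proof -
    have rn: "r n \<ge> N" using seq_suble[OF r, of n] that by simp
    have "(LINT x|lborel. D x) = - (LINT x|lborel. Dn (r n) x - D x)"
      using iDn[OF rn] iD Dn0[OF rn] by simp
    then have "norm (LINT x|lborel. D x) = norm (LINT x|lborel. Dn (r n) x - D x)" by simp
    also have "\<dots> \<le> (LINT x|lborel. b (r n) x)"
      using iDn[OF rn] iD ib bound by (intro order_trans[OF integral_norm_bound] integral_mono) auto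
    finally show ?thesis .
  qed
  then have "norm (LINT x|lborel. D x) \<le> 0"
    using LIMSEQ_le[OF tendsto_const blim, of "norm (LINT x|lborel. D x)"] by blast
  then have "(LINT x|lborel. D x) \<bullet> i = 0" by simp
  then have "(LINT x|lborel. D x \<bullet> i) = 0" using iD by simp
  moreover have "(\<lambda>x. D x \<bullet> i) = (\<lambda>x. (F (u' x) (v' x) *\<^sub>R grad \<phi> x) \<bullet> i + (\<phi> x *\<^sub>R (A (u' x) (v' x) *\<^sub>R U' x + B (u' x) (v' x) *\<^sub>R V' x)) \<bullet> i)"
    by (simp add: D_def inner_add_left)
  ultimately have "(LINT x|lborel. (F (u' x) (v' x) *\<^sub>R grad \<phi> x) \<bullet> i) + (LINT x|lborel. (\<phi> x *\<^sub>R (A (u' x) (v' x) *\<^sub>R U' x + B (u' x) (v' x) *\<^sub>R V' x)) \<bullet> i) = 0"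
    using integrable_inner_left[OF iF, of i] integrable_inner_left[OF iW, of i] by simp
  then have main: "(LINT x|lborel. (grad \<phi> x \<bullet> i) *\<^sub>R F (u' x) (v' x)) = - (LINT x|lborel. \<phi> x *\<^sub>R ((A (u' x) (v' x) *\<^sub>R U' x + B (u' x) (v' x) *\<^sub>R V' x) \<bullet> i))"
    by (simp add: mult.commute)
  have Kb: "K \<in> sets borel" "\<Omega> \<in> sets borel" using K \<Omega> by (auto simp: compact_imp_closed)
  have aeK: "AE x in lebesgue. x \<in> K \<longrightarrow> u' x = u x \<and> v' x = v x \<and> U' x = U x \<and> V' x = V x"
    using u'' v'' by eventually_elim (use K' in auto)
  have "(LINT x|lebesgue_on \<Omega>. (grad \<phi> x \<bullet> i) *\<^sub>R F (u x) (v x)) = (LINT x|lborel. (grad \<phi> x \<bullet> i) *\<^sub>R F (u' x) (v' x))"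
  proof (rule integral_representative[OF Kb(1) K(2) Kb(2)])
    show "(\<lambda>x. F (u x) (v x)) \<in> borel_measurable (lebesgue_on K)"
      using lu K unfolding locally_integrable_def by (intro continuous_two_measurable[OF cF]) auto
    show "AE x in lebesgue. x \<in> K \<longrightarrow> F (u' x) (v' x) = F (u x) (v x)" using aeK by eventually_elim auto
  qed (use C1c_grad_support[OF c\<phi>] in auto)
  moreover have "(LINT x|lebesgue_on \<Omega>. \<phi> x *\<^sub>R ((A (u x) (v x) *\<^sub>R U x + B (u x) (v x) *\<^sub>R V x) \<bullet> i)) = (LINT x|lborel. \<phi> x *\<^sub>R ((A (u' x) (v' x) *\<^sub>R U' x + B (u' x) (v' x) *\<^sub>R V' x) \<bullet> i))"
  proof (rule integral_representative[OF Kb(1) K(2) Kb(2)])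
    show "(\<lambda>x. (A (u x) (v x) *\<^sub>R U x + B (u x) (v x) *\<^sub>R V x) \<bullet> i) \<in> borel_measurable (lebesgue_on K)"
      using borel_measurable_integrable[OF lW[OF K]] by (intro borel_measurable_inner) auto
    show "AE x in lebesgue. x \<in> K \<longrightarrow> (A (u' x) (v' x) *\<^sub>R U' x + B (u' x) (v' x) *\<^sub>R V' x) \<bullet> i = (A (u x) (v x) *\<^sub>R U x + B (u x) (v x) *\<^sub>R V x) \<bullet> i"
      using aeK by eventually_elim auto
  qed (use c\<phi> in \<open>auto simp: C1c_def\<close>)
  ultimately show "(LINT x|lebesgue_on \<Omega>. F (u x) (v x) * frechet_derivative \<phi> (at x) i) =
      - (LINT x|lebesgue_on \<Omega>. ((A (u x) (v x) *\<^sub>R U x + B (u x) (v x) *\<^sub>R V x) \<bullet> i) * \<phi> x)"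
    using main i by (simp add: grad_inner mult.commute)
qed

section \<open>Uniqueness of weak gradients and functions with zero gradient\<close>

lemma AE_locally:
  fixes \<Omega> :: "'a::euclidean_space set"
  assumes "\<And>x. x \<in> \<Omega> \<Longrightarrow> \<exists>r>0. AE y in lborel. y \<in> ball x r \<longrightarrow> P y"
  shows "AE y in lborel. y \<in> \<Omega> \<longrightarrow> P y"
proof -
  define F where "F = {ball x r |x r. x \<in> \<Omega> \<and> r > 0 \<and> (AE y in lborel. y \<in> ball x r \<longrightarrow> P y)}"
  \<comment> \<open>Countably many balls suffice, so that the union of the exceptional null sets is
    still a null set.\<close>
  obtain F' where F': "F' \<subseteq> F" "countable F'" "\<Union>F' = \<Union>F"
    by (rule Lindelof[of F]) (auto simp: F_def)
  have "AE y in lborel. \<forall>S\<in>F'. y \<in> S \<longrightarrow> P y"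
    using F' by (intro AE_ball_countable') (auto simp: F_def subset_iff)
  then show ?thesis
  proof eventually_elim
    case (elim y)
    show ?case
    proof
      assume "y \<in> \<Omega>"
      then obtain r where "r > 0" "AE z in lborel. z \<in> ball y r \<longrightarrow> P z" using assms by blast
      then have "ball y r \<in> F" using \<open>y \<in> \<Omega>\<close> by (auto simp: F_def)
      then have "y \<in> \<Union>F'" using \<open>r > 0\<close> F'(3) by (metis UnionI centre_in_ball)
      then show "P y" using elim by blast
    qed
  qed
qed

lemma not_AE_empty_ball:
  fixes x :: "'a::euclidean_space"
  assumes "r > 0" "AE y in lborel. y \<in> ball x r \<longrightarrow> False"
  shows False
proof -
  have "AE y in lebesgue. y \<notin> ball x r" using assms(2) by (intro AE_completion) auto
  then have "ball x r \<in> null_sets lebesgue" by (simp add: completion.AE_iff_null_sets ball_def)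
  then have "negligible (ball x r)" by (simp add: negligible_iff_null_sets)
  then show False using open_not_negligible assms(1) by (metis open_ball ball_eq_empty not_less)
qed

text \<open>Representatives are taken on the ball of radius \<open>2 * r\<close>. Once the
  mollification radius is below \<open>r\<close>, the mollified gradient is the gradient of the
  mollification on the ball of radius \<open>r\<close>.\<close>

lemma local_mollification:
  assumes \<Omega>: "open \<Omega>" and wg: "is_weak_gradient \<Omega> z W" and x0: "x0 \<in> \<Omega>"
  obtains r z' W' N where "r > 0" "cball x0 (2 * r) \<subseteq> \<Omega>" "integrable lborel z'" "integrable lborel W'"
    "AE y in lborel. if y \<in> cball x0 (2 * r) then z' y = z y \<and> W' y = W y else z' y = 0 \<and> W' y = 0"
    "\<forall>n x. n \<ge> N \<longrightarrow> x \<in> ball x0 r \<longrightarrow> (GDERIV (mollify n z') x :> mollify n W' x)"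
proof -
  obtain e where e: "e > 0" "cball x0 e \<subseteq> \<Omega>" using \<Omega> x0 open_contains_cball by blast
  define r where "r = e / 2"
  have r: "r > 0" "cball x0 (2 * r) \<subseteq> \<Omega>" using e by (auto simp: r_def)
  obtain z' W' where rep: "weak_gradient_rep (cball x0 (2 * r)) z' W'"
    "AE x in lebesgue. x \<in> cball x0 (2 * r) \<longrightarrow> z' x = z x" "AE x in lebesgue. x \<in> cball x0 (2 * r) \<longrightarrow> W' x = W x"
    using weak_gradient_representative[OF \<Omega> compact_cball r(2) wg] by blast
  obtain N where N: "1 / real (Suc N) < r" using r(1) nat_approx_posE[of r] by auto
  have "\<forall>n x. n \<ge> N \<longrightarrow> x \<in> ball x0 r \<longrightarrow> (GDERIV (mollify n z') x :> mollify n W' x)"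
  proof (intro allI impI)
    fix n x assume n: "n \<ge> N" and x: "x \<in> ball x0 r"
    have "cball x (1 / Suc n) \<subseteq> cball x0 (2 * r)"
    proof
      fix y assume y: "y \<in> cball x (1 / Suc n)"
      have "1 / real (Suc n) \<le> 1 / real (Suc N)" using n by (simp add: frac_le)
      then have "dist x y < r" using y N by auto
      then show "y \<in> cball x0 (2 * r)" using x dist_triangle[of x0 y x] by auto
    qed
    then show "GDERIV (mollify n z') x :> mollify n W' x" using GDERIV_mollify_weak[OF rep(1)] by blast
  qed
  moreover have "AE y in lborel. if y \<in> cball x0 (2 * r) then z' y = z y \<and> W' y = W y else z' y = 0 \<and> W' y = 0"
  proof -
    have "AE y in lebesgue. if y \<in> cball x0 (2 * r) then z' y = z y \<and> W' y = W y else z' y = 0 \<and> W' y = 0"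
      using rep(2,3) by eventually_elim (use rep(1) in \<open>auto simp: weak_gradient_rep_def\<close>)
    then show ?thesis by (simp only: AE_completion_iff)
  qed
  ultimately show ?thesis using that r rep(1) unfolding weak_gradient_rep_def by blast
qed

lemma mollify_cong_zero:
  fixes w :: "'a::euclidean_space \<Rightarrow> 'b::euclidean_space"
  assumes "AE y in lborel. w y = 0" "w \<in> borel_measurable borel"
  shows "mollify n w x = 0"
proof -
  have [measurable]: "w \<in> borel_measurable borel" by fact
  have "mollify n w x = (LINT y|(lborel::'a measure). (0::'b))" unfolding mollify_def
    by (rule integral_cong_AE) (use assms(1) in auto)
  then show ?thesis by simp
qed

lemma C1_two_diff: "C1_two (\<lambda>a b. a - b) (\<lambda>a b. 1) (\<lambda>a b. - 1) 1"
  unfolding C1_two_def by (auto intro!: derivative_eq_intros simp: case_prod_unfold)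

lemma weak_gradient_diff:
  assumes "open \<Omega>" "is_weak_gradient \<Omega> u U" "is_weak_gradient \<Omega> v V"
  shows "is_weak_gradient \<Omega> (\<lambda>x. u x - v x) (\<lambda>x. U x - V x)"
  using weak_gradient_chain[OF assms(1) C1_two_diff assms(2,3)] by simp

text \<open>The difference vanishes almost everywhere, so its local mollifications are identically
  zero. On a smaller ball their gradients, the mollifications of \<open>W'\<close>, are then zero
  too, and these converge to \<open>W'\<close> in L^1.\<close>

lemma weak_gradient_unique:
  assumes \<Omega>: "open \<Omega>" and "is_weak_gradient \<Omega> u U" "is_weak_gradient \<Omega> v V"
    and uv: "AE x in lebesgue_on \<Omega>. u x = v x"
  shows "AE x in lebesgue_on \<Omega>. U x = V x"
proof -
  define z W where "z x = u x - v x" and "W x = U x - V x" for x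
  have wg: "is_weak_gradient \<Omega> z W" unfolding z_def W_def using assms by (intro weak_gradient_diff)
  have \<Omega>b: "\<Omega> \<in> sets borel" using \<Omega> by simp
  have z0: "AE x in lborel. x \<in> \<Omega> \<longrightarrow> z x = 0"
    using uv unfolding AE_lebesgue_on[OF \<Omega>b] z_def by eventually_elim auto
  have "AE x in lborel. x \<in> \<Omega> \<longrightarrow> W x = 0"
  proof (rule AE_locally)
    fix x0 assume x0: "x0 \<in> \<Omega>"
    obtain r z' W' N where r: "r > 0" "cball x0 (2 * r) \<subseteq> \<Omega>" and i: "integrable lborel z'" "integrable lborel W'"
      and ae: "AE y in lborel. if y \<in> cball x0 (2 * r) then z' y = z y \<and> W' y = W y else z' y = 0 \<and> W' y = 0"
      and gd: "\<forall>n x. n \<ge> N \<longrightarrow> x \<in> ball x0 r \<longrightarrow> (GDERIV (mollify n z') x :> mollify n W' x)"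
      by (rule local_mollification[OF \<Omega> wg x0])
    have "AE y in lborel. z' y = 0" using ae z0 by eventually_elim (use r in \<open>auto split: if_splits\<close>)
    then have "mollify n z' x = 0" for n x using i by (intro mollify_cong_zero) auto
    then have mz: "mollify n z' = (\<lambda>x. 0)" for n by auto
    have "mollify n W' x = 0" if "n \<ge> N" "x \<in> ball x0 r" for n x
      using gd that GDERIV_const[of 0 x] GDERIV_unique unfolding mz by blast
    then have le: "(LINT x|lborel. indicator (ball x0 r) x * norm (W' x)) \<le> (LINT x|lborel. norm (mollify n W' x - W' x))" if "n \<ge> N" for n
      using that i mollify_L1(1)[OF i(2), of n] integrable_mult_indicator[of "ball x0 r" lborel "\<lambda>x. norm (W' x)"]
      by (intro integral_mono) (auto simp: indicator_def)
    have "(LINT x|lborel. indicator (ball x0 r) x * norm (W' x)) \<le> 0"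
      by (rule LIMSEQ_le[OF tendsto_const mollify_L1(2)[OF i(2)]]) (use le in blast)
    then have "(LINT x|lborel. indicator (ball x0 r) x * norm (W' x)) = 0"
      by (intro antisym Bochner_Integration.integral_nonneg) auto
    then have "AE x in lborel. indicator (ball x0 r) x * norm (W' x) = (0::real)"
      using integrable_mult_indicator[of "ball x0 r" lborel "\<lambda>x. norm (W' x)"] i
      by (subst (asm) integral_nonneg_eq_0_iff_AE) auto
    then have "AE y in lborel. y \<in> ball x0 r \<longrightarrow> W y = 0"
      using ae by eventually_elim (use r in \<open>auto simp: indicator_def split: if_splits\<close>)
    then show "\<exists>r>0. AE y in lborel. y \<in> ball x0 r \<longrightarrow> W y = 0" using r by blast
  qed
  then show ?thesis unfolding AE_lebesgue_on[OF \<Omega>b] W_def by simp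
qed

text \<open>Mollifications with zero gradient are constant on a ball, so \<open>z\<close> is
  constant almost everywhere near each point; connectedness makes the local constants agree.\<close>

lemma zero_weak_gradient_constant:
  assumes \<Omega>: "open \<Omega>" "connected \<Omega>" and wg: "is_weak_gradient \<Omega> z W"
    and W0: "AE x in lebesgue_on \<Omega>. W x = 0"
  shows "\<exists>c. AE x in lebesgue_on \<Omega>. z x = c"
proof -
  have \<Omega>b: "\<Omega> \<in> sets borel" using \<Omega> by simp
  have W0': "AE x in lborel. x \<in> \<Omega> \<longrightarrow> W x = 0" using W0 unfolding AE_lebesgue_on[OF \<Omega>b] .
  \<comment> \<open>\<open>loc x c\<close> says that \<open>c\<close> is the constant near
    \<open>x\<close>. At a point of \<open>\<Omega>\<close> it holds for exactly one
    \<open>c\<close>, and it persists nearby, so the points with a given constant and the points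
    with another one split \<open>\<Omega>\<close> into two open sets.\<close>
  define loc where "loc x c \<longleftrightarrow> (\<exists>r>0. AE y in lborel. y \<in> ball x r \<longrightarrow> z y = c)" for x c
  have ex: "\<exists>c. loc x0 c" if x0: "x0 \<in> \<Omega>" for x0
  proof -
    obtain r z' W' N where r: "r > 0" "cball x0 (2 * r) \<subseteq> \<Omega>" and i: "integrable lborel z'" "integrable lborel W'"
      and ae: "AE y in lborel. if y \<in> cball x0 (2 * r) then z' y = z y \<and> W' y = W y else z' y = 0 \<and> W' y = 0"
      and gd: "\<forall>n x. n \<ge> N \<longrightarrow> x \<in> ball x0 r \<longrightarrow> (GDERIV (mollify n z') x :> mollify n W' x)"
      by (rule local_mollification[OF \<Omega>(1) wg x0])
    have "AE y in lborel. W' y = 0" using ae W0' by eventually_elim (use r in \<open>auto split: if_splits\<close>)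
    then have mW: "mollify n W' x = 0" for n x using i by (intro mollify_cong_zero) auto
    have "\<exists>c. \<forall>x\<in>ball x0 r. mollify n z' x = c" if "n \<ge> N" for n
    proof (rule has_derivative_zero_constant)
      show "(mollify n z' has_derivative (\<lambda>h. 0)) (at x within ball x0 r)" if "x \<in> ball x0 r" for x
        using gd \<open>n \<ge> N\<close> that unfolding mW gderiv_def by (auto intro: has_derivative_at_withinI)
    qed simp
    then have cst: "mollify n z' x = mollify n z' y" if "n \<ge> N" "x \<in> ball x0 r" "y \<in> ball x0 r" for n x y
      using that by metis
    have "(\<lambda>n. LINT x|lborel. norm (mollify n z' x - z' x)) \<longlonglongrightarrow> 0" by (rule mollify_L1(2)[OF i(1)])
    then obtain s :: "nat \<Rightarrow> nat" where s: "strict_mono s" "AE x in lborel. (\<lambda>n. mollify (s n) z' x - z' x) \<longlonglongrightarrow> 0"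
      using tendsto_L1_AE_subseq[of lborel "\<lambda>n x. mollify n z' x - z' x"] i mollify_L1(1)[OF i(1)] by auto
    \<comment> \<open>A reference point of convergence exists because a ball is not a null set. The
      mollifications are constant on the ball, so \<open>z' y\<close> is their limit almost
      everywhere in it.\<close>
    obtain y where y: "y \<in> ball x0 r" "(\<lambda>n. mollify (s n) z' y - z' y) \<longlonglongrightarrow> 0"
    proof (rule ccontr)
      assume "\<not> thesis"
      then have "AE y in lborel. y \<in> ball x0 r \<longrightarrow> False" using s(2) that by (auto elim: eventually_mono)
      then show False using not_AE_empty_ball r(1) by blast
    qed
    have "AE x in lborel. x \<in> ball x0 r \<longrightarrow> z x = z' y"
      using s(2) ae
    proof eventually_elim
      case (elim x)
      show ?case
      proof
        assume x: "x \<in> ball x0 r"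
        have "(\<lambda>n. (mollify (s n) z' x - z' x) - (mollify (s n) z' y - z' y)) \<longlonglongrightarrow> 0 - 0"
          using elim(1) y(2) by (rule tendsto_diff)
        moreover have "\<forall>\<^sub>F n in sequentially. (mollify (s n) z' x - z' x) - (mollify (s n) z' y - z' y) = z' y - z' x"
          using cst[OF _ x y(1)] seq_suble[OF s(1)] by (intro eventually_sequentiallyI[of N]) (metis (no_types, lifting) diff_diff_eq2 diff_add_cancel le_trans add_diff_cancel_left' diff_diff_eq add.commute)
        ultimately have "(\<lambda>n::nat. z' y - z' x) \<longlonglongrightarrow> 0" using Lim_transform_eventually by force
        then have "z' x = z' y" by (simp add: LIMSEQ_const_iff)
        then show "z x = z' y" using elim(2) x r by auto
      qed
    qed
    then show ?thesis using r(1) unfolding loc_def by blast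
  qed
  have uniq: "c = c'" if l: "loc x c" "loc x c'" for x c c'
  proof (rule ccontr)
    assume ne: "c \<noteq> c'"
    obtain r r' where r: "r > 0" "AE y in lborel. y \<in> ball x r \<longrightarrow> z y = c" "r' > 0" "AE y in lborel. y \<in> ball x r' \<longrightarrow> z y = c'"
      using l unfolding loc_def by blast
    have "AE y in lborel. y \<in> ball x (min r r') \<longrightarrow> False"
      using r(2,4) by eventually_elim (use ne in auto)
    then show False using not_AE_empty_ball[of "min r r'" x] r by auto
  qed
  have nbh: "\<exists>e>0. \<forall>y\<in>ball x e. loc y c" if l: "loc x c" for x c
  proof -
    obtain r where r: "r > 0" "AE y in lborel. y \<in> ball x r \<longrightarrow> z y = c" using l unfolding loc_def by blast
    have "loc y c" if "y \<in> ball x r" for y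
    proof -
      have "ball y (r - dist x y) \<subseteq> ball x r" using that by (auto simp: subset_iff dist_commute intro: le_less_trans[OF dist_triangle])
        (metis add.commute dist_commute dist_triangle_lt less_diff_eq)
      then have "AE w in lborel. w \<in> ball y (r - dist x y) \<longrightarrow> z w = c" using r(2) by (auto elim!: eventually_mono)
      then show ?thesis unfolding loc_def using that by (intro exI[of _ "r - dist x y"]) auto
    qed
    then show ?thesis using r(1) by blast
  qed
  show ?thesis
  proof (cases "\<Omega> = {}")
    case True then show ?thesis by (auto simp: AE_lebesgue_on)
  next
    case False
    then obtain x0 where x0: "x0 \<in> \<Omega>" by blast
    then obtain c where c: "loc x0 c" using ex by blast
    define S where "S = {x\<in>\<Omega>. loc x c}"
    define T where "T = {x\<in>\<Omega>. \<exists>c'. c' \<noteq> c \<and> loc x c'}"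
    have opn: "open {x\<in>\<Omega>. \<exists>c'. Q c' \<and> loc x c'}" for Q
      unfolding open_contains_ball
    proof
      fix x assume "x \<in> {x\<in>\<Omega>. \<exists>c'. Q c' \<and> loc x c'}"
      then obtain c' where c': "x \<in> \<Omega>" "Q c'" "loc x c'" by auto
      obtain e where e: "e > 0" "\<forall>y\<in>ball x e. loc y c'" using nbh[OF c'(3)] by blast
      obtain e' where e': "e' > 0" "ball x e' \<subseteq> \<Omega>" using \<Omega>(1) c'(1) open_contains_ball by blast
      show "\<exists>e>0. ball x e \<subseteq> {x\<in>\<Omega>. \<exists>c'. Q c' \<and> loc x c'}"
        using e e' c' by (intro exI[of _ "min e e'"]) auto
    qed
    have "open S" using opn[of "\<lambda>c'. c' = c"] by (simp add: S_def)
    moreover have "open T" using opn[of "\<lambda>c'. c' \<noteq> c"] by (simp add: T_def)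
    moreover have "S \<inter> T = {}" using uniq by (auto simp: S_def T_def)
    moreover have "\<Omega> = S \<union> T"
    proof (rule set_eqI)
      fix x
      show "x \<in> \<Omega> \<longleftrightarrow> x \<in> S \<union> T"
      proof (cases "x \<in> \<Omega>")
        case True
        then obtain c' where "loc x c'" using ex by blast
        then show ?thesis using True by (cases "c' = c") (auto simp: S_def T_def)
      qed (auto simp: S_def T_def)
    qed
    moreover have "x0 \<in> S" using x0 c by (simp add: S_def)
    ultimately have "T = {}" using \<Omega>(2) unfolding connected_def by blast
    then have "loc x c" if "x \<in> \<Omega>" for x using that \<open>\<Omega> = S \<union> T\<close> unfolding S_def by blast
    then have "AE x in lborel. x \<in> \<Omega> \<longrightarrow> z x = c" by (intro AE_locally) (auto simp: loc_def)
    then show ?thesis unfolding AE_lebesgue_on[OF \<Omega>b] by blast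
  qed
qed

text \<open>Integration by parts: \<open>u x * \<phi> x\<close> is C^1 with compact support, so its
  gradient integrates to zero.\<close>

lemma C1_weak_gradient:
  assumes \<Omega>: "open \<Omega>" and u: "\<And>x. x \<in> \<Omega> \<Longrightarrow> GDERIV u x :> D x" and D: "continuous_on \<Omega> D"
  shows "is_weak_gradient \<Omega> u D"
  unfolding is_weak_gradient_def
proof (intro conjI allI impI ballI)
  have cu: "continuous_on \<Omega> u" using u GDERIV_continuous by (metis continuous_at_imp_continuous_on)
  show "locally_integrable \<Omega> u" "locally_integrable \<Omega> D"
    unfolding locally_integrable_def using cu D
    by (auto intro!: integrable_lebesgue_on_compact intro: continuous_on_subset)
  fix \<phi> and i :: 'a assume t: "test_function \<Omega> \<phi>" and i: "i \<in> Basis"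
  define K where "K = closure {x. \<phi> x \<noteq> 0}"
  have K: "compact K" "K \<subseteq> \<Omega>" using t by (auto simp: test_function_def K_def)
  have c\<phi>: "C1c K \<phi> (grad \<phi>)" unfolding K_def using t by (rule test_function_C1c)
  have c: "C1c K (\<lambda>x. u x * \<phi> x) (\<lambda>x. u x *\<^sub>R grad \<phi> x + \<phi> x *\<^sub>R D x)"
    by (rule C1c_product[OF \<Omega> u D c\<phi> K(2)])
  have z: "\<phi> x = 0" "grad \<phi> x = 0" if "x \<notin> K" for x
    using c\<phi> C1c_grad_support[OF c\<phi> that] that by (auto simp: C1c_def)
  have z\<Omega>: "\<phi> x = 0" "grad \<phi> x = 0" if "x \<notin> \<Omega>" for x using z K(2) that by blast+
  have ext: "continuous_on UNIV f" if "continuous_on \<Omega> f" "\<And>x. x \<notin> K \<Longrightarrow> f x = 0" for f :: "'a \<Rightarrow> real"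
  proof -
    have "continuous_on (\<Omega> \<union> - K) f"
    proof (rule continuous_on_open_Un[OF \<Omega>])
      show "open (- K)" using K by (simp add: compact_imp_closed open_Compl)
      have "continuous_on (- K) (\<lambda>x. 0::real)" by simp
      then show "continuous_on (- K) f" by (rule continuous_on_eq) (use that in auto)
    qed (use that in auto)
    moreover have "\<Omega> \<union> - K = UNIV" using K by auto
    ultimately show ?thesis by simp
  qed
  have cg: "continuous_on UNIV (grad \<phi>)" "continuous_on UNIV \<phi>" using c\<phi> C1c_continuous[OF c\<phi>] by (auto simp: C1c_def)
  have c1: "continuous_on UNIV (\<lambda>x. u x * (grad \<phi> x \<bullet> i))"
    by (rule ext, intro continuous_intros cu continuous_on_subset[OF cg(1)]) (auto simp: z)
  have c2: "continuous_on UNIV (\<lambda>x. (D x \<bullet> i) * \<phi> x)"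
    by (rule ext, intro continuous_intros D continuous_on_subset[OF cg(2)]) (auto simp: z)
  have i1: "integrable lborel (\<lambda>x. u x * (grad \<phi> x \<bullet> i))"
    by (rule continuous_compact_support_integrable[OF c1 K(1)]) (simp add: z)
  have i2: "integrable lborel (\<lambda>x. (D x \<bullet> i) * \<phi> x)"
    by (rule continuous_compact_support_integrable[OF c2 K(1)]) (simp add: z)
  have cc: "continuous_on UNIV (\<lambda>x. u x *\<^sub>R grad \<phi> x + \<phi> x *\<^sub>R D x)" using c by (simp add: C1c_def)
  have i3: "integrable lborel (\<lambda>x. u x *\<^sub>R grad \<phi> x + \<phi> x *\<^sub>R D x)"
    by (rule continuous_compact_support_integrable[OF cc K(1)]) (simp add: z)
  have "(LINT x|lborel. (u x *\<^sub>R grad \<phi> x + \<phi> x *\<^sub>R D x) \<bullet> i) = 0"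
    using C1c_integral_grad[OF c] integral_inner_left[OF i3, of i] by simp
  then have "(LINT x|lborel. u x * (grad \<phi> x \<bullet> i)) + (LINT x|lborel. (D x \<bullet> i) * \<phi> x) = 0"
    using i1 i2 by (simp add: inner_add_left mult.commute)
  moreover have "(LINT x|lebesgue_on \<Omega>. u x * (grad \<phi> x \<bullet> i)) = (LINT x|lborel. u x * (grad \<phi> x \<bullet> i))"
    by (rule integral_lebesgue_on_support) (use \<Omega> c1 z\<Omega> in \<open>auto intro: borel_measurable_continuous_onI\<close>)
  moreover have "(LINT x|lebesgue_on \<Omega>. (D x \<bullet> i) * \<phi> x) = (LINT x|lborel. (D x \<bullet> i) * \<phi> x)"
    by (rule integral_lebesgue_on_support) (use \<Omega> c2 z\<Omega> in \<open>auto intro: borel_measurable_continuous_onI\<close>)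
  ultimately show "(LINT x|lebesgue_on \<Omega>. u x * frechet_derivative \<phi> (at x) i) = - (LINT x|lebesgue_on \<Omega>. (D x \<bullet> i) * \<phi> x)"
    using i by (simp add: grad_inner)
qed

section \<open>The Sobolev inequality on smooth domains\<close>

lemma integral_scale:
  fixes f :: "'a::euclidean_space \<Rightarrow> real"
  assumes [measurable]: "f \<in> borel_measurable borel" and s: "s > 0"
  shows "(LINT \<theta>|lborel. f (x - s *\<^sub>R \<theta>)) = (LINT y|lborel. f y) / s ^ DIM('a)"
    and "integrable lborel f \<Longrightarrow> integrable lborel (\<lambda>\<theta>. f (x - s *\<^sub>R \<theta>))"
proof -
  have eq: "lborel = density (distr lborel borel (\<lambda>\<theta>. x + (- s) *\<^sub>R \<theta>)) (\<lambda>_. ennreal (s ^ DIM('a)))"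
    using lborel_affine[of "- s" x] s by simp
  have "(LINT y|lborel. f y) = (LINT y|density (distr lborel borel (\<lambda>\<theta>. x + (- s) *\<^sub>R \<theta>)) (\<lambda>_. ennreal (s ^ DIM('a))). f y)"
    using eq by simp
  also have "\<dots> = s ^ DIM('a) * (LINT \<theta>|lborel. f (x - s *\<^sub>R \<theta>))"
    using s by (subst integral_density) (auto simp: integral_distr)
  finally show "(LINT \<theta>|lborel. f (x - s *\<^sub>R \<theta>)) = (LINT y|lborel. f y) / s ^ DIM('a)"
    using s by (simp add: field_simps)
  assume "integrable lborel f"
  then have "integrable (density (distr lborel borel (\<lambda>\<theta>. x + (- s) *\<^sub>R \<theta>)) (\<lambda>_. ennreal (s ^ DIM('a)))) f"
    using eq by simp
  then show "integrable lborel (\<lambda>\<theta>. f (x - s *\<^sub>R \<theta>))"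
    using s by (subst (asm) integrable_density) (auto simp: integrable_distr_eq)
qed

text \<open>The vector field \<open>x \<mapsto> \<integral>\<^sub>C \<integral>\<^sub>0\<^sup>1 f (x - s \<theta>) \<theta> ds d\<theta>\<close> solves the divergence equation with
  right-hand side \<open>|C| f\<close>, up to a smooth error. Testing the weak gradient of \<open>u\<close> with it bounds
  \<open>\<integral> u f\<close> by duality.\<close>

locale cone_field =
  fixes f :: "'a::euclidean_space \<Rightarrow> real" and K :: "'a set" and e :: 'a and r :: real
  assumes smooth: "smooth_on UNIV f" and K: "compact K" "\<And>x. x \<notin> K \<Longrightarrow> f x = 0"
    and f01: "\<And>x. 0 \<le> f x" "\<And>x. f x \<le> 1" and r: "r > 0"
begin

definition C where "C = cball e r"
text \<open>The domain of integration in \<open>s\<close> and \<open>\<theta>\<close> as a weight.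
  Written as one weighted integral over the product, each component of \<open>\<Psi>\<close> is a
  superposition of translates of \<open>f\<close>, hence smooth.\<close>

definition wgt :: "real \<times> 'a \<Rightarrow> real" where "wgt = indicator ({0..1} \<times> C)"
definition \<Psi> where "\<Psi> x = (LINT z|lborel. wgt z *\<^sub>R (f (x - fst z *\<^sub>R snd z) *\<^sub>R snd z))"
definition R where "R = norm e + r"

lemma c1: "C1c K f (grad f)" using smooth K by (rule smooth_C1c)
lemma f_cont: "continuous_on UNIV f" using c1 by (rule C1c_continuous)
lemma f_meas [measurable]: "f \<in> borel_measurable borel" using f_cont by (rule borel_measurable_continuous_onI)
lemma gf_cont: "continuous_on UNIV (grad f)" using c1 by (simp add: C1c_def)
lemma gf_meas [measurable]: "grad f \<in> borel_measurable borel" using gf_cont by (rule borel_measurable_continuous_onI)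
lemma f_int: "integrable lborel f" using continuous_compact_support_integrable[OF f_cont K] .

lemma C_compact: "compact C" by (simp add: C_def)
lemma C_meas [measurable]: "C \<in> sets borel" by (simp add: C_def)
lemma C_norm: "\<theta> \<in> C \<Longrightarrow> norm \<theta> \<le> R"
  unfolding C_def R_def using norm_triangle_sub[of \<theta> e] by (auto simp: dist_norm norm_minus_commute)
lemma R_pos: "R > 0" using r by (simp add: R_def add_nonneg_pos)

lemma box_compact: "compact ({0..1::real} \<times> C)" by (intro compact_Times C_compact compact_Icc)

lemma wgt_meas [measurable]: "wgt \<in> borel_measurable borel"
proof -
  have "{0..1::real} \<times> C \<in> sets borel" using box_compact by (simp add: compact_imp_closed)
  then show ?thesis unfolding wgt_def by (rule borel_measurable_indicator)
qed

lemma wgt_int: "integrable lborel (\<lambda>z. wgt z *\<^sub>R g z)"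
  if "continuous_on UNIV g" for g :: "real \<times> 'a \<Rightarrow> 'b::euclidean_space"
  using borel_integrable_compact[OF box_compact, of g] continuous_on_subset[OF that]
  by (simp add: wgt_def)

lemma partial_smooth: "smooth_on UNIV (\<lambda>x. LINT z|lborel. (wgt z * (snd z \<bullet> i)) * f (x - fst z *\<^sub>R snd z))"
  and partial_GDERIV: "GDERIV (\<lambda>x. LINT z|lborel. (wgt z * (snd z \<bullet> i)) * f (x - fst z *\<^sub>R snd z)) x :>
      (LINT z|lborel. (wgt z * (snd z \<bullet> i)) *\<^sub>R grad f (x - fst z *\<^sub>R snd z))"
  and partial_int: "integrable lborel (\<lambda>z. (wgt z * (snd z \<bullet> i)) *\<^sub>R grad f (x - fst z *\<^sub>R snd z))"
proof -
  have i: "integrable lborel (\<lambda>z. wgt z * (snd z \<bullet> i))"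
    using wgt_int[of "\<lambda>z. snd z \<bullet> i"] by (simp add: continuous_intros)
  have m: "(\<lambda>z::real \<times> 'a. fst z *\<^sub>R snd z) \<in> borel_measurable lborel"
    by (simp, intro borel_measurable_continuous_onI continuous_intros)
  show "smooth_on UNIV (\<lambda>x. LINT z|lborel. (wgt z * (snd z \<bullet> i)) * f (x - fst z *\<^sub>R snd z))"
    by (rule superposition_smooth[OF smooth K i m])
  show "GDERIV (\<lambda>x. LINT z|lborel. (wgt z * (snd z \<bullet> i)) * f (x - fst z *\<^sub>R snd z)) x :>
      (LINT z|lborel. (wgt z * (snd z \<bullet> i)) *\<^sub>R grad f (x - fst z *\<^sub>R snd z))"
    by (rule superposition_GDERIV(1)[OF c1 i m])
  show "integrable lborel (\<lambda>z. (wgt z * (snd z \<bullet> i)) *\<^sub>R grad f (x - fst z *\<^sub>R snd z))"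
    by (rule superposition_GDERIV(3)[OF c1 i m])
qed

lemma shift_cont: "continuous_on UNIV (\<lambda>z::real \<times> 'a. f (x - fst z *\<^sub>R snd z))"
  by (rule continuous_on_compose2[OF f_cont]) (auto intro!: continuous_intros)

lemma \<Psi>_int: "integrable lborel (\<lambda>z. wgt z *\<^sub>R (f (x - fst z *\<^sub>R snd z) *\<^sub>R snd z))"
  by (rule wgt_int) (intro continuous_intros shift_cont)

lemma \<Psi>_inner: "\<Psi> x \<bullet> i = (LINT z|lborel. (wgt z * (snd z \<bullet> i)) * f (x - fst z *\<^sub>R snd z))"
  unfolding \<Psi>_def by (subst integral_inner_left[symmetric, OF \<Psi>_int]) (simp add: mult_ac)

text \<open>Since \<open>\<theta> \<bullet> grad f (x - s *\<^sub>R \<theta>)\<close> is minus the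
  derivative of \<open>f (x - s *\<^sub>R \<theta>)\<close> in \<open>s\<close>, integration over
  \<open>s\<close> gives \<open>f x - f (x - \<theta>)\<close>, and integration over the ball
  \<open>C\<close> gives the two terms. The second one is the error, a local integral of
  \<open>f\<close>.\<close>

lemma divergence:
  "(\<Sum>i\<in>Basis. grad (\<lambda>x. \<Psi> x \<bullet> i) x \<bullet> i) = measure lborel C * f x - (LINT \<theta>|lborel. indicator C \<theta> * f (x - \<theta>))"
proof -
  have g: "grad (\<lambda>x. \<Psi> x \<bullet> i) x = (LINT z|lborel. (wgt z * (snd z \<bullet> i)) *\<^sub>R grad f (x - fst z *\<^sub>R snd z))" for i
    unfolding \<Psi>_inner using partial_GDERIV[of i x] smooth_on_GDERIV[OF partial_smooth, of x i] GDERIV_unique by blast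
  have gc: "continuous_on UNIV (\<lambda>z::real \<times> 'a. snd z \<bullet> grad f (x - fst z *\<^sub>R snd z))"
    by (intro continuous_intros continuous_on_compose2[OF gf_cont]) auto
  have "(\<Sum>i\<in>Basis. grad (\<lambda>x. \<Psi> x \<bullet> i) x \<bullet> i) = (\<Sum>i\<in>Basis. (LINT z|lborel. wgt z * ((snd z \<bullet> i) * (grad f (x - fst z *\<^sub>R snd z) \<bullet> i))))"
    unfolding g by (intro sum.cong refl, subst integral_inner_left[symmetric, OF partial_int]) (simp add: mult_ac)
  also have "\<dots> = (LINT z|lborel. (\<Sum>i\<in>Basis. wgt z * ((snd z \<bullet> i) * (grad f (x - fst z *\<^sub>R snd z) \<bullet> i))))"
    using integrable_inner_left[OF partial_int] by (subst Bochner_Integration.integral_sum) (auto simp: mult_ac)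
  also have "\<dots> = (LINT z|lborel. wgt z *\<^sub>R (snd z \<bullet> grad f (x - fst z *\<^sub>R snd z)))"
    by (simp add: sum_distrib_left[symmetric] euclidean_inner[symmetric])
  also have "\<dots> = (LINT z|(lborel \<Otimes>\<^sub>M lborel). (\<lambda>(s, \<theta>). wgt (s, \<theta>) *\<^sub>R (\<theta> \<bullet> grad f (x - s *\<^sub>R \<theta>))) z)"
    unfolding lborel_prod by (simp add: case_prod_unfold)
  also have "\<dots> = (LINT \<theta>|lborel. (LINT s|lborel. wgt (s, \<theta>) *\<^sub>R (\<theta> \<bullet> grad f (x - s *\<^sub>R \<theta>))))"
    using wgt_int[OF gc] by (subst lborel_pair.integral_snd) (simp_all add: lborel_prod case_prod_unfold)
  also have "\<dots> = (LINT \<theta>|lborel. indicator C \<theta> * f x - indicator C \<theta> * f (x - \<theta>))"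
  proof (intro Bochner_Integration.integral_cong refl)
    fix \<theta> :: 'a
    have vd: "((\<lambda>s. - f (x - s *\<^sub>R \<theta>)) has_vector_derivative \<theta> \<bullet> grad f (x - s *\<^sub>R \<theta>)) (at s within {0..1})" for s
    proof -
      have a: "(f has_derivative (\<lambda>h. h \<bullet> grad f (x - s *\<^sub>R \<theta>))) (at (x - s *\<^sub>R \<theta>))"
        using c1 by (simp add: C1c_def gderiv_def)
      have "((\<lambda>s. x - s *\<^sub>R \<theta>) has_derivative (\<lambda>h. 0 - h *\<^sub>R \<theta>)) (at s within {0..1})"
        by (intro has_derivative_diff has_derivative_const has_derivative_scaleR_left has_derivative_ident)
      then have b: "((\<lambda>s. x - s *\<^sub>R \<theta>) has_derivative (\<lambda>h. - (h *\<^sub>R \<theta>))) (at s within {0..1})"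
        by simp
      from has_derivative_minus[OF has_derivative_compose[OF b a]] show ?thesis by (simp add: has_vector_derivative_def)
    qed
    have "(LINT s|lborel. indicator {0..1} s *\<^sub>R (\<theta> \<bullet> grad f (x - s *\<^sub>R \<theta>))) = - f (x - 1 *\<^sub>R \<theta>) - (- f (x - 0 *\<^sub>R \<theta>))"
      by (rule integral_FTC_atLeastAtMost[OF _ vd])
        (auto intro!: continuous_intros continuous_on_compose2[OF gf_cont])
    then show "(LINT s|lborel. wgt (s, \<theta>) *\<^sub>R (\<theta> \<bullet> grad f (x - s *\<^sub>R \<theta>))) = indicator C \<theta> * f x - indicator C \<theta> * f (x - \<theta>)"
      by (cases "\<theta> \<in> C") (simp_all add: wgt_def indicator_times)
  qed
  also have "\<dots> = measure lborel C * f x - (LINT \<theta>|lborel. indicator C \<theta> * f (x - \<theta>))"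
  proof -
    have "integrable lborel (\<lambda>\<theta>. indicator C \<theta> *\<^sub>R f (x - \<theta>))"
      by (rule borel_integrable_compact[OF C_compact]) (auto intro!: continuous_intros continuous_on_compose2[OF f_cont])
    moreover have "integrable lborel (indicat_real C)"
      using C_compact emeasure_compact_finite[OF C_compact] by (intro integrable_real_indicator) auto
    ultimately show ?thesis by simp
  qed
  finally show ?thesis .
qed

lemma error_bound:
  "0 \<le> (LINT \<theta>|lborel. indicator C \<theta> * f (x - \<theta>))"
  "(LINT \<theta>|lborel. indicator C \<theta> * f (x - \<theta>)) \<le> (LINT y|lborel. f y)"
proof -
  show "0 \<le> (LINT \<theta>|lborel. indicator C \<theta> * f (x - \<theta>))" using f01 by (intro Bochner_Integration.integral_nonneg) auto
  have i: "integrable lborel (\<lambda>\<theta>. f (x - \<theta>))" using f_int integral_reflect(2)[of f x] by simp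
  have "(LINT \<theta>|lborel. indicator C \<theta> * f (x - \<theta>)) \<le> (LINT \<theta>|lborel. f (x - \<theta>))"
    using i f01 integrable_mult_indicator[of C lborel "\<lambda>\<theta>. f (x - \<theta>)"] by (intro integral_mono) (auto split: split_indicator)
  then show "(LINT \<theta>|lborel. indicator C \<theta> * f (x - \<theta>)) \<le> (LINT y|lborel. f y)"
    using integral_reflect(1)[of f x] by simp
qed

lemma \<Psi>_support: "\<Psi> x = 0" if "\<And>s \<theta>. s \<in> {0..1} \<Longrightarrow> \<theta> \<in> C \<Longrightarrow> x - s *\<^sub>R \<theta> \<notin> K"
proof -
  have "wgt z *\<^sub>R (f (x - fst z *\<^sub>R snd z) *\<^sub>R snd z) = 0" for z
    using that[of "fst z" "snd z"] K(2) by (cases z) (auto simp: wgt_def indicator_def)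
  then have "(\<lambda>z. wgt z *\<^sub>R (f (x - fst z *\<^sub>R snd z) *\<^sub>R snd z)) = (\<lambda>z. 0)" by (rule ext)
  then show ?thesis unfolding \<Psi>_def by simp
qed

text \<open>The inner integral \<open>J s\<close> is at most the measure of \<open>C\<close> because
  \<open>f \<le> 1\<close>. By rescaling it is also at most \<open>m * s powr (- \<nu>)\<close>,
  where \<open>s \<le> 1\<close> allows the dimension to be raised to \<open>\<nu>\<close>. The
  first bound up to \<open>\<tau>\<close> and the second beyond it yield the power
  \<open>1 / \<nu>\<close> of \<open>m\<close>. Working with \<open>\<nu>\<close> in place of the
  dimension keeps the exponent above 1 also on the line.\<close>

lemma \<Psi>_bound:
  assumes m: "0 < m" "(LINT y|lborel. f y) \<le> m" and \<nu>: "\<nu> > 1" "\<nu> \<ge> real DIM('a)"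
  shows "norm (\<Psi> x) \<le> R * (measure lborel C + 1 / (\<nu> - 1)) * m powr (1 / \<nu>)"
proof -
  define J where "J s = (LINT \<theta>|lborel. indicator C \<theta> * f (x - s *\<^sub>R \<theta>))" for s
  \<comment> \<open>The value of \<open>s\<close> at which \<open>m * s powr (- \<nu>)\<close>
    equals 1. If it exceeds 1, the second range is empty.\<close>
  define \<tau> where "\<tau> = m powr (1 / \<nu>)"
  have \<tau>: "\<tau> > 0" using m by (simp add: \<tau>_def)
  have \<tau>m: "m = \<tau> powr \<nu>" using m \<nu> by (simp add: \<tau>_def powr_powr)
  have \<beta>i: "integrable lborel (indicat_real C)"
    using C_compact emeasure_compact_finite[OF C_compact] by (intro integrable_real_indicator) auto
  have ifs: "integrable lborel (\<lambda>\<theta>. indicator C \<theta> *\<^sub>R f (x - s *\<^sub>R \<theta>))" for s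
    by (rule borel_integrable_compact[OF C_compact]) (auto intro!: continuous_intros continuous_on_compose2[OF f_cont])
  have J0: "0 \<le> J s" for s unfolding J_def using f01 by (intro Bochner_Integration.integral_nonneg) auto
  have J1: "J s \<le> measure lborel C" for s
  proof -
    have "J s \<le> (LINT \<theta>|lborel. indicator C \<theta>)"
      unfolding J_def using ifs[of s] \<beta>i f01 by (intro integral_mono) (auto split: split_indicator)
    then show ?thesis by simp
  qed
  have J2: "J s \<le> m * s powr (- \<nu>)" if s: "0 < s" "s \<le> 1" for s
  proof -
    have "J s \<le> (LINT \<theta>|lborel. f (x - s *\<^sub>R \<theta>))"
      unfolding J_def using ifs[of s] integral_scale(2)[OF f_meas s(1) f_int, of x] f01 by (intro integral_mono) (auto split: split_indicator)
    also have "\<dots> = (LINT y|lborel. f y) / s ^ DIM('a)" by (rule integral_scale(1)[OF f_meas s(1)])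
    also have "\<dots> \<le> m / s ^ DIM('a)" using m s by (intro divide_right_mono) auto
    also have "\<dots> = m * s powr (- real DIM('a))" using s by (simp add: powr_minus powr_realpow divide_inverse)
    also have "\<dots> \<le> m * s powr (- \<nu>)" using m s \<nu> by (intro mult_left_mono powr_mono') auto
    finally show ?thesis .
  qed
  have "norm (\<Psi> x) \<le> (LINT z|lborel. norm (wgt z *\<^sub>R (f (x - fst z *\<^sub>R snd z) *\<^sub>R snd z)))"
    unfolding \<Psi>_def by (rule integral_norm_bound)
  also have "\<dots> \<le> (LINT z|lborel. R * (wgt z *\<^sub>R f (x - fst z *\<^sub>R snd z)))"
  proof (rule integral_mono)
    show "integrable lborel (\<lambda>z. norm (wgt z *\<^sub>R (f (x - fst z *\<^sub>R snd z) *\<^sub>R snd z)))"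
      by (intro integrable_norm \<Psi>_int)
    show "integrable lborel (\<lambda>z. R * (wgt z *\<^sub>R f (x - fst z *\<^sub>R snd z)))"
      by (intro integrable_mult_right wgt_int shift_cont)
    fix z :: "real \<times> 'a"
    show "norm (wgt z *\<^sub>R (f (x - fst z *\<^sub>R snd z) *\<^sub>R snd z)) \<le> R * (wgt z *\<^sub>R f (x - fst z *\<^sub>R snd z))"
      using C_norm[of "snd z"] f01 by (cases z) (auto simp: wgt_def indicator_def intro!: mult_left_mono simp: mult.commute[of R])
  qed
  also have "\<dots> = R * (LINT z|lborel. wgt z *\<^sub>R f (x - fst z *\<^sub>R snd z))" by simp
  also have "(LINT z|lborel. wgt z *\<^sub>R f (x - fst z *\<^sub>R snd z)) = (LINT z|(lborel \<Otimes>\<^sub>M lborel). (\<lambda>(s, \<theta>). wgt (s, \<theta>) *\<^sub>R f (x - s *\<^sub>R \<theta>)) z)"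
    unfolding lborel_prod by (simp add: case_prod_unfold)
  also have "\<dots> = (LINT s|lborel. (LINT \<theta>|lborel. wgt (s, \<theta>) *\<^sub>R f (x - s *\<^sub>R \<theta>)))"
    using wgt_int[OF shift_cont[of x]] by (subst lborel_pair.integral_fst) (simp_all add: lborel_prod case_prod_unfold)
  also have "\<dots> = (LINT s|lborel. indicator {0..1} s * J s)"
    unfolding J_def by (intro Bochner_Integration.integral_cong refl) (simp_all add: wgt_def indicator_times mult.assoc)
  also have "\<dots> \<le> (measure lborel C + 1 / (\<nu> - 1)) * \<tau>"
  proof -
    have iJ: "integrable lborel (\<lambda>s. indicator {0..1} s * J s)"
    proof -
      have "integrable lborel (\<lambda>s. (LINT \<theta>|lborel. wgt (s, \<theta>) *\<^sub>R f (x - s *\<^sub>R \<theta>)))"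
        using wgt_int[OF shift_cont[of x]] by (intro lborel_pair.integrable_fst) (simp add: lborel_prod case_prod_unfold)
      moreover have "(\<lambda>s. (LINT \<theta>|lborel. wgt (s, \<theta>) *\<^sub>R f (x - s *\<^sub>R \<theta>))) =
          (\<lambda>s. indicator {0..1} s * (LINT \<theta>|lborel. indicator C \<theta> * f (x - s *\<^sub>R \<theta>)))"
        by (rule ext) (simp add: wgt_def indicator_times mult.assoc)
      ultimately show ?thesis unfolding J_def by metis
    qed
    have FTC: "(LINT s|lborel. indicator {\<tau>..1} s *\<^sub>R (m * s powr (- \<nu>))) \<le> \<tau> / (\<nu> - 1)"
      and iP: "integrable lborel (\<lambda>s. indicator {\<tau>..1} s *\<^sub>R (m * s powr (- \<nu>)))"
    proof -
      have co: "continuous_on {\<tau>..1} (\<lambda>s. m * s powr (- \<nu>))" using \<tau> by (intro continuous_intros) auto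
      then show "integrable lborel (\<lambda>s. indicator {\<tau>..1} s *\<^sub>R (m * s powr (- \<nu>)))"
        by (intro borel_integrable_compact) auto
      show "(LINT s|lborel. indicator {\<tau>..1} s *\<^sub>R (m * s powr (- \<nu>))) \<le> \<tau> / (\<nu> - 1)"
      proof (cases "\<tau> \<le> 1")
        case True
        have "(LINT s|lborel. indicator {\<tau>..1} s *\<^sub>R (m * s powr (- \<nu>)))
           = - (m * 1 powr (1 - \<nu>) / (\<nu> - 1)) - - (m * \<tau> powr (1 - \<nu>) / (\<nu> - 1))"
        proof (rule integral_FTC_atLeastAtMost[OF True _ co])
          fix s assume s: "\<tau> \<le> s" "s \<le> 1"
          have "((\<lambda>s. - (m * s powr (1 - \<nu>) / (\<nu> - 1))) has_real_derivative m * s powr (- \<nu>)) (at s within {\<tau>..1})"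
          proof -
            have "((\<lambda>s. - (m * s powr (1 - \<nu>) / (\<nu> - 1))) has_real_derivative - (m * ((1 - \<nu>) * s powr (1 - \<nu> - 1)) / (\<nu> - 1))) (at s)"
              using s \<tau> \<nu> by (auto intro!: derivative_eq_intros)
            also have "- (m * ((1 - \<nu>) * s powr (1 - \<nu> - 1)) / (\<nu> - 1)) = m * s powr (- \<nu>)"
              using \<nu> by (simp add: field_simps)
            finally show ?thesis by (rule has_field_derivative_at_within)
          qed
          then show "((\<lambda>s. - (m * s powr (1 - \<nu>) / (\<nu> - 1))) has_vector_derivative m * s powr (- \<nu>)) (at s within {\<tau>..1})"
            by (rule has_real_derivative_iff_has_vector_derivative[THEN iffD1])
        qed
        also have "\<dots> \<le> m * \<tau> powr (1 - \<nu>) / (\<nu> - 1)" using m \<nu> by simp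
        also have "m * \<tau> powr (1 - \<nu>) = \<tau>" unfolding \<tau>m using \<tau> by (simp flip: powr_add)
        finally show ?thesis .
      next
        case False
        then show ?thesis using \<tau> \<nu> by simp
      qed
    qed
    have i0: "integrable lborel (\<lambda>s. measure lborel C * indicator {0..\<tau>} s)"
      by (intro integrable_mult_right integrable_real_indicator) (auto simp: emeasure_lborel_Icc_eq)
    have "(LINT s|lborel. indicator {0..1} s * J s) \<le> (LINT s|lborel. measure lborel C * indicator {0..\<tau>} s + indicator {\<tau>..1} s *\<^sub>R (m * s powr (- \<nu>)))"
    proof (intro integral_mono iJ Bochner_Integration.integrable_add i0 iP)
      fix s :: real
      define a where "a = m * s powr (- \<nu>)"
      have "0 \<le> a" using m by (simp add: a_def)
      then show "indicator {0..1} s * J s \<le> measure lborel C * indicator {0..\<tau>} s + indicator {\<tau>..1} s *\<^sub>R (m * s powr (- \<nu>))"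
        using J1[of s] J2[of s] \<tau> unfolding a_def[symmetric] by (auto simp: indicator_def)
    qed
    also have "\<dots> = measure lborel C * \<tau> + (LINT s|lborel. indicator {\<tau>..1} s *\<^sub>R (m * s powr (- \<nu>)))"
      using i0 iP \<tau> by simp
    also have "\<dots> \<le> measure lborel C * \<tau> + \<tau> / (\<nu> - 1)" using FTC by simp
    finally show ?thesis by (simp add: algebra_simps)
  qed
  finally show ?thesis using R_pos by (simp add: \<tau>_def mult.assoc mult_left_mono)
qed

end

section \<open>Local cones and the weak-type bound\<close>

lemma local_defining_function_gradient:
  assumes "local_defining_function \<Omega> U \<rho>" "y \<in> U"
  shows "GDERIV \<rho> y :> grad \<rho> y" "grad \<rho> y \<noteq> 0"
proof -
  show g: "GDERIV \<rho> y :> grad \<rho> y"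
    using assms smooth_on_GDERIV unfolding local_defining_function_def by blast
  then show "grad \<rho> y \<noteq> 0" using assms unfolding local_defining_function_def by metis
qed

lemma nonincreasing_along:
  assumes g: "\<And>y. y \<in> S \<Longrightarrow> GDERIV \<rho> y :> G y" and seg: "\<And>t. t \<in> {0..s} \<Longrightarrow> x + t *\<^sub>R \<theta> \<in> S"
    and d: "\<And>y. y \<in> S \<Longrightarrow> \<theta> \<bullet> G y \<le> c" and s: "0 \<le> s"
  shows "\<rho> (x + s *\<^sub>R \<theta>) \<le> \<rho> x + c * s"
proof -
  have "(\<lambda>t. \<rho> (x + t *\<^sub>R \<theta>) - c * t) s \<le> (\<lambda>t. \<rho> (x + t *\<^sub>R \<theta>) - c * t) 0"
  proof (rule DERIV_nonpos_imp_nonincreasing[OF s])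
    fix t assume t: "0 \<le> t" "t \<le> s"
    have a: "(\<rho> has_derivative (\<lambda>h. h \<bullet> G (x + t *\<^sub>R \<theta>))) (at (x + t *\<^sub>R \<theta>))"
      using g[OF seg, of t] t by (simp add: gderiv_def)
    have "((\<lambda>t. x + t *\<^sub>R \<theta>) has_derivative (\<lambda>h. 0 + h *\<^sub>R \<theta>)) (at t)"
      by (intro has_derivative_add has_derivative_const has_derivative_scaleR_left has_derivative_ident)
    then have b: "((\<lambda>t. x + t *\<^sub>R \<theta>) has_derivative (\<lambda>h. h *\<^sub>R \<theta>)) (at t)" by simp
    have "((\<lambda>t. \<rho> (x + t *\<^sub>R \<theta>)) has_field_derivative (\<theta> \<bullet> G (x + t *\<^sub>R \<theta>))) (at t)"
      unfolding has_field_derivative_def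
      using has_derivative_compose[OF b a] by (simp add: mult_commute_abs)
    then have "((\<lambda>t. \<rho> (x + t *\<^sub>R \<theta>) - c * t) has_field_derivative (\<theta> \<bullet> G (x + t *\<^sub>R \<theta>) - c)) (at t)"
      by (auto intro!: derivative_eq_intros)
    then show "\<exists>y. ((\<lambda>t. \<rho> (x + t *\<^sub>R \<theta>) - c * t) has_real_derivative y) (at t) \<and> y \<le> 0"
      using d[OF seg, of t] t by force
  qed
  then show ?thesis by simp
qed

text \<open>Near a boundary point the directions close to a multiple of \<open>- D\<close> do not
  increase \<open>\<rho>\<close>, by continuity of its gradient, so segments that start in
  \<open>\<Omega>\<close> stay where \<open>\<rho>\<close> is negative. At an interior point a small
  ball of directions about 0 serves as the cone.\<close>

lemma cone_condition:
  assumes \<Omega>: "open \<Omega>" and bd: "\<forall>x\<in>frontier \<Omega>. \<exists>U \<rho>. x \<in> U \<and> local_defining_function \<Omega> U \<rho>"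
    and x0: "x0 \<in> closure \<Omega>"
  shows "\<exists>V e r. open V \<and> x0 \<in> V \<and> r > 0 \<and> (\<forall>x\<in>V \<inter> \<Omega>. \<forall>\<theta>\<in>cball e r. \<forall>s\<in>{0..1}. x + s *\<^sub>R \<theta> \<in> \<Omega>)"
proof (cases "x0 \<in> \<Omega>")
  case True
  then obtain d where d: "d > 0" "ball x0 d \<subseteq> \<Omega>" using \<Omega> open_contains_ball by blast
  have "x + s *\<^sub>R \<theta> \<in> \<Omega>" if "x \<in> ball x0 (d/2)" "\<theta> \<in> cball 0 (d/2)" "s \<in> {0..1}" for x \<theta> s
  proof -
    have "norm (s *\<^sub>R \<theta>) \<le> 1 * (d/2)" unfolding norm_scaleR using that by (intro mult_mono) auto
    then have "dist x0 (x + s *\<^sub>R \<theta>) < d"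
      using that(1) dist_triangle[of x0 "x + s *\<^sub>R \<theta>" x] by (simp add: dist_norm)
    then show ?thesis using d by auto
  qed
  then show ?thesis using d(1) by (intro exI[of _ "ball x0 (d/2)"] exI[of _ 0] exI[of _ "d/2"]) auto
next
  case False
  then have "x0 \<in> frontier \<Omega>" using \<Omega> x0 by (simp add: frontier_def interior_open)
  then obtain U \<rho> where U: "x0 \<in> U" "local_defining_function \<Omega> U \<rho>" using bd by blast
  have oU: "open U" and \<Omega>U: "\<Omega> \<inter> U = {y\<in>U. \<rho> y < 0}" and sm: "smooth_on U \<rho>"
    using U(2) by (auto simp: local_defining_function_def)
  note gr = local_defining_function_gradient[OF U(2)]
  define D where "D = grad \<rho> x0"
  have D: "D \<noteq> 0" using gr(2)[OF U(1)] by (simp add: D_def)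
  have "continuous (at x0) (grad \<rho>)"
    using smooth_on_grad_continuous[OF sm] oU U(1) continuous_on_eq_continuous_at by blast
  then obtain d1 where d1: "d1 > 0" "\<And>y. dist y x0 < d1 \<Longrightarrow> dist (grad \<rho> y) D < norm D / 4"
    using D unfolding continuous_at_eps_delta D_def by (metis divide_pos_pos zero_less_norm_iff zero_less_numeral)
  obtain d2 where d2: "d2 > 0" "ball x0 d2 \<subseteq> U" using oU U(1) open_contains_ball by blast
  define d where "d = min d1 d2"
  have d: "d > 0" using d1 d2 by (simp add: d_def)
  \<comment> \<open>This size gives \<open>norm \<theta>\<close> at most 5/16 of \<open>d\<close>,
    so that segments starting within \<open>d / 2\<close> of \<open>x0\<close> stay in the ball of
    radius \<open>d\<close>.\<close>
  define t where "t = d / (4 * norm D)"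
  have t: "t > 0" using d D by (simp add: t_def)
  have tD: "t * norm D = d / 4" using D by (simp add: t_def)
  have "x + s *\<^sub>R \<theta> \<in> \<Omega>" if x: "x \<in> ball x0 (d/2) \<inter> \<Omega>" and \<theta>: "\<theta> \<in> cball (- (t *\<^sub>R D)) (t * norm D / 4)" and s: "s \<in> {0..1}" for x \<theta> s
  proof -
    define \<xi> where "\<xi> = \<theta> + t *\<^sub>R D"
    have \<xi>: "norm \<xi> \<le> t * norm D / 4" using \<theta> by (simp add: \<xi>_def dist_norm norm_minus_commute)
    have \<theta>eq: "\<theta> = \<xi> - t *\<^sub>R D" by (simp add: \<xi>_def)
    have "norm \<theta> \<le> norm \<xi> + norm (t *\<^sub>R D)" unfolding \<theta>eq by (rule norm_triangle_ineq4)
    then have n\<theta>: "norm \<theta> < d / 2" using \<xi> t tD d by simp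
    have seg: "x + \<tau> *\<^sub>R \<theta> \<in> ball x0 d" if "\<tau> \<in> {0..s}" for \<tau>
    proof -
      have "norm (\<tau> *\<^sub>R \<theta>) \<le> 1 * norm \<theta>" unfolding norm_scaleR using that s by (intro mult_right_mono) auto
      then show ?thesis using x n\<theta> dist_triangle[of x0 "x + \<tau> *\<^sub>R \<theta>" x] by (simp add: dist_norm)
    qed
    have neg: "\<theta> \<bullet> grad \<rho> y \<le> 0" if "y \<in> ball x0 d" for y
    proof -
      define \<eta> where "\<eta> = grad \<rho> y - D"
      have \<eta>: "norm \<eta> \<le> norm D / 4" using d1(2)[of y] that by (simp add: \<eta>_def dist_norm d_def norm_minus_commute)
      \<comment> \<open>The main term is \<open>- t * (D \<bullet> D)\<close>; the three
        perturbations are at most 1/4, 1/16 and 1/4 of its size.\<close>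
      have "\<theta> \<bullet> grad \<rho> y = \<xi> \<bullet> D + \<xi> \<bullet> \<eta> - t * (D \<bullet> D) - t * (D \<bullet> \<eta>)"
        by (simp add: \<theta>eq \<eta>_def algebra_simps inner_diff_left inner_diff_right)
      moreover have "\<xi> \<bullet> D \<le> (t * norm D / 4) * norm D"
        using norm_cauchy_schwarz[of \<xi> D] mult_right_mono[OF \<xi>, of "norm D"] by simp
      moreover have "\<xi> \<bullet> \<eta> \<le> (t * norm D / 4) * (norm D / 4)"
        using norm_cauchy_schwarz[of \<xi> \<eta>] mult_mono[OF \<xi> \<eta>] t by simp
      moreover have "- (D \<bullet> \<eta>) \<le> norm D * (norm D / 4)"
        using norm_cauchy_schwarz[of "- D" \<eta>] mult_left_mono[OF \<eta>, of "norm D"] by simp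
      then have "t * (- (D \<bullet> \<eta>)) \<le> t * (norm D * (norm D / 4))" using t by (intro mult_left_mono) auto
      moreover have "D \<bullet> D = norm D * norm D" by (simp add: power2_norm_eq_inner[symmetric] power2_eq_square)
      moreover have "t * (norm D * norm D) \<ge> 0" using t by simp
      ultimately show ?thesis by (simp add: algebra_simps)
    qed
    have "\<rho> (x + s *\<^sub>R \<theta>) \<le> \<rho> x + 0 * s"
      by (rule nonincreasing_along[where S = "ball x0 d" and G = "grad \<rho>"]) (use gr(1) d2 seg neg s in \<open>auto simp: d_def\<close>)
    also have "\<dots> < 0"
    proof -
      have "x \<in> ball x0 d2" using x d by (auto simp: d_def)
      then show ?thesis using x \<Omega>U d2 by auto
    qed
    finally have "\<rho> (x + s *\<^sub>R \<theta>) < 0" .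
    moreover have "x + s *\<^sub>R \<theta> \<in> U" using seg[of s] s d2 by (auto simp: d_def)
    ultimately show ?thesis using \<Omega>U by blast
  qed
  moreover have "t * norm D / 4 > 0" using t D by simp
  ultimately show ?thesis using d
    by (intro exI[of _ "ball x0 (d/2)"] exI[of _ "- (t *\<^sub>R D)"] exI[of _ "t * norm D / 4"]) auto
qed

text \<open>The indicator of the \<open>d / 2\<close>-neighbourhood \<open>W\<close> of
  \<open>K\<close>, mollified with radius below \<open>d / 2\<close>, is 1 on \<open>K\<close> and 0
  outside the \<open>d\<close>-neighbourhood.\<close>

lemma smooth_urysohn:
  fixes K :: "'a::euclidean_space set"
  assumes "compact K" "open Q" "K \<subseteq> Q"
  obtains f K' where "smooth_on UNIV f" "compact K'" "K' \<subseteq> Q" "\<And>x. x \<notin> K' \<Longrightarrow> f x = (0::real)"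
    "\<And>x. 0 \<le> f x" "\<And>x. f x \<le> 1" "\<And>x. x \<in> K \<Longrightarrow> f x = 1"
proof -
  obtain d where d: "d > 0" "compact (\<Union>x\<in>K. cball x d)" "(\<Union>x\<in>K. cball x d) \<subseteq> Q"
    using compact_neighbourhood[OF assms] by blast
  define K' where "K' = (\<Union>x\<in>K. cball x d)"
  define W where "W = (\<Union>x\<in>K. ball x (d/2))"
  have W: "open W" "W \<subseteq> K'" unfolding W_def K'_def using d(1) by (auto intro!: bexI)
  have [measurable]: "W \<in> sets borel" using W by simp
  have wint: "integrable lborel (indicat_real W)"
    using bounded_subset[OF compact_imp_bounded[OF d(2)[folded K'_def]] W(2)] emeasure_bounded_finite
    by (intro integrable_real_indicator) auto
  obtain n where n: "1 / real (Suc n) < d / 2" using d(1) nat_approx_posE[of "d/2"] by auto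
  define f where "f x = (LINT y|lborel. indicat_real W y * moll n (x - y))" for x
  have sm: "smooth_on UNIV f" unfolding f_def
    by (rule superposition_smooth[OF moll_smooth compact_cball[of 0 "1 / real (Suc n)"] moll_support wint]) auto
  have ms: "integrable lborel (\<lambda>y. moll n (x - y))" "(LINT y|lborel. moll n (x - y)) = 1" for x :: 'a
    using integral_reflect[of "moll n" x] moll_integrable moll_integral by auto
  have im: "integrable lborel (\<lambda>y. indicat_real W y * moll n (x - y))" for x
    using integrable_mult_indicator[of W lborel "\<lambda>y. moll n (x - y)"] ms by simp
  have near: "norm (x - y) < d / 2" if "moll n (x - y) \<noteq> 0" for x y :: 'a
  proof -
    have "x - y \<in> cball 0 (1 / Suc n)" using that moll_support by blast
    then have "norm (x - y) \<le> 1 / real (Suc n)" by (simp add: norm_minus_commute)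
    then show ?thesis using n by linarith
  qed
  have "f x = 0" if "x \<notin> K'" for x
  proof -
    have "indicat_real W y * moll n (x - y) = 0" for y
    proof (rule ccontr)
      assume "indicat_real W y * moll n (x - y) \<noteq> 0"
      then have "y \<in> W" "norm (x - y) < d / 2" using near by (auto simp: indicator_def split: if_splits)
      then obtain z where "z \<in> K" "dist z y < d/2" by (auto simp: W_def)
      then have "dist z x \<le> d" using \<open>norm (x - y) < d/2\<close> dist_triangle[of z x y] by (simp add: dist_norm norm_minus_commute)
      then show False using that \<open>z \<in> K\<close> by (auto simp: K'_def)
    qed
    then have "(\<lambda>y. indicat_real W y * moll n (x - y)) = (\<lambda>y. 0)" by (rule ext)
    then show ?thesis by (simp add: f_def)
  qed
  moreover have "0 \<le> f x" for x unfolding f_def by (intro Bochner_Integration.integral_nonneg) (simp add: moll_nonneg)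
  moreover have "f x \<le> 1" for x
  proof -
    have "f x \<le> (LINT y|lborel. moll n (x - y))"
      unfolding f_def using im ms by (intro integral_mono) (auto simp: moll_nonneg split: split_indicator)
    then show ?thesis using ms by simp
  qed
  moreover have "f x = 1" if "x \<in> K" for x
  proof -
    have "indicat_real W y * moll n (x - y) = moll n (x - y)" for y
      using near[of x y] that by (cases "moll n (x - y) = 0") (auto simp: W_def indicator_def dist_norm)
    then have "(\<lambda>y. indicat_real W y * moll n (x - y)) = (\<lambda>y. moll n (x - y))" by (rule ext)
    then show ?thesis unfolding f_def using ms by simp
  qed
  ultimately show ?thesis using that sm d unfolding K'_def by blast
qed

lemma measurable_lebesgue_on_borel: "f \<in> borel_measurable borel \<Longrightarrow> f \<in> borel_measurable (lebesgue_on \<Omega>)"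
  by (intro measurable_restrict_space1 measurable_completion) simp

text \<open>Testing the weak gradient with the components of \<open>\<Psi>\<close> and adding
  expresses \<open>\<beta>\<close> times the integral of \<open>f x * u x\<close> through the error
  term and \<open>\<Psi> \<bullet> U\<close>. The cone condition keeps the support of
  \<open>\<Psi>\<close> inside \<open>\<Omega>\<close>. The constant does not depend on
  \<open>f\<close>, which can therefore approximate the indicator of a level set.\<close>

lemma cone_duality:
  fixes \<Omega> :: "'a::euclidean_space set"
  assumes \<Omega>: "open \<Omega>" and r: "r > 0"
    and cone: "\<forall>x\<in>V \<inter> \<Omega>. \<forall>\<theta>\<in>cball e r. \<forall>s\<in>{0..1}. x + s *\<^sub>R \<theta> \<in> \<Omega>"
    and \<nu>: "\<nu> > 1" "\<nu> \<ge> real DIM('a)" and M0: "M0 > 0"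
  shows "\<exists>C>0. \<forall>u U f K m. is_weak_gradient \<Omega> u U \<longrightarrow> integrable (lebesgue_on \<Omega>) u \<longrightarrow> integrable (lebesgue_on \<Omega>) U \<longrightarrow>
     smooth_on UNIV f \<longrightarrow> compact K \<longrightarrow> K \<subseteq> V \<inter> \<Omega> \<longrightarrow> (\<forall>x. x \<notin> K \<longrightarrow> f x = 0) \<longrightarrow> (\<forall>x. 0 \<le> f x \<and> f x \<le> 1) \<longrightarrow>
     0 < m \<longrightarrow> m \<le> M0 \<longrightarrow> (LINT x|lborel. f x) \<le> m \<longrightarrow>
     (LINT x|lebesgue_on \<Omega>. f x * u x) \<le> C * m powr (1 / \<nu>) * ((LINT x|lebesgue_on \<Omega>. \<bar>u x\<bar>) + (LINT x|lebesgue_on \<Omega>. norm (U x)))"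
proof -
  define \<beta> where "\<beta> = measure lborel (cball e r)"
  have \<beta>: "\<beta> > 0" unfolding \<beta>_def using r content_cball_pos[of r e] by simp
  define B1 where "B1 = (norm e + r) * (\<beta> + 1 / (\<nu> - 1))"
  have B1: "B1 \<ge> 0" unfolding B1_def using r \<beta> \<nu> by (intro mult_nonneg_nonneg add_nonneg_nonneg) auto
  \<comment> \<open>The error term is only bounded by \<open>m\<close>; because
    \<open>m \<le> M0\<close>, this is at most \<open>B2 * m powr (1 / \<nu>)\<close>.\<close>
  define B2 where "B2 = M0 powr (1 - 1 / \<nu>)"
  have B2: "B2 > 0" using M0 by (simp add: B2_def)
  define Cc where "Cc = (B1 + B2) / \<beta>"
  have Cc: "Cc > 0" using B1 B2 \<beta> by (simp add: Cc_def)
  have "(LINT x|lebesgue_on \<Omega>. f x * u x) \<le> Cc * m powr (1 / \<nu>) * ((LINT x|lebesgue_on \<Omega>. \<bar>u x\<bar>) + (LINT x|lebesgue_on \<Omega>. norm (U x)))"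
    if wg: "is_weak_gradient \<Omega> u U" and iu: "integrable (lebesgue_on \<Omega>) u" and iU: "integrable (lebesgue_on \<Omega>) U"
    and f: "smooth_on UNIV f" "compact K" "K \<subseteq> V \<inter> \<Omega>" "\<forall>x. x \<notin> K \<longrightarrow> f x = 0" "\<forall>x. 0 \<le> f x \<and> f x \<le> 1"
    and m: "0 < m" "m \<le> M0" "(LINT x|lborel. f x) \<le> m" for u U f K m
  proof -
    interpret cf: cone_field f K e r by unfold_locales (use f r in auto)
    note cf.f_meas[measurable]
    \<comment> \<open>The points reached from \<open>K\<close> along the cone: a compact set outside
      of which \<open>\<Psi>\<close> vanishes.\<close>
    define K2 where "K2 = (\<lambda>(x, s, \<theta>). x + s *\<^sub>R \<theta>) ` (K \<times> {0..1::real} \<times> cball e r)"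
    have K2: "compact K2" unfolding K2_def
      by (intro compact_continuous_image compact_Times f(2) compact_Icc compact_cball)
        (auto simp: case_prod_unfold intro!: continuous_intros)
    have K2\<Omega>: "K2 \<subseteq> \<Omega>" unfolding K2_def using f(3) by (auto simp del: mem_cball intro!: cone[rule_format])
    have zero: "cf.\<Psi> x = 0" if "x \<notin> K2" for x
    proof (rule cf.\<Psi>_support)
      fix s :: real and \<theta> assume s: "s \<in> {0..1}" and \<theta>: "\<theta> \<in> cf.C"
      show "x - s *\<^sub>R \<theta> \<notin> K"
      proof
        assume "x - s *\<^sub>R \<theta> \<in> K"
        then have "(\<lambda>(x, s, \<theta>). x + s *\<^sub>R \<theta>) (x - s *\<^sub>R \<theta>, s, \<theta>) \<in> K2"
          unfolding K2_def using s \<theta> by (intro imageI) (auto simp: cf.C_def)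
        then show False using that by simp
      qed
    qed
    define J where "J x = (LINT \<theta>|lborel. indicator cf.C \<theta> * f (x - \<theta>))" for x
    define G where "G i x = grad (\<lambda>x. cf.\<Psi> x \<bullet> i) x \<bullet> i" for i x
    have sm: "smooth_on UNIV (\<lambda>x. cf.\<Psi> x \<bullet> i)" for i
      unfolding cf.\<Psi>_inner by (rule cf.partial_smooth)
    have tf: "test_function \<Omega> (\<lambda>x. cf.\<Psi> x \<bullet> i)" for i
      by (rule test_functionI[OF sm K2 K2\<Omega>]) (simp add: zero)
    have c1: "C1c K2 (\<lambda>x. cf.\<Psi> x \<bullet> i) (grad (\<lambda>x. cf.\<Psi> x \<bullet> i))" for i
      by (rule smooth_C1c[OF sm K2]) (simp add: zero)
    have Gc: "continuous_on UNIV (G i)" for i using c1[of i] unfolding G_def C1c_def by (intro continuous_intros) auto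
    have Gz: "G i x = 0" if "x \<notin> K2" for i x unfolding G_def using C1c_grad_support[OF c1 that] by simp
    have iGu: "integrable (lebesgue_on \<Omega>) (\<lambda>x. G i x *\<^sub>R u x)" for i
    proof -
      obtain B where "\<And>x. norm (G i x) \<le> B" using continuous_compact_support_bounded[OF Gc K2 Gz] by metis
      then show ?thesis by (intro bounded_mult_integrable[OF iu, of _ B] measurable_lebesgue_on_borel borel_measurable_continuous_onI Gc) auto
    qed
    have \<Psi>c: "continuous_on UNIV (\<lambda>x. cf.\<Psi> x \<bullet> i)" for i using C1c_continuous[OF c1] .
    then have \<Psi>c': "continuous_on UNIV cf.\<Psi>" by (subst continuous_on_componentwise) blast
    have \<Psi>b: "norm (cf.\<Psi> x) \<le> B1 * m powr (1 / \<nu>)" for x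
      using cf.\<Psi>_bound[OF m(1,3) \<nu>] unfolding B1_def \<beta>_def cf.R_def cf.C_def .
    have iU\<Psi>: "integrable (lebesgue_on \<Omega>) (\<lambda>x. (cf.\<Psi> x \<bullet> i) *\<^sub>R (U x \<bullet> i))" if "i \<in> Basis" for i
    proof (rule bounded_mult_integrable)
      show "integrable (lebesgue_on \<Omega>) (\<lambda>x. U x \<bullet> i)" by (intro integrable_inner_left iU)
      show "(\<lambda>x. cf.\<Psi> x \<bullet> i) \<in> borel_measurable (lebesgue_on \<Omega>)"
        by (intro measurable_lebesgue_on_borel borel_measurable_continuous_onI \<Psi>c)
      show "\<bar>cf.\<Psi> x \<bullet> i\<bar> \<le> B1 * m powr (1 / \<nu>)" for x
        using Basis_le_norm[OF that, of "cf.\<Psi> x"] \<Psi>b[of x] by linarith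
    qed
    have weak: "(LINT x|lebesgue_on \<Omega>. G i x *\<^sub>R u x) = - (LINT x|lebesgue_on \<Omega>. (cf.\<Psi> x \<bullet> i) *\<^sub>R (U x \<bullet> i))" if "i \<in> Basis" for i
      using wg tf[of i] that unfolding is_weak_gradient_def G_def by (simp add: grad_inner mult.commute)
    have div: "(\<Sum>i\<in>Basis. G i x) = \<beta> * f x - J x" for x
      unfolding G_def cf.divergence J_def \<beta>_def cf.C_def ..
    have "(LINT x|lebesgue_on \<Omega>. (\<beta> * f x - J x) * u x) = (LINT x|lebesgue_on \<Omega>. (\<Sum>i\<in>Basis. G i x *\<^sub>R u x))"
      unfolding div[symmetric] by (simp add: sum_distrib_right)
    also have "\<dots> = (\<Sum>i\<in>Basis. (LINT x|lebesgue_on \<Omega>. G i x *\<^sub>R u x))" using iGu by (intro Bochner_Integration.integral_sum)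
    also have "\<dots> = - (\<Sum>i\<in>Basis. (LINT x|lebesgue_on \<Omega>. (cf.\<Psi> x \<bullet> i) *\<^sub>R (U x \<bullet> i)))"
      unfolding sum_negf[symmetric] by (intro sum.cong refl weak)
    also have "\<dots> = - (LINT x|lebesgue_on \<Omega>. (\<Sum>i\<in>Basis. (cf.\<Psi> x \<bullet> i) *\<^sub>R (U x \<bullet> i)))"
      using iU\<Psi> by (subst Bochner_Integration.integral_sum) auto
    also have "\<dots> = - (LINT x|lebesgue_on \<Omega>. cf.\<Psi> x \<bullet> U x)" by (simp add: euclidean_inner[symmetric])
    finally have eq: "(LINT x|lebesgue_on \<Omega>. (\<beta> * f x - J x) * u x) = - (LINT x|lebesgue_on \<Omega>. cf.\<Psi> x \<bullet> U x)" .
    have ifu: "integrable (lebesgue_on \<Omega>) (\<lambda>x. f x *\<^sub>R u x)"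
      using f(5) by (intro bounded_mult_integrable[OF iu, of f 1] measurable_lebesgue_on_borel) auto
    have J: "0 \<le> J x" "J x \<le> m" for x using cf.error_bound[of x] m(3) unfolding J_def by linarith+
    have Jmeas: "J \<in> borel_measurable borel"
    proof -
      have "J = (\<lambda>x. \<beta> * f x - (\<Sum>i\<in>Basis. G i x))" using div by (simp add: fun_eq_iff)
      then show ?thesis using borel_measurable_continuous_onI[OF Gc] by simp
    qed
    have iJu: "integrable (lebesgue_on \<Omega>) (\<lambda>x. J x *\<^sub>R u x)"
      using J by (intro bounded_mult_integrable[OF iu, of J m] measurable_lebesgue_on_borel Jmeas) auto
    have "(LINT x|lebesgue_on \<Omega>. (\<beta> * f x - J x) * u x) = (LINT x|lebesgue_on \<Omega>. \<beta> * (f x *\<^sub>R u x) - J x *\<^sub>R u x)"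
      by (simp add: algebra_simps)
    also have "\<dots> = \<beta> * (LINT x|lebesgue_on \<Omega>. f x * u x) - (LINT x|lebesgue_on \<Omega>. J x * u x)"
      using ifu iJu by simp
    finally have "\<beta> * (LINT x|lebesgue_on \<Omega>. f x * u x) = (LINT x|lebesgue_on \<Omega>. J x * u x) - (LINT x|lebesgue_on \<Omega>. cf.\<Psi> x \<bullet> U x)"
      using eq by simp
    also have "\<dots> \<le> m * (LINT x|lebesgue_on \<Omega>. \<bar>u x\<bar>) + B1 * m powr (1 / \<nu>) * (LINT x|lebesgue_on \<Omega>. norm (U x))"
    proof -
      have "(LINT x|lebesgue_on \<Omega>. J x * u x) \<le> (LINT x|lebesgue_on \<Omega>. m * \<bar>u x\<bar>)"
      proof (intro integral_mono)
        show "J x * u x \<le> m * \<bar>u x\<bar>" for x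
          using J[of x] mult_mono[of "J x" m "\<bar>u x\<bar>" "\<bar>u x\<bar>"] abs_ge_self[of "u x"] mult_left_mono[of "u x" "\<bar>u x\<bar>" "J x"] by auto
      qed (use iJu iu in auto)
      moreover have "\<bar>LINT x|lebesgue_on \<Omega>. cf.\<Psi> x \<bullet> U x\<bar> \<le> (LINT x|lebesgue_on \<Omega>. B1 * m powr (1 / \<nu>) * norm (U x))"
      proof (rule order_trans[OF integral_abs_bound], intro integral_mono)
        have "integrable (lebesgue_on \<Omega>) (\<lambda>x. \<Sum>i\<in>Basis. (cf.\<Psi> x \<bullet> i) *\<^sub>R (U x \<bullet> i))"
          by (intro Bochner_Integration.integrable_sum iU\<Psi>)
        then show "integrable (lebesgue_on \<Omega>) (\<lambda>x. \<bar>cf.\<Psi> x \<bullet> U x\<bar>)" by (simp add: euclidean_inner[symmetric])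
        show "integrable (lebesgue_on \<Omega>) (\<lambda>x. B1 * m powr (1 / \<nu>) * norm (U x))" using iU by simp
        show "\<bar>cf.\<Psi> x \<bullet> U x\<bar> \<le> B1 * m powr (1 / \<nu>) * norm (U x)" for x
          using Cauchy_Schwarz_ineq2[of "cf.\<Psi> x" "U x"] mult_right_mono[OF \<Psi>b[of x], of "norm (U x)"] by simp
      qed
      ultimately show ?thesis by simp
    qed
    also have "\<dots> \<le> m powr (1 / \<nu>) * B2 * (LINT x|lebesgue_on \<Omega>. \<bar>u x\<bar>) + B1 * m powr (1 / \<nu>) * (LINT x|lebesgue_on \<Omega>. norm (U x))"
    proof -
      have "m = m powr (1 / \<nu>) * m powr (1 - 1 / \<nu>)" using m by (simp flip: powr_add)
      also have "\<dots> \<le> m powr (1 / \<nu>) * B2"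
        unfolding B2_def using m \<nu> by (intro mult_left_mono powr_mono2) auto
      finally show ?thesis by (intro add_right_mono mult_right_mono Bochner_Integration.integral_nonneg) auto
    qed
    also have "\<dots> \<le> m powr (1 / \<nu>) * (B1 + B2) * (LINT x|lebesgue_on \<Omega>. \<bar>u x\<bar>) + (B1 + B2) * m powr (1 / \<nu>) * (LINT x|lebesgue_on \<Omega>. norm (U x))"
      using B1 B2 by (intro add_mono mult_right_mono mult_left_mono Bochner_Integration.integral_nonneg) auto
    also have "\<dots> = \<beta> * (Cc * m powr (1 / \<nu>) * ((LINT x|lebesgue_on \<Omega>. \<bar>u x\<bar>) + (LINT x|lebesgue_on \<Omega>. norm (U x))))"
    proof -
      have "\<beta> * Cc = B1 + B2" using \<beta> by (simp add: Cc_def)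
      then show ?thesis unfolding mult.assoc[symmetric] by (simp add: algebra_simps)
    qed
    finally show ?thesis using \<beta> by simp
  qed
  then show ?thesis using Cc by blast
qed

text \<open>With \<open>f\<close> close to the indicator of the level set \<open>S\<close>, duality
  bounds \<open>t\<close> times the measure of \<open>S\<close> by its power
  \<open>1 / \<nu>\<close> times the L^1 norms of \<open>u\<close> and \<open>U\<close>. Dividing by
  that power of the measure gives the claim.\<close>

lemma cone_weak_type:
  fixes \<Omega> :: "'a::euclidean_space set"
  assumes \<Omega>: "open \<Omega>" "bounded \<Omega>" and V: "open V" and r: "r > 0"
    and cone: "\<forall>x\<in>V \<inter> \<Omega>. \<forall>\<theta>\<in>cball e r. \<forall>s\<in>{0..1}. x + s *\<^sub>R \<theta> \<in> \<Omega>"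
    and \<nu>: "\<nu> > 1" "\<nu> \<ge> real DIM('a)"
  shows "\<exists>C>0. \<forall>u U t. is_weak_gradient \<Omega> u U \<longrightarrow> integrable (lebesgue_on \<Omega>) u \<longrightarrow> integrable (lebesgue_on \<Omega>) U \<longrightarrow>
     (AE x in lebesgue_on \<Omega>. 0 \<le> u x) \<longrightarrow> 0 < t \<longrightarrow>
     measure lebesgue ({x\<in>\<Omega>. t \<le> u x} \<inter> V) \<le>
       (C / t * ((LINT x|lebesgue_on \<Omega>. \<bar>u x\<bar>) + (LINT x|lebesgue_on \<Omega>. norm (U x)))) powr (1 / (1 - 1 / \<nu>))"
proof -
  have \<Omega>b: "\<Omega> \<in> sets borel" using \<Omega> by simp
  define M0 where "M0 = 2 * measure lebesgue \<Omega> + 1"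
  have M0: "M0 > 0" by (simp add: M0_def add_nonneg_pos)
  obtain C0 where C0: "C0 > 0" and dual: "\<forall>u U f K m. is_weak_gradient \<Omega> u U \<longrightarrow> integrable (lebesgue_on \<Omega>) u \<longrightarrow> integrable (lebesgue_on \<Omega>) U \<longrightarrow>
     smooth_on UNIV f \<longrightarrow> compact K \<longrightarrow> K \<subseteq> V \<inter> \<Omega> \<longrightarrow> (\<forall>x. x \<notin> K \<longrightarrow> f x = 0) \<longrightarrow> (\<forall>x. 0 \<le> f x \<and> f x \<le> 1) \<longrightarrow>
     0 < m \<longrightarrow> m \<le> M0 \<longrightarrow> (LINT x|lborel. f x) \<le> m \<longrightarrow>
     (LINT x|lebesgue_on \<Omega>. f x * u x) \<le> C0 * m powr (1 / \<nu>) * ((LINT x|lebesgue_on \<Omega>. \<bar>u x\<bar>) + (LINT x|lebesgue_on \<Omega>. norm (U x)))"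
    using cone_duality[OF \<Omega>(1) r cone \<nu> M0] by blast
  have "measure lebesgue ({x\<in>\<Omega>. t \<le> u x} \<inter> V) \<le>
       (4 * C0 / t * ((LINT x|lebesgue_on \<Omega>. \<bar>u x\<bar>) + (LINT x|lebesgue_on \<Omega>. norm (U x)))) powr (1 / (1 - 1 / \<nu>))"
    if wg: "is_weak_gradient \<Omega> u U" and iu: "integrable (lebesgue_on \<Omega>) u" and iU: "integrable (lebesgue_on \<Omega>) U"
      and u0: "AE x in lebesgue_on \<Omega>. 0 \<le> u x" and t: "0 < t" for u U t
  proof (cases "measure lebesgue ({x\<in>\<Omega>. t \<le> u x} \<inter> V) = 0")
    case False
    define S where "S = {x\<in>\<Omega>. t \<le> u x} \<inter> V"
    define W where "W = (LINT x|lebesgue_on \<Omega>. \<bar>u x\<bar>) + (LINT x|lebesgue_on \<Omega>. norm (U x))"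
    have "{x \<in> space (lebesgue_on \<Omega>). t \<le> u x} \<in> sets (lebesgue_on \<Omega>)"
      using borel_measurable_integrable[OF iu] by measurable
    then have "{x\<in>\<Omega>. t \<le> u x} \<in> sets lebesgue" using \<Omega>b by (simp add: sets_restrict_space_iff)
    then have Sm: "S \<in> sets lebesgue" unfolding S_def using V by auto
    have S\<Omega>: "S \<subseteq> \<Omega>" by (auto simp: S_def)
    have Sl: "S \<in> lmeasurable" using Sm bounded_subset[OF \<Omega>(2) S\<Omega>] by (rule bounded_set_imp_lmeasurable[rotated])
    define \<mu> where "\<mu> = measure lebesgue S"
    have \<mu>: "\<mu> > 0" using False by (simp add: \<mu>_def S_def zero_less_measure_iff)
    \<comment> \<open>A compact part with more than half the measure of \<open>S\<close>. Together
      with the open set \<open>Q'\<close> of measure at most \<open>2 * k\<close> it makes the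
      integral of \<open>f\<close> and the measure of \<open>S\<close> comparable.\<close>
    obtain K where K: "closed K" "K \<subseteq> S" "S - K \<in> lmeasurable" "emeasure lebesgue (S - K) < ennreal (\<mu> / 2)"
      using sets_lebesgue_inner_closed[OF Sm, of "\<mu>/2"] \<mu> by auto
    have Kc: "compact K" using K S\<Omega> bounded_subset[OF \<Omega>(2)] by (meson compact_eq_bounded_closed subset_trans)
    define k where "k = measure lebesgue K"
    have Kl: "K \<in> lmeasurable" using Kc by (rule lmeasurable_compact)
    have "measure lebesgue (S - K) < \<mu> / 2"
      using K(4) emeasure_eq_measure2[OF K(3)] \<mu> by (simp add: ennreal_less_iff)
    moreover have "measure lebesgue (S - K) = \<mu> - k"
      unfolding \<mu>_def k_def using Sl K(2) Kl by (intro measure_Diff) (auto simp: fmeasurable_def)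
    ultimately have k: "\<mu> \<le> 2 * k" "k > 0" using \<mu> by linarith+
    have KV: "K \<subseteq> V \<inter> \<Omega>" using K(2) by (auto simp: S_def)
    have kl: "k = measure lborel K" unfolding k_def using Kc by (simp add: compact_imp_closed)
    obtain Q where Q: "open Q" "K \<subseteq> Q" "emeasure lborel (Q - K) < ennreal k"
      using outer_regular_lborel[of K k] Kc k by (auto simp: compact_imp_closed)
    define Q' where "Q' = Q \<inter> V \<inter> \<Omega>"
    have Q': "open Q'" "K \<subseteq> Q'" using Q V \<Omega> KV by (auto simp: Q'_def)
    obtain f K' where f: "smooth_on UNIV f" "compact K'" "K' \<subseteq> Q'" "\<And>x. x \<notin> K' \<Longrightarrow> f x = (0::real)"
      "\<And>x. 0 \<le> f x" "\<And>x. f x \<le> 1" "\<And>x. x \<in> K \<Longrightarrow> f x = 1"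
      using smooth_urysohn[OF Kc Q'] by blast
    have eQ: "emeasure lborel Q' \<le> ennreal (2 * k)"
    proof -
      have "emeasure lborel Q' \<le> emeasure lborel (K \<union> (Q - K))" using Q Q' Kc by (intro emeasure_mono) (auto simp: Q'_def compact_imp_closed)
      also have "\<dots> \<le> emeasure lborel K + emeasure lborel (Q - K)"
        using Kc Q by (intro emeasure_subadditive) (auto simp: compact_imp_closed)
      also have "\<dots> \<le> ennreal k + ennreal k"
        using Q emeasure_compact_finite[OF Kc] unfolding kl by (intro add_mono) (auto simp: measure_def)
      finally show ?thesis using k by (simp flip: ennreal_plus)
    qed
    have iQ: "integrable lborel (indicat_real Q')"
      using Q' le_less_trans[OF eQ ennreal_less_top] by (intro integrable_real_indicator) auto
    have f_le: "f x \<le> indicator Q' x" for x 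
    proof (cases "x \<in> K'")
      case True
      then show ?thesis using f(3) f(6)[of x] by auto
    next
      case False
      then show ?thesis by (simp add: f(4))
    qed
    have fc: "continuous_on UNIV f" using f(1) by (rule smooth_on_continuous)
    have "(LINT x|lborel. f x) \<le> (LINT x|lborel. indicator Q' x)"
      using continuous_compact_support_integrable[OF fc f(2,4)] iQ f_le by (intro integral_mono) auto
    also have "\<dots> \<le> 2 * k" using eQ k by (simp add: measure_def enn2real_leI)
    finally have fm: "(LINT x|lborel. f x) \<le> 2 * k" .
    have "k \<le> measure lebesgue \<Omega>" unfolding k_def
      using K S\<Omega> Kl \<Omega> by (intro measure_mono_fmeasurable) (auto intro: bounded_set_imp_lmeasurable)
    then have mM: "2 * k \<le> M0" by (simp add: M0_def)
    have fu: "(LINT x|lebesgue_on \<Omega>. f x * u x) \<le> C0 * (2 * k) powr (1 / \<nu>) * W"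
      unfolding W_def by (rule dual[rule_format, OF wg iu iU f(1,2)]) (use f k fm mM in \<open>auto simp: Q'_def\<close>)
    have ifu: "integrable (lebesgue_on \<Omega>) (\<lambda>x. f x *\<^sub>R u x)"
      using f(5,6) by (intro bounded_mult_integrable[OF iu, of f 1] measurable_lebesgue_on_borel borel_measurable_continuous_onI fc) auto
    have iK: "integrable (lebesgue_on \<Omega>) (indicat_real K)" and mK: "(LINT x|lebesgue_on \<Omega>. indicat_real K x) = k"
    proof -
      have "K \<subseteq> \<Omega>" using KV by auto
      then have eq: "(\<lambda>x. indicat_real \<Omega> x * indicat_real K x) = indicat_real K" by (auto simp: fun_eq_iff split: split_indicator)
      show "integrable (lebesgue_on \<Omega>) (indicat_real K)"
        using \<Omega>b Kl by (subst integrable_restrict_space) (auto simp: eq fmeasurable_def)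
      show "(LINT x|lebesgue_on \<Omega>. indicat_real K x) = k"
        using \<Omega>b Kl by (subst integral_restrict_space) (auto simp: eq k_def fmeasurable_def)
    qed
    have "t * k = (LINT x|lebesgue_on \<Omega>. t * indicator K x)" using mK by simp
    also have "\<dots> \<le> (LINT x|lebesgue_on \<Omega>. f x * u x)"
    proof (rule integral_mono_AE)
      show "AE x in lebesgue_on \<Omega>. t * indicator K x \<le> f x * u x"
        using u0
      proof eventually_elim
        case (elim x)
        then show ?case using f(5)[of x] f(7)[of x] K(2) by (cases "x \<in> K") (auto simp: S_def)
      qed
    qed (use iK ifu in auto)
    also note fu
    also have "C0 * (2 * k) powr (1 / \<nu>) * W = k powr (1 / \<nu>) * (2 powr (1 / \<nu>) * C0 * W)"
      using k by (simp add: powr_mult)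
    finally have 1: "t * k \<le> k powr (1 / \<nu>) * (2 powr (1 / \<nu>) * C0 * W)" .
    have W: "W \<ge> 0" unfolding W_def by (intro add_nonneg_nonneg Bochner_Integration.integral_nonneg) auto
    define a where "a = 1 / \<nu>"
    have a: "0 < a" "a < 1" using \<nu> by (auto simp: a_def)
    have "k = k powr a * k powr (1 - a)" using k by (simp flip: powr_add)
    then have "k powr a * (t * k powr (1 - a)) \<le> k powr a * (2 powr a * C0 * W)" using 1 by (simp add: a_def mult_ac)
    then have 2: "t * k powr (1 - a) \<le> 2 powr a * C0 * W" using k by simp
    have "\<mu> powr (1 - a) \<le> (2 * k) powr (1 - a)" using k \<mu> a by (intro powr_mono2) auto
    also have "\<dots> = 2 powr (1 - a) * k powr (1 - a)" using k by (simp add: powr_mult)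
    finally have "t * \<mu> powr (1 - a) \<le> 2 powr (1 - a) * (t * k powr (1 - a))" using t by (simp add: mult_ac)
    also have "\<dots> \<le> 2 powr (1 - a) * (2 powr a * C0 * W)" using 2 by (intro mult_left_mono) auto
    also have "\<dots> = 2 * C0 * W" by (simp flip: powr_add)
    also have "\<dots> \<le> 4 * C0 * W" using C0 W by (intro mult_right_mono) auto
    finally have "\<mu> powr (1 - a) \<le> 4 * C0 / t * W" using t by (simp add: field_simps)
    then have "(\<mu> powr (1 - a)) powr (1 / (1 - a)) \<le> (4 * C0 / t * W) powr (1 / (1 - a))"
      using a by (intro powr_mono2) auto
    then show ?thesis using \<mu> a by (simp add: powr_powr \<mu>_def S_def a_def W_def)
  qed simp
  then show ?thesis using C0 by (intro exI[of _ "4 * C0"]) auto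
qed

text \<open>Cones exist only locally, but finitely many of their neighbourhoods cover the compact
  closure, and the local bounds add up.\<close>

lemma weak_type:
  fixes \<Omega> :: "'a::euclidean_space set"
  assumes \<Omega>: "open \<Omega>" "bounded \<Omega>" and bd: "\<forall>x\<in>frontier \<Omega>. \<exists>U \<rho>. x \<in> U \<and> local_defining_function \<Omega> U \<rho>"
    and \<nu>: "\<nu> > 1" "\<nu> \<ge> real DIM('a)"
  shows "\<exists>C>0. \<forall>u U t. is_weak_gradient \<Omega> u U \<longrightarrow> integrable (lebesgue_on \<Omega>) u \<longrightarrow> integrable (lebesgue_on \<Omega>) U \<longrightarrow>
     (AE x in lebesgue_on \<Omega>. 0 \<le> u x) \<longrightarrow> 0 < t \<longrightarrow>
     measure lebesgue {x\<in>\<Omega>. t \<le> u x} \<le>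
       C * (1 / t * ((LINT x|lebesgue_on \<Omega>. \<bar>u x\<bar>) + (LINT x|lebesgue_on \<Omega>. norm (U x)))) powr (1 / (1 - 1 / \<nu>))"
proof -
  define good where "good V \<longleftrightarrow> open V \<and> (\<exists>C>0. \<forall>u U t. is_weak_gradient \<Omega> u U \<longrightarrow> integrable (lebesgue_on \<Omega>) u \<longrightarrow> integrable (lebesgue_on \<Omega>) U \<longrightarrow>
     (AE x in lebesgue_on \<Omega>. 0 \<le> u x) \<longrightarrow> 0 < t \<longrightarrow>
     measure lebesgue ({x\<in>\<Omega>. t \<le> u x} \<inter> V) \<le>
       (C / t * ((LINT x|lebesgue_on \<Omega>. \<bar>u x\<bar>) + (LINT x|lebesgue_on \<Omega>. norm (U x)))) powr (1 / (1 - 1 / \<nu>)))" for V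
  have "\<exists>V. good V \<and> x \<in> V" if x: "x \<in> closure \<Omega>" for x
  proof -
    obtain V e r where V: "open V" "x \<in> V" "r > 0" "\<forall>x\<in>V \<inter> \<Omega>. \<forall>\<theta>\<in>cball e r. \<forall>s\<in>{0..1}. x + s *\<^sub>R \<theta> \<in> \<Omega>"
      using cone_condition[OF \<Omega>(1) bd x] by blast
    have "good V" unfolding good_def using V(1) cone_weak_type[OF \<Omega> V(1,3,4) \<nu>] by blast
    then show ?thesis using V(2) by blast
  qed
  then have sub: "closure \<Omega> \<subseteq> \<Union>{V. good V}" by blast
  have "compact (closure \<Omega>)" using \<Omega>(2) by (simp add: compact_closure)
  then obtain F where F: "F \<subseteq> {V. good V}" "finite F" "closure \<Omega> \<subseteq> \<Union>F"
    using sub by (rule compactE) (auto simp: good_def)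
  define pw where "pw = 1 / (1 - 1 / \<nu>)"
  have pw: "pw > 0" using \<nu> by (simp add: pw_def)
  define c where "c V = (SOME C. C > 0 \<and> (\<forall>u U t. is_weak_gradient \<Omega> u U \<longrightarrow> integrable (lebesgue_on \<Omega>) u \<longrightarrow> integrable (lebesgue_on \<Omega>) U \<longrightarrow>
     (AE x in lebesgue_on \<Omega>. 0 \<le> u x) \<longrightarrow> 0 < t \<longrightarrow>
     measure lebesgue ({x\<in>\<Omega>. t \<le> u x} \<inter> V) \<le>
       (C / t * ((LINT x|lebesgue_on \<Omega>. \<bar>u x\<bar>) + (LINT x|lebesgue_on \<Omega>. norm (U x)))) powr pw))" for V
  have c: "c V > 0 \<and> (\<forall>u U t. is_weak_gradient \<Omega> u U \<longrightarrow> integrable (lebesgue_on \<Omega>) u \<longrightarrow> integrable (lebesgue_on \<Omega>) U \<longrightarrow>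
     (AE x in lebesgue_on \<Omega>. 0 \<le> u x) \<longrightarrow> 0 < t \<longrightarrow>
     measure lebesgue ({x\<in>\<Omega>. t \<le> u x} \<inter> V) \<le>
       (c V / t * ((LINT x|lebesgue_on \<Omega>. \<bar>u x\<bar>) + (LINT x|lebesgue_on \<Omega>. norm (U x)))) powr pw)" if "V \<in> F" for V
  proof -
    have "good V" using F(1) that by blast
    from conjunct2[OF this[unfolded good_def pw_def[symmetric]]] show ?thesis unfolding c_def by (rule someI_ex)
  qed
  define C where "C = 1 + (\<Sum>V\<in>F. c V powr pw)"
  have C: "C > 0" unfolding C_def by (intro add_pos_nonneg sum_nonneg) auto
  have "measure lebesgue {x\<in>\<Omega>. t \<le> u x} \<le> C * (1 / t * ((LINT x|lebesgue_on \<Omega>. \<bar>u x\<bar>) + (LINT x|lebesgue_on \<Omega>. norm (U x)))) powr pw"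
    if wg: "is_weak_gradient \<Omega> u U" and iu: "integrable (lebesgue_on \<Omega>) u" and iU: "integrable (lebesgue_on \<Omega>) U"
      and u0: "AE x in lebesgue_on \<Omega>. 0 \<le> u x" and t: "0 < t" for u U t
  proof -
    define W where "W = (LINT x|lebesgue_on \<Omega>. \<bar>u x\<bar>) + (LINT x|lebesgue_on \<Omega>. norm (U x))"
    have W: "W \<ge> 0" unfolding W_def by (intro add_nonneg_nonneg Bochner_Integration.integral_nonneg) auto
    define E where "E = {x\<in>\<Omega>. t \<le> u x}"
    have "{x \<in> space (lebesgue_on \<Omega>). t \<le> u x} \<in> sets (lebesgue_on \<Omega>)"
      using borel_measurable_integrable[OF iu] by measurable
    then have Em: "E \<in> sets lebesgue" using \<Omega>(1) by (simp add: sets_restrict_space_iff E_def)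
    have EV: "E \<inter> V \<in> sets lebesgue" if "V \<in> F" for V using F(1) that Em by (auto simp: good_def subset_iff)
    have "E = (\<Union>V\<in>F. E \<inter> V)" using F(3) closure_subset[of \<Omega>] by (auto simp: E_def)
    then have "measure lebesgue E = measure lebesgue (\<Union>V\<in>F. E \<inter> V)" by (rule arg_cong)
    also have "\<dots> \<le> (\<Sum>V\<in>F. measure lebesgue (E \<inter> V))" by (rule measure_UNION_le[OF F(2) EV])
    also have "\<dots> \<le> (\<Sum>V\<in>F. (c V / t * W) powr pw)"
    proof (rule sum_mono)
      fix V assume "V \<in> F"
      then show "measure lebesgue (E \<inter> V) \<le> (c V / t * W) powr pw"
        using c[THEN conjunct2, rule_format, OF _ wg iu iU u0 t] unfolding E_def W_def by blast
    qed
    also have "\<dots> = (\<Sum>V\<in>F. c V powr pw * (1 / t * W) powr pw)"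
    proof (rule sum.cong[OF refl])
      fix V assume "V \<in> F"
      have "c V / t * W = c V * (1 / t * W)" by simp
      then show "(c V / t * W) powr pw = c V powr pw * (1 / t * W) powr pw"
        using c[OF \<open>V \<in> F\<close>] W t by (simp only: powr_mult) 
    qed
    also have "\<dots> \<le> C * (1 / t * W) powr pw"
      by (simp add: C_def sum_distrib_right[symmetric] distrib_right)
    finally show ?thesis by (simp add: E_def W_def)
  qed
  then show ?thesis using C unfolding pw_def by blast
qed

section \<open>Truncation and the strong-type Sobolev inequality\<close>

lemma DERIV_pos_powr:
  fixes q t :: real
  assumes q: "q > 1"
  shows "DERIV (\<lambda>t. max 0 t powr q) t :> q * max 0 t powr (q - 1)"
proof -
  consider "t > 0" | "t < 0" | "t = 0" by linarith
  then show ?thesis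
  proof cases
    case 1
    have "DERIV (\<lambda>t. t powr q) t :> q * max 0 t powr (q - 1)"
      using 1 by (auto intro!: derivative_eq_intros)
    then show ?thesis
      by (rule has_field_derivative_transform_within_open[where S = "{0<..}"]) (use 1 in auto)
  next
    case 2
    have "DERIV (\<lambda>t. 0) t :> q * max 0 t powr (q - 1)" using 2 by simp
    then show ?thesis
      by (rule has_field_derivative_transform_within_open[where S = "{..<0}"]) (use 2 in auto)
  next
    case 3
    have "((\<lambda>h. max 0 h powr q / h) \<longlongrightarrow> 0) (at 0)"
    proof (rule Lim_null_comparison)
      have "((\<lambda>h. \<bar>h\<bar> powr (q - 1)) \<longlongrightarrow> 0 powr (q - 1)) (at (0::real))"
        using q by (intro tendsto_powr2 tendsto_eq_intros) (auto simp: tendsto_rabs_zero)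
      then show "((\<lambda>h. \<bar>h\<bar> powr (q - 1)) \<longlongrightarrow> 0) (at (0::real))" by simp
      have "norm (max 0 h powr q / h) \<le> \<bar>h\<bar> powr (q - 1)" if "h \<noteq> 0" for h
      proof (cases "h > 0")
        case True
        then show ?thesis by (simp add: powr_diff)
      qed simp
      then show "\<forall>\<^sub>F h in at 0. norm (max 0 h powr q / h) \<le> \<bar>h\<bar> powr (q - 1)"
        by (simp add: eventually_at_filter)
    qed
    then show ?thesis using 3 by (simp add: DERIV_def)
  qed
qed

text \<open>A C^1 step from 0 for \<open>t \<le> 1\<close> to 1 for \<open>t \<ge> 2\<close>,
  quadratic on each half of the transition. A piecewise linear truncation would fall outside the
  class \<open>C1_two\<close>.\<close>

definition cutoff :: "real \<Rightarrow> real" where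
  "cutoff t = 2 * (max 0 (t - 1) powr 2 - 2 * max 0 (t - 3/2) powr 2 + max 0 (t - 2) powr 2)"

definition cutoff' :: "real \<Rightarrow> real" where
  "cutoff' t = 4 * (max 0 (t - 1) - 2 * max 0 (t - 3/2) + max 0 (t - 2))"

lemma DERIV_cutoff: "DERIV cutoff t :> cutoff' t"
proof -
  have d: "DERIV (\<lambda>t. max 0 (t - c) powr 2) t :> 2 * max 0 (t - c)" for c :: real
  proof -
    have "DERIV (\<lambda>t. max 0 (t - c) powr 2) t :> (2 * max 0 (t - c) powr (2 - 1)) * 1"
      by (rule DERIV_chain2[OF DERIV_pos_powr]) (auto intro!: derivative_eq_intros)
    then show ?thesis by simp
  qed
  show ?thesis unfolding cutoff_def cutoff'_def
    by (rule derivative_eq_intros d refl)+ simp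
qed

lemma cutoff_bounds:
  "0 \<le> cutoff t" "cutoff t \<le> 1" "t \<le> 1 \<Longrightarrow> cutoff t = 0" "2 \<le> t \<Longrightarrow> cutoff t = 1"
  "\<bar>cutoff' t\<bar> \<le> 2" "t < 1 \<Longrightarrow> cutoff' t = 0" "2 \<le> t \<Longrightarrow> cutoff' t = 0"
proof -
  have sq: "max 0 a powr 2 = max 0 a * max 0 a" for a :: real
    by (simp add: powr_numeral power2_eq_square)
  show 0: "t \<le> 1 \<Longrightarrow> cutoff t = 0" by (simp add: cutoff_def sq)
  show 1: "2 \<le> t \<Longrightarrow> cutoff t = 1" by (simp add: cutoff_def sq max_def algebra_simps power2_eq_square)
  consider "t \<le> 1" | "1 < t" "t \<le> 3/2" | "3/2 < t" "t < 2" | "2 \<le> t" by linarith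
  then have "0 \<le> cutoff t \<and> cutoff t \<le> 1"
  proof cases
    case 2
    have "(t - 1) * (t - 1) \<le> (1/2) * (1/2)" using 2 by (intro mult_mono) auto
    moreover have m: "max 0 (t - 1) = t - 1" "max 0 (t - 3/2) = 0" "max 0 (t - 2) = 0" using 2 by auto
    have "cutoff t = 2 * ((t - 1) * (t - 1))" using 2 by (simp add: cutoff_def m power2_eq_square)
    moreover have "(t - 1) * (t - 1) \<ge> 0" by simp
    ultimately show ?thesis by linarith
  next
    case 3
    have "cutoff t = 1 - 2 * ((2 - t) * (2 - t))" using 3 by (simp add: cutoff_def sq max_def algebra_simps power2_eq_square)
    moreover have "(2 - t) * (2 - t) \<le> (1/2) * (1/2)" using 3 by (intro mult_mono) auto
    moreover have "(2 - t) * (2 - t) \<ge> 0" by simp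
    ultimately show ?thesis by linarith
  qed (use 0 1 in auto)
  then show "0 \<le> cutoff t" "cutoff t \<le> 1" by auto
  show "\<bar>cutoff' t\<bar> \<le> 2" "t < 1 \<Longrightarrow> cutoff' t = 0" "2 \<le> t \<Longrightarrow> cutoff' t = 0"
    by (auto simp: cutoff'_def max_def abs_if)
qed

text \<open>Scaling height and width together keeps the derivative bound independent of
  \<open>T\<close>, so that all dyadic levels are treated alike.\<close>

lemma C1_two_cutoff:
  assumes T: "T > 0"
  shows "C1_two (\<lambda>a b. T * cutoff (a / T)) (\<lambda>a b. cutoff' (a / T)) (\<lambda>a b. 0) 2"
  unfolding C1_two_def
proof (intro conjI allI)
  have cc: "continuous_on UNIV cutoff'" unfolding cutoff'_def by (intro continuous_intros)
  show "continuous_on UNIV (\<lambda>(a, b). cutoff' (a / T))"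
    unfolding case_prod_unfold using T by (intro continuous_on_compose2[OF cc] continuous_intros) auto
  fix a b :: real
  have d: "DERIV (\<lambda>a. T * cutoff (a / T)) a :> cutoff' (a / T)"
  proof -
    have "DERIV (\<lambda>a. cutoff (a / T)) a :> cutoff' (a / T) * (1 / T)"
      by (rule DERIV_chain2[OF DERIV_cutoff]) (use T in \<open>auto intro!: derivative_eq_intros\<close>)
    from DERIV_cmult[OF this, of T] T show ?thesis by simp
  qed
  have "(fst has_derivative fst) (at (a, b))" by (intro derivative_intros)
  from has_derivative_compose[OF this, of "\<lambda>a. T * cutoff (a / T)" "\<lambda>h. cutoff' (a / T) * h"] d
  show "((\<lambda>(x, y). T * cutoff (x / T)) has_derivative (\<lambda>(h, k). cutoff' (a / T) * h + 0 * k)) (at (a, b))"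
    by (simp add: has_field_derivative_def case_prod_unfold)
qed (auto simp: cutoff_bounds)

text \<open>Hoelder's inequality against an indicator, from Young's inequality with a free scale
  \<open>l\<close> that is optimized at the end.\<close>

lemma Holder_support:
  fixes f :: "'a \<Rightarrow> real"
  assumes p: "p > 1" and f: "f \<in> borel_measurable M" "\<And>x. 0 \<le> f x" "integrable M (\<lambda>x. f x powr p)"
    and E: "E \<in> sets M" "emeasure M E < \<infinity>" "\<And>x. x \<notin> E \<Longrightarrow> f x = 0"
  shows "integrable M f" "(LINT x|M. f x) \<le> (LINT x|M. f x powr p) powr (1 / p) * measure M E powr (1 - 1 / p)"
proof -
  define A where "A = (LINT x|M. f x powr p)"
  define m where "m = measure M E"
  have iE: "integrable M (indicat_real E)" using E by (intro integrable_real_indicator) auto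
  have young: "f x \<le> l * ((f x / l) powr p / p + (1 - 1 / p) * indicator E x)" if l: "l > 0" for l x
  proof (cases "x \<in> E")
    case True
    define p' where "p' = 1 / (1 - 1 / p)"
    have p': "p' > 1" "1 / p + 1 / p' = 1" using p by (auto simp: p'_def field_simps)
    have "f x / l * 1 \<le> (f x / l) powr p / p + 1 powr p' / p'"
      using p p' f(2)[of x] l by (intro Youngs_inequality) auto
    then have "f x / l \<le> (f x / l) powr p / p + (1 - 1 / p)" by (simp add: p'_def)
    then have "l * (f x / l) \<le> l * ((f x / l) powr p / p + (1 - 1 / p))" using l by (intro mult_left_mono) auto
    then show ?thesis using True l by simp
  qed (use E(3) in simp)
  have iy: "integrable M (\<lambda>x. l * ((f x / l) powr p / p + (1 - 1 / p) * indicator E x))" if "l > 0" for l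
    using f iE that by (simp add: powr_divide)
  show "integrable M f"
    by (rule Bochner_Integration.integrable_bound[OF iy[of 1] f(1)]) (use young[of 1] f(2) in \<open>auto intro!: order_trans[OF _ abs_ge_self]\<close>)
  then have le: "(LINT x|M. f x) \<le> l * (A / l powr p / p + (1 - 1 / p) * m)" if "l > 0" for l
  proof -
    have "(LINT x|M. f x) \<le> (LINT x|M. l * ((f x / l) powr p / p + (1 - 1 / p) * indicator E x))"
      by (intro integral_mono \<open>integrable M f\<close> iy young that)
    then show ?thesis using f iE that E(1) by (simp add: powr_divide A_def m_def sets.Int_space_eq2)
  qed
  show "(LINT x|M. f x) \<le> (LINT x|M. f x powr p) powr (1 / p) * measure M E powr (1 - 1 / p)"
  proof (cases "A = 0 \<or> m = 0")
    case True
    have "AE x in M. f x = 0"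
    proof (cases "A = 0")
      case True
      then have "AE x in M. f x powr p = 0" using integral_nonneg_eq_0_iff_AE[OF f(3)] by (simp add: A_def)
      then show ?thesis by eventually_elim (use p in auto)
    next
      case False
      then have "E \<in> null_sets M" using True E by (auto simp: m_def null_sets_def measure_def enn2real_eq_0_iff)
      from AE_I'[OF this, of "\<lambda>x. f x = 0"] show ?thesis using E(3) by auto
    qed
    then have "(LINT x|M. f x) = 0" using integral_cong_AE[of f M "\<lambda>x. 0"] f(1) by simp
    then show ?thesis by simp
  next
    case False
    then have A: "A > 0" "m > 0" unfolding A_def m_def by (auto simp: less_le Bochner_Integration.integral_nonneg)
    \<comment> \<open>The minimizing scale: with it \<open>A / l powr p\<close> becomes
      \<open>m\<close>.\<close>
    define l where "l = (A / m) powr (1 / p)"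
    have l: "l > 0" "l powr p = A / m" using A p by (auto simp: l_def powr_powr)
    have "(LINT x|M. f x) \<le> l * (m / p + (1 - 1 / p) * m)" using le[OF l(1)] A by (simp add: l(2))
    also have "\<dots> = l * m" by (simp add: algebra_simps)
    also have "\<dots> = A powr (1 / p) * m powr (1 - 1 / p)" using A by (simp add: l_def powr_divide powr_diff)
    finally show ?thesis by (simp add: A_def m_def)
  qed
qed

text \<open>The numbers \<open>(2 ^ k) powr p\<close> grow at least by the factor 2, so a sum of
  them is at most twice its largest term.\<close>

lemma dyadic_sum_le:
  assumes "p \<ge> 1" "t \<ge> 0"
  shows "(\<Sum>k<n. if 2 ^ k \<le> t then (2 ^ k :: real) powr p else 0) \<le> 2 * t powr p"
proof (induction n)
  case (Suc n)
  have g: "(\<Sum>k<n. (2 ^ k :: real) powr p) \<le> (2 ^ n) powr p" for n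
  proof (induction n)
    case (Suc n)
    have "2 * (2 ^ n :: real) powr p \<le> 2 powr p * (2 ^ n) powr p"
      using powr_mono[of 1 p "2::real"] assms by (intro mult_right_mono) auto
    moreover have "(2 ^ Suc n :: real) powr p = 2 powr p * (2 ^ n) powr p" by (simp add: powr_mult)
    ultimately show ?case unfolding sum.lessThan_Suc using Suc by linarith
  qed simp
  show ?case
  proof (cases "2 ^ n \<le> t")
    case True
    have "(\<Sum>k<Suc n. if 2 ^ k \<le> t then (2 ^ k :: real) powr p else 0) \<le> (\<Sum>k<Suc n. (2 ^ k :: real) powr p)"
      by (intro sum_mono) auto
    also have "\<dots> \<le> 2 * (2 ^ n) powr p" using g[of n] by simp
    also have "\<dots> \<le> 2 * t powr p" using True assms by (intro mult_left_mono powr_mono2) auto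
    finally show ?thesis .
  qed (use Suc in simp)
qed simp

lemma dyadic_bands: "(\<Sum>k<n. if 2 ^ k \<le> t \<and> t < 2 ^ Suc k then 1 else 0 :: real) = (if 1 \<le> t \<and> t < (2::real) ^ n then 1 else 0)"
proof (induction n)
  case (Suc n)
  obtain a where a: "(2::real) ^ n = a" "1 \<le> a" by simp
  show ?case unfolding sum.lessThan_Suc Suc.IH unfolding power_Suc a(1) using a(2) by auto
qed simp

lemma powr_add_le:
  assumes "a \<ge> 0" "b \<ge> 0" "p \<ge> (0::real)"
  shows "(a + b) powr p \<le> 2 powr p * (a powr p + b powr p)"
proof -
  have "(a + b) powr p \<le> (2 * max a b) powr p" using assms by (intro powr_mono2) auto
  also have "\<dots> = 2 powr p * max a b powr p" by (rule powr_mult)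
  also have "\<dots> \<le> 2 powr p * (a powr p + b powr p)"
    by (intro mult_left_mono) (auto simp: max_def)
  finally show ?thesis .
qed

text \<open>Summing the recursion bounds a finite sum by \<open>\<theta>\<close> times itself plus
  known terms, and \<open>\<theta> < 1\<close> lets that part be absorbed. This is legitimate for
  finite sums before convergence is known.\<close>

lemma bounded_recursion_sums:
  fixes x A :: "nat \<Rightarrow> real"
  assumes \<theta>: "0 \<le> \<theta>" "\<theta> < 1" and x: "\<And>k. 0 \<le> x k" and rec: "\<And>k. x (Suc k) \<le> \<theta> * x k + c * A k"
    and A: "\<And>n. (\<Sum>k<n. A k) \<le> M" and c: "0 \<le> c"
  shows "(\<Sum>k<n. x k) \<le> (x 0 + c * M) / (1 - \<theta>)"
proof (cases n)
  case 0
  have "0 \<le> M" using A[of 0] by simp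
  then show ?thesis using 0 \<theta> x[of 0] c by simp
next
  case (Suc m)
  have "(\<Sum>k<Suc m. x k) = x 0 + (\<Sum>k<m. x (Suc k))" by (rule sum.lessThan_Suc_shift)
  also have "(\<Sum>k<m. x (Suc k)) \<le> (\<Sum>k<m. \<theta> * x k + c * A k)" by (intro sum_mono rec)
  also have "\<dots> = \<theta> * (\<Sum>k<m. x k) + c * (\<Sum>k<m. A k)" by (simp add: sum.distrib sum_distrib_left)
  also have "\<dots> \<le> \<theta> * (\<Sum>k<Suc m. x k) + c * M"
    using A[of m] \<theta> x[of m] c by (intro add_mono mult_left_mono) auto
  finally have "(1 - \<theta>) * (\<Sum>k<Suc m. x k) \<le> x 0 + c * M" by (simp add: algebra_simps)
  then show ?thesis using Suc \<theta> by (simp add: pos_le_divide_eq mult.commute)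
qed

lemma lebesgue_on_finite:
  fixes \<Omega> :: "'a::euclidean_space set"
  assumes "open \<Omega>" "bounded \<Omega>"
  shows "finite_measure (lebesgue_on \<Omega>)"
  using assms by (intro finite_measure_lebesgue_on bounded_set_imp_lmeasurable) auto

lemma le_one_plus_powr: "0 \<le> x \<Longrightarrow> s \<le> r \<Longrightarrow> 0 \<le> s \<Longrightarrow> (x::real) powr s \<le> 1 + x powr r"
  by (cases "x \<le> 1") (auto intro: order_trans[OF powr_le1] order_trans[OF powr_mono[of s r x]])

lemma integrable_powr_le:
  fixes u :: "'a \<Rightarrow> real"
  assumes "finite_measure M" "u \<in> borel_measurable M" "AE x in M. 0 \<le> u x" "integrable M (\<lambda>x. u x powr r)" "0 \<le> s" "s \<le> r"
  shows "integrable M (\<lambda>x. u x powr s)"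
proof (rule Bochner_Integration.integrable_bound)
  show "integrable M (\<lambda>x. 1 + u x powr r)"
    using assms(4) finite_measure.integrable_const[OF assms(1)] by (intro Bochner_Integration.integrable_add) auto
  show "AE x in M. norm (u x powr s) \<le> norm (1 + u x powr r)"
    using assms(3)
  proof eventually_elim
    case (elim x)
    then show ?case using le_one_plus_powr[of "u x" s r] assms(5,6) by simp
  qed
qed (use assms(2) in auto)

lemma Lp_fun_integrable:
  fixes f :: "'a::euclidean_space \<Rightarrow> 'b::euclidean_space"
  assumes "open \<Omega>" "bounded \<Omega>" "1 \<le> p" "Lp_fun \<Omega> p f"
  shows "integrable (lebesgue_on \<Omega>) f"
proof -
  have m: "f \<in> borel_measurable (lebesgue_on \<Omega>)" using assms by (simp add: Lp_fun_def)
  have "integrable (lebesgue_on \<Omega>) (\<lambda>x. norm (f x) powr 1)"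
    by (rule integrable_powr_le[OF lebesgue_on_finite, where r = p]) (use assms m in \<open>auto simp: Lp_fun_def\<close>)
  then show ?thesis using m by (simp add: integrable_norm_iff)
qed

text \<open>The truncation method: the weak-type bound is applied to \<open>u\<close> cut off
  between \<open>2 ^ k\<close> and \<open>2 ^ Suc k\<close>. The gradients of these truncations live
  on disjoint bands, so their p-th powers can be summed over \<open>k\<close>. This summation
  improves the weak-type bound to integrability at the limiting exponent.\<close>

lemma sobolev:
  fixes \<Omega> :: "'a::euclidean_space set"
  assumes \<Omega>: "open \<Omega>" "bounded \<Omega>" and bd: "\<forall>x\<in>frontier \<Omega>. \<exists>U \<rho>. x \<in> U \<and> local_defining_function \<Omega> U \<rho>"
    and p: "p > 1" and \<nu>: "\<nu> > p" "\<nu> \<ge> real DIM('a)"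
    and wg: "is_weak_gradient \<Omega> u U" and Lp: "Lp_fun \<Omega> p u" "Lp_fun \<Omega> p U" and u0: "AE x in lebesgue_on \<Omega>. 0 \<le> u x"
  shows "integrable (lebesgue_on \<Omega>) (\<lambda>x. u x powr (p * \<nu> / (\<nu> - p)))"
proof -
  define M where "M = lebesgue_on \<Omega>"
  interpret finite_measure M unfolding M_def using \<Omega> by (rule lebesgue_on_finite)
  have \<nu>1: "\<nu> > 1" using \<nu> p by simp
  obtain C where C: "C > 0" and wt: "\<forall>u U t. is_weak_gradient \<Omega> u U \<longrightarrow> integrable M u \<longrightarrow> integrable M U \<longrightarrow>
     (AE x in M. 0 \<le> u x) \<longrightarrow> 0 < t \<longrightarrow>
     measure lebesgue {x\<in>\<Omega>. t \<le> u x} \<le>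
       C * (1 / t * ((LINT x|M. \<bar>u x\<bar>) + (LINT x|M. norm (U x)))) powr (1 / (1 - 1 / \<nu>))"
    using weak_type[OF \<Omega> bd \<nu>1 \<nu>(2)] unfolding M_def by blast
  \<comment> \<open>\<open>b\<close> is the weak-type exponent for integrable gradients,
    \<open>r\<close> the Sobolev exponent of \<open>p\<close> in dimension \<open>\<nu>\<close>, and
    \<open>\<theta>\<close> the power of \<open>e k\<close> that is left after Hoelder's
    inequality.\<close>
  define b where "b = 1 / (1 - 1 / \<nu>)"
  define r where "r = p * \<nu> / (\<nu> - p)"
  define \<theta> where "\<theta> = b * (1 - 1 / p)"
  have b: "b > 1" using \<nu>1 by (simp add: b_def)
  have r: "r > 0" using p \<nu> by (simp add: r_def)
  have "1 - 1 / p < 1 - 1 / \<nu>" using p \<nu> by (simp add: frac_less2)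
  then have \<theta>: "0 < \<theta>" "\<theta> < 1" using p \<nu>1 by (auto simp: \<theta>_def b_def)
  \<comment> \<open>This identity makes the powers of \<open>2 ^ k\<close> cancel in the recursion
    for \<open>x\<close>; it determines the value of \<open>r\<close>.\<close>
  have exps: "r - b - r * \<theta> = 0"
  proof -
    have nz: "\<nu> - p \<noteq> 0" "\<nu> - 1 \<noteq> 0" "\<nu> \<noteq> 0" "p \<noteq> 0" using p \<nu> \<nu>1 by auto
    have "b = \<nu> / (\<nu> - 1)" using nz by (simp add: b_def field_simps)
    moreover have "1 - \<theta> = (\<nu> - p) / (p * (\<nu> - 1))" using nz by (simp add: \<theta>_def calculation field_simps)
    ultimately have "r * (1 - \<theta>) = b" using nz by (simp add: r_def)
    then show ?thesis by (simp add: algebra_simps)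
  qed
  have um: "u \<in> borel_measurable M" and Um: "U \<in> borel_measurable M"
    and up: "integrable M (\<lambda>x. \<bar>u x\<bar> powr p)" and Up: "integrable M (\<lambda>x. norm (U x) powr p)"
    using Lp by (auto simp: Lp_fun_def M_def)
  note [measurable] = um Um
  have iu: "integrable M u" and iU: "integrable M U"
    using Lp_fun_integrable[OF \<Omega> _ Lp(1)] Lp_fun_integrable[OF \<Omega> _ Lp(2)] p by (auto simp: M_def)
  define E where "E k = {x \<in> space M. 2 ^ k \<le> u x}" for k :: nat
  have E: "E k \<in> sets M" for k unfolding E_def by measurable
  define e where "e k = measure M (E k)" for k
  have eq: "e k = measure lebesgue {x\<in>\<Omega>. 2 ^ k \<le> u x}" for k
    unfolding e_def E_def M_def using \<Omega>(1) by (subst measure_restrict_space) auto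
  \<comment> \<open>Dominates the truncation at level \<open>2 ^ k\<close> together with the norm of
    its gradient. The gradient part is supported in the band between two levels.\<close>
  define g where "g k x = 2 ^ k * indicator (E k) x + 2 * norm (U x) * indicator (E k - E (Suc k)) x" for k x
  have gm [measurable]: "g k \<in> borel_measurable M" for k unfolding g_def using E by measurable
  have g0: "0 \<le> g k x" for k x by (simp add: g_def)
  have gE: "g k x = 0" if "x \<notin> E k" for k x using that by (simp add: g_def)
  \<comment> \<open>A majorant of \<open>g k x powr p\<close> that can be summed over
    \<open>k\<close>: the first part is a geometric sum up to \<open>\<bar>u x\<bar>\<close>, and in
    the second part each point belongs to at most one band.\<close>
  define h where "h k x = 2 powr p * ((if 2 ^ k \<le> \<bar>u x\<bar> then (2 ^ k) powr p else 0) +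
      2 powr p * (norm (U x) powr p * (if 2 ^ k \<le> u x \<and> u x < 2 ^ Suc k then 1 else 0)))" for k x
  have hm [measurable]: "h k \<in> borel_measurable M" for k unfolding h_def by measurable
  have gh: "g k x powr p \<le> h k x" for k x
  proof (cases "x \<in> E k")
    case True
    have "g k x powr p \<le> 2 powr p * ((2 ^ k * indicator (E k) x) powr p + (2 * norm (U x) * indicator (E k - E (Suc k)) x) powr p)"
      unfolding g_def using p by (intro powr_add_le) auto
    also have "\<dots> \<le> h k x" unfolding h_def using True
      by (intro mult_left_mono add_mono) (auto simp: E_def indicator_def powr_mult)
    finally show ?thesis .
  next
    case False
    then show ?thesis using gE p by (simp add: h_def)
  qed
  have hsum: "(\<Sum>k<n. h k x) \<le> 2 powr p * (2 * \<bar>u x\<bar> powr p + 2 powr p * norm (U x) powr p)" for n x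
  proof -
    have "(\<Sum>k<n. h k x) = 2 powr p * ((\<Sum>k<n. if 2 ^ k \<le> \<bar>u x\<bar> then (2 ^ k) powr p else 0) +
       2 powr p * (norm (U x) powr p * (\<Sum>k<n. if 2 ^ k \<le> u x \<and> u x < 2 ^ Suc k then 1 else 0)))"
      by (simp only: h_def sum_distrib_left[symmetric] sum.distrib)
    also have "\<dots> \<le> 2 powr p * (2 * \<bar>u x\<bar> powr p + 2 powr p * (norm (U x) powr p * 1))"
      unfolding dyadic_bands using p by (intro mult_left_mono add_mono dyadic_sum_le) auto
    finally show ?thesis by simp
  qed
  have h0: "0 \<le> h k x" for k x by (simp add: h_def)
  have ih1: "integrable M (\<lambda>x. 2 powr p * (2 * \<bar>u x\<bar> powr p + 2 powr p * norm (U x) powr p))" using up Up by simp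
  have ih: "integrable M (h k)" for k
  proof (rule Bochner_Integration.integrable_bound[OF ih1 hm], intro AE_I2)
    fix x
    have "h k x \<le> (\<Sum>k<Suc k. h k x)" using h0 by (simp add: sum_nonneg)
    then show "norm (h k x) \<le> norm (2 powr p * (2 * \<bar>u x\<bar> powr p + 2 powr p * norm (U x) powr p))"
      using hsum[where n = "Suc k" and x = x] h0[of k x] by simp
  qed
  have ig: "integrable M (\<lambda>x. g k x powr p)" for k
    by (rule Bochner_Integration.integrable_bound[OF ih[of k]]) (use gh h0 in auto)
  define A where "A k = (LINT x|M. g k x powr p)" for k
  have A0: "0 \<le> A k" for k unfolding A_def by (intro Bochner_Integration.integral_nonneg) auto
  define S where "S = (LINT x|M. 2 powr p * (2 * \<bar>u x\<bar> powr p + 2 powr p * norm (U x) powr p))"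
  have Asum: "(\<Sum>k<n. A k) \<le> S" for n
  proof -
    have "(\<Sum>k<n. A k) \<le> (\<Sum>k<n. (LINT x|M. h k x))" unfolding A_def by (intro sum_mono integral_mono ig ih gh)
    also have "\<dots> = (LINT x|M. (\<Sum>k<n. h k x))" using ih by simp
    also have "\<dots> \<le> S" unfolding S_def by (intro integral_mono Bochner_Integration.integrable_sum ih ih1 hsum)
    finally show ?thesis .
  qed
  have S0: "0 \<le> S" using Asum[of 0] by simp
  have AS: "A k \<le> S" for k using Asum[of "Suc k"] sum_nonneg[of "{..<k}" A] A0 by simp
  have level: "e (Suc k) \<le> C * (1 / 2 ^ k * (A k powr (1 / p) * e k powr (1 - 1 / p))) powr b" for k
  proof -
    define T where "T = (2::real) ^ k"
    have T: "T > 0" by (simp add: T_def)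
    define v where "v x = T * cutoff (u x / T)" for x
    define V where "V x = cutoff' (u x / T) *\<^sub>R U x" for x
    have wgv: "is_weak_gradient \<Omega> v V"
      using weak_gradient_chain[OF \<Omega>(1) C1_two_cutoff[OF T] wg wg] by (simp add: v_def[abs_def] V_def[abs_def])
    have "isCont cutoff t" for t using DERIV_cutoff by (rule DERIV_isCont)
    then have cc: "continuous_on UNIV cutoff" "continuous_on UNIV cutoff'"
      by (auto simp: cutoff'_def[abs_def] intro!: continuous_at_imp_continuous_on continuous_intros)
    have [measurable]: "cutoff \<in> borel_measurable borel" "cutoff' \<in> borel_measurable borel"
      using cc by (auto intro: borel_measurable_continuous_onI)
    have vm [measurable]: "v \<in> borel_measurable M" "V \<in> borel_measurable M" unfolding v_def V_def by measurable
    have bd1: "\<bar>v x\<bar> \<le> 2 ^ k * indicator (E k) x" if "x \<in> space M" for x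
    proof (cases "x \<in> E k")
      case True then show ?thesis using cutoff_bounds(1,2)[of "u x / T"] T by (simp add: v_def abs_mult T_def)
    next
      case False
      then have "u x / T \<le> 1" using that T by (simp add: E_def T_def)
      then show ?thesis using False by (simp add: v_def cutoff_bounds)
    qed
    have bd2: "norm (V x) \<le> 2 * norm (U x) * indicator (E k - E (Suc k)) x" if "x \<in> space M" for x
    proof (cases "x \<in> E k - E (Suc k)")
      case True then show ?thesis using cutoff_bounds(5)[of "u x / T"] by (simp add: V_def mult_right_mono)
    next
      case False
      then have "u x / T < 1 \<or> 2 \<le> u x / T" using that T by (auto simp: E_def T_def field_simps)
      then show ?thesis by (auto simp: V_def cutoff_bounds)
    qed
    have iv: "integrable M v"
      by (rule integrable_const_bound[of _ "2 ^ k"]) (use bd1 in \<open>auto intro!: AE_I2 order_trans[OF bd1] simp: indicator_def\<close>)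
    have iV: "integrable M V"
      by (rule Bochner_Integration.integrable_bound[OF integrable_mult_right[OF integrable_norm[OF iU], of 2]])
        (use bd2 in \<open>auto intro!: AE_I2 order_trans[OF bd2] simp: indicator_def\<close>)
    have ig1: "integrable M (g k)" and hol: "(LINT x|M. g k x) \<le> A k powr (1 / p) * e k powr (1 - 1 / p)"
    proof -
      have fin: "emeasure M (E k) < \<infinity>" using emeasure_finite[of "E k"] unfolding infinity_ennreal_def less_top .
      note hs = Holder_support[OF p gm[of k] g0[of k] ig[of k] E[of k] fin gE[of _ k]]
      show "integrable M (g k)" by (rule hs(1))
      show "(LINT x|M. g k x) \<le> A k powr (1 / p) * e k powr (1 - 1 / p)" unfolding A_def e_def by (rule hs(2))
    qed
    have "e (Suc k) \<le> measure lebesgue {x\<in>\<Omega>. T \<le> v x}"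
    proof -
      have "{x \<in> space M. T \<le> v x} \<in> sets M" by measurable
      then have m: "{x\<in>\<Omega>. T \<le> v x} \<in> lmeasurable" using \<Omega> unfolding M_def
        by (intro bounded_set_imp_lmeasurable) (auto simp: sets_restrict_space_iff intro: bounded_subset)
      have "{x \<in> space M. 2 ^ Suc k \<le> u x} \<in> sets M" by measurable
      then have m2: "{x\<in>\<Omega>. 2 ^ Suc k \<le> u x} \<in> sets lebesgue" using \<Omega> unfolding M_def by (auto simp: sets_restrict_space_iff)
      have "{x\<in>\<Omega>. 2 ^ Suc k \<le> u x} \<subseteq> {x\<in>\<Omega>. T \<le> v x}"
      proof safe
        fix x assume "2 ^ Suc k \<le> u x"
        then have "2 \<le> u x / T" using T by (simp add: T_def pos_le_divide_eq)
        then show "T \<le> v x" by (simp add: v_def cutoff_bounds)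
      qed
      then show ?thesis unfolding eq using m m2 by (intro measure_mono_fmeasurable)
    qed
    also have "\<dots> \<le> C * (1 / T * ((LINT x|M. \<bar>v x\<bar>) + (LINT x|M. norm (V x)))) powr b"
      unfolding b_def by (rule wt[rule_format, OF wgv iv iV _ T]) (use T cutoff_bounds(1) in \<open>auto simp: v_def\<close>)
    also have "\<dots> \<le> C * (1 / T * (A k powr (1 / p) * e k powr (1 - 1 / p))) powr b"
    proof -
      have "(LINT x|M. \<bar>v x\<bar>) + (LINT x|M. norm (V x)) = (LINT x|M. \<bar>v x\<bar> + norm (V x))" using iv iV by simp
      also have "\<dots> \<le> (LINT x|M. g k x)" unfolding g_def
        by (rule integral_mono) (use iv iV ig1[unfolded g_def] in \<open>auto intro!: add_mono bd1 bd2\<close>)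
      also note hol
      finally show ?thesis using C T b
        by (intro mult_left_mono powr_mono2 add_nonneg_nonneg mult_nonneg_nonneg Bochner_Integration.integral_nonneg) auto
    qed
    finally show ?thesis by (simp add: T_def)
  qed
  define x where "x k = (2 ^ k) powr r * e k" for k
  have e0: "0 \<le> e k" for k by (simp add: e_def)
  have x0: "0 \<le> x k" for k using e0 by (simp add: x_def)
  define c1 where "c1 = C * 2 powr r * S powr (b - 1)"
  have c1: "c1 \<ge> 0" using C by (simp add: c1_def)
  have rec0: "x (Suc k) \<le> x k powr \<theta> * (c1 * A k powr (1 - \<theta>))" for k
  proof -
    define T where "T = (2::real) ^ k"
    have T: "T > 0" by (simp add: T_def)
    have "x (Suc k) = 2 powr r * T powr r * e (Suc k)" by (simp add: x_def T_def powr_mult)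
    also have "\<dots> \<le> 2 powr r * T powr r * (C * (1 / T * (A k powr (1 / p) * e k powr (1 - 1 / p))) powr b)"
      using level[of k] unfolding T_def by (intro mult_left_mono) auto
    also have "(1 / T * (A k powr (1 / p) * e k powr (1 - 1 / p))) powr b = T powr (- b) * (A k powr (b / p) * e k powr \<theta>)"
      using T A0 e0 by (simp add: powr_mult powr_powr powr_divide powr_minus_divide \<theta>_def mult.commute)
    also have "2 powr r * T powr r * (C * (T powr (- b) * (A k powr (b / p) * e k powr \<theta>))) = (C * 2 powr r) * (T powr (r - b)) * e k powr \<theta> * A k powr (b / p)"
      using T by (simp add: powr_diff powr_minus field_simps)
    also have "r - b = r * \<theta>" using exps by simp
    also have "(C * 2 powr r) * T powr (r * \<theta>) * e k powr \<theta> * A k powr (b / p) = (C * 2 powr r) * x k powr \<theta> * A k powr (b / p)"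
      using T e0 by (simp add: x_def powr_mult powr_powr T_def)
    also have "\<dots> \<le> (C * 2 powr r) * x k powr \<theta> * (S powr (b - 1) * A k powr (1 - \<theta>))"
    proof -
      \<comment> \<open>The power \<open>b - 1 > 0\<close> of \<open>A k\<close> is given away to
        the uniform bound \<open>S\<close>. The remaining power \<open>1 - \<theta>\<close> is the
        one that matches \<open>x k powr \<theta>\<close> in Young's inequality.\<close>
      have "b / p = (b - 1) + (1 - \<theta>)" using p by (simp add: \<theta>_def algebra_simps)
      then have "A k powr (b / p) = A k powr (b - 1) * A k powr (1 - \<theta>)" using powr_add[of "A k" "b - 1" "1 - \<theta>"] by simp
      also have "\<dots> \<le> S powr (b - 1) * A k powr (1 - \<theta>)" using AS A0 b by (intro mult_right_mono powr_mono2) auto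
      finally show ?thesis using C by (intro mult_left_mono) auto
    qed
    finally show ?thesis by (simp add: c1_def mult_ac)
  qed
  \<comment> \<open>The constant produced by Young's inequality, which turns the product in
    \<open>rec0\<close> into a linear recursion with factor \<open>\<theta> < 1\<close>.\<close>
  define c2 where "c2 = (1 - \<theta>) * c1 powr (1 / (1 - \<theta>))"
  have rec: "x (Suc k) \<le> \<theta> * x k + c2 * A k" for k
  proof (cases "x k = 0 \<or> c1 = 0 \<or> A k = 0")
    case True
    then have "x (Suc k) \<le> 0" using rec0[of k] by auto
    also have "0 \<le> \<theta> * x k + c2 * A k" using \<theta> x0 A0 by (auto simp: c2_def intro!: add_nonneg_nonneg mult_nonneg_nonneg)
    finally show ?thesis .
  next
    case False
    then have pos: "x k > 0" "c1 > 0" "A k > 0" using x0[of k] c1 A0[of k] by auto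
    define D where "D = c1 powr (1 / (1 - \<theta>)) * A k"
    have D: "D > 0" using pos by (simp add: D_def)
    have "D powr (1 - \<theta>) = c1 * A k powr (1 - \<theta>)" using pos \<theta> by (simp add: D_def powr_mult powr_powr)
    then have "x (Suc k) \<le> x k powr \<theta> * D powr (1 - \<theta>)" using rec0[of k] by simp
    also have "\<dots> \<le> \<theta> * x k + (1 - \<theta>) * D" using \<theta> pos D by (intro Youngs_inequality_0) auto
    finally show ?thesis by (simp add: c2_def D_def)
  qed
  define B where "B = (x 0 + c2 * S) / (1 - \<theta>)"
  have "(\<Sum>k<n. x k) \<le> B" for n
    unfolding B_def using \<theta> by (intro bounded_recursion_sums[where A = A] x0 rec Asum) (auto simp: c2_def)
  then have sx: "summable x" using x0 by (intro summableI_nonneg_bounded[of x B])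
  \<comment> \<open>Below 1 the power is at most 1. Otherwise the last dyadic level that does not
    exceed \<open>u y\<close> determines it up to the factor \<open>2 powr r\<close>.\<close>
  have pt: "ennreal (u y powr r) \<le> 1 + (\<Sum>k. ennreal (2 powr r * ((2 ^ k) powr r * indicator (E k) y)))" if y: "y \<in> space M" "0 \<le> u y" for y
  proof (cases "u y < 1")
    case True
    then have "u y powr r \<le> 1" using y r by (intro powr_le1) auto
    then have "ennreal (u y powr r) \<le> 1" by (simp add: ennreal_le_1)
    also have "1 \<le> 1 + (\<Sum>k. ennreal (2 powr r * ((2 ^ k) powr r * indicator (E k) y)))" by simp
    finally show ?thesis .
  next
    case False
    obtain n where n: "u y < 2 ^ n" using real_arch_pow[of 2 "u y"] by auto
    define m where "m = (LEAST n. u y < 2 ^ n)"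
    have m: "u y < 2 ^ m" unfolding m_def using n by (rule LeastI)
    then have "m \<noteq> 0" using False by (cases m) auto
    then obtain k where k: "m = Suc k" using not0_implies_Suc by blast
    have "\<not> u y < 2 ^ k" using not_less_Least[of k "\<lambda>n. u y < 2 ^ n"] k by (simp add: m_def[symmetric])
    then have Ek: "y \<in> E k" using y by (simp add: E_def)
    have "u y powr r \<le> (2 * 2 ^ k) powr r" using m k y r by (intro powr_mono2) auto
    also have "\<dots> = 2 powr r * ((2 ^ k) powr r * indicator (E k) y)" using Ek by (simp add: powr_mult)
    finally have "ennreal (u y powr r) \<le> ennreal (2 powr r * ((2 ^ k) powr r * indicator (E k) y))" by (rule ennreal_leI)
    also have "\<dots> \<le> (\<Sum>k. ennreal (2 powr r * ((2 ^ k) powr r * indicator (E k) y)))"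
    proof -
      have "F k \<le> suminf F" for F :: "nat \<Rightarrow> ennreal" using sum_le_suminf[of F "{k}"] by simp
      then show ?thesis .
    qed
    also have "\<dots> \<le> 1 + (\<Sum>k. ennreal (2 powr r * ((2 ^ k) powr r * indicator (E k) y)))" by (rule add_increasing) auto
    finally show ?thesis .
  qed
  have "(\<integral>\<^sup>+y. ennreal (u y powr r) \<partial>M) \<le> (\<integral>\<^sup>+y. 1 + (\<Sum>k. ennreal (2 powr r * ((2 ^ k) powr r * indicator (E k) y))) \<partial>M)"
  proof (rule nn_integral_mono_AE)
    show "AE y in M. ennreal (u y powr r) \<le> 1 + (\<Sum>k. ennreal (2 powr r * ((2 ^ k) powr r * indicator (E k) y)))"
      using u0[folded M_def] AE_space[of M] by eventually_elim (rule pt)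
  qed
  also have "\<dots> = emeasure M (space M) + (\<Sum>k. (\<integral>\<^sup>+y. ennreal (2 powr r * ((2 ^ k) powr r * indicator (E k) y)) \<partial>M))"
    using E by (subst nn_integral_add) (auto simp: nn_integral_suminf)
  also have "(\<lambda>k. (\<integral>\<^sup>+y. ennreal (2 powr r * ((2 ^ k) powr r * indicator (E k) y)) \<partial>M)) = (\<lambda>k. ennreal (2 powr r * x k))"
  proof
    fix k
    have "(\<integral>\<^sup>+y. ennreal (2 powr r * ((2 ^ k) powr r * indicator (E k) y)) \<partial>M) = ennreal (LINT y|M. 2 powr r * ((2 ^ k) powr r * indicator (E k) y))"
      using E[of k] by (intro nn_integral_eq_integral) (auto intro!: integrable_real_indicator simp: emeasure_eq_measure)
    also have "(LINT y|M. 2 powr r * ((2 ^ k) powr r * indicator (E k) y)) = 2 powr r * x k"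
      using E[of k] by (simp add: x_def e_def sets.Int_space_eq2)
    finally show "(\<integral>\<^sup>+y. ennreal (2 powr r * ((2 ^ k) powr r * indicator (E k) y)) \<partial>M) = ennreal (2 powr r * x k)" .
  qed
  also have "(\<Sum>k. ennreal (2 powr r * x k)) = ennreal (\<Sum>k. 2 powr r * x k)"
    using sx x0 by (intro suminf_ennreal2) auto
  also have "emeasure M (space M) + ennreal (\<Sum>k. 2 powr r * x k) < \<infinity>" using emeasure_finite by (simp add: less_top[symmetric])
  finally have "(\<integral>\<^sup>+y. ennreal (u y powr r) \<partial>M) < \<infinity>" .
  then have "integrable M (\<lambda>y. u y powr r)" by (intro integrableI_bounded) auto
  then show ?thesis by (simp add: M_def r_def)
qed

text \<open>\<open>\<nu>\<close> plays the part of the dimension. If \<open>p\<close> is below the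
  dimension, \<open>\<nu>\<close> equals it and the growth condition says that
  \<open>\<sigma> + 1\<close> is at most the Sobolev exponent. Otherwise every
  \<open>\<nu> > p\<close> is admissible, and the exponent is as large as desired when
  \<open>\<nu>\<close> is close to \<open>p\<close>.\<close>

lemma sobolev_growth:
  fixes \<Omega> :: "'a::euclidean_space set"
  assumes \<Omega>: "open \<Omega>" "bounded \<Omega>" and bd: "\<forall>x\<in>frontier \<Omega>. \<exists>U \<rho>. x \<in> U \<and> local_defining_function \<Omega> U \<rho>"
    and p: "p > 1" and \<sigma>: "\<sigma> > 0" "\<sigma> * (real DIM('a) - p) \<le> (p - 1) * real DIM('a) + p"
    and wg: "is_weak_gradient \<Omega> u U" and Lp: "Lp_fun \<Omega> p u" "Lp_fun \<Omega> p U" and u0: "AE x in lebesgue_on \<Omega>. 0 \<le> u x"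
  shows "integrable (lebesgue_on \<Omega>) (\<lambda>x. u x powr (\<sigma> + 1))"
proof -
  define N where "N = real DIM('a)"
  obtain \<nu> where \<nu>: "\<nu> > p" "\<nu> \<ge> N" "\<sigma> + 1 \<le> p * \<nu> / (\<nu> - p)"
  proof (cases "p < N")
    case True
    have "(\<sigma> + 1) * (N - p) \<le> p * N" using \<sigma>(2) by (simp add: N_def algebra_simps)
    then show ?thesis using that[of N] True by (simp add: pos_le_divide_eq)
  next
    case False
    \<comment> \<open>With \<open>\<nu> = p + d\<close> the exponent is
      \<open>p * (p + d) / d\<close>, which is at least
      \<open>p * p / d = \<sigma> + 1\<close>.\<close>
    define d where "d = p * p / (\<sigma> + 1)"
    have d: "d > 0" using p \<sigma> by (simp add: d_def)
    have "(\<sigma> + 1) * d = p * p" using \<sigma> by (simp add: d_def)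
    also have "\<dots> \<le> p * (p + d)" using p d by simp
    finally have "\<sigma> + 1 \<le> p * (p + d) / d" using d by (simp add: pos_le_divide_eq)
    then show ?thesis using that[of "p + d"] d False by simp
  qed
  have "integrable (lebesgue_on \<Omega>) (\<lambda>x. u x powr (p * \<nu> / (\<nu> - p)))"
    by (rule sobolev[OF \<Omega> bd p \<nu>(1) _ wg Lp u0]) (use \<nu> N_def in auto)
  then show ?thesis
    by (rule integrable_powr_le[OF lebesgue_on_finite[OF \<Omega>] _ u0, where r = "p * \<nu> / (\<nu> - p)", rotated])
      (use \<sigma> \<nu> Lp in \<open>auto simp: Lp_fun_def\<close>)
qed

section \<open>Nonlinear operations on Sobolev spaces\<close>

locale lp_domain =
  fixes \<Omega> :: "'a::euclidean_space set" and p :: real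
  assumes \<Omega>: "open \<Omega>" "bounded \<Omega>" and p: "p > 1"
begin

abbreviation M where "M \<equiv> lebesgue_on \<Omega>"

lemma finM: "finite_measure M" using \<Omega> by (rule lebesgue_on_finite)

text \<open>The p-th power of the L^p norm. Estimates for it are integrals of pointwise estimates,
  without roots.\<close>

definition ps :: "('a \<Rightarrow> 'b::euclidean_space) \<Rightarrow> real" where "ps f = (LINT x|M. norm (f x) powr p)"

text \<open>Couples a function with one representative of its weak gradient, so that gradients given
  by formulas can be used in place of the choice made by \<open>weak_gradient\<close>.\<close>

definition sob where "sob u U \<longleftrightarrow> Lp_fun \<Omega> p u \<and> is_weak_gradient \<Omega> u U \<and> Lp_fun \<Omega> p U"

lemma Lp_meas: "Lp_fun \<Omega> p f \<Longrightarrow> f \<in> borel_measurable M"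
  and Lp_int: "Lp_fun \<Omega> p f \<Longrightarrow> integrable M (\<lambda>x. norm (f x) powr p)"
  by (auto simp: Lp_fun_def)

lemma ps_nonneg: "0 \<le> ps f" unfolding ps_def by (intro Bochner_Integration.integral_nonneg) auto

lemma Lp_L1: "Lp_fun \<Omega> p f \<Longrightarrow> integrable M f" for f :: "'a \<Rightarrow> 'b::euclidean_space"
  using Lp_fun_integrable[OF \<Omega>, of p f] p by simp

lemma Lp_bound:
  fixes g :: "'a \<Rightarrow> 'b::euclidean_space" and h :: "'a \<Rightarrow> 'c::euclidean_space" and f :: "'a \<Rightarrow> 'd::euclidean_space"
  assumes "Lp_fun \<Omega> p g" "Lp_fun \<Omega> p h" "f \<in> borel_measurable M" "c \<ge> 0" "\<And>x. norm (f x) \<le> c * (norm (g x) + norm (h x))"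
  shows "Lp_fun \<Omega> p f" "ps f \<le> (2 * c) powr p * (ps g + ps h)"
proof -
  have b: "norm (f x) powr p \<le> (2 * c) powr p * (norm (g x) powr p + norm (h x) powr p)" for x
  proof -
    have "norm (f x) powr p \<le> (c * (norm (g x) + norm (h x))) powr p" using assms(5) p by (intro powr_mono2) auto
    also have "\<dots> = c powr p * (norm (g x) + norm (h x)) powr p" by (rule powr_mult)
    also have "\<dots> \<le> c powr p * (2 powr p * (norm (g x) powr p + norm (h x) powr p))"
      using p by (intro mult_left_mono powr_add_le) auto
    finally show ?thesis by (simp add: powr_mult mult_ac)
  qed
  have i: "integrable M (\<lambda>x. (2 * c) powr p * (norm (g x) powr p + norm (h x) powr p))"
    using Lp_int[OF assms(1)] Lp_int[OF assms(2)] by (intro integrable_mult_right Bochner_Integration.integrable_add)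
  have j: "integrable M (\<lambda>x. norm (f x) powr p)"
    by (rule Bochner_Integration.integrable_bound[OF i]) (use assms(3) b in \<open>auto intro: order_trans[OF _ abs_ge_self]\<close>)
  then show "Lp_fun \<Omega> p f" using assms(3) by (simp add: Lp_fun_def)
  have "ps f \<le> (LINT x|M. (2 * c) powr p * (norm (g x) powr p + norm (h x) powr p))"
    unfolding ps_def by (rule integral_mono[OF j i b])
  then show "ps f \<le> (2 * c) powr p * (ps g + ps h)"
    using Lp_int[OF assms(1)] Lp_int[OF assms(2)] by (simp add: ps_def)
qed

lemma meas_AE_cong:
  fixes f g :: "'a \<Rightarrow> 'b::euclidean_space"
  assumes f: "f \<in> borel_measurable M" and ae: "AE x in M. f x = g x"
  shows "g \<in> borel_measurable M"
proof -
  have \<Omega>s: "\<Omega> \<inter> space lebesgue \<in> sets lebesgue" using \<Omega> by auto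
  have "(\<lambda>x. indicator \<Omega> x *\<^sub>R f x) \<in> borel_measurable lebesgue"
    using f by (subst (asm) borel_measurable_restrict_space_iff[OF \<Omega>s])
  moreover have "AE x in lebesgue. indicator \<Omega> x *\<^sub>R f x = indicator \<Omega> x *\<^sub>R g x"
    using ae unfolding AE_restrict_space_iff[OF \<Omega>s] by eventually_elim (auto simp: indicator_def)
  ultimately have "(\<lambda>x. indicator \<Omega> x *\<^sub>R g x) \<in> borel_measurable lebesgue" by (rule borel_measurable_AE)
  then show ?thesis by (subst borel_measurable_restrict_space_iff[OF \<Omega>s])
qed

lemma Lp_AE_cong:
  fixes f g :: "'a \<Rightarrow> 'b::euclidean_space"
  assumes f: "Lp_fun \<Omega> p f" and ae: "AE x in M. f x = g x"
  shows "Lp_fun \<Omega> p g" "ps g = ps f"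
proof -
  have gm: "g \<in> borel_measurable M" by (rule meas_AE_cong[OF Lp_meas[OF f] ae])
  have m: "(\<lambda>x. norm (f x) powr p) \<in> borel_measurable M" "(\<lambda>x. norm (g x) powr p) \<in> borel_measurable M"
    using Lp_meas[OF f] gm by auto
  have ae2: "AE x in M. norm (f x) powr p = norm (g x) powr p" using ae by eventually_elim simp
  show "Lp_fun \<Omega> p g" unfolding Lp_fun_def using gm integrable_cong_AE[OF m ae2, THEN iffD1, OF Lp_int[OF f]] by (rule conjI)
  show "ps g = ps f" unfolding ps_def by (rule integral_cong_AE[OF m ae2, symmetric])
qed

lemma W1p_iff: "u \<in> W1p \<Omega> p \<longleftrightarrow> (\<exists>U. sob u U)" by (auto simp: W1p_def sob_def)

lemma sob_weak_gradient:
  assumes "sob u U" shows "sob u (weak_gradient \<Omega> u)" "AE x in M. U x = weak_gradient \<Omega> u x"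
proof -
  have w: "is_weak_gradient \<Omega> u (weak_gradient \<Omega> u)"
    unfolding weak_gradient_def using assms by (intro someI[of "is_weak_gradient \<Omega> u" U]) (simp add: sob_def)
  show ae: "AE x in M. U x = weak_gradient \<Omega> u x"
    using assms w by (intro weak_gradient_unique[OF \<Omega>(1)]) (auto simp: sob_def)
  show "sob u (weak_gradient \<Omega> u)" using assms w Lp_AE_cong(1)[OF _ ae] by (auto simp: sob_def)
qed

lemma norm_less:
  assumes s: "sob u U" and e: "e > 0"
  shows "W1p_norm \<Omega> p u < e \<longleftrightarrow> ps u + ps U < e powr p"
proof -
  have "ps (weak_gradient \<Omega> u) = ps U"
    using sob_weak_gradient(2)[OF s] s by (intro Lp_AE_cong(2)) (auto simp: sob_def)
  then have n: "W1p_norm \<Omega> p u = (ps u + ps U) powr (1 / p)" by (simp add: W1p_norm_def ps_def)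
  have nn: "0 \<le> ps u + ps U" using ps_nonneg[of u] ps_nonneg[of U] by simp
  have pp: "((ps u + ps U) powr (1 / p)) powr p = ps u + ps U" using p nn by (simp add: powr_powr)
  show ?thesis
  proof
    assume "W1p_norm \<Omega> p u < e"
    then have "((ps u + ps U) powr (1 / p)) powr p < e powr p" unfolding n using p by (intro powr_less_mono2) auto
    then show "ps u + ps U < e powr p" using pp by simp
  next
    assume "ps u + ps U < e powr p"
    then have "(ps u + ps U) powr (1 / p) < (e powr p) powr (1 / p)" using p nn by (intro powr_less_mono2) auto
    then show "W1p_norm \<Omega> p u < e" unfolding n using p e by (simp add: powr_powr)
  qed
qed

lemma meas_two:
  fixes F :: "real \<Rightarrow> real \<Rightarrow> real"
  assumes "continuous_on UNIV (\<lambda>(a, b). F a b)" "sob u U" "sob v V"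
  shows "(\<lambda>x. F (u x) (v x)) \<in> borel_measurable M"
  using assms Lp_meas by (intro continuous_two_measurable[OF assms(1)]) (auto simp: sob_def)

text \<open>Since \<open>F 0 0 = 0\<close>, the Lipschitz estimate bounds the composition by
  \<open>\<bar>u x\<bar> + \<bar>v x\<bar>\<close>, and bounded coefficients do the same for the
  gradient.\<close>

lemma sob_C1_two:
  assumes F: "C1_two F A B L" "F 0 0 = 0" and u: "sob u U" and v: "sob v V"
  shows "sob (\<lambda>x. F (u x) (v x)) (\<lambda>x. A (u x) (v x) *\<^sub>R U x + B (u x) (v x) *\<^sub>R V x)"
  unfolding sob_def
proof (intro conjI)
  have AL: "\<And>a b. \<bar>A a b\<bar> \<le> L" and BL: "\<And>a b. \<bar>B a b\<bar> \<le> L"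
    and cA: "continuous_on UNIV (\<lambda>(a, b). A a b)" "continuous_on UNIV (\<lambda>(a, b). B a b)" using F by (auto simp: C1_two_def)
  have L: "L \<ge> 0" using AL[of 0 0] by linarith
  show "is_weak_gradient \<Omega> (\<lambda>x. F (u x) (v x)) (\<lambda>x. A (u x) (v x) *\<^sub>R U x + B (u x) (v x) *\<^sub>R V x)"
    using u v by (intro weak_gradient_chain[OF \<Omega>(1) F(1)]) (auto simp: sob_def)
  show "Lp_fun \<Omega> p (\<lambda>x. F (u x) (v x))"
    by (rule Lp_bound(1)[of u v _ "2 * L"])
      (use u v L C1_two_lipschitz[OF F(1), of _ _ 0 0] F(2) meas_two[OF C1_two_continuous[OF F(1)] u v] in \<open>auto simp: sob_def\<close>)
  show "Lp_fun \<Omega> p (\<lambda>x. A (u x) (v x) *\<^sub>R U x + B (u x) (v x) *\<^sub>R V x)"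
  proof (rule Lp_bound(1)[of U V _ L])
    show "(\<lambda>x. A (u x) (v x) *\<^sub>R U x + B (u x) (v x) *\<^sub>R V x) \<in> borel_measurable M"
      using meas_two[OF cA(1) u v] meas_two[OF cA(2) u v] u v Lp_meas[of U] Lp_meas[of V] by (auto simp: sob_def)
    show "norm (A (u x) (v x) *\<^sub>R U x + B (u x) (v x) *\<^sub>R V x) \<le> L * (norm (U x) + norm (V x))" for x
      unfolding distrib_left by (intro norm_triangle_le add_mono) (auto intro!: mult_right_mono AL BL)
  qed (use u v L in \<open>auto simp: sob_def\<close>)
qed

lemma sob_diff: "sob u U \<Longrightarrow> sob v V \<Longrightarrow> sob (\<lambda>x. u x - v x) (\<lambda>x. U x - V x)"
  using sob_C1_two[OF C1_two_diff] by simp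

lemma Lp_continuous:
  fixes f :: "'a \<Rightarrow> 'b::euclidean_space"
  assumes "continuous_on UNIV f" "\<And>x. norm (f x) \<le> B"
  shows "Lp_fun \<Omega> p f" "ps f \<le> B powr p * measure M \<Omega>"
proof -
  interpret finite_measure M by (rule finM)
  have m: "f \<in> borel_measurable M" using assms(1) by (intro measurable_lebesgue_on_borel borel_measurable_continuous_onI)
  have b: "norm (f x) powr p \<le> B powr p" for x using assms(2) p by (intro powr_mono2) auto
  have i: "integrable M (\<lambda>x. norm (f x) powr p)" by (rule integrable_const_bound[of _ "B powr p"]) (use m b in auto)
  then show "Lp_fun \<Omega> p f" using m by (simp add: Lp_fun_def)
  have "ps f \<le> (LINT x|M. B powr p)" unfolding ps_def by (rule integral_mono[OF i]) (use b in auto)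
  then show "ps f \<le> B powr p * measure M \<Omega>" by (simp add: mult.commute)
qed

lemma sob_C1c:
  assumes c: "C1c K f D" shows "sob f D"
  unfolding sob_def
proof (intro conjI)
  have K: "compact K" "\<And>x. x \<notin> K \<Longrightarrow> f x = 0" "continuous_on UNIV D" using c by (auto simp: C1c_def)
  show "is_weak_gradient \<Omega> f D"
    using c by (intro C1_weak_gradient[OF \<Omega>(1)]) (auto simp: C1c_def intro: continuous_on_subset)
  show "Lp_fun \<Omega> p f" using continuous_compact_support_bounded[OF C1c_continuous[OF c] K(1,2)] Lp_continuous(1)[OF C1c_continuous[OF c]] by metis
  show "Lp_fun \<Omega> p D" using continuous_compact_support_bounded[OF K(3,1) C1c_grad_support[OF c]] Lp_continuous(1)[OF K(3)] by metis
qed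

lemma sob_test: "test_function \<Omega> \<phi> \<Longrightarrow> sob \<phi> (grad \<phi>)"
  using sob_C1c[OF test_function_C1c] .

lemma W01p_iff:
  assumes s: "sob u U"
  shows "u \<in> W01p \<Omega> p \<longleftrightarrow> (\<forall>e>0. \<exists>\<phi>. test_function \<Omega> \<phi> \<and> ps (\<lambda>x. u x - \<phi> x) + ps (\<lambda>x. U x - grad \<phi> x) < e)"
proof -
  have eq: "W1p_norm \<Omega> p (\<lambda>x. u x - \<phi> x) < e \<longleftrightarrow> ps (\<lambda>x. u x - \<phi> x) + ps (\<lambda>x. U x - grad \<phi> x) < e powr p"
    if "test_function \<Omega> \<phi>" "e > 0" for e \<phi>
    by (rule norm_less[OF sob_diff[OF s sob_test[OF that(1)]] that(2)])
  show ?thesis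
  proof
    assume l: "u \<in> W01p \<Omega> p"
    show "\<forall>e>0. \<exists>\<phi>. test_function \<Omega> \<phi> \<and> ps (\<lambda>x. u x - \<phi> x) + ps (\<lambda>x. U x - grad \<phi> x) < e"
    proof (intro allI impI)
      fix e :: real assume e: "e > 0"
      then have pos: "e powr (1 / p) > 0" by simp
      then obtain \<phi> where \<phi>: "test_function \<Omega> \<phi>" "W1p_norm \<Omega> p (\<lambda>x. u x - \<phi> x) < e powr (1 / p)" using l unfolding W01p_def by blast
      have "(e powr (1 / p)) powr p = e" using e p by (simp add: powr_powr)
      then show "\<exists>\<phi>. test_function \<Omega> \<phi> \<and> ps (\<lambda>x. u x - \<phi> x) + ps (\<lambda>x. U x - grad \<phi> x) < e"
        using \<phi> eq[OF \<phi>(1) \<open>e powr (1 / p) > 0\<close>] by auto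
    qed
  next
    assume r: "\<forall>e>0. \<exists>\<phi>. test_function \<Omega> \<phi> \<and> ps (\<lambda>x. u x - \<phi> x) + ps (\<lambda>x. U x - grad \<phi> x) < e"
    have "\<exists>\<phi>. test_function \<Omega> \<phi> \<and> W1p_norm \<Omega> p (\<lambda>x. u x - \<phi> x) < e" if "e > 0" for e
      using r[rule_format, of "e powr p"] eq that by auto
    then show "u \<in> W01p \<Omega> p" using s W1p_iff by (auto simp: W01p_def)
  qed
qed

lemma W01p_closed:
  assumes s: "sob z Z" and a: "\<And>e. e > 0 \<Longrightarrow> \<exists>y Y. sob y Y \<and> y \<in> W01p \<Omega> p \<and> ps (\<lambda>x. z x - y x) + ps (\<lambda>x. Z x - Y x) < e"
  shows "z \<in> W01p \<Omega> p"
  unfolding W01p_iff[OF s]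
proof (intro allI impI)
  fix e :: real assume e: "e > 0"
  define d where "d = e / (2 * 2 powr p)"
  have d: "d > 0" using e by (simp add: d_def)
  obtain y Y where y: "sob y Y" "y \<in> W01p \<Omega> p" "ps (\<lambda>x. z x - y x) + ps (\<lambda>x. Z x - Y x) < d" using a[OF d] by blast
  obtain \<phi> where \<phi>: "test_function \<Omega> \<phi>" "ps (\<lambda>x. y x - \<phi> x) + ps (\<lambda>x. Y x - grad \<phi> x) < d"
    using y(2) d unfolding W01p_iff[OF y(1)] by blast
  have L: "Lp_fun \<Omega> p (\<lambda>x. z x - y x)" "Lp_fun \<Omega> p (\<lambda>x. Z x - Y x)" "Lp_fun \<Omega> p (\<lambda>x. y x - \<phi> x)" "Lp_fun \<Omega> p (\<lambda>x. Y x - grad \<phi> x)"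
    "Lp_fun \<Omega> p (\<lambda>x. z x - \<phi> x)" "Lp_fun \<Omega> p (\<lambda>x. Z x - grad \<phi> x)"
    using sob_diff[OF s y(1)] sob_diff[OF y(1) sob_test[OF \<phi>(1)]] sob_diff[OF s sob_test[OF \<phi>(1)]] by (auto simp: sob_def)
  have "ps (\<lambda>x. z x - \<phi> x) \<le> (2 * 1) powr p * (ps (\<lambda>x. z x - y x) + ps (\<lambda>x. y x - \<phi> x))"
    by (rule Lp_bound(2)[OF L(1,3) Lp_meas[OF L(5)]]) auto
  moreover have "ps (\<lambda>x. Z x - grad \<phi> x) \<le> (2 * 1) powr p * (ps (\<lambda>x. Z x - Y x) + ps (\<lambda>x. Y x - grad \<phi> x))"
    by (rule Lp_bound(2)[OF L(2,4) Lp_meas[OF L(6)]]) (auto intro: norm_triangle_sub order_trans[OF norm_diff_triangle_le[OF order_refl order_refl]])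
  ultimately have "ps (\<lambda>x. z x - \<phi> x) + ps (\<lambda>x. Z x - grad \<phi> x)
     \<le> 2 powr p * ((ps (\<lambda>x. z x - y x) + ps (\<lambda>x. Z x - Y x)) + (ps (\<lambda>x. y x - \<phi> x) + ps (\<lambda>x. Y x - grad \<phi> x)))"
    by (simp add: algebra_simps)
  also have "\<dots> < 2 powr p * (d + d)" using y(3) \<phi>(2) by (intro mult_strict_left_mono add_strict_mono) auto
  also have "\<dots> = e" by (simp add: d_def)
  finally show "\<exists>\<phi>. test_function \<Omega> \<phi> \<and> ps (\<lambda>x. z x - \<phi> x) + ps (\<lambda>x. Z x - grad \<phi> x) < e" using \<phi>(1) by blast
qed

end

section \<open>The space \<open>W01p\<close>: approximation, compositions and constants\<close>

lemma mollify_uniform: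
  fixes w :: "'a::euclidean_space \<Rightarrow> 'b::euclidean_space"
  assumes w: "integrable lborel w" "uniformly_continuous_on UNIV w" and e: "e > 0"
  shows "\<exists>N. \<forall>n\<ge>N. \<forall>x. norm (mollify n w x - w x) \<le> e"
proof -
  obtain d where d: "d > 0" "\<And>x x'. dist x' x < d \<Longrightarrow> dist (w x') (w x) < e"
    using w(2) e unfolding uniformly_continuous_on_def by (metis UNIV_I)
  obtain N where N: "1 / real (Suc N) < d" using d(1) nat_approx_posE by blast
  have "norm (mollify n w x - w x) \<le> e" if "n \<ge> N" for n x
  proof -
    have m: "integrable lborel (\<lambda>y. moll n (x - y))" "(LINT y|lborel. moll n (x - y)) = 1"
      using integral_reflect[of "moll n" x] moll_integrable moll_integral by auto
    have "mollify n w x - w x = (LINT y|lborel. moll n (x - y) *\<^sub>R w y) - (LINT y|lborel. moll n (x - y) *\<^sub>R w x)"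
      using m by (simp add: mollify_def)
    also have "\<dots> = (LINT y|lborel. moll n (x - y) *\<^sub>R w y - moll n (x - y) *\<^sub>R w x)"
      using mollify_integrable[OF w(1)] m by (subst Bochner_Integration.integral_diff) auto
    also have "norm \<dots> \<le> (LINT y|lborel. e * moll n (x - y))"
    proof (rule order_trans[OF integral_norm_bound], rule integral_mono)
      show "integrable lborel (\<lambda>y. norm (moll n (x - y) *\<^sub>R w y - moll n (x - y) *\<^sub>R w x))"
        using mollify_integrable[OF w(1)] m by auto
      fix y
      have "norm (w y - w x) \<le> e" if "moll n (x - y) \<noteq> 0"
      proof -
        have "x - y \<in> cball 0 (1 / Suc n)" using that moll_support by blast
        then have "norm (x - y) \<le> 1 / real (Suc n)" by (simp add: norm_minus_commute)
        also have "\<dots> \<le> 1 / real (Suc N)" using \<open>n \<ge> N\<close> by (simp add: frac_le)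
        finally show ?thesis using N d(2)[of y x] by (simp add: dist_norm norm_minus_commute)
      qed
      then show "norm (moll n (x - y) *\<^sub>R w y - moll n (x - y) *\<^sub>R w x) \<le> e * moll n (x - y)"
        using moll_nonneg[of n "x - y"] by (cases "moll n (x - y) = 0") (auto simp: scaleR_diff_right[symmetric] mult.commute[of e] mult_left_mono)
    qed (use m in auto)
    also have "\<dots> = e" using m by simp
    finally show ?thesis .
  qed
  then show ?thesis by blast
qed

context lp_domain
begin

text \<open>Mollifications of \<open>f\<close> are test functions once their radius is below the
  width of a neighbourhood of \<open>K\<close> in \<open>\<Omega>\<close>. Both \<open>f\<close> and
  \<open>D\<close> are uniformly continuous and hence uniformly approximated.\<close>

lemma W01p_C1c:
  assumes c: "C1c K f D" and K: "K \<subseteq> \<Omega>"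
  shows "f \<in> W01p \<Omega> p"
  unfolding W01p_iff[OF sob_C1c[OF c]]
proof (intro allI impI)
  fix e :: real assume e: "e > 0"
  have cK: "compact K" "\<And>x. x \<notin> K \<Longrightarrow> f x = 0" "continuous_on UNIV D" using c by (auto simp: C1c_def)
  note cf = C1c_continuous[OF c] and D0 = C1c_grad_support[OF c]
  have i: "integrable lborel f" "integrable lborel D"
    using continuous_compact_support_integrable[OF cf cK(1,2)] continuous_compact_support_integrable[OF cK(3,1) D0] by auto
  have uc: "uniformly_continuous_on UNIV f" "uniformly_continuous_on UNIV D"
    using continuous_compact_support_uniform[OF cf cK(1,2)] continuous_compact_support_uniform[OF cK(3,1) D0] by auto
  define m where "m = measure M \<Omega> + 1"
  have m: "m > 0" by (simp add: m_def add_nonneg_pos)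
  \<comment> \<open>Chosen so that two errors, each at most \<open>\<eta> powr p\<close> times the
    measure of \<open>\<Omega>\<close>, add up to less than \<open>e\<close>.\<close>
  define \<eta> where "\<eta> = (e / (2 * m)) powr (1 / p)"
  have \<eta>: "\<eta> > 0" using e m by (simp add: \<eta>_def)
  have \<eta>p: "\<eta> powr p = e / (2 * m)" using e m p by (simp add: \<eta>_def powr_powr)
  obtain N1 N2 where N: "\<forall>n\<ge>N1. \<forall>x. norm (mollify n f x - f x) \<le> \<eta>" "\<forall>n\<ge>N2. \<forall>x. norm (mollify n D x - D x) \<le> \<eta>"
    using mollify_uniform[OF i(1) uc(1) \<eta>] mollify_uniform[OF i(2) uc(2) \<eta>] by blast
  obtain d where d: "d > 0" "compact (\<Union>x\<in>K. cball x d)" "(\<Union>x\<in>K. cball x d) \<subseteq> \<Omega>"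
    using compact_neighbourhood[OF cK(1) \<Omega>(1) K] by blast
  obtain N3 where N3: "1 / real (Suc N3) < d" using d(1) nat_approx_posE by blast
  define n where "n = N1 + N2 + N3"
  define \<phi> where "\<phi> = mollify n f"
  have eq: "\<phi> = (\<lambda>x. LINT y|lborel. f y * moll n (x - y))" unfolding \<phi>_def mollify_def by (simp add: mult.commute)
  have sm: "smooth_on UNIV \<phi>"
    unfolding eq by (rule superposition_smooth[OF moll_smooth compact_cball[of 0 "1 / real (Suc n)"] moll_support i(1)]) auto
  have z: "\<phi> x = 0" if "x \<notin> (\<Union>x\<in>K. cball x d)" for x
  proof -
    have "f y * moll n (x - y) = 0" for y
    proof (cases "y \<in> K")
      case True
      have "1 / real (Suc n) \<le> 1 / real (Suc N3)" by (simp add: n_def frac_le)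
      then have nb: "x - y \<notin> cball 0 (1 / Suc n)" using True that N3 by (auto simp: dist_norm norm_minus_commute)
      show ?thesis by (simp add: moll_support[OF nb])
    qed (use cK in simp)
    then have "(\<lambda>y. f y * moll n (x - y)) = (\<lambda>y. 0)" by (rule ext)
    then show ?thesis unfolding eq by simp
  qed
  have t: "test_function \<Omega> \<phi>" by (rule test_functionI[OF sm d(2,3) z])
  have g: "grad \<phi> x = mollify n D x" for x
  proof -
    have a: "mollify n f = (\<lambda>x. LINT y|lborel. moll n y * f (x - y))"
      using cf by (intro ext) (simp add: mollify_alt borel_measurable_continuous_onI)
    have "GDERIV (\<lambda>x. LINT y|lborel. moll n y * f (x - y)) x :> (LINT y|lborel. moll n y *\<^sub>R D (x - y))"
      by (rule superposition_GDERIV(1)[OF c moll_integrable]) auto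
    then have "GDERIV \<phi> x :> mollify n D x" unfolding \<phi>_def a using cK(3) by (simp add: mollify_alt borel_measurable_continuous_onI)
    then show ?thesis using smooth_on_GDERIV[OF sm, of x] GDERIV_unique by blast
  qed
  have cg: "continuous_on UNIV \<phi>" "continuous_on UNIV (grad \<phi>)" using smooth_on_continuous[OF sm] smooth_on_grad_continuous[OF sm] .
  have "ps (\<lambda>x. f x - \<phi> x) \<le> \<eta> powr p * measure M \<Omega>"
    by (rule Lp_continuous(2)) (use N(1) cf cg in \<open>auto simp: \<phi>_def n_def norm_minus_commute intro!: continuous_intros simp flip: real_norm_def\<close>)
  moreover have "ps (\<lambda>x. D x - grad \<phi> x) \<le> \<eta> powr p * measure M \<Omega>"
    by (rule Lp_continuous(2)) (use N(2) cK(3) cg g in \<open>auto simp: n_def norm_minus_commute intro!: continuous_intros\<close>)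
  ultimately have "ps (\<lambda>x. f x - \<phi> x) + ps (\<lambda>x. D x - grad \<phi> x) \<le> 2 * (\<eta> powr p * measure M \<Omega>)" by linarith
  also have "\<dots> = e * (measure M \<Omega> / m)" by (simp add: \<eta>p)
  also have "\<dots> < e * 1" using e m by (intro mult_strict_left_mono) (auto simp: m_def divide_less_eq)
  finally show "\<exists>\<phi>. test_function \<Omega> \<phi> \<and> ps (\<lambda>x. f x - \<phi> x) + ps (\<lambda>x. D x - grad \<phi> x) < e" using t by auto
qed

lemma W01p_sequence:
  assumes s: "sob u U" and "u \<in> W01p \<Omega> p"
  obtains \<phi> where "\<And>n::nat. test_function \<Omega> (\<phi> n)" "(\<lambda>n. ps (\<lambda>x. \<phi> n x - u x)) \<longlonglongrightarrow> 0" "(\<lambda>n. ps (\<lambda>x. grad (\<phi> n) x - U x)) \<longlonglongrightarrow> 0"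
proof -
  have "\<forall>n. \<exists>\<phi>. test_function \<Omega> \<phi> \<and> ps (\<lambda>x. u x - \<phi> x) + ps (\<lambda>x. U x - grad \<phi> x) < 1 / real (Suc n)"
    using assms(2) unfolding W01p_iff[OF s] by auto
  then obtain \<phi> where \<phi>: "\<And>n. test_function \<Omega> (\<phi> n)" "\<And>n. ps (\<lambda>x. u x - \<phi> n x) + ps (\<lambda>x. U x - grad (\<phi> n) x) < 1 / real (Suc n)"
    by metis
  have b: "0 \<le> ps (\<lambda>x. \<phi> n x - u x)" "0 \<le> ps (\<lambda>x. grad (\<phi> n) x - U x)"
     "ps (\<lambda>x. \<phi> n x - u x) \<le> 1 / real (Suc n)" "ps (\<lambda>x. grad (\<phi> n) x - U x) \<le> 1 / real (Suc n)" for n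
  proof -
    have "ps (\<lambda>x. \<phi> n x - u x) = ps (\<lambda>x. u x - \<phi> n x)" "ps (\<lambda>x. grad (\<phi> n) x - U x) = ps (\<lambda>x. U x - grad (\<phi> n) x)"
      by (simp_all add: ps_def norm_minus_commute abs_minus_commute)
    then show "0 \<le> ps (\<lambda>x. \<phi> n x - u x)" "0 \<le> ps (\<lambda>x. grad (\<phi> n) x - U x)"
     "ps (\<lambda>x. \<phi> n x - u x) \<le> 1 / real (Suc n)" "ps (\<lambda>x. grad (\<phi> n) x - U x) \<le> 1 / real (Suc n)"
      using \<phi>(2)[of n] ps_nonneg[of "\<lambda>x. \<phi> n x - u x"] ps_nonneg[of "\<lambda>x. grad (\<phi> n) x - U x"] by linarith+
  qed
  have l: "(\<lambda>n. 1 / real (Suc n)) \<longlonglongrightarrow> 0" by (rule LIMSEQ_Suc[OF lim_1_over_n])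
  have "(\<lambda>n. ps (\<lambda>x. \<phi> n x - u x)) \<longlonglongrightarrow> 0" "(\<lambda>n. ps (\<lambda>x. grad (\<phi> n) x - U x)) \<longlonglongrightarrow> 0"
    by (rule tendsto_sandwich[OF _ _ tendsto_const l]; use b in auto)+
  then show ?thesis by (rule that[OF \<phi>(1)])
qed

end

context lp_domain
begin

lemma sob_meas: "sob u U \<Longrightarrow> u \<in> borel_measurable M" "sob u U \<Longrightarrow> U \<in> borel_measurable M"
  unfolding sob_def by (auto dest: Lp_meas)

text \<open>For test functions \<open>f n\<close> and \<open>g n\<close> the composition is C^1 and,
  as \<open>F 0 0 = 0\<close>, vanishes off the union of the supports, so it lies in
  \<open>W01p\<close>. These compositions approximate in the Sobolev norm along a subsequence, the
  gradient coefficients by dominated convergence.\<close>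

lemma W01p_C1_two:
  assumes F: "C1_two F A B L" "F 0 0 = 0" and u: "sob u U" "u \<in> W01p \<Omega> p" and v: "sob v V" "v \<in> W01p \<Omega> p"
  shows "(\<lambda>x. F (u x) (v x)) \<in> W01p \<Omega> p"
proof (rule W01p_closed[OF sob_C1_two[OF F u(1) v(1)]])
  fix e :: real assume e: "e > 0"
  have AL: "\<And>a b. \<bar>A a b\<bar> \<le> L" and BL: "\<And>a b. \<bar>B a b\<bar> \<le> L"
    and cA: "continuous_on UNIV (\<lambda>(a, b). A a b)" "continuous_on UNIV (\<lambda>(a, b). B a b)" using F by (auto simp: C1_two_def)
  have L: "L \<ge> 0" using AL[of 0 0] by linarith
  have A2: "\<bar>A a b - A a' b'\<bar> \<le> 2 * L" "\<bar>B a b - B a' b'\<bar> \<le> 2 * L" for a b a' b'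
    using AL[of a b] AL[of a' b'] BL[of a b] BL[of a' b'] by linarith+
  obtain f where f: "\<And>n::nat. test_function \<Omega> (f n)" "(\<lambda>n. ps (\<lambda>x. f n x - u x)) \<longlonglongrightarrow> 0" "(\<lambda>n. ps (\<lambda>x. grad (f n) x - U x)) \<longlonglongrightarrow> 0"
    using W01p_sequence[OF u] by blast
  obtain g where g: "\<And>n::nat. test_function \<Omega> (g n)" "(\<lambda>n. ps (\<lambda>x. g n x - v x)) \<longlonglongrightarrow> 0" "(\<lambda>n. ps (\<lambda>x. grad (g n) x - V x)) \<longlonglongrightarrow> 0"
    using W01p_sequence[OF v] by blast
  have Lf: "Lp_fun \<Omega> p (\<lambda>x. f n x - u x)" "Lp_fun \<Omega> p (\<lambda>x. grad (f n) x - U x)"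
    "Lp_fun \<Omega> p (\<lambda>x. g n x - v x)" "Lp_fun \<Omega> p (\<lambda>x. grad (g n) x - V x)" for n
    using sob_diff[OF sob_test[OF f(1)] u(1)] sob_diff[OF sob_test[OF g(1)] v(1)] by (auto simp: sob_def)
  obtain r where r: "strict_mono r" "AE x in M. (\<lambda>n. \<bar>f (r n) x - u x\<bar> powr p) \<longlonglongrightarrow> 0 \<and> (\<lambda>n. \<bar>g (r n) x - v x\<bar> powr p) \<longlonglongrightarrow> 0"
  proof (rule L1_pair_subseq[of M "\<lambda>n x. \<bar>f n x - u x\<bar> powr p" "\<lambda>n x. \<bar>g n x - v x\<bar> powr p"])
    show "(\<lambda>n. LINT x|M. \<bar>\<bar>f n x - u x\<bar> powr p\<bar>) \<longlonglongrightarrow> 0" "(\<lambda>n. LINT x|M. \<bar>\<bar>g n x - v x\<bar> powr p\<bar>) \<longlonglongrightarrow> 0"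
      using f(2) g(2) by (simp_all add: ps_def)
  qed (use Lp_int[OF Lf(1)] Lp_int[OF Lf(3)] in auto)
  have conv: "AE x in M. (\<lambda>n. f (r n) x) \<longlonglongrightarrow> u x \<and> (\<lambda>n. g (r n) x) \<longlonglongrightarrow> v x"
    using r(2)
  proof eventually_elim
    case (elim x)
    have *: "(\<lambda>n. a n) \<longlonglongrightarrow> b" if "(\<lambda>n. \<bar>a n - b\<bar> powr p) \<longlonglongrightarrow> 0" for a and b :: real
    proof -
      have "(\<lambda>n. (\<bar>a n - b\<bar> powr p) powr (1 / p)) \<longlonglongrightarrow> 0 powr (1 / p)"
        using that p by (intro tendsto_powr2 tendsto_const) auto
      then have "(\<lambda>n. \<bar>a n - b\<bar>) \<longlonglongrightarrow> 0" using p by (simp add: powr_powr)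
      then show ?thesis by (simp add: LIM_zero_iff tendsto_rabs_zero_iff)
    qed
    show ?case using elim * by auto
  qed
  define y where "y n x = F (f n x) (g n x)" for n x
  define Y where "Y n x = A (f n x) (g n x) *\<^sub>R grad (f n) x + B (f n x) (g n x) *\<^sub>R grad (g n) x" for n x
  define z where "z x = F (u x) (v x)" for x
  define Z where "Z x = A (u x) (v x) *\<^sub>R U x + B (u x) (v x) *\<^sub>R V x" for x
  have sy: "sob (y n) (Y n)" for n unfolding y_def Y_def by (intro sob_C1_two[OF F] sob_test f g)
  have sz: "sob z Z" unfolding z_def Z_def by (rule sob_C1_two[OF F u(1) v(1)])
  have yW: "y n \<in> W01p \<Omega> p" for n
  proof -
    define K where "K = closure {x. f n x \<noteq> 0} \<union> closure {x. g n x \<noteq> 0}"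
    have cf: "C1c (closure {x. f n x \<noteq> 0}) (f n) (grad (f n))" "C1c (closure {x. g n x \<noteq> 0}) (g n) (grad (g n))"
      by (rule test_function_C1c[OF f(1)] test_function_C1c[OF g(1)])+
    have cK: "compact (closure {x. f n x \<noteq> 0})" "compact (closure {x. g n x \<noteq> 0})"
      and gd: "GDERIV (f n) x :> grad (f n) x" "GDERIV (g n) x :> grad (g n) x"
      and cg: "continuous_on UNIV (grad (f n))" "continuous_on UNIV (grad (g n))"
      and z: "x \<notin> K \<Longrightarrow> f n x = 0 \<and> g n x = 0" for x
      using cf unfolding C1c_def K_def by blast+
    have "C1c K (y n) (Y n)"
      unfolding C1c_def
    proof (intro conjI allI impI)
      show "compact K" unfolding K_def by (rule compact_Un[OF cK])
      show "GDERIV (y n) x :> Y n x" for x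
        unfolding y_def[abs_def] Y_def by (rule C1_two_GDERIV[OF F(1) gd])
      show "continuous_on UNIV (Y n)" unfolding Y_def[abs_def]
        by (intro continuous_intros continuous_on_two[OF cA(1)] continuous_on_two[OF cA(2)] C1c_continuous[OF cf(1)] C1c_continuous[OF cf(2)] cg)
      show "y n x = 0" if "x \<notin> K" for x using z[OF that] F(2) by (simp add: y_def)
    qed
    moreover have "K \<subseteq> \<Omega>" using f(1)[of n] g(1)[of n] by (auto simp: K_def test_function_def)
    ultimately show ?thesis by (rule W01p_C1c)
  qed
  define R where "R n x = \<bar>A (f n x) (g n x) - A (u x) (v x)\<bar> *\<^sub>R U x" for n x
  define S where "S n x = \<bar>B (f n x) (g n x) - B (u x) (v x)\<bar> *\<^sub>R V x" for n x
  have mA: "(\<lambda>x. \<bar>A (f n x) (g n x) - A (u x) (v x)\<bar>) \<in> borel_measurable M" "(\<lambda>x. \<bar>B (f n x) (g n x) - B (u x) (v x)\<bar>) \<in> borel_measurable M" for n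
    using meas_two[OF cA(1) u(1) v(1)] meas_two[OF cA(2) u(1) v(1)] meas_two[OF cA(1) sob_test[OF f(1)] sob_test[OF g(1)]]
       meas_two[OF cA(2) sob_test[OF f(1)] sob_test[OF g(1)]] by auto
  have LUV: "Lp_fun \<Omega> p U" "Lp_fun \<Omega> p V" using u v by (auto simp: sob_def)
  have RS: "R n \<in> borel_measurable M" "S n \<in> borel_measurable M" for n
    unfolding R_def S_def by (rule borel_measurable_scaleR[OF mA(1) Lp_meas[OF LUV(1)]] borel_measurable_scaleR[OF mA(2) Lp_meas[OF LUV(2)]])+
  have bR': "norm (R n x) \<le> 2 * L * norm (U x)" "norm (S n x) \<le> 2 * L * norm (V x)" for n x
    unfolding R_def S_def using A2 by (auto intro!: mult_right_mono)
  have bR: "norm (R n x) \<le> (2 * L) * (norm (U x) + norm (U x))" "norm (S n x) \<le> (2 * L) * (norm (V x) + norm (V x))" for n x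
    using bR'[of n x] mult_nonneg_nonneg[OF L norm_ge_zero[of "U x"]] mult_nonneg_nonneg[OF L norm_ge_zero[of "V x"]]
    by (simp_all add: distrib_left)
  have LRS: "Lp_fun \<Omega> p (R n)" "Lp_fun \<Omega> p (S n)" for n
    using Lp_bound(1)[OF LUV(1) LUV(1) RS(1) _ bR(1)] Lp_bound(1)[OF LUV(2) LUV(2) RS(2) _ bR(2)] L by auto
  have limRS: "(\<lambda>n. ps (R (r n))) \<longlonglongrightarrow> (LINT x|M. 0)" "(\<lambda>n. ps (S (r n))) \<longlonglongrightarrow> (LINT x|M. 0)"
    unfolding ps_def
  proof -
    show "(\<lambda>n. LINT x|M. norm (R (r n) x) powr p) \<longlonglongrightarrow> (LINT x|M. 0)"
    proof (rule integral_dominated_convergence[where w = "\<lambda>x. (2 * L) powr p * norm (U x) powr p"])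
      show "AE x in M. (\<lambda>n. norm (R (r n) x) powr p) \<longlonglongrightarrow> 0" using conv
      proof eventually_elim
        case (elim x)
        then have "(\<lambda>n. A (f (r n) x) (g (r n) x)) \<longlonglongrightarrow> A (u x) (v x)" using tendsto_two[OF cA(1)] by blast
        then have "(\<lambda>n. norm (R (r n) x)) \<longlonglongrightarrow> 0" unfolding R_def by (auto intro!: tendsto_eq_intros)
        from tendsto_powr2[OF this tendsto_const, of p] show ?case using p by auto
      qed
      show "AE x in M. norm (norm (R (r n) x) powr p) \<le> (2 * L) powr p * norm (U x) powr p" for n
        using bR'(1)[of "r n"] p by (intro AE_I2) (auto simp flip: powr_mult intro!: powr_mono2)
    qed (use RS Lp_int[OF LUV(1)] in auto)
    show "(\<lambda>n. LINT x|M. norm (S (r n) x) powr p) \<longlonglongrightarrow> (LINT x|M. 0)"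
    proof (rule integral_dominated_convergence[where w = "\<lambda>x. (2 * L) powr p * norm (V x) powr p"])
      show "AE x in M. (\<lambda>n. norm (S (r n) x) powr p) \<longlonglongrightarrow> 0" using conv
      proof eventually_elim
        case (elim x)
        then have "(\<lambda>n. B (f (r n) x) (g (r n) x)) \<longlonglongrightarrow> B (u x) (v x)" using tendsto_two[OF cA(2)] by blast
        then have "(\<lambda>n. norm (S (r n) x)) \<longlonglongrightarrow> 0" unfolding S_def by (auto intro!: tendsto_eq_intros)
        from tendsto_powr2[OF this tendsto_const, of p] show ?case using p by auto
      qed
      show "AE x in M. norm (norm (S (r n) x) powr p) \<le> (2 * L) powr p * norm (V x) powr p" for n
        using bR'(2)[of "r n"] p by (intro AE_I2) (auto simp flip: powr_mult intro!: powr_mono2)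
    qed (use RS Lp_int[OF LUV(2)] in auto)
  qed
  define a where "a n = (4 * L) powr p * (ps (\<lambda>x. f n x - u x) + ps (\<lambda>x. g n x - v x))" for n
  define b where "b n = 2 powr p * ((2 * L) powr p * (ps (\<lambda>x. grad (f n) x - U x) + ps (\<lambda>x. grad (g n) x - V x)) + 2 powr p * (ps (R n) + ps (S n)))" for n
  have az: "ps (\<lambda>x. z x - y n x) \<le> a n" for n
  proof -
    have "ps (\<lambda>x. z x - y n x) \<le> (2 * (2 * L)) powr p * (ps (\<lambda>x. f n x - u x) + ps (\<lambda>x. g n x - v x))"
    proof (rule Lp_bound(2)[OF Lf(1,3)])
      show "(\<lambda>x. z x - y n x) \<in> borel_measurable M" using sob_meas[OF sz] sob_meas[OF sy[of n]] by auto
      show "norm (z x - y n x) \<le> (2 * L) * (norm (f n x - u x) + norm (g n x - v x))" for x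
        using C1_two_lipschitz[OF F(1), of "u x" "v x" "f n x" "g n x"] by (simp add: z_def y_def abs_minus_commute)
    qed (use L in auto)
    then show ?thesis by (simp add: a_def)
  qed
  have bz: "ps (\<lambda>x. Z x - Y n x) \<le> b n" for n
  proof -
    define P where "P x = A (f n x) (g n x) *\<^sub>R (grad (f n) x - U x) + B (f n x) (g n x) *\<^sub>R (grad (g n) x - V x)" for x
    define Q where "Q x = (A (f n x) (g n x) - A (u x) (v x)) *\<^sub>R U x + (B (f n x) (g n x) - B (u x) (v x)) *\<^sub>R V x" for x
    have mP: "P \<in> borel_measurable M" unfolding P_def
      using meas_two[OF cA(1) sob_test[OF f(1)] sob_test[OF g(1)], of n n] meas_two[OF cA(2) sob_test[OF f(1)] sob_test[OF g(1)], of n n]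
        Lp_meas[OF Lf(2)] Lp_meas[OF Lf(4)] by auto
    have ZY: "Z x - Y n x = - (P x + Q x)" for x by (simp add: Z_def Y_def P_def Q_def algebra_simps)
    have mZ: "(\<lambda>x. Z x - Y n x) \<in> borel_measurable M" using sob_meas[OF sz] sob_meas[OF sy[of n]] by auto
    have "Q = (\<lambda>x. - (Z x - Y n x) - P x)" by (rule ext) (simp add: ZY)
    then have mQ: "Q \<in> borel_measurable M" using sob_meas[OF sz] sob_meas[OF sy[of n]] mP by auto
    note PP = Lp_bound[OF Lf(2,4) mP L]
    have bP: "norm (P x) \<le> L * (norm (grad (f n) x - U x) + norm (grad (g n) x - V x))" for x
      unfolding P_def distrib_left by (intro norm_triangle_le add_mono) (auto intro!: mult_right_mono AL BL)
    have bQ: "norm (Q x) \<le> 1 * (norm (R n x) + norm (S n x))" for x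
      unfolding Q_def R_def S_def by (auto intro: norm_triangle_le)
    have nz: "norm (Z x - Y n x) \<le> 1 * (norm (P x) + norm (Q x))" for x
      unfolding ZY norm_minus_cancel mult_1 by (rule norm_triangle_ineq)
    have "ps (\<lambda>x. Z x - Y n x) \<le> (2 * 1) powr p * (ps P + ps Q)"
      by (rule Lp_bound(2)[OF PP(1)[OF bP] Lp_bound(1)[OF LRS mQ _ bQ] mZ _ nz]) auto
    also have "\<dots> \<le> 2 powr p * ((2 * L) powr p * (ps (\<lambda>x. grad (f n) x - U x) + ps (\<lambda>x. grad (g n) x - V x)) + (2 * 1) powr p * (ps (R n) + ps (S n)))"
      using PP(2)[OF bP] Lp_bound(2)[OF LRS mQ _ bQ] by (simp add: add_mono)
    finally show ?thesis by (simp add: b_def)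
  qed
  have "(\<lambda>n. a (r n) + b (r n)) \<longlonglongrightarrow> (4 * L) powr p * (0 + 0) + 2 powr p * ((2 * L) powr p * (0 + 0) + 2 powr p * ((LINT x|M. 0) + (LINT x|M. 0)))"
    unfolding a_def b_def
    by (intro tendsto_intros limRS LIMSEQ_subseq_LIMSEQ[OF f(2) r(1), unfolded comp_def] LIMSEQ_subseq_LIMSEQ[OF f(3) r(1), unfolded comp_def]
       LIMSEQ_subseq_LIMSEQ[OF g(2) r(1), unfolded comp_def] LIMSEQ_subseq_LIMSEQ[OF g(3) r(1), unfolded comp_def])
  then have "\<forall>\<^sub>F n in sequentially. a (r n) + b (r n) < e" using e by (intro order_tendstoD(2)) auto
  then obtain n where "a (r n) + b (r n) < e" using eventually_happens' sequentially_bot by blast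
  then have "ps (\<lambda>x. z x - y (r n) x) + ps (\<lambda>x. Z x - Y (r n) x) < e" using az[of "r n"] bz[of "r n"] by linarith
  then show "\<exists>y Y. sob y Y \<and> y \<in> W01p \<Omega> p \<and> ps (\<lambda>x. F (u x) (v x) - y x) +
      ps (\<lambda>x. A (u x) (v x) *\<^sub>R U x + B (u x) (v x) *\<^sub>R V x - Y x) < e"
    unfolding z_def Z_def using sy yW by blast
qed

text \<open>The common bound \<open>L\<close> on the derivatives gives majorants in L^p, so
  pointwise convergence of the functions and of their derivatives suffices. The limit may fail to be
  C^1, which is needed for \<open>pth\<close> at the origin.\<close>

lemma sob_limit:
  fixes Fn An Bn :: "nat \<Rightarrow> real \<Rightarrow> real \<Rightarrow> real"
  assumes F: "\<And>n. C1_two (Fn n) (An n) (Bn n) L" "\<And>n. Fn n 0 0 = 0"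
    and lim: "\<And>a b. (\<lambda>n. Fn n a b) \<longlonglongrightarrow> F a b" "\<And>a b. (\<lambda>n. An n a b) \<longlonglongrightarrow> A a b" "\<And>a b. (\<lambda>n. Bn n a b) \<longlonglongrightarrow> B a b"
    and u: "sob u U" and v: "sob v V"
  shows "sob (\<lambda>x. F (u x) (v x)) (\<lambda>x. A (u x) (v x) *\<^sub>R U x + B (u x) (v x) *\<^sub>R V x)"
    and "u \<in> W01p \<Omega> p \<Longrightarrow> v \<in> W01p \<Omega> p \<Longrightarrow> (\<lambda>x. F (u x) (v x)) \<in> W01p \<Omega> p"
proof -
  define z where "z x = F (u x) (v x)" for x
  define Z where "Z x = A (u x) (v x) *\<^sub>R U x + B (u x) (v x) *\<^sub>R V x" for x
  define y where "y n x = Fn n (u x) (v x)" for n x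
  define Y where "Y n x = An n (u x) (v x) *\<^sub>R U x + Bn n (u x) (v x) *\<^sub>R V x" for n x
  have AL: "\<bar>An n a b\<bar> \<le> L" "\<bar>Bn n a b\<bar> \<le> L" for n a b using F(1)[of n] by (auto simp: C1_two_def)
  have L: "L \<ge> 0" using AL(1)[of 0 0 0] by linarith
  have sy: "sob (y n) (Y n)" for n unfolding y_def Y_def by (rule sob_C1_two[OF F u v])
  have yz: "(\<lambda>n. y n x) \<longlonglongrightarrow> z x" "(\<lambda>n. Y n x) \<longlonglongrightarrow> Z x" for x
    unfolding y_def z_def Y_def Z_def by (intro tendsto_intros lim)+
  have by1: "norm (y n x) \<le> 2 * L * (norm (u x) + norm (v x))" for n x
    using C1_two_lipschitz[OF F(1)[of n], of "u x" "v x" 0 0] F(2)[of n] by (simp add: y_def)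
  have bY1: "norm (Y n x) \<le> L * (norm (U x) + norm (V x))" for n x
    unfolding Y_def distrib_left by (intro norm_triangle_le add_mono) (auto intro!: mult_right_mono AL)
  have bz: "norm (z x) \<le> 2 * L * (norm (u x) + norm (v x))" "norm (Z x) \<le> L * (norm (U x) + norm (V x))" for x
    by (rule LIMSEQ_le_const2[OF tendsto_norm[OF yz(1)]], use by1 in blast)
       (rule LIMSEQ_le_const2[OF tendsto_norm[OF yz(2)]], use bY1 in blast)
  have mz: "z \<in> borel_measurable M" "Z \<in> borel_measurable M"
    by (rule borel_measurable_LIMSEQ_metric[OF sob_meas(1)[OF sy] yz(1)])
      (rule borel_measurable_LIMSEQ_metric[OF sob_meas(2)[OF sy] yz(2)])
  have Lu: "Lp_fun \<Omega> p u" "Lp_fun \<Omega> p v" "Lp_fun \<Omega> p U" "Lp_fun \<Omega> p V" using u v by (auto simp: sob_def)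
  have Lz: "Lp_fun \<Omega> p z" "Lp_fun \<Omega> p Z"
    using Lp_bound(1)[OF Lu(1,2) mz(1) _ bz(1)] Lp_bound(1)[OF Lu(3,4) mz(2) _ bz(2)] L by auto
  have my: "y n \<in> borel_measurable M" "Y n \<in> borel_measurable M" for n using sob_meas[OF sy[of n]] by auto
  have iw: "integrable M (\<lambda>x. 2 * L * (norm (u x) + norm (v x)))" "integrable M (\<lambda>x. L * (norm (U x) + norm (V x)))"
    using Lp_L1[OF Lu(1)] Lp_L1[OF Lu(2)] Lp_L1[OF Lu(3)] Lp_L1[OF Lu(4)] by auto
  have wg: "is_weak_gradient \<Omega> z Z"
    unfolding is_weak_gradient_def
  proof (intro conjI allI impI ballI)
    have li: "locally_integrable \<Omega> f" if "integrable M f" for f :: "'a \<Rightarrow> 'b::euclidean_space"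
      unfolding locally_integrable_def
    proof (intro allI impI)
      fix K assume K: "compact K \<and> K \<subseteq> \<Omega>"
      have "integrable lebesgue (\<lambda>x. indicator \<Omega> x *\<^sub>R f x)" using that \<Omega> by (subst (asm) integrable_restrict_space) auto
      then have "integrable lebesgue (\<lambda>x. indicator K x *\<^sub>R (indicator \<Omega> x *\<^sub>R f x))"
        using K by (intro integrable_mult_indicator[of K]) (auto simp: compact_imp_closed)
      also have "(\<lambda>x. indicator K x *\<^sub>R (indicator \<Omega> x *\<^sub>R f x)) = (\<lambda>x. indicator K x *\<^sub>R f x)"
        using K by (auto simp: fun_eq_iff split: split_indicator)
      finally show "integrable (lebesgue_on K) f" using K by (subst integrable_restrict_space) (auto simp: compact_imp_closed)
    qed
    show "locally_integrable \<Omega> z" "locally_integrable \<Omega> Z" using li Lp_L1[OF Lz(1)] Lp_L1[OF Lz(2)] by auto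
    fix \<phi> and i :: 'a assume t: "test_function \<Omega> \<phi>" and i: "i \<in> Basis"
    note c = test_function_C1c[OF t]
    have cg: "continuous_on UNIV \<phi>" "continuous_on UNIV (grad \<phi>)" using c C1c_continuous[OF c] unfolding C1c_def by blast+
    have cK: "compact (closure {x. \<phi> x \<noteq> 0})" and z0: "\<And>x. x \<notin> closure {x. \<phi> x \<noteq> 0} \<Longrightarrow> \<phi> x = 0"
      using c unfolding C1c_def by blast+
    obtain B1 where B1: "\<And>x. norm (\<phi> x) \<le> B1" using continuous_compact_support_bounded[OF cg(1) cK z0] by blast
    obtain B2 where B2: "\<And>x. norm (grad \<phi> x) \<le> B2" using continuous_compact_support_bounded[OF cg(2) cK C1c_grad_support[OF c]] by blast
    note B = B1 B2
    have m\<phi>: "\<phi> \<in> borel_measurable M" "(\<lambda>x. grad \<phi> x \<bullet> i) \<in> borel_measurable M"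
      using cg by (auto intro!: measurable_lebesgue_on_borel borel_measurable_continuous_onI continuous_intros)
    have "(\<lambda>n. LINT x|M. y n x * (grad \<phi> x \<bullet> i)) \<longlonglongrightarrow> (LINT x|M. z x * (grad \<phi> x \<bullet> i))"
    proof (rule integral_dominated_convergence[where w = "\<lambda>x. (2 * L * (norm (u x) + norm (v x))) * B2"])
      show "AE x in M. norm (y n x * (grad \<phi> x \<bullet> i)) \<le> (2 * L * (norm (u x) + norm (v x))) * B2" for n
      proof (rule AE_I2)
        fix x
        have "\<bar>grad \<phi> x \<bullet> i\<bar> \<le> B2" using Basis_le_norm[OF i] B(2) order_trans by blast
        then show "norm (y n x * (grad \<phi> x \<bullet> i)) \<le> (2 * L * (norm (u x) + norm (v x))) * B2"
          unfolding norm_mult using by1[of n x] L by (intro mult_mono) auto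
      qed
    qed (use my mz m\<phi> iw yz in \<open>auto intro!: tendsto_intros\<close>)
    moreover have "(\<lambda>n. - (LINT x|M. (Y n x \<bullet> i) * \<phi> x)) \<longlonglongrightarrow> - (LINT x|M. (Z x \<bullet> i) * \<phi> x)"
    proof (intro tendsto_minus, rule integral_dominated_convergence[where w = "\<lambda>x. (L * (norm (U x) + norm (V x))) * B1"])
      show "AE x in M. norm ((Y n x \<bullet> i) * \<phi> x) \<le> (L * (norm (U x) + norm (V x))) * B1" for n
      proof (rule AE_I2)
        fix x
        have "\<bar>Y n x \<bullet> i\<bar> \<le> L * (norm (U x) + norm (V x))" using Basis_le_norm[OF i] bY1 order_trans by blast
        then show "norm ((Y n x \<bullet> i) * \<phi> x) \<le> (L * (norm (U x) + norm (V x))) * B1"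
          unfolding norm_mult using B(1)[of x] L by (intro mult_mono) auto
      qed
    qed (use my mz m\<phi> iw yz in \<open>auto intro!: tendsto_intros\<close>)
    moreover have "(LINT x|M. y n x * (grad \<phi> x \<bullet> i)) = - (LINT x|M. (Y n x \<bullet> i) * \<phi> x)" for n
      using sy[of n] t i unfolding sob_def is_weak_gradient_def by (simp add: grad_inner)
    ultimately have "(LINT x|M. z x * (grad \<phi> x \<bullet> i)) = - (LINT x|M. (Z x \<bullet> i) * \<phi> x)"
      by (simp add: LIMSEQ_unique)
    then show "(LINT x|M. z x * frechet_derivative \<phi> (at x) i) = - (LINT x|M. (Z x \<bullet> i) * \<phi> x)"
      using i by (simp add: grad_inner)
  qed
  have sz: "sob z Z" using wg Lz by (simp add: sob_def)
  then show "sob (\<lambda>x. F (u x) (v x)) (\<lambda>x. A (u x) (v x) *\<^sub>R U x + B (u x) (v x) *\<^sub>R V x)"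
    unfolding z_def Z_def .
  assume W: "u \<in> W01p \<Omega> p" "v \<in> W01p \<Omega> p"
  have "z \<in> W01p \<Omega> p"
  proof (rule W01p_closed[OF sz])
    fix e :: real assume e: "e > 0"
    have dct: "(\<lambda>n. ps (\<lambda>x. f x - fn n x)) \<longlonglongrightarrow> (LINT x|M. 0)"
      if "\<And>x. (\<lambda>n. fn n x) \<longlonglongrightarrow> f x" "\<And>n. fn n \<in> borel_measurable M" "f \<in> borel_measurable M"
        "\<And>n x. norm (fn n x) \<le> w x" "\<And>x. norm (f x) \<le> w x" "Lp_fun \<Omega> p w"
      for f :: "'a \<Rightarrow> 'b::euclidean_space" and fn :: "nat \<Rightarrow> 'a \<Rightarrow> 'b" and w :: "'a \<Rightarrow> real"
      unfolding ps_def
    proof (rule integral_dominated_convergence[where w = "\<lambda>x. 2 powr p * norm (w x) powr p"])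
      show "AE x in M. (\<lambda>n. norm (f x - fn n x) powr p) \<longlonglongrightarrow> 0"
      proof (rule AE_I2)
        fix x
        have "(\<lambda>n. norm (f x - fn n x)) \<longlonglongrightarrow> norm (f x - f x)" by (intro tendsto_intros that(1))
        from tendsto_powr2[OF this tendsto_const, of p] show "(\<lambda>n. norm (f x - fn n x) powr p) \<longlonglongrightarrow> 0" using p by auto
      qed
      show "AE x in M. norm (norm (f x - fn n x) powr p) \<le> 2 powr p * norm (w x) powr p" for n
      proof (rule AE_I2)
        fix x
        have "norm (f x - fn n x) \<le> 2 * norm (w x)" using norm_triangle_ineq4[of "f x" "fn n x"] that(4)[of n x] that(5)[of x] by auto
        then show "norm (norm (f x - fn n x) powr p) \<le> 2 powr p * norm (w x) powr p"
          using p by (auto simp flip: powr_mult intro!: powr_mono2)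
      qed
    qed (use that Lp_int[OF that(6)] in auto)
    have "Lp_fun \<Omega> p (\<lambda>x. 2 * L * (norm (u x) + norm (v x)))" "Lp_fun \<Omega> p (\<lambda>x. L * (norm (U x) + norm (V x)))"
      by (rule Lp_bound(1)[OF Lu(1,2), of _ "2 * L"]; use L Lp_meas[OF Lu(1)] Lp_meas[OF Lu(2)] in \<open>auto simp: abs_mult\<close>)
         (rule Lp_bound(1)[OF Lu(3,4), of _ L]; use L Lp_meas[OF Lu(3)] Lp_meas[OF Lu(4)] in \<open>auto simp: abs_mult\<close>)
    note w = this
    have "(\<lambda>n. ps (\<lambda>x. z x - y n x) + ps (\<lambda>x. Z x - Y n x)) \<longlonglongrightarrow> (LINT x|M. 0) + (LINT x|M. 0)"
      by (intro tendsto_add dct[OF yz(1) my(1) mz(1) by1 bz(1) w(1)] dct[OF yz(2) my(2) mz(2) bY1 bz(2) w(2)])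
    then have "\<forall>\<^sub>F n in sequentially. ps (\<lambda>x. z x - y n x) + ps (\<lambda>x. Z x - Y n x) < e" using e by (intro order_tendstoD(2)) auto
    then obtain n where "ps (\<lambda>x. z x - y n x) + ps (\<lambda>x. Z x - Y n x) < e" using eventually_happens' sequentially_bot by blast
    moreover have "y n \<in> W01p \<Omega> p" unfolding y_def by (rule W01p_C1_two[OF F u W(1) v W(2)])
    ultimately show "\<exists>y Y. sob y Y \<and> y \<in> W01p \<Omega> p \<and> ps (\<lambda>x. z x - y x) + ps (\<lambda>x. Z x - Y x) < e" using sy by blast
  qed
  then show "(\<lambda>x. F (u x) (v x)) \<in> W01p \<Omega> p" unfolding z_def .
qed

text \<open>Where \<open>norm (f x)\<close> exceeds \<open>\<eta>\<close>, it is at most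
  \<open>\<eta> powr (1 - p)\<close> times its p-th power. If
  \<open>ps f \<le> \<eta> powr p\<close>, both terms of the bound are of order
  \<open>\<eta>\<close>.\<close>

lemma small_integral:
  fixes f :: "'a \<Rightarrow> 'b::euclidean_space"
  assumes f: "Lp_fun \<Omega> p f" and \<eta>: "\<eta> > 0"
  shows "(LINT x|M. norm (f x)) \<le> \<eta> * measure M \<Omega> + \<eta> powr (1 - p) * ps f"
proof -
  interpret finite_measure M by (rule finM)
  have b: "norm (f x) \<le> \<eta> + \<eta> powr (1 - p) * norm (f x) powr p" for x
  proof (cases "norm (f x) \<le> \<eta>")
    case False
    then have "norm (f x) = norm (f x) powr (1 - p) * norm (f x) powr p" using \<eta> by (simp flip: powr_add)
    also have "\<dots> \<le> \<eta> powr (1 - p) * norm (f x) powr p" using False \<eta> p by (intro mult_right_mono powr_mono2') auto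
    finally show ?thesis using \<eta> by simp
  qed (simp add: add_increasing2)
  have "(LINT x|M. norm (f x)) \<le> (LINT x|M. \<eta> + \<eta> powr (1 - p) * norm (f x) powr p)"
    using b Lp_int[OF f] Lp_L1[OF f] by (intro integral_mono) auto
  then show ?thesis using Lp_int[OF f] by (simp add: ps_def mult.commute)
qed

text \<open>The coordinate function has the constant gradient \<open>i\<close>, so the integral of a
  test function \<open>\<phi>\<close> is minus that of
  \<open>(x \<bullet> i) * (grad \<phi> x \<bullet> i)\<close>. If test functions approximate the
  constant \<open>c\<close>, their gradients tend to zero, hence so do their integrals, and
  \<open>c\<close> times the measure of \<open>\<Omega>\<close> is zero.\<close>

lemma W01p_constant:
  assumes u: "sob u U" "u \<in> W01p \<Omega> p" and c: "AE x in M. u x = c" and ne: "\<Omega> \<noteq> {}"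
  shows "c = 0"
proof -
  interpret finite_measure M by (rule finM)
  have "is_weak_gradient \<Omega> (\<lambda>x. c) (\<lambda>x. 0)" by (intro C1_weak_gradient[OF \<Omega>(1)] GDERIV_const) auto
  then have U0: "AE x in M. U x = 0" using u(1) c by (intro weak_gradient_unique[OF \<Omega>(1)]) (auto simp: sob_def)
  obtain i :: 'a where i: "i \<in> Basis" using nonempty_Basis by blast
  obtain R where R: "R > 0" "\<And>x. x \<in> \<Omega> \<Longrightarrow> norm x \<le> R" using \<Omega>(2) bounded_pos by metis
  have xi: "is_weak_gradient \<Omega> (\<lambda>x. x \<bullet> i) (\<lambda>x. i)"
    by (rule C1_weak_gradient[OF \<Omega>(1)]) (auto simp: gderiv_def intro!: derivative_eq_intros)
  define m where "m = measure M \<Omega>"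
  have m: "m > 0"
  proof -
    have "\<not> negligible \<Omega>" using \<Omega> ne open_not_negligible by blast
    then have "measure lebesgue \<Omega> > 0"
      using \<Omega> by (metis bounded_set_imp_lmeasurable lmeasurable_open negligible_iff_measure zero_less_measure_iff)
    then show ?thesis using \<Omega> unfolding m_def by (simp add: measure_restrict_space)
  qed
  have main: "\<bar>c\<bar> * m \<le> \<eta> * ((1 + R) * (m + 1))" if \<eta>: "\<eta> > 0" for \<eta>
  proof -
    obtain \<phi> where t: "test_function \<Omega> \<phi>" and s: "ps (\<lambda>x. u x - \<phi> x) + ps (\<lambda>x. U x - grad \<phi> x) < \<eta> powr p"
      using u(2) \<eta> unfolding W01p_iff[OF u(1)] by (metis powr_gt_zero less_numeral_extra(3))
    have L: "Lp_fun \<Omega> p (\<lambda>x. u x - \<phi> x)" "Lp_fun \<Omega> p (\<lambda>x. U x - grad \<phi> x)" "Lp_fun \<Omega> p \<phi>" "Lp_fun \<Omega> p (grad \<phi>)" "Lp_fun \<Omega> p u"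
      using sob_diff[OF u(1) sob_test[OF t]] sob_test[OF t] u(1) by (auto simp: sob_def)
    have e1: "\<eta> powr (1 - p) * \<eta> powr p = \<eta>" using \<eta> by (simp flip: powr_add)
    have small: "(LINT x|M. norm (f x)) \<le> \<eta> * (m + 1)" if "Lp_fun \<Omega> p f" "ps f \<le> \<eta> powr p" for f :: "'a \<Rightarrow> 'b::euclidean_space"
    proof -
      have "(LINT x|M. norm (f x)) \<le> \<eta> * m + \<eta> powr (1 - p) * ps f" unfolding m_def by (rule small_integral[OF that(1) \<eta>])
      also have "\<dots> \<le> \<eta> * m + \<eta> powr (1 - p) * \<eta> powr p" using that by (intro add_left_mono mult_left_mono) auto
      finally show ?thesis using e1 by (simp add: algebra_simps)
    qed
    have s1: "(LINT x|M. norm (u x - \<phi> x)) \<le> \<eta> * (m + 1)"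
      using small[OF L(1)] s ps_nonneg[of "\<lambda>x. U x - grad \<phi> x"] by linarith
    have s2: "(LINT x|M. norm (U x - grad \<phi> x)) \<le> \<eta> * (m + 1)"
      using small[OF L(2)] s ps_nonneg[of "\<lambda>x. u x - \<phi> x"] by linarith
    have "(LINT x|M. norm (U x - grad \<phi> x)) = (LINT x|M. norm (grad \<phi> x))"
      using Lp_meas[OF L(2)] Lp_meas[OF L(4)] U0 by (intro integral_cong_AE) (auto elim!: eventually_mono)
    then have s3: "(LINT x|M. norm (grad \<phi> x)) \<le> \<eta> * (m + 1)" using s2 by simp
    have "(LINT x|M. \<phi> x) = - (LINT x|M. (x \<bullet> i) * (grad \<phi> x \<bullet> i))"
      using xi t i unfolding is_weak_gradient_def by (simp add: grad_inner)
    then have "\<bar>LINT x|M. \<phi> x\<bar> = \<bar>LINT x|M. (x \<bullet> i) * (grad \<phi> x \<bullet> i)\<bar>" by simp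
    also have "\<dots> \<le> (LINT x|M. R * norm (grad \<phi> x))"
    proof -
      have b: "\<bar>(x \<bullet> i) * (grad \<phi> x \<bullet> i)\<bar> \<le> R * norm (grad \<phi> x)" if "x \<in> space M" for x
        unfolding abs_mult using R(2)[of x] that Basis_le_norm[OF i, of x] Basis_le_norm[OF i, of "grad \<phi> x"] R(1)
        by (intro mult_mono) auto
      have mx: "(\<lambda>x. x \<bullet> i) \<in> borel_measurable M" by (intro measurable_lebesgue_on_borel) auto
      have I: "integrable M (\<lambda>x. (x \<bullet> i) * (grad \<phi> x \<bullet> i))"
        by (rule Bochner_Integration.integrable_bound[OF integrable_mult_right[OF integrable_norm[OF Lp_L1[OF L(4)]], of R]])
          (use b mx Lp_meas[OF L(4)] in \<open>auto intro!: AE_I2 order_trans[OF b abs_ge_self]\<close>)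
      show ?thesis
        by (rule order_trans[OF integral_abs_bound], rule integral_mono[OF integrable_abs[OF I]])
          (use b Lp_L1[OF L(4)] in auto)
    qed
    also have "\<dots> \<le> R * (\<eta> * (m + 1))" using s3 R by simp
    finally have p1: "\<bar>LINT x|M. \<phi> x\<bar> \<le> R * (\<eta> * (m + 1))" .
    have "(LINT x|M. u x) = (LINT x|M. c)" using c Lp_meas[OF L(5)] by (intro integral_cong_AE) auto
    then have "\<bar>c\<bar> * m = \<bar>LINT x|M. u x\<bar>" using m by (simp add: m_def abs_mult)
    also have "\<dots> = \<bar>(LINT x|M. u x - \<phi> x) + (LINT x|M. \<phi> x)\<bar>" using Lp_L1[OF L(5)] Lp_L1[OF L(3)] by simp
    also have "\<dots> \<le> (LINT x|M. \<bar>u x - \<phi> x\<bar>) + R * (\<eta> * (m + 1))"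
      using p1 integral_abs_bound[of M "\<lambda>x. u x - \<phi> x"] by linarith
    also have "\<dots> \<le> \<eta> * (m + 1) + R * (\<eta> * (m + 1))" using s1 by simp
    finally show ?thesis by (simp add: algebra_simps)
  qed
  show "c = 0"
  proof (rule ccontr)
    assume "c \<noteq> 0"
    define k where "k = (1 + R) * (m + 1)"
    have k: "k > 0" using R m by (simp add: k_def)
    have cm: "\<bar>c\<bar> * m > 0" using \<open>c \<noteq> 0\<close> m by simp
    then have "\<bar>c\<bar> * m \<le> \<bar>c\<bar> * m / (2 * k) * k" using main[of "\<bar>c\<bar> * m / (2 * k)"] k by (simp add: k_def)
    also have "\<dots> = \<bar>c\<bar> * m / 2" using k by simp
    finally show False using cm by linarith
  qed
qed

end

section \<open>Hidden convexity\<close>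

text \<open>The partial derivatives of \<open>pth q t a b\<close> in \<open>a\<close> and \<open>b\<close> are \<open>pA q t a b\<close> and \<open>pB q t a b\<close>, away from
  the origin.\<close>

definition pth :: "real \<Rightarrow> real \<Rightarrow> real \<Rightarrow> real \<Rightarrow> real" where
  "pth q t a b = ((1 - t) * max 0 a powr q + t * max 0 b powr q) powr (1 / q)"

definition pA :: "real \<Rightarrow> real \<Rightarrow> real \<Rightarrow> real \<Rightarrow> real" where
  "pA q t a b = ((1 - t) * max 0 a powr q + t * max 0 b powr q) powr (1 / q - 1) * ((1 - t) * max 0 a powr (q - 1))"

definition pB :: "real \<Rightarrow> real \<Rightarrow> real \<Rightarrow> real \<Rightarrow> real" where
  "pB q t a b = ((1 - t) * max 0 a powr q + t * max 0 b powr q) powr (1 / q - 1) * (t * max 0 b powr (q - 1))"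

lemma continuous_on_pos_powr: "r > 0 \<Longrightarrow> continuous_on UNIV (\<lambda>a::real. max 0 a powr r)"
  by (intro continuous_on_powr' continuous_intros) auto

text \<open>\<open>pth\<close> is not differentiable at the origin; it is regularized by a positive shift \<open>e\<close>.\<close>

lemma C1_two_pth_shift:
  assumes q: "q > 1" and t: "0 < t" "t < 1" and e: "e > 0"
  defines "w \<equiv> \<lambda>a b. (1 - t) * max 0 a powr q + t * max 0 b powr q + e"
  shows "C1_two (\<lambda>a b. w a b powr (1 / q) - e powr (1 / q)) (\<lambda>a b. w a b powr (1 / q - 1) * ((1 - t) * max 0 a powr (q - 1)))
     (\<lambda>a b. w a b powr (1 / q - 1) * (t * max 0 b powr (q - 1))) 1"
proof -
  have wpos: "w a b > 0" for a b unfolding w_def using t e by (intro add_nonneg_pos add_nonneg_nonneg mult_nonneg_nonneg) auto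
  have wc: "continuous_on UNIV (\<lambda>z. w (fst z) (snd z))" unfolding w_def using q
    by (intro continuous_intros continuous_on_compose2[OF continuous_on_pos_powr]) auto
  have wne: "\<forall>z\<in>UNIV. w (fst z) (snd z) \<noteq> 0" using wpos by (auto simp: less_le)
  \<comment> \<open>Since \<open>1 / q - 1 < 0\<close>, the lower bound
    \<open>s * max 0 c powr q\<close> for \<open>w a b\<close> makes the product at most
    \<open>s powr (1 / q)\<close>. This does not depend on the shift \<open>e\<close>, as
    \<open>sob_limit\<close> requires.\<close>
  have bnd: "w a b powr (1 / q - 1) * (s * max 0 c powr (q - 1)) \<le> 1" if s: "0 < s" "s < 1" "s * max 0 c powr q \<le> w a b" for a b c s
  proof (cases "c > 0")
    case True
    have "w a b powr (1 / q - 1) \<le> (s * max 0 c powr q) powr (1 / q - 1)"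
      using s True q by (intro powr_mono2') auto
    also have "\<dots> = s powr (1 / q - 1) * c powr (1 - q)"
      using True s q by (simp add: powr_mult powr_powr right_diff_distrib)
    finally have "w a b powr (1 / q - 1) * (s * max 0 c powr (q - 1)) \<le> (s powr (1 / q - 1) * c powr (1 - q)) * (s * max 0 c powr (q - 1))"
      using s by (intro mult_right_mono) auto
    also have "\<dots> = (s powr (1 / q - 1) * s powr 1) * (c powr (1 - q) * c powr (q - 1))" using True s by simp
    also have "\<dots> = s powr (1 / q)" using True by (simp only: powr_add[symmetric]) simp
    also have "\<dots> \<le> 1" using s q by (intro powr_le1) auto
    finally show ?thesis .
  next
    case False
    then show ?thesis using q by simp
  qed
  have nn: "0 \<le> w a b powr (1 / q - 1) * (s * max 0 c powr (q - 1))" if "0 < s" for a b c s using that by simp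
  show ?thesis unfolding C1_two_def
  proof (intro conjI allI)
    fix a b
    have d1: "((\<lambda>z::real \<times> real. max 0 (fst z) powr q) has_derivative (\<lambda>h. (q * max 0 a powr (q - 1)) * fst h)) (at (a, b))"
      using has_derivative_compose[OF has_derivative_fst[OF has_derivative_ident] DERIV_pos_powr[OF q, of "fst (a, b)", unfolded has_field_derivative_def]] by simp
    have d2: "((\<lambda>z::real \<times> real. max 0 (snd z) powr q) has_derivative (\<lambda>h. (q * max 0 b powr (q - 1)) * snd h)) (at (a, b))"
      using has_derivative_compose[OF has_derivative_snd[OF has_derivative_ident] DERIV_pos_powr[OF q, of "snd (a, b)", unfolded has_field_derivative_def]] by simp
    have dw: "((\<lambda>z. w (fst z) (snd z)) has_derivative (\<lambda>h. (1 - t) * ((q * max 0 a powr (q - 1)) * fst h) + t * ((q * max 0 b powr (q - 1)) * snd h) + 0)) (at (a, b))"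
      unfolding w_def by (intro has_derivative_add has_derivative_const has_derivative_mult_right d1 d2)
    have dp: "DERIV (\<lambda>s. s powr (1 / q) - e powr (1 / q)) (w a b) :> 1 / q * w a b powr (1 / q - 1)"
      using wpos[of a b] by (auto intro!: derivative_eq_intros)
    have dp': "((\<lambda>s. s powr (1 / q) - e powr (1 / q)) has_derivative (*) (1 / q * w a b powr (1 / q - 1))) (at (w (fst (a, b)) (snd (a, b))))"
      using dp unfolding has_field_derivative_def by simp
    have "((\<lambda>z. w (fst z) (snd z) powr (1 / q) - e powr (1 / q)) has_derivative
       (\<lambda>h. (1 / q * w a b powr (1 / q - 1)) * ((1 - t) * ((q * max 0 a powr (q - 1)) * fst h) + t * ((q * max 0 b powr (q - 1)) * snd h) + 0))) (at (a, b))"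
      by (rule has_derivative_compose[OF dw dp'])
    moreover have "(\<lambda>h. (1 / q * w a b powr (1 / q - 1)) * ((1 - t) * ((q * max 0 a powr (q - 1)) * fst h) + t * ((q * max 0 b powr (q - 1)) * snd h) + 0))
       = (\<lambda>(h, k). w a b powr (1 / q - 1) * ((1 - t) * max 0 a powr (q - 1)) * h + w a b powr (1 / q - 1) * (t * max 0 b powr (q - 1)) * k)"
    proof
      fix h :: "real \<times> real"
      have "1 / q * X * ((1 - t) * (q * Y * x) + t * (q * Z * y) + 0) = X * ((1 - t) * Y) * x + X * (t * Z) * y" for X Y Z x y
        using q by (simp add: field_simps)
      then show "(1 / q * w a b powr (1 / q - 1)) * ((1 - t) * ((q * max 0 a powr (q - 1)) * fst h) + t * ((q * max 0 b powr (q - 1)) * snd h) + 0)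
        = (case h of (h, k) \<Rightarrow> w a b powr (1 / q - 1) * ((1 - t) * max 0 a powr (q - 1)) * h + w a b powr (1 / q - 1) * (t * max 0 b powr (q - 1)) * k)"
        by (simp only: case_prod_beta)
    qed
    ultimately show "((\<lambda>(x, y). w x y powr (1 / q) - e powr (1 / q)) has_derivative
        (\<lambda>(h, k). w a b powr (1 / q - 1) * ((1 - t) * max 0 a powr (q - 1)) * h + w a b powr (1 / q - 1) * (t * max 0 b powr (q - 1)) * k)) (at (a, b))"
      by (simp only: case_prod_unfold)
    have "(1 - t) * max 0 a powr q \<le> w a b" "t * max 0 b powr q \<le> w a b" unfolding w_def using t e by (auto simp: add_increasing add_increasing2)
    then show "\<bar>w a b powr (1 / q - 1) * ((1 - t) * max 0 a powr (q - 1))\<bar> \<le> 1" "\<bar>w a b powr (1 / q - 1) * (t * max 0 b powr (q - 1))\<bar> \<le> 1"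
      using bnd[of "1 - t" a a b] bnd[of t b a b] nn[of "1 - t" a b a] nn[of t a b b] t by auto
  next
    have wp: "continuous_on UNIV (\<lambda>z. w (fst z) (snd z) powr (1 / q - 1))"
      by (intro continuous_on_powr wc continuous_intros wne)
    show "continuous_on UNIV (\<lambda>(a, b). w a b powr (1 / q - 1) * ((1 - t) * max 0 a powr (q - 1)))"
      "continuous_on UNIV (\<lambda>(a, b). w a b powr (1 / q - 1) * (t * max 0 b powr (q - 1)))"
      unfolding case_prod_unfold using q by (intro continuous_intros wp continuous_on_compose2[OF continuous_on_pos_powr]; simp)+
  qed
qed

text \<open>If the sum of powers is zero, then \<open>max 0 a\<close> and \<open>max 0 b\<close>
  vanish and the regularized derivatives are zero; so are \<open>pA\<close> and \<open>pB\<close>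
  there, by their factors \<open>max 0 a powr (q - 1)\<close> and
  \<open>max 0 b powr (q - 1)\<close>.\<close>

lemma pth_shift_tendsto:
  assumes q: "q > 1" and t: "0 < t" "t < 1"
  defines "w \<equiv> \<lambda>n a b. (1 - t) * max 0 a powr q + t * max 0 b powr q + 1 / real (Suc n)"
  shows "(\<lambda>n. w n a b powr (1 / q) - (1 / real (Suc n)) powr (1 / q)) \<longlonglongrightarrow> pth q t a b"
    and "(\<lambda>n. w n a b powr (1 / q - 1) * ((1 - t) * max 0 a powr (q - 1))) \<longlonglongrightarrow> pA q t a b"
    and "(\<lambda>n. w n a b powr (1 / q - 1) * (t * max 0 b powr (q - 1))) \<longlonglongrightarrow> pB q t a b"
proof -
  define s where "s = (1 - t) * max 0 a powr q + t * max 0 b powr q"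
  have s: "s \<ge> 0" unfolding s_def using t by (intro add_nonneg_nonneg mult_nonneg_nonneg) auto
  have l: "(\<lambda>n. 1 / real (Suc n)) \<longlonglongrightarrow> 0" by (rule LIMSEQ_Suc[OF lim_1_over_n])
  have w: "(\<lambda>n. w n a b) \<longlonglongrightarrow> s" using tendsto_add[OF tendsto_const l, of s] by (simp add: w_def s_def)
  have "(\<lambda>n. w n a b powr (1 / q) - (1 / real (Suc n)) powr (1 / q)) \<longlonglongrightarrow> s powr (1 / q) - 0 powr (1 / q)"
    using q s t by (intro tendsto_diff tendsto_powr2[OF w] tendsto_powr2[OF l] tendsto_const) (auto simp: w_def s_def[symmetric])
  then show "(\<lambda>n. w n a b powr (1 / q) - (1 / real (Suc n)) powr (1 / q)) \<longlonglongrightarrow> pth q t a b"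
    by (simp add: pth_def s_def)
  have P: "(\<lambda>n. w n a b powr (1 / q - 1) * (r * max 0 c powr (q - 1))) \<longlonglongrightarrow> s powr (1 / q - 1) * (r * max 0 c powr (q - 1))"
    if "r > 0" "r * max 0 c powr q \<le> s" for r c
  proof (cases "s = 0")
    case True
    then have "max 0 c powr q \<le> 0" using that by (simp add: mult_le_0_iff)
    then have "max 0 c = 0" using q by (auto simp: max_def powr_le_cancel_iff split: if_splits)
    then show ?thesis by simp
  next
    case False
    then show ?thesis by (intro tendsto_intros tendsto_powr w) auto
  qed
  have "(1 - t) * max 0 a powr q \<le> s" "t * max 0 b powr q \<le> s" using t by (auto simp: s_def)
  from P[OF _ this(1)] P[OF _ this(2)] t
  show "(\<lambda>n. w n a b powr (1 / q - 1) * ((1 - t) * max 0 a powr (q - 1))) \<longlonglongrightarrow> pA q t a b"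
    "(\<lambda>n. w n a b powr (1 / q - 1) * (t * max 0 b powr (q - 1))) \<longlonglongrightarrow> pB q t a b"
    by (auto simp: pA_def pB_def s_def)
qed

lemma (in lp_domain) sob_pth:
  assumes q: "q > 1" and t: "0 < t" "t < 1" and u: "sob u U" and v: "sob v V"
  shows "sob (\<lambda>x. pth q t (u x) (v x)) (\<lambda>x. pA q t (u x) (v x) *\<^sub>R U x + pB q t (u x) (v x) *\<^sub>R V x)"
    and "u \<in> W01p \<Omega> p \<Longrightarrow> v \<in> W01p \<Omega> p \<Longrightarrow> (\<lambda>x. pth q t (u x) (v x)) \<in> W01p \<Omega> p"
proof -
  have e: "1 / real (Suc n) > 0" for n by simp
  note lim = sob_limit[OF C1_two_pth_shift[OF q t e] _ pth_shift_tendsto[OF q t] u v]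
  show "sob (\<lambda>x. pth q t (u x) (v x)) (\<lambda>x. pA q t (u x) (v x) *\<^sub>R U x + pB q t (u x) (v x) *\<^sub>R V x)"
    by (rule lim(1)) (use q in simp)
  show "u \<in> W01p \<Omega> p \<Longrightarrow> v \<in> W01p \<Omega> p \<Longrightarrow> (\<lambda>x. pth q t (u x) (v x)) \<in> W01p \<Omega> p"
    by (rule lim(2)) (use q in simp_all)
qed

section \<open>Pointwise convexity inequalities and their equality cases\<close>

lemma Bernoulli_powr:
  fixes x \<theta> :: real
  assumes "0 \<le> x" "0 < \<theta>" "\<theta> < 1"
  shows "x powr \<theta> \<le> 1 + \<theta> * (x - 1)" "x \<noteq> 1 \<Longrightarrow> x powr \<theta> < 1 + \<theta> * (x - 1)"
proof -
  have le: "y powr \<theta> \<le> 1 + \<theta> * (y - 1)" if "0 \<le> y" for y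
    using Youngs_inequality_0[of \<theta> "1 - \<theta>" y 1] that assms by (cases "y = 0") (auto simp: algebra_simps)
  then show "x powr \<theta> \<le> 1 + \<theta> * (x - 1)" using assms by simp
  assume "x \<noteq> 1"
  \<comment> \<open>Strictness comes from the weak inequality at \<open>sqrt x\<close>: squaring it
    leaves the gap \<open>\<theta> * (1 - \<theta>)\<close> times the square of
    \<open>r - 1\<close>.\<close>
  define r where "r = sqrt x"
  have r: "r \<ge> 0" "r * r = x" "r \<noteq> 1" using assms \<open>x \<noteq> 1\<close> by (auto simp: r_def)
  have "x powr \<theta> = r powr \<theta> * r powr \<theta>" using r by (metis powr_mult)
  also have "\<dots> \<le> (1 + \<theta> * (r - 1)) * (1 + \<theta> * (r - 1))" 
    using le[OF r(1)] order_trans[OF powr_ge_zero le[OF r(1)]] by (intro mult_mono) auto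
  also have "\<dots> = 1 + \<theta> * (x - 1) - \<theta> * (1 - \<theta>) * ((r - 1) * (r - 1))" unfolding r(2)[symmetric] by (simp add: algebra_simps)
  also have "\<dots> < 1 + \<theta> * (x - 1)"
  proof -
    have a: "0 < (r - 1) * (r - 1)" using r(3) by (cases "r > 1") (auto intro: mult_pos_pos mult_neg_neg)
    have "0 < \<theta> * (1 - \<theta>)" using assms by simp
    from mult_pos_pos[OF this a] show ?thesis by linarith
  qed
  finally show "x powr \<theta> < 1 + \<theta> * (x - 1)" .
qed

text \<open>\<open>pth\<close> is homogeneous of degree 1 and \<open>pA\<close>, \<open>pB\<close>
  are homogeneous of degree 0, so one may divide by the value of \<open>pth\<close>. The
  coefficients then become plain powers of the normalized arguments.\<close>

lemma pth_normalize:
  assumes q: "q > 1" and t: "0 < t" "t < 1" and ab: "a \<ge> 0" "b \<ge> 0" and w: "(1 - t) * a powr q + t * b powr q > 0"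
  obtains y z where "y \<ge> 0" "z \<ge> 0" "(1 - t) * y powr q + t * z powr q = 1" "a = y * pth q t a b" "b = z * pth q t a b"
    "pA q t a b = (1 - t) * y powr (q - 1)" "pB q t a b = t * z powr (q - 1)"
proof -
  define s where "s = (1 - t) * a powr q + t * b powr q"
  define P where "P = s powr (1 / q)"
  have P: "P > 0" "P powr q = s" using w q by (auto simp: P_def s_def powr_powr)
  have eP: "pth q t a b = P" using ab by (simp add: pth_def P_def s_def)
  have sp: "s powr (1 / q - 1) = 1 / P powr (q - 1)"
  proof -
    have "1 / q - 1 = - (1 / q * (q - 1))" using q by (simp add: field_simps)
    then show ?thesis unfolding P_def powr_powr powr_minus_divide[symmetric] by simp
  qed
  have c: "s powr (1 / q - 1) * (r * c powr (q - 1)) = r * (c / P) powr (q - 1)" if "c \<ge> 0" for r c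
    using P that by (simp add: sp powr_divide)
  have "(1 - t) * (a / P) powr q + t * (b / P) powr q = s / s"
    using ab P(1) unfolding powr_divide P(2)
    by (simp only: times_divide_eq_right add_divide_distrib[symmetric] s_def[symmetric])
  then have "(1 - t) * (a / P) powr q + t * (b / P) powr q = 1" using w by (simp add: s_def)
  then show ?thesis using ab P c[of a "1 - t"] c[of b t]
    by (intro that[of "a / P" "b / P"]) (auto simp: eP pA_def pB_def s_def[symmetric])
qed

text \<open>This is Hoelder's inequality: the coefficients are
  \<open>(1 - t) * y powr (q - 1)\<close> and \<open>t * z powr (q - 1)\<close>, where the weighted
  q-th powers of \<open>y\<close> and \<open>z\<close> sum to 1. It is derived from Young's
  inequality after dividing by \<open>N\<close>, the weighted q-mean of the two norms.\<close>

lemma pth_gradient_le: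
  fixes U V :: "'a::real_normed_vector"
  assumes q: "q > 1" and t: "0 < t" "t < 1" and ab: "a \<ge> 0" "b \<ge> 0"
  shows "norm (pA q t a b *\<^sub>R U + pB q t a b *\<^sub>R V) powr q \<le> (1 - t) * norm U powr q + t * norm V powr q"
proof (cases "(1 - t) * a powr q + t * b powr q > 0")
  case False
  moreover have "(1 - t) * a powr q + t * b powr q \<ge> 0" using t by (intro add_nonneg_nonneg mult_nonneg_nonneg) auto
  ultimately have "(1 - t) * a powr q + t * b powr q = 0" by simp
  then have "pA q t a b = 0" "pB q t a b = 0" using ab by (auto simp: pA_def pB_def)
  then show ?thesis using t by simp
next
  case True
  obtain y z where yz: "y \<ge> 0" "z \<ge> 0" "(1 - t) * y powr q + t * z powr q = 1"
    "pA q t a b = (1 - t) * y powr (q - 1)" "pB q t a b = t * z powr (q - 1)"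
    using pth_normalize[OF q t ab True] by metis
  define S where "S = (1 - t) * norm U powr q + t * norm V powr q"
  have S0: "S \<ge> 0" unfolding S_def using t by (intro add_nonneg_nonneg mult_nonneg_nonneg) auto
  have n: "norm (pA q t a b *\<^sub>R U + pB q t a b *\<^sub>R V) \<le> (1 - t) * (y powr (q - 1) * norm U) + t * (z powr (q - 1) * norm V)"
    using norm_triangle_ineq[of "pA q t a b *\<^sub>R U" "pB q t a b *\<^sub>R V"] t by (simp add: yz)
  show ?thesis
  proof (cases "S = 0")
    case True
    have "(1 - t) * norm U powr q \<ge> 0" "t * norm V powr q \<ge> 0" using t by auto
    then have "(1 - t) * norm U powr q = 0" "t * norm V powr q = 0" using True unfolding S_def by linarith+
    then have "U = 0" "V = 0" using t q by auto
    then show ?thesis by simp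
  next
    case False
    define N where "N = S powr (1 / q)"
    have N: "N > 0" "N powr q = S" using False S0 q by (auto simp: N_def powr_powr)
    define q' where "q' = q / (q - 1)"
    have q': "q' > 1" "1 / q' + 1 / q = 1" "(q - 1) * q' = q" "1 / q' = 1 - 1 / q" using q by (auto simp: q'_def field_simps)
    have Y: "y powr (q - 1) * (c / N) \<le> y powr q / q' + (c / N) powr q / q" if "y \<ge> 0" "c \<ge> 0" for y c
      using Youngs_inequality[of q' q "y powr (q - 1)" "c / N"] q q' that N by (simp add: powr_powr)
    have "(1 - t) * (y powr (q - 1) * (norm U / N)) + t * (z powr (q - 1) * (norm V / N))
       \<le> (1 - t) * (y powr q / q' + (norm U / N) powr q / q) + t * (z powr q / q' + (norm V / N) powr q / q)"
      using t yz by (intro add_mono mult_left_mono Y) auto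
    also have "\<dots> = ((1 - t) * y powr q + t * z powr q) / q' + (S / N powr q) / q"
    proof -
      have *: "(1 - t) * (X / q' + A / R / q) + t * (Z / q' + B / R / q) = ((1 - t) * X + t * Z) / q' + (((1 - t) * A + t * B) / R) / q"
        for X A Z B R by (simp add: add_divide_distrib diff_divide_distrib algebra_simps)
      show ?thesis
        unfolding powr_divide S_def by (rule *)
    qed
    also have "\<dots> = 1" using q'(2) N False by (simp add: yz(3))
    finally have "(1 - t) * (y powr (q - 1) * norm U) + t * (z powr (q - 1) * norm V) \<le> N" using N by (simp add: field_simps)
    then have "norm (pA q t a b *\<^sub>R U + pB q t a b *\<^sub>R V) powr q \<le> N powr q" using n q by (intro powr_mono2) auto
    then show ?thesis using N by (simp add: S_def)
  qed
qed

text \<open>If the norms are nonzero, equality makes the mean of \<open>y powr (q - 1)\<close> and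
  \<open>z powr (q - 1)\<close> at least 1, while the q-th powers have mean 1. Strict concavity of
  the power \<open>\<theta> = 1 - 1 / q\<close> forces \<open>y = z = 1\<close>, hence
  \<open>a = b\<close>. Then \<open>norm (U + V) = 2 * norm V\<close>, and the parallelogram law
  gives \<open>U = V\<close>.\<close>

lemma pth_gradient_eq:
  fixes U V :: "'a::real_inner"
  assumes q: "q > 1" and ab: "a \<ge> 0" "b \<ge> 0" and eq: "norm U = norm V" "norm (pA q (1/2) a b *\<^sub>R U + pB q (1/2) a b *\<^sub>R V) = norm V"
  shows "U = V" "a = b \<or> U = 0"
proof -
  have "U = V \<and> (a = b \<or> U = 0)"
  proof (cases "norm V = 0")
    case True
    then show ?thesis using eq(1) by simp
  next
    case False
    then have n: "norm V > 0" by simp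
    have "(1 - 1/2) * a powr q + 1/2 * b powr q > 0"
    proof (rule ccontr)
      assume "\<not> ?thesis"
      moreover have "(1 - 1/2) * a powr q + 1/2 * b powr q \<ge> 0" by simp
      ultimately have "(1 - 1/2) * a powr q + 1/2 * b powr q = 0" by linarith
      then have "pA q (1/2) a b = 0" "pB q (1/2) a b = 0" using ab by (auto simp: pA_def pB_def)
      then show False using eq(2) n by simp
    qed
    then obtain y z where yz: "y \<ge> 0" "z \<ge> 0" "(1 - 1/2) * y powr q + 1/2 * z powr q = 1" "a = y * pth q (1/2) a b" "b = z * pth q (1/2) a b"
      "pA q (1/2) a b = (1 - 1/2) * y powr (q - 1)" "pB q (1/2) a b = 1/2 * z powr (q - 1)"
      using pth_normalize[OF q _ _ ab, of "1/2"] by auto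
    define \<theta> where "\<theta> = 1 - 1 / q"
    have \<theta>: "0 < \<theta>" "\<theta> < 1" "q * \<theta> = q - 1" using q by (auto simp: \<theta>_def algebra_simps)
    have pw: "c powr (q - 1) = (c powr q) powr \<theta>" for c by (simp add: powr_powr \<theta>)
    have "norm V \<le> (1/2) * y powr (q - 1) * norm U + (1/2) * z powr (q - 1) * norm V"
      using norm_triangle_ineq[of "pA q (1/2) a b *\<^sub>R U" "pB q (1/2) a b *\<^sub>R V", unfolded eq(2)] by (simp add: yz(6,7))
    then have "norm V * 1 \<le> norm V * ((y powr (q - 1) + z powr (q - 1)) / 2)" by (simp add: eq(1) algebra_simps)
    then have ge: "2 \<le> (y powr q) powr \<theta> + (z powr q) powr \<theta>" using n unfolding pw by simp
    have sum2: "y powr q + z powr q = 2" using yz(3) by simp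
    have B: "(y powr q) powr \<theta> \<le> 1 + \<theta> * (y powr q - 1)" "(z powr q) powr \<theta> \<le> 1 + \<theta> * (z powr q - 1)"
      by (rule Bernoulli_powr(1)[OF _ \<theta>(1,2)], simp)+
    have zero: "\<theta> * (y powr q - 1) + \<theta> * (z powr q - 1) = 0"
    proof -
      have "\<theta> * (y powr q - 1) + \<theta> * (z powr q - 1) = \<theta> * ((y powr q + z powr q) - 2)" by (simp add: algebra_simps)
      then show ?thesis by (simp add: sum2)
    qed
    have "y powr q = 1"
    proof (rule ccontr)
      assume "y powr q \<noteq> 1"
      then have "(y powr q) powr \<theta> < 1 + \<theta> * (y powr q - 1)" by (intro Bernoulli_powr(2)[OF _ \<theta>(1,2)]) auto
      then show False using B ge zero by linarith
    qed
    then have "z powr q = 1" using sum2 by simp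
    have one: "c = 1" if "c powr q = 1" "c \<ge> 0" for c
    proof -
      have "c = (c powr q) powr (1 / q)" using that(2) q by (simp add: powr_powr)
      then show ?thesis unfolding that(1) by simp
    qed
    have y1: "y = 1" "z = 1" using one[OF \<open>y powr q = 1\<close> yz(1)] one[OF \<open>z powr q = 1\<close> yz(2)] by blast+
    have "pA q (1/2) a b *\<^sub>R U + pB q (1/2) a b *\<^sub>R V = (1/2) *\<^sub>R (U + V)"
    proof -
      have "pA q (1/2) a b = 1/2" "pB q (1/2) a b = 1/2" using yz(6,7) y1 by simp_all
      then show ?thesis by (simp only: scaleR_add_right)
    qed
    then have "norm ((1/2) *\<^sub>R (U + V)) = norm V" using eq(2) by simp
    then have uv: "norm (U + V) = 2 * norm V" by simp
    have "(norm (U + V))\<^sup>2 + (norm (U - V))\<^sup>2 = 2 * (norm U)\<^sup>2 + 2 * (norm V)\<^sup>2"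
      by (simp add: power2_norm_eq_inner inner_add_left inner_add_right inner_diff_left inner_diff_right inner_commute)
    then have "(norm (U - V))\<^sup>2 = 0" by (simp add: uv eq(1) power_mult_distrib)
    then show ?thesis using yz(4,5) y1 by simp
  qed
  then show "U = V" "a = b \<or> U = 0" by auto
qed

text \<open>Mean value points on the two sides of the intermediate point express the convexity
  defect as a multiple of an increment of \<open>k'\<close>. Plain and strict convexity thus follow
  from monotonicity of \<open>k'\<close> on the open half-line, with only continuity of
  \<open>k\<close> at 0.\<close>

lemma convex_MVT:
  fixes k k' :: "real \<Rightarrow> real"
  assumes c: "continuous_on {0..} k" and d: "\<And>s. s > 0 \<Longrightarrow> DERIV k s :> k' s" and ab: "0 \<le> a" "a < b" and t: "0 < t" "t < 1"
  shows "\<exists>\<xi> \<eta>. 0 < \<xi> \<and> \<xi> < \<eta> \<and> (1 - t) * k a + t * k b - k ((1 - t) * a + t * b) = t * (1 - t) * (b - a) * (k' \<eta> - k' \<xi>)"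
proof -
  define m where "m = (1 - t) * a + t * b"
  have m: "m - a = t * (b - a)" "b - m = (1 - t) * (b - a)" by (simp_all add: m_def algebra_simps)
  then have am: "a < m" "m < b" using ab t by (metis diff_gt_0_iff_gt mult_pos_pos)+
  have dd: "k differentiable (at x)" if "x > 0" for x using d[OF that] real_differentiable_def by blast
  obtain \<xi> l where \<xi>: "a < \<xi>" "\<xi> < m" "DERIV k \<xi> :> l" "k m - k a = (m - a) * l"
    using MVT[of a m k] am ab dd continuous_on_subset[OF c, of "{a..m}"] by auto
  obtain \<eta> l' where \<eta>: "m < \<eta>" "\<eta> < b" "DERIV k \<eta> :> l'" "k b - k m = (b - m) * l'"
    using MVT[of m b k] am ab dd continuous_on_subset[OF c, of "{m..b}"] by auto
  have l: "l = k' \<xi>" "l' = k' \<eta>" using DERIV_unique d \<xi> \<eta> ab by (metis order_le_less_trans order_less_trans)+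
  have "(1 - t) * k a + t * k b - k m = t * (k b - k m) - (1 - t) * (k m - k a)" by (simp add: algebra_simps)
  also have "\<dots> = t * (1 - t) * (b - a) * (k' \<eta> - k' \<xi>)" unfolding \<xi>(4) \<eta>(4) m l by (simp add: algebra_simps)
  finally show ?thesis using \<xi> \<eta> ab by (intro exI[of _ \<xi>] exI[of _ \<eta>]) (auto simp: m_def)
qed

lemma convex_ineq:
  fixes k k' :: "real \<Rightarrow> real"
  assumes c: "continuous_on {0..} k" and d: "\<And>s. s > 0 \<Longrightarrow> DERIV k s :> k' s" and ab: "0 \<le> a" "0 \<le> b" and t: "0 < t" "t < 1"
  shows "(\<And>r s. 0 < r \<Longrightarrow> r < s \<Longrightarrow> k' r \<le> k' s) \<Longrightarrow> k ((1 - t) * a + t * b) \<le> (1 - t) * k a + t * k b"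
    and "(\<And>r s. 0 < r \<Longrightarrow> r < s \<Longrightarrow> k' r < k' s) \<Longrightarrow> a \<noteq> b \<Longrightarrow> k ((1 - t) * a + t * b) < (1 - t) * k a + t * k b"
proof -
  have *: "a = b \<or> (\<exists>\<xi> \<eta> c. 0 < \<xi> \<and> \<xi> < \<eta> \<and> c > 0 \<and> (1 - t) * k a + t * k b - k ((1 - t) * a + t * b) = c * (k' \<eta> - k' \<xi>))"
  proof (cases a b rule: linorder_cases)
    case less
    have "0 < t * (1 - t) * (b - a)" using less t by simp
    then show ?thesis using convex_MVT[OF c d ab(1) less t] by blast
  next
    case greater
    have t': "0 < 1 - t" "1 - t < 1" using t by auto
    have "0 < (1 - t) * (1 - (1 - t)) * (a - b)" using greater t by simp
    moreover obtain \<xi> \<eta> where "0 < \<xi>" "\<xi> < \<eta>"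
      "(1 - (1 - t)) * k b + (1 - t) * k a - k ((1 - (1 - t)) * b + (1 - t) * a) = (1 - t) * (1 - (1 - t)) * (a - b) * (k' \<eta> - k' \<xi>)"
      using convex_MVT[OF c d ab(2) greater t'] by blast
    ultimately show ?thesis by (intro disjI2 exI[of _ \<xi>] exI[of _ \<eta>] exI[of _ "(1 - t) * (1 - (1 - t)) * (a - b)"]) (auto simp: add.commute)
  qed simp
  show "k ((1 - t) * a + t * b) \<le> (1 - t) * k a + t * k b" if m: "\<And>r s. 0 < r \<Longrightarrow> r < s \<Longrightarrow> k' r \<le> k' s"
    using *
  proof (elim disjE exE conjE)
    fix \<xi> \<eta> c assume "0 < \<xi>" "\<xi> < \<eta>" "c > 0" "(1 - t) * k a + t * k b - k ((1 - t) * a + t * b) = c * (k' \<eta> - k' \<xi>)"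
    moreover have "0 \<le> c * (k' \<eta> - k' \<xi>)" using m calculation by simp
    ultimately show ?thesis by linarith
  qed (simp add: algebra_simps)
  show "k ((1 - t) * a + t * b) < (1 - t) * k a + t * k b" if m: "\<And>r s. 0 < r \<Longrightarrow> r < s \<Longrightarrow> k' r < k' s" and ne: "a \<noteq> b"
    using *
  proof (elim disjE exE conjE)
    fix \<xi> \<eta> c assume "0 < \<xi>" "\<xi> < \<eta>" "c > 0" "(1 - t) * k a + t * k b - k ((1 - t) * a + t * b) = c * (k' \<eta> - k' \<xi>)"
    moreover have "0 < c * (k' \<eta> - k' \<xi>)" using m calculation by simp
    ultimately show ?thesis by linarith
  qed (use ne in simp)
qed

lemma primitive_props:
  assumes c: "continuous_on {0..} f"
  shows "primitive f 0 = 0" "continuous_on {0..} (primitive f)" "t > 0 \<Longrightarrow> DERIV (primitive f) t :> f t"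
proof -
  have eq: "primitive f t = integral {0..t} f" if "t \<ge> 0" for t
  proof -
    have "set_integrable lborel {0..t} f"
      by (intro borel_integrable_atLeastAtMost' continuous_on_subset[OF c]) auto
    then show ?thesis unfolding primitive_def using that by (subst interval_integral_eq_integral) auto
  qed
  show "primitive f 0 = 0" using eq[of 0] by simp
  have der: "((\<lambda>x. integral {0..x} f) has_real_derivative f s) (at s within {0..b})" if "s \<in> {0..b}" for s b
    using that by (intro integral_has_real_derivative continuous_on_subset[OF c]) auto
  show "DERIV (primitive f) t :> f t" if t: "t > 0" for t
  proof -
    have "((\<lambda>x. integral {0..x} f) has_real_derivative f t) (at t)"
      using der[of t "t + 1"] t at_within_interior[of t "{0..t+1}"] by (simp add: interior_atLeastAtMost_real)
    then show ?thesis
      by (rule has_field_derivative_transform_within_open[where S = "{0<..}"]) (use t eq in auto)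
  qed
  show "continuous_on {0..} (primitive f)"
  proof (rule continuous_on_eq[of _ "\<lambda>x. integral {0..x} f"])
    show "continuous_on {0..} (\<lambda>x. integral {0..x} f)"
      unfolding continuous_on_eq_continuous_within
    proof
      fix s :: real assume s: "s \<in> {0..}"
      have "continuous (at s within {0..s + 1}) (\<lambda>x. integral {0..x} f)" using der[of s "s + 1"] s by (intro DERIV_continuous) auto
      moreover have "at s within {0..s + 1} = at s within {0..}"
        using s by (intro at_within_nhd[of _ "{..<s + 1}"]) auto
      ultimately show "continuous (at s within {0..}) (\<lambda>x. integral {0..x} f)" by simp
    qed
  qed (use eq in auto)
qed

lemma primitive_MVT:
  assumes c: "continuous_on {0..} f" and t: "t > 0"
  obtains s where "0 < s" "s < t" "primitive f t = t * f s"
proof -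
  have dd: "primitive f differentiable (at x)" if "x > 0" for x using primitive_props(3)[OF c that] real_differentiable_def by blast
  obtain s l where s: "0 < s" "s < t" "DERIV (primitive f) s :> l" "primitive f t - primitive f 0 = (t - 0) * l"
    using MVT[of 0 t "primitive f"] t dd continuous_on_subset[OF primitive_props(2)[OF c], of "{0..t}"] by auto
  have "l = f s" using DERIV_unique primitive_props(3)[OF c s(1)] s(3) by blast
  then show ?thesis using that s primitive_props(1)[OF c] by simp
qed

section \<open>The energy along the path\<close>

text \<open>A Caratheodory function is jointly measurable after a change on a null set, and the
  integral over the second variable is then measurable in the first.\<close>

lemma (in lp_domain) borel_measurable_primitive:
  assumes g: "caratheodory \<Omega> g" and u: "u \<in> borel_measurable M" "AE x in M. 0 \<le> u x"
  shows "(\<lambda>x. primitive (g x) (u x)) \<in> borel_measurable M"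
proof -
  obtain N where N: "N \<in> sets M" "emeasure M N = 0" "{x \<in> space M. \<not> continuous_on UNIV (g x)} \<subseteq> N"
  proof -
    have "AE x in M. continuous_on UNIV (g x)" using g by (simp add: caratheodory_def)
    then obtain N where "{x \<in> space M. \<not> continuous_on UNIV (g x)} \<subseteq> N" "emeasure M N = 0" "N \<in> sets M" by (rule AE_E)
    then show ?thesis by (intro that)
  qed
  \<comment> \<open>Continuity in the second variable holds only off a null set. Putting 0 there
    makes it hold everywhere, and completeness of Lebesgue measure allows the result to be corrected
    at the end.\<close>
  define g0 where "g0 x s = (if x \<in> N then 0 else g x s)" for x s
  have gm: "(\<lambda>x. g x s) \<in> borel_measurable M" for s using g by (simp add: caratheodory_def)
  have m0: "(\<lambda>x. g0 x s) \<in> borel_measurable M" for s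
    unfolding g0_def by (rule measurable_If_set[OF measurable_const gm]) (use N in auto)
  have c0: "isCont (g0 x) s" if "x \<in> space M" for x s
  proof (cases "x \<in> N")
    case False
    then have "continuous_on UNIV (g x)" using N(3) that by blast
    moreover have "g0 x = g x" using False by (auto simp: g0_def)
    ultimately show ?thesis by (simp add: continuous_on_eq_continuous_at)
  next
    case True
    then have "g0 x = (\<lambda>s. 0)" by (auto simp: g0_def)
    then show ?thesis by simp
  qed
  \<comment> \<open>Rounding \<open>snd z\<close> down to a multiple of \<open>1 / Suc n\<close>
    leaves countably many sections, each measurable in \<open>fst z\<close>; continuity gives
    convergence as \<open>n\<close> grows.\<close>
  have jm: "(\<lambda>z. g0 (fst z) (snd z)) \<in> borel_measurable (M \<Otimes>\<^sub>M lborel)"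
  proof (rule borel_measurable_LIMSEQ_metric)
    fix n :: nat
    have "(\<lambda>z. \<lfloor>real (Suc n) * snd z\<rfloor>) \<in> measurable (M \<Otimes>\<^sub>M lborel) (count_space UNIV)" by measurable
    moreover have "(\<lambda>z. g0 (fst z) (real_of_int i / real (Suc n))) \<in> borel_measurable (M \<Otimes>\<^sub>M lborel)" for i
      by (rule measurable_compose[OF measurable_fst m0])
    ultimately show "(\<lambda>z. g0 (fst z) (real_of_int \<lfloor>real (Suc n) * snd z\<rfloor> / real (Suc n))) \<in> borel_measurable (M \<Otimes>\<^sub>M lborel)"
      by (rule measurable_compose_countable[rotated])
  next
    fix z :: "'a \<times> real" assume z: "z \<in> space (M \<Otimes>\<^sub>M lborel)"
    have "(\<lambda>n. real_of_int \<lfloor>real (Suc n) * snd z\<rfloor> / real (Suc n)) \<longlonglongrightarrow> snd z"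
    proof (rule tendsto_sandwich)
      have l: "(\<lambda>n. 1 / real (Suc n)) \<longlonglongrightarrow> 0" by (rule LIMSEQ_Suc[OF lim_1_over_n])
      show "(\<lambda>n. snd z - 1 / real (Suc n)) \<longlonglongrightarrow> snd z" using tendsto_diff[OF tendsto_const l, of "snd z"] by simp
      show "\<forall>\<^sub>F n in sequentially. snd z - 1 / real (Suc n) \<le> real_of_int \<lfloor>real (Suc n) * snd z\<rfloor> / real (Suc n)"
      proof (intro always_eventually allI)
        fix n
        have "real (Suc n) * snd z - 1 \<le> real_of_int \<lfloor>real (Suc n) * snd z\<rfloor>" by linarith
        then have "(real (Suc n) * snd z - 1) / real (Suc n) \<le> real_of_int \<lfloor>real (Suc n) * snd z\<rfloor> / real (Suc n)"
          by (rule divide_right_mono) simp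
        then show "snd z - 1 / real (Suc n) \<le> real_of_int \<lfloor>real (Suc n) * snd z\<rfloor> / real (Suc n)" by (simp add: diff_divide_distrib)
      qed
      show "\<forall>\<^sub>F n in sequentially. real_of_int \<lfloor>real (Suc n) * snd z\<rfloor> / real (Suc n) \<le> snd z"
      proof (intro always_eventually allI)
        fix n
        have "real_of_int \<lfloor>real (Suc n) * snd z\<rfloor> \<le> snd z * real (Suc n)" by (metis mult.commute of_int_floor_le)
        then show "real_of_int \<lfloor>real (Suc n) * snd z\<rfloor> / real (Suc n) \<le> snd z" by (simp add: pos_divide_le_eq)
      qed
    qed simp
    then show "(\<lambda>n. g0 (fst z) (real_of_int \<lfloor>real (Suc n) * snd z\<rfloor> / real (Suc n))) \<longlonglongrightarrow> g0 (fst z) (snd z)"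
      using z by (intro isCont_tendsto_compose[OF c0]) (auto simp: space_pair_measure)
  qed
  have "(\<lambda>z. indicator {0..u (fst z)} (snd z) *\<^sub>R g0 (fst z) (snd z)) = (\<lambda>z. if 0 \<le> snd z \<and> snd z \<le> u (fst z) then g0 (fst z) (snd z) else 0)"
    by (auto simp: indicator_def)
  moreover have "(\<lambda>z. if 0 \<le> snd z \<and> snd z \<le> u (fst z) then g0 (fst z) (snd z) else 0) \<in> borel_measurable (M \<Otimes>\<^sub>M lborel)"
  proof (rule measurable_If[OF jm])
    have "(\<lambda>z. u (fst z)) \<in> borel_measurable (M \<Otimes>\<^sub>M lborel)" by (rule measurable_compose[OF measurable_fst u(1)])
    then show "{z \<in> space (M \<Otimes>\<^sub>M lborel). 0 \<le> snd z \<and> snd z \<le> u (fst z)} \<in> sets (M \<Otimes>\<^sub>M lborel)" by measurable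
  qed simp
  ultimately have "(\<lambda>(x, s). indicator {0..u x} s *\<^sub>R g0 x s) \<in> borel_measurable (M \<Otimes>\<^sub>M lborel)" by (simp add: case_prod_unfold)
  then have m: "(\<lambda>x. LINT s|lborel. indicator {0..u x} s *\<^sub>R g0 x s) \<in> borel_measurable M"
    by (rule lborel.borel_measurable_lebesgue_integral)
  have "AE x in M. x \<notin> N" using N by (intro AE_not_in) (auto simp: null_sets_def)
  then have "AE x in M. (LINT s|lborel. indicator {0..u x} s *\<^sub>R g0 x s) = primitive (g x) (u x)"
    using u(2)
  proof eventually_elim
    case (elim x)
    then have "g0 x = g x" by (auto simp: g0_def)
    then show ?case using elim by (simp add: primitive_def interval_integral_Icc set_lebesgue_integral_def)
  qed
  from meas_AE_cong[OF m this] show ?thesis .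
qed

text \<open>Put \<open>K s = primitive h (s powr (p / q))\<close>. Its derivative is the positive
  nondecreasing \<open>h\<close> times a strictly increasing power, as \<open>p / q > 1\<close>. So
  \<open>K\<close> is strictly increasing, which compares \<open>n powr q\<close> with the mean of
  the other two powers, and strictly convex, which compares \<open>K\<close> at the mean with the
  mean of \<open>K\<close>. Under the reverse inequality both comparisons are equalities.\<close>

lemma strongly_convex_primitive:
  fixes h :: "real \<Rightarrow> real" and p q :: real
  assumes h: "\<And>t. t > 0 \<Longrightarrow> 0 < h t" "continuous_on {0..} h" "mono_on {0..} h" and q: "1 < q" "q < p"
    and n: "0 \<le> n" "0 \<le> a" "0 \<le> b" "n powr q \<le> (1 - t) * a powr q + t * b powr q" and t: "0 < t" "t < 1"
  shows "primitive h (n powr p) \<le> (1 - t) * primitive h (a powr p) + t * primitive h (b powr p)"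
    and "(1 - t) * primitive h (a powr p) + t * primitive h (b powr p) \<le> primitive h (n powr p) \<Longrightarrow> n = a \<and> n = b"
proof -
  define K where "K s = primitive h (s powr (p / q))" for s
  define K' where "K' s = h (s powr (p / q)) * (p / q * s powr (p / q - 1))" for s
  have pq: "p / q > 1" using q by simp
  have Kp: "K (c powr q) = primitive h (c powr p)" for c using q by (simp add: K_def powr_powr)
  have cK: "continuous_on {0..} K" unfolding K_def
    using pq by (intro continuous_on_compose2[OF primitive_props(2)[OF h(2)]] continuous_on_powr' continuous_intros) auto
  have dK: "DERIV K s :> K' s" if "s > 0" for s
  proof -
    have "DERIV (\<lambda>s. s powr (p / q)) s :> p / q * s powr (p / q - 1)" using that by (rule has_real_derivative_powr)
    then show ?thesis unfolding K_def K'_def using that by (intro DERIV_chain2[OF primitive_props(3)[OF h(2)]]) auto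
  qed
  have K'pos: "0 < K' s" if "s > 0" for s unfolding K'_def using that h(1)[of "s powr (p / q)"] pq by (intro mult_pos_pos) auto
  have K'mono: "K' r < K' s" if "0 < r" "r < s" for r s
  proof -
    have "h (r powr (p / q)) \<le> h (s powr (p / q))"
      using that pq by (intro mono_onD[OF h(3)] powr_mono2) auto
    moreover have "p / q * r powr (p / q - 1) < p / q * s powr (p / q - 1)" using that pq by (intro mult_strict_left_mono powr_less_mono2) auto
    moreover have "0 < h (r powr (p / q))" "0 \<le> p / q * r powr (p / q - 1)"
      using that(1) h(1)[of "r powr (p / q)"] mult_nonneg_nonneg[of "p / q" "r powr (p / q - 1)"] pq by auto
    ultimately show ?thesis unfolding K'_def by (rule mult_le_less_imp_less)
  qed
  have K_less: "K r < K s" if "0 \<le> r" "r < s" for r s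
    using that dK K'pos continuous_on_subset[OF cK, of "{r..s}"] by (intro DERIV_pos_imp_increasing_open[OF that(2)]) (force intro: order_le_less_trans)+
  define A where "A = a powr q"
  define B where "B = b powr q"
  define m where "m = (1 - t) * A + t * B"
  have AB: "0 \<le> A" "0 \<le> B" by (simp_all add: A_def B_def)
  have m0: "0 \<le> m" unfolding m_def using AB t by simp
  have n1: "K (n powr q) \<le> K m" using K_less[of "n powr q" m] n(4) by (cases "n powr q = m") (auto simp: m_def A_def B_def)
  have c1: "K m \<le> (1 - t) * K A + t * K B" unfolding m_def
    by (rule convex_ineq(1)[OF cK dK AB t]) (use K'mono in \<open>auto intro: less_imp_le\<close>)
  show "primitive h (n powr p) \<le> (1 - t) * primitive h (a powr p) + t * primitive h (b powr p)"
    using n1 c1 by (simp add: Kp A_def B_def)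
  assume "(1 - t) * primitive h (a powr p) + t * primitive h (b powr p) \<le> primitive h (n powr p)"
  then have e: "(1 - t) * K A + t * K B \<le> K (n powr q)" by (simp add: Kp A_def B_def)
  have "A = B"
  proof (rule ccontr)
    assume "A \<noteq> B"
    have "K m < (1 - t) * K A + t * K B" unfolding m_def by (rule convex_ineq(2)[OF cK dK AB t K'mono \<open>A \<noteq> B\<close>])
    then show False using e n1 by linarith
  qed
  then have mA: "m = A" by (simp add: m_def algebra_simps)
  have "n powr q = m"
  proof (rule ccontr)
    assume "n powr q \<noteq> m"
    then have "K (n powr q) < K m" using n(4) by (intro K_less) (auto simp: m_def A_def B_def)
    then show False using e c1 by linarith
  qed
  then have eq: "n powr q = a powr q" "n powr q = b powr q" using mA \<open>A = B\<close> by (auto simp: A_def B_def)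
  have inj: "x = y" if "x powr q = y powr q" "0 \<le> x" "0 \<le> y" for x y :: real
  proof -
    have "x = (x powr q) powr (1 / q)" using that(2) q by (simp add: powr_powr)
    also have "\<dots> = (y powr q) powr (1 / q)" unfolding that(1) by (rule refl)
    also have "\<dots> = y" using that(3) q by (simp add: powr_powr)
    finally show ?thesis .
  qed
  show "n = a \<and> n = b" using inj eq n by blast
qed

text \<open>As a function of \<open>s\<close>, \<open>- primitive g (s powr (1 / q))\<close> is
  convex: its derivative is \<open>- (1 / q)\<close> times \<open>g c / c powr (q - 1)\<close> at
  \<open>c = s powr (1 / q)\<close>, which is nondecreasing. The path is linear in the q-th
  powers.\<close>

lemma primitive_pth_ge:
  assumes g: "continuous_on UNIV g" "antimono_on {0<..} (\<lambda>t. g t / t powr (q - 1))" and q: "1 < q"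
    and ab: "0 \<le> a" "0 \<le> b" and t: "0 < t" "t < 1"
  shows "(1 - t) * primitive g a + t * primitive g b \<le> primitive g (pth q t a b)"
proof -
  have gc: "continuous_on {0..} g" using g(1) by (rule continuous_on_subset) simp
  define k where "k s = - primitive g (s powr (1 / q))" for s
  define k' where "k' s = - (g (s powr (1 / q)) * (1 / q * s powr (1 / q - 1)))" for s
  have kp: "k (c powr q) = - primitive g c" if "c \<ge> 0" for c using q that by (simp add: k_def powr_powr)
  have ck: "continuous_on {0..} k" unfolding k_def
    using q by (intro continuous_intros continuous_on_compose2[OF primitive_props(2)[OF gc]] continuous_on_powr') auto
  have dk: "DERIV k s :> k' s" if "s > 0" for s
  proof -
    have "DERIV (\<lambda>s. s powr (1 / q)) s :> 1 / q * s powr (1 / q - 1)" using that by (rule has_real_derivative_powr)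
    then show ?thesis unfolding k_def k'_def using that by (intro DERIV_minus DERIV_chain2[OF primitive_props(3)[OF gc]]) auto
  qed
  have k'mono: "k' r \<le> k' s" if "0 < r" "r < s" for r s
  proof -
    have eq: "k' c = - (1 / q * (g (c powr (1 / q)) / (c powr (1 / q)) powr (q - 1)))" if "c > 0" for c
    proof -
      have "1 / q - 1 = - (1 / q * (q - 1))" using q by (simp add: field_simps)
      then have "c powr (1 / q - 1) = 1 / (c powr (1 / q)) powr (q - 1)" unfolding powr_powr powr_minus_divide[symmetric] by simp
      then show ?thesis by (simp add: k'_def)
    qed
    have lt: "r powr (1 / q) \<le> s powr (1 / q)" using that q by (intro powr_mono2) auto
    have "g (s powr (1 / q)) / (s powr (1 / q)) powr (q - 1) \<le> g (r powr (1 / q)) / (r powr (1 / q)) powr (q - 1)"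
      by (rule monotone_onD[OF g(2) _ _ lt]) (use that in auto)
    then have "1 / q * (g (s powr (1 / q)) / (s powr (1 / q)) powr (q - 1)) \<le> 1 / q * (g (r powr (1 / q)) / (r powr (1 / q)) powr (q - 1))"
      using q by (intro mult_left_mono) auto
    then show ?thesis using that by (simp add: eq)
  qed
  have "k ((1 - t) * a powr q + t * b powr q) \<le> (1 - t) * k (a powr q) + t * k (b powr q)"
    by (rule convex_ineq(1)[OF ck dk _ _ t k'mono]) auto
  then show ?thesis using ab by (simp add: kp) (simp add: k_def pth_def)
qed

lemma primitive_growth:
  assumes f: "continuous_on UNIV f" "\<And>t. \<bar>f t\<bar> \<le> C * (1 + \<bar>t\<bar> powr \<sigma>)" and C: "0 < C" "0 < \<sigma>" and t: "0 \<le> t"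
  shows "\<bar>primitive f t\<bar> \<le> C * (t + t powr (\<sigma> + 1))"
proof (cases "t = 0")
  case True
  then show ?thesis using primitive_props(1)[OF continuous_on_subset[OF f(1)]] by simp
next
  case False
  then have tp: "t > 0" using t by simp
  obtain s where s: "0 < s" "s < t" "primitive f t = t * f s" using primitive_MVT[OF continuous_on_subset[OF f(1)] tp] by blast
  have "\<bar>f s\<bar> \<le> C * (1 + s powr \<sigma>)" using f(2)[of s] s by simp
  also have "\<dots> \<le> C * (1 + t powr \<sigma>)" using s C by (intro mult_left_mono add_left_mono powr_mono2) auto
  finally have "t * \<bar>f s\<bar> \<le> t * (C * (1 + t powr \<sigma>))" using tp by (intro mult_left_mono) auto
  then show ?thesis using tp s by (simp add: abs_mult powr_add algebra_simps)
qed

section \<open>Integrability and convexity of the energy\<close>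

locale energy_domain = lp_domain \<Omega> p for \<Omega> :: "'a::euclidean_space set" and p :: real +
  fixes h :: "real \<Rightarrow> real" and g :: "'a \<Rightarrow> real \<Rightarrow> real" and q C \<sigma> :: real
  assumes ne: "\<Omega> \<noteq> {}" and conn: "connected \<Omega>"
    and bd: "\<forall>x\<in>frontier \<Omega>. \<exists>U \<rho>. x \<in> U \<and> local_defining_function \<Omega> U \<rho>"
    and h: "\<And>t. t > 0 \<Longrightarrow> 0 < h t" "continuous_on {0..} h" "mono_on {0..} h" "bounded (h ` {0..})"
    and gc: "caratheodory \<Omega> g"
    and C: "0 < C" "0 < \<sigma>" "\<sigma> * (real DIM('a) - p) \<le> (p - 1) * real DIM('a) + p"
    and gg: "\<And>x t. x \<in> \<Omega> \<Longrightarrow> \<bar>g x t\<bar> \<le> C * (1 + \<bar>t\<bar> powr \<sigma>)"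
    and q: "1 < q" "q < p" and gm: "AE x in lebesgue_on \<Omega>. antimono_on {0<..} (\<lambda>t. g x t / t powr (q - 1))"
begin

lemma good: "AE x in M. x \<in> \<Omega> \<and> continuous_on UNIV (g x) \<and> antimono_on {0<..} (\<lambda>t. g x t / t powr (q - 1))"
proof -
  have "AE x in M. x \<in> space M" by (rule AE_space)
  moreover have "AE x in M. continuous_on UNIV (g x)" using gc by (simp add: caratheodory_def)
  ultimately show ?thesis using gm by eventually_elim simp
qed

lemma int_G:
  assumes u: "sob u U" "AE x in M. 0 \<le> u x"
  shows "integrable M (\<lambda>x. primitive (g x) (u x))"
proof (rule Bochner_Integration.integrable_bound)
  have "integrable M (\<lambda>x. u x powr (\<sigma> + 1))"
    by (rule sobolev_growth[OF \<Omega> bd p C(2,3)]) (use u in \<open>auto simp: sob_def\<close>)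
  moreover have "integrable M u" using u(1) unfolding sob_def by (blast intro: Lp_L1)
  ultimately show "integrable M (\<lambda>x. C * (u x + u x powr (\<sigma> + 1)))" by (intro integrable_mult_right Bochner_Integration.integrable_add)
  show "AE x in M. norm (primitive (g x) (u x)) \<le> norm (C * (u x + u x powr (\<sigma> + 1)))"
    using good u(2)
  proof eventually_elim
    case (elim x)
    then have "\<bar>primitive (g x) (u x)\<bar> \<le> C * (u x + u x powr (\<sigma> + 1))" using gg C by (intro primitive_growth) auto
    then show ?case by simp
  qed
  show "(\<lambda>x. primitive (g x) (u x)) \<in> borel_measurable M"
    by (rule borel_measurable_primitive[OF gc sob_meas(1)[OF u(1)] u(2)])
qed

text \<open>Since \<open>h\<close> is bounded on the half-line, its primitive grows at most
  linearly, so p-integrability of the gradient is enough.\<close>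

lemma int_H:
  assumes u: "sob u U"
  shows "integrable M (\<lambda>x. primitive h (norm (U x) powr p))"
proof -
  obtain B where B: "B > 0" "\<And>t. t \<ge> 0 \<Longrightarrow> \<bar>h t\<bar> \<le> B" using h(4) unfolding bounded_pos by auto
  have b: "\<bar>primitive h s\<bar> \<le> B * s" if "s \<ge> 0" for s
  proof (cases "s = 0")
    case True
    then show ?thesis using primitive_props(1)[OF h(2)] by simp
  next
    case False
    then have "s > 0" using that by simp
    then obtain r where r: "0 < r" "r < s" "primitive h s = s * h r" by (rule primitive_MVT[OF h(2)])
    then show ?thesis using B(2)[of r] that by (simp add: abs_mult mult.commute mult_left_mono)
  qed
  show ?thesis
  proof (rule Bochner_Integration.integrable_bound)
    show "integrable M (\<lambda>x. B * norm (U x) powr p)" using u by (intro integrable_mult_right Lp_int) (simp add: sob_def)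
    show "AE x in M. norm (primitive h (norm (U x) powr p)) \<le> norm (B * norm (U x) powr p)"
      by (intro AE_I2) (simp add: order_trans[OF b abs_ge_self])
    \<comment> \<open>\<open>max 0\<close> extends the primitive continuously to the whole line,
      which gives measurability without changing its values at powers of norms.\<close>
    have c: "continuous_on UNIV (\<lambda>s. primitive h (max 0 s))"
      by (intro continuous_on_compose2[OF primitive_props(2)[OF h(2)]] continuous_intros) auto
    have m: "(\<lambda>x. norm (U x) powr p) \<in> borel_measurable M" using sob_meas(2)[OF u] by measurable
    have "(\<lambda>x. primitive h (max 0 (norm (U x) powr p))) \<in> borel_measurable M"
      by (rule measurable_compose[OF m borel_measurable_continuous_onI[OF c]])
    then show "(\<lambda>x. primitive h (norm (U x) powr p)) \<in> borel_measurable M" by simp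
  qed
qed

text \<open>Lets the explicit gradient of the path replace the chosen \<open>weak_gradient\<close>
  inside the energy.\<close>

lemma energy_eq:
  assumes u: "sob u U" "AE x in M. 0 \<le> u x"
  shows "energy \<Omega> p h g u = (LINT x|M. (1 / p) * primitive h (norm (U x) powr p) - primitive (g x) (u x))"
    and "integrable M (\<lambda>x. (1 / p) * primitive h (norm (U x) powr p) - primitive (g x) (u x))"
proof -
  show i: "integrable M (\<lambda>x. (1 / p) * primitive h (norm (U x) powr p) - primitive (g x) (u x))"
    by (intro Bochner_Integration.integrable_diff integrable_mult_right int_H[OF u(1)] int_G[OF u])
  have j: "integrable M (\<lambda>x. (1 / p) * primitive h (norm (weak_gradient \<Omega> u x) powr p) - primitive (g x) (u x))"
    by (intro Bochner_Integration.integrable_diff integrable_mult_right int_H[OF sob_weak_gradient(1)[OF u(1)]] int_G[OF u])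
  show "energy \<Omega> p h g u = (LINT x|M. (1 / p) * primitive h (norm (U x) powr p) - primitive (g x) (u x))"
    unfolding energy_def
  proof (rule integral_cong_AE[OF borel_measurable_integrable[OF j] borel_measurable_integrable[OF i]])
    show "AE x in M. 1 / p * primitive h (norm (weak_gradient \<Omega> u x) powr p) - primitive (g x) (u x)
      = (1 / p) * primitive h (norm (U x) powr p) - primitive (g x) (u x)"
      using sob_weak_gradient(2)[OF u(1)] by eventually_elim simp
  qed
qed

lemma pth_nonneg: "0 \<le> pth q t a b" by (simp add: pth_def)

text \<open>\<open>d\<close> is the pointwise convexity defect of the integrand. It is nonnegative
  almost everywhere, so it vanishes if its integral is not positive. Its gradient part
  \<open>X\<close> then vanishes as well, which gives the equalities of norms; from the part with
  \<open>g\<close> only the sign is used.\<close>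

lemma energy_pth:
  assumes u: "sob u U" "AE x in M. 0 \<le> u x" and v: "sob v V" "AE x in M. 0 \<le> v x" and t: "0 < t" "t < 1"
  shows "energy \<Omega> p h g (\<lambda>x. pth q t (u x) (v x)) \<le> (1 - t) * energy \<Omega> p h g u + t * energy \<Omega> p h g v"
    and "(1 - t) * energy \<Omega> p h g u + t * energy \<Omega> p h g v \<le> energy \<Omega> p h g (\<lambda>x. pth q t (u x) (v x)) \<Longrightarrow>
      AE x in M. norm (U x) = norm (V x) \<and> norm (pA q t (u x) (v x) *\<^sub>R U x + pB q t (u x) (v x) *\<^sub>R V x) = norm (V x)"
proof -
  define w where "w x = pth q t (u x) (v x)" for x
  define W where "W x = pA q t (u x) (v x) *\<^sub>R U x + pB q t (u x) (v x) *\<^sub>R V x" for x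
  have w: "sob w W" "AE x in M. 0 \<le> w x"
    using sob_pth(1)[OF q(1) t u(1) v(1)] by (simp_all add: w_def[abs_def] W_def[abs_def] pth_nonneg)
  define e where "e y Y x = (1 / p) * primitive h (norm (Y x) powr p) - primitive (g x) (y x)" for y and Y :: "'a \<Rightarrow> 'a" and x
  have eq: "energy \<Omega> p h g y = (LINT x|M. e y Y x)" "integrable M (e y Y)" if "sob y Y" "AE x in M. 0 \<le> y x" for y Y
    using energy_eq[OF that] unfolding e_def[abs_def] by auto
  define d where "d x = ((1 - t) * e u U x + t * e v V x) - e w W x" for x
  have di: "integrable M d" unfolding d_def
    by (intro Bochner_Integration.integrable_diff Bochner_Integration.integrable_add integrable_mult_right eq(2) u v w)
  have dI: "(LINT x|M. d x) = ((1 - t) * energy \<Omega> p h g u + t * energy \<Omega> p h g v) - energy \<Omega> p h g w"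
    unfolding d_def eq(1)[OF u] eq(1)[OF v] eq(1)[OF w] using eq(2)[OF u] eq(2)[OF v] eq(2)[OF w] by simp
  have main: "AE x in M. 0 \<le> d x \<and> (d x \<le> 0 \<longrightarrow> norm (U x) = norm (V x) \<and> norm (W x) = norm (V x))"
    using good u(2) v(2)
  proof eventually_elim
    case (elim x)
    have G: "(1 - t) * primitive (g x) (u x) + t * primitive (g x) (v x) \<le> primitive (g x) (w x)"
      unfolding w_def using elim q t by (intro primitive_pth_ge) auto
    have n: "norm (W x) powr q \<le> (1 - t) * norm (U x) powr q + t * norm (V x) powr q"
      unfolding W_def using elim by (intro pth_gradient_le q t) auto
    note H = strongly_convex_primitive[OF h(1,2,3) q norm_ge_zero norm_ge_zero norm_ge_zero n t]
    define X where "X = (1 - t) * primitive h (norm (U x) powr p) + t * primitive h (norm (V x) powr p) - primitive h (norm (W x) powr p)"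
    have dx: "d x = (1 / p) * X + (primitive (g x) (w x) - ((1 - t) * primitive (g x) (u x) + t * primitive (g x) (v x)))"
    proof -
      have "((1 - t) * (c * A - B) + t * (c * A' - B')) - (c * A'' - B'') = c * ((1 - t) * A + t * A' - A'') + (B'' - ((1 - t) * B + t * B'))"
        for c A B A' B' A'' B'' :: real by (simp add: algebra_simps)
      then show ?thesis unfolding d_def e_def X_def .
    qed
    have X0: "0 \<le> X" using H(1) by (simp add: X_def)
    have pX: "0 \<le> (1 / p) * X" using X0 p by simp
    show ?case
    proof (intro conjI impI)
      show "0 \<le> d x" using dx pX G by linarith
    next
      assume "d x \<le> 0"
      then have "(1 / p) * X \<le> 0" using dx G by linarith
      then have "X \<le> 0" using p by (simp add: divide_le_0_iff)
      then have "norm (W x) = norm (U x) \<and> norm (W x) = norm (V x)" by (intro H(2)) (simp_all add: X_def)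
      then show "norm (U x) = norm (V x)" "norm (W x) = norm (V x)" by simp_all
    qed
  qed
  have d0: "AE x in M. 0 \<le> d x" using main by eventually_elim simp
  show "energy \<Omega> p h g (\<lambda>x. pth q t (u x) (v x)) \<le> (1 - t) * energy \<Omega> p h g u + t * energy \<Omega> p h g v"
    using integral_nonneg_AE[OF d0] unfolding dI by (simp add: w_def[abs_def])
  assume "(1 - t) * energy \<Omega> p h g u + t * energy \<Omega> p h g v \<le> energy \<Omega> p h g (\<lambda>x. pth q t (u x) (v x))"
  then have "(LINT x|M. d x) \<le> 0" unfolding dI by (simp add: w_def[abs_def])
  then have "(LINT x|M. d x) = 0" using integral_nonneg_AE[OF d0] by linarith
  then have "AE x in M. d x = 0" using integral_nonneg_eq_0_iff_AE[OF di d0] by simp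
  then show "AE x in M. norm (U x) = norm (V x) \<and> norm (pA q t (u x) (v x) *\<^sub>R U x + pB q t (u x) (v x) *\<^sub>R V x) = norm (V x)"
    using main unfolding W_def by eventually_elim simp
qed

text \<open>At equality along the path the gradients coincide, so the difference of the two functions is
  constant; a nonzero constant forces both gradients to vanish.\<close>

lemma rigidity:
  assumes u: "sob u U" "AE x in M. 0 \<le> u x" and v: "sob v V" "AE x in M. 0 \<le> v x"
    and le: "energy \<Omega> p h g u \<le> energy \<Omega> p h g (\<lambda>x. pth q (1/2) (u x) (v x))"
      "energy \<Omega> p h g v \<le> energy \<Omega> p h g (\<lambda>x. pth q (1/2) (u x) (v x))"
  shows "same_class \<Omega> u v \<or> (\<exists>c d. (AE x in M. u x = c) \<and> (AE x in M. v x = d))"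
proof -
  have "(1 - 1/2) * energy \<Omega> p h g u + 1/2 * energy \<Omega> p h g v \<le> energy \<Omega> p h g (\<lambda>x. pth q (1/2) (u x) (v x))"
    using le by simp
  from energy_pth(2)[OF u v _ _ this]
  have "AE x in M. norm (U x) = norm (V x) \<and> norm (pA q (1/2) (u x) (v x) *\<^sub>R U x + pB q (1/2) (u x) (v x) *\<^sub>R V x) = norm (V x)" by simp
  then have UV: "AE x in M. U x = V x \<and> (u x = v x \<or> U x = 0)"
    using u(2) v(2)
  proof eventually_elim
    case (elim x)
    show ?case using pth_gradient_eq[OF q(1) elim(2,3) conjunct1[OF elim(1)] conjunct2[OF elim(1)]] by blast
  qed
  have const: "\<exists>c. AE x in M. y x = c" if "sob y Y" "AE x in M. Y x = 0" for y Y
    using zero_weak_gradient_constant[OF \<Omega>(1) conn _ that(2)] that(1) by (simp add: sob_def)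
  have "AE x in M. U x - V x = 0" using UV by eventually_elim simp
  from const[OF sob_diff[OF u(1) v(1)] this] obtain c where c: "AE x in M. u x - v x = c" by blast
  show ?thesis
  proof (cases "c = 0")
    case True
    have "AE x in M. u x = v x" using c by eventually_elim (simp add: True)
    then show ?thesis by (simp add: same_class_def)
  next
    case False
    have "AE x in M. U x = 0" using UV c by eventually_elim (use False in auto)
    moreover have "AE x in M. V x = 0" using UV c by eventually_elim (use False in auto)
    ultimately show ?thesis using const[OF u(1)] const[OF v(1)] by blast
  qed
qed

end

section \<open>Comparison of strongly positive functions\<close>

text \<open>If no constant worked, points violating the bound with factors \<open>Suc n\<close>
  would accumulate at a point of the closure, near which the bound holds with a fixed
  factor.\<close>

lemma bounded_local_ratio:
  fixes u v :: "'a::euclidean_space \<Rightarrow> real"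
  assumes S: "bounded S" and u: "\<And>x. x \<in> S \<Longrightarrow> 0 \<le> u x"
    and loc: "\<And>x0. x0 \<in> closure S \<Longrightarrow> \<exists>D e. e > 0 \<and> (\<forall>x\<in>S. dist x x0 < e \<longrightarrow> v x \<le> D * u x)"
  shows "\<exists>D\<ge>1. \<forall>x\<in>S. v x \<le> D * u x"
proof (rule ccontr)
  assume "\<not> ?thesis"
  then have "\<forall>n. \<exists>x\<in>S. v x > real (Suc n) * u x"
    by (metis not_le of_nat_1 of_nat_mono Suc_le_mono le0 One_nat_def)
  then obtain f where f: "\<And>n. f n \<in> S" "\<And>n. v (f n) > real (Suc n) * u (f n)" by metis
  have "compact (closure S)" using S by simp
  then obtain x0 r where r: "x0 \<in> closure S" "strict_mono (r :: nat \<Rightarrow> nat)" "(f \<circ> r) \<longlonglongrightarrow> x0"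
    using f(1) closure_subset unfolding compact_def by (metis subsetD)
  obtain D e where D: "e > 0" "\<And>x. x \<in> S \<Longrightarrow> dist x x0 < e \<Longrightarrow> v x \<le> D * u x" using loc[OF r(1)] by blast
  obtain n0 where n0: "\<And>n. n \<ge> n0 \<Longrightarrow> dist ((f \<circ> r) n) x0 < e" using r(3) D(1) unfolding lim_sequentially by blast
  obtain n1 where n1: "D \<le> real n1" using real_arch_simple by blast
  define n where "n = max n0 n1"
  have "v (f (r n)) \<le> D * u (f (r n))" using n0[of n] f(1) by (intro D(2)) (auto simp: n_def)
  also have "\<dots> \<le> real (Suc (r n)) * u (f (r n))"
  proof (rule mult_right_mono)
    have "n1 \<le> r n" using seq_suble[OF r(2), of n] by (simp add: n_def)
    then show "D \<le> real (Suc (r n))" using n1 by linarith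
  qed (use u f in blast)
  finally show False using f(2)[of "r n"] by linarith
qed

lemma local_ratio_interior:
  fixes u v :: "'a::metric_space \<Rightarrow> real"
  assumes c: "continuous_on S u" "continuous_on S v" and x0: "x0 \<in> S" "u x0 > 0"
  shows "\<exists>D e. e > 0 \<and> (\<forall>x\<in>S. dist x x0 < e \<longrightarrow> v x \<le> D * u x)"
proof -
  obtain e1 where e1: "e1 > 0" "\<And>x. x \<in> S \<Longrightarrow> dist x x0 < e1 \<Longrightarrow> dist (u x) (u x0) < u x0 / 2"
    using c(1) x0 unfolding continuous_on_iff by (metis half_gt_zero)
  obtain e2 where e2: "e2 > 0" "\<And>x. x \<in> S \<Longrightarrow> dist x x0 < e2 \<Longrightarrow> dist (v x) (v x0) < 1"
    using c(2) x0 unfolding continuous_on_iff by (metis zero_less_one)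
  define D where "D = (\<bar>v x0\<bar> + 1) / (u x0 / 2)"
  have "v x \<le> D * u x" if x: "x \<in> S" "dist x x0 < min e1 e2" for x
  proof -
    have a: "u x > u x0 / 2" "v x < \<bar>v x0\<bar> + 1" using e1(2)[of x] e2(2)[of x] x by (auto simp: dist_real_def abs_if split: if_splits)
    have "v x \<le> D * (u x0 / 2)" using a(2) x0 by (simp add: D_def)
    also have "\<dots> \<le> D * u x" using a(1) x0 by (intro mult_left_mono) (auto simp: D_def)
    finally show ?thesis .
  qed
  then show ?thesis using e1(1) e2(1) by (intro exI[of _ D] exI[of _ "min e1 e2"]) auto
qed

lemma first_exit:
  fixes x :: "'a::real_normed_vector"
  assumes \<Omega>: "open \<Omega>" and x: "x \<in> \<Omega>" and s: "0 \<le> s" "x + s *\<^sub>R \<nu> \<notin> \<Omega>"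
  obtains s1 where "0 < s1" "s1 \<le> s" "x + s1 *\<^sub>R \<nu> \<in> frontier \<Omega>" "\<And>t. 0 \<le> t \<Longrightarrow> t < s1 \<Longrightarrow> x + t *\<^sub>R \<nu> \<in> \<Omega>"
    "\<And>t. t \<in> {0..s1} \<Longrightarrow> x + t *\<^sub>R \<nu> \<in> closure \<Omega>"
proof -
  define T where "T = {t \<in> {0..s}. x + t *\<^sub>R \<nu> \<in> - \<Omega>}"
  have c: "continuous_on A (\<lambda>t. x + t *\<^sub>R \<nu>)" for A :: "real set" by (intro continuous_intros)
  have "closed ({0..s} \<inter> (\<lambda>t. x + t *\<^sub>R \<nu>) -` (- \<Omega>))"
    using \<Omega> by (intro continuous_closed_preimage c) auto
  moreover have "{0..s} \<inter> (\<lambda>t. x + t *\<^sub>R \<nu>) -` (- \<Omega>) = T" by (auto simp: T_def)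
  ultimately have T: "closed T" "T \<noteq> {}" "bdd_below T" using s by (auto simp: T_def bdd_below_def intro: exI[of _ 0])
  define s1 where "s1 = Inf T"
  have s1T: "s1 \<in> T" unfolding s1_def by (rule closed_contains_Inf[OF T(2,3,1)])
  have lt: "x + t *\<^sub>R \<nu> \<in> \<Omega>" if "0 \<le> t" "t < s1" for t
  proof (rule ccontr)
    assume "x + t *\<^sub>R \<nu> \<notin> \<Omega>"
    then have "t \<in> T" using that s1T by (auto simp: T_def)
    then have "s1 \<le> t" unfolding s1_def using T(3) by (rule cInf_lower)
    then show False using that by simp
  qed
  have s1p: "0 < s1"
  proof (rule ccontr)
    assume "\<not> 0 < s1"
    then have "s1 = 0" using s1T by (auto simp: T_def)
    then show False using s1T x by (simp add: T_def)
  qed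
  have cl: "x + t *\<^sub>R \<nu> \<in> closure \<Omega>" if "t \<in> {0..s1}" for t
  proof -
    have "(\<lambda>t. x + t *\<^sub>R \<nu>) ` closure {0..<s1} \<subseteq> closure \<Omega>"
      by (rule image_closure_subset[OF c closed_closure]) (auto intro!: subsetD[OF closure_subset] lt)
    moreover have "closure {0..<s1} = {0..s1}" using s1p by simp
    ultimately show ?thesis using that by blast
  qed
  have "x + s1 *\<^sub>R \<nu> \<in> frontier \<Omega>" using cl[of s1] s1T s1p \<Omega> by (simp add: frontier_def interior_open T_def)
  then show ?thesis using that s1p s1T lt cl by (auto simp: T_def)
qed

text \<open>Moving from a point near the boundary along the outward normal until the first exit from
  \<open>\<Omega>\<close>, both functions decrease to zero, \<open>u\<close> at a definite rate and \<open>v\<close> at a bounded rate.\<close>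

lemma local_ratio_boundary:
  assumes \<Omega>: "open \<Omega>" and bd: "\<forall>x\<in>frontier \<Omega>. \<exists>U \<rho>. x \<in> U \<and> local_defining_function \<Omega> U \<rho>"
    and u: "C1_closure \<Omega> u Du" "\<forall>x\<in>frontier \<Omega>. u x = 0" and v: "C1_closure \<Omega> v Dv" "\<forall>x\<in>frontier \<Omega>. v x = 0"
    and x0: "x0 \<in> frontier \<Omega>" and neg: "Du x0 \<bullet> outward_normal \<Omega> x0 < 0"
  shows "\<exists>D e. e > 0 \<and> (\<forall>x\<in>\<Omega>. dist x x0 < e \<longrightarrow> v x \<le> D * u x)"
proof -
  define \<nu> where "\<nu> = outward_normal \<Omega> x0"
  obtain U0 \<rho>0 where U0: "x0 \<in> U0" "local_defining_function \<Omega> U0 \<rho>0" using bspec[OF bd x0] by (elim exE conjE)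
  \<comment> \<open>Existence of one such normal allows the choice in \<open>outward_normal\<close>
    to be opened: \<open>\<nu>\<close> is the normalized gradient of some local defining
    function.\<close>
  have "\<exists>n U \<rho> D. x0 \<in> U \<and> local_defining_function \<Omega> U \<rho> \<and> GDERIV \<rho> x0 :> D \<and> n = D /\<^sub>R norm D"
    by (intro exI[of _ "grad \<rho>0 x0 /\<^sub>R norm (grad \<rho>0 x0)"] exI[of _ U0] exI[of _ \<rho>0] exI[of _ "grad \<rho>0 x0"] conjI U0
        local_defining_function_gradient(1)[OF U0(2,1)] refl)
  from someI_ex[OF this] have "\<exists>U \<rho> D. x0 \<in> U \<and> local_defining_function \<Omega> U \<rho> \<and> GDERIV \<rho> x0 :> D \<and> \<nu> = D /\<^sub>R norm D"
    unfolding \<nu>_def outward_normal_def .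
  then obtain U \<rho> D where U: "x0 \<in> U" "local_defining_function \<Omega> U \<rho>" "GDERIV \<rho> x0 :> D" "\<nu> = D /\<^sub>R norm D"
    by (elim exE conjE)
  have oU: "open U" and \<Omega>U: "\<Omega> \<inter> U = {y\<in>U. \<rho> y < 0}" and sm: "smooth_on U \<rho>"
    using U(2) by (auto simp: local_defining_function_def)
  note gr = local_defining_function_gradient[OF U(2)]
  have D: "D = grad \<rho> x0" "D \<noteq> 0" using gr[OF U(1)] GDERIV_unique[OF U(3)] by auto
  have n1: "norm \<nu> = 1" using U(4) D(2) by simp
  have "\<nu> \<bullet> D = norm D" using U(4) D(2) by (simp add: dot_square_norm power2_eq_square)
  then have nD: "0 < \<nu> \<bullet> D" using D(2) by simp
  define k where "k = \<nu> \<bullet> D / 2"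
  have k: "k > 0" using nD by (simp add: k_def)
  have "continuous (at x0) (grad \<rho>)"
    using smooth_on_grad_continuous[OF sm] oU U(1) continuous_on_eq_continuous_at by blast
  then have "continuous (at x0) (\<lambda>y. \<nu> \<bullet> grad \<rho> y)" by (intro continuous_intros)
  then obtain d1 where d1: "d1 > 0" "\<And>y. dist y x0 < d1 \<Longrightarrow> dist (\<nu> \<bullet> grad \<rho> y) (\<nu> \<bullet> D) < k"
    using k unfolding continuous_at_eps_delta D(1) by blast
  obtain d2 where d2: "d2 > 0" "ball x0 d2 \<subseteq> U" using oU U(1) open_contains_ball by blast
  have x0c: "x0 \<in> closure \<Omega>" "x0 \<notin> \<Omega>" using x0 \<Omega> by (auto simp: frontier_def interior_open)
  define c where "c = - (Du x0 \<bullet> \<nu>) / 2"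
  have c: "c > 0" using neg by (simp add: c_def \<nu>_def)
  have "continuous_on (closure \<Omega>) (\<lambda>y. Du y \<bullet> \<nu>)" using u(1) unfolding C1_closure_def by (intro continuous_intros) auto
  then obtain d3 where d3: "d3 > 0" "\<And>y. y \<in> closure \<Omega> \<Longrightarrow> dist y x0 < d3 \<Longrightarrow> dist (Du y \<bullet> \<nu>) (Du x0 \<bullet> \<nu>) < c"
    using c x0c(1) unfolding continuous_on_iff by blast
  have "continuous_on (closure \<Omega>) (\<lambda>y. Dv y \<bullet> \<nu>)" using v(1) unfolding C1_closure_def by (intro continuous_intros) auto
  then obtain d4 where d4: "d4 > 0" "\<And>y. y \<in> closure \<Omega> \<Longrightarrow> dist y x0 < d4 \<Longrightarrow> dist (Dv y \<bullet> \<nu>) (Dv x0 \<bullet> \<nu>) < 1"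
    using x0c(1) unfolding continuous_on_iff by (metis zero_less_one)
  define B where "B = \<bar>Dv x0 \<bullet> \<nu>\<bar> + 1"
  \<comment> \<open>In this ball, moving along \<open>\<nu>\<close> raises \<open>\<rho>\<close> at
    rate at least \<open>k\<close>; within the closure of \<open>\<Omega>\<close> it lowers
    \<open>u\<close> at rate at least \<open>c\<close> and \<open>v\<close> at rate at most
    \<open>B\<close>.\<close>
  define d where "d = min (min d1 d2) (min d3 d4)"
  have d: "d > 0" using d1 d2 d3 d4 by (simp add: d_def)
  have Drho: "\<nu> \<bullet> grad \<rho> y \<ge> k" if "y \<in> ball x0 d" for y
    using d1(2)[of y] that by (auto simp: d_def dist_commute k_def dist_real_def abs_if split: if_splits)
  have DU: "Du y \<bullet> \<nu> \<le> - c" if "y \<in> closure \<Omega>" "y \<in> ball x0 d" for y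
    using d3(2)[of y] that by (auto simp: d_def dist_commute c_def dist_real_def abs_if split: if_splits)
  have DV: "Dv y \<bullet> \<nu> \<ge> - B" if "y \<in> closure \<Omega>" "y \<in> ball x0 d" for y
    using d4(2)[of y] that by (auto simp: d_def dist_commute B_def dist_real_def abs_if split: if_splits)
  have "isCont \<rho> x0" using gr(1)[OF U(1)] GDERIV_continuous by blast
  moreover have "\<rho> x0 \<ge> 0" using x0c(2) U(1) \<Omega>U by force
  \<comment> \<open>Within \<open>d5\<close> of \<open>x0\<close> the value of \<open>\<rho>\<close>
    exceeds \<open>- (k * (d / 2))\<close>, so a walk of length \<open>d / 2\<close> along
    \<open>\<nu>\<close> ends where \<open>\<rho>\<close> is positive, outside
    \<open>\<Omega>\<close>.\<close>
  ultimately obtain d5 where d5: "d5 > 0" "\<And>y. dist y x0 < d5 \<Longrightarrow> dist (\<rho> y) (\<rho> x0) < k * (d / 2)"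
    using k d unfolding continuous_at_eps_delta by (metis half_gt_zero mult_pos_pos)
  have main: "v x \<le> (B / c) * u x" if x: "x \<in> \<Omega>" "dist x x0 < min (d / 2) d5" for x
  proof -
    have seg: "x + t *\<^sub>R \<nu> \<in> ball x0 d" if "t \<in> {0..d/2}" for t
    proof -
      have "dist (x + t *\<^sub>R \<nu>) x0 \<le> dist x x0 + norm (t *\<^sub>R \<nu>)" by (metis add_diff_cancel_left' add.commute dist_norm dist_triangle)
      also have "\<dots> < d" using x(2) that n1 by simp
      finally show ?thesis by (simp add: dist_commute)
    qed
    have bU: "ball x0 d \<subseteq> U" using d2 by (auto simp: d_def)
    have "\<rho> ((x + (d/2) *\<^sub>R \<nu>) + (d/2) *\<^sub>R (- \<nu>)) \<le> \<rho> (x + (d/2) *\<^sub>R \<nu>) + (- k) * (d/2)"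
    proof (rule nonincreasing_along[where S = "ball x0 d" and G = "grad \<rho>"])
      show "GDERIV \<rho> y :> grad \<rho> y" if "y \<in> ball x0 d" for y using gr(1) that bU by blast
      show "(x + (d/2) *\<^sub>R \<nu>) + t *\<^sub>R (- \<nu>) \<in> ball x0 d" if "t \<in> {0..d/2}" for t
        using seg[of "d/2 - t"] that by (simp add: scaleR_left_diff_distrib add_diff_eq)
      show "- \<nu> \<bullet> grad \<rho> y \<le> - k" if "y \<in> ball x0 d" for y using Drho[OF that] by simp
    qed (use d in simp)
    then have "\<rho> x + k * (d/2) \<le> \<rho> (x + (d/2) *\<^sub>R \<nu>)" by simp
    moreover have "\<rho> x > - (k * (d/2))" using d5(2)[of x] x(2) \<open>\<rho> x0 \<ge> 0\<close> by (auto simp: dist_real_def abs_if split: if_splits)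
    ultimately have "\<rho> (x + (d/2) *\<^sub>R \<nu>) > 0" by linarith
    moreover have "x + (d/2) *\<^sub>R \<nu> \<in> U" using seg[of "d/2"] bU d by auto
    ultimately have "x + (d/2) *\<^sub>R \<nu> \<notin> \<Omega>" using \<Omega>U by force
    then obtain s where s: "0 < s" "s \<le> d/2" "x + s *\<^sub>R \<nu> \<in> frontier \<Omega>" "\<And>t. 0 \<le> t \<Longrightarrow> t < s \<Longrightarrow> x + t *\<^sub>R \<nu> \<in> \<Omega>"
      "\<And>t. t \<in> {0..s} \<Longrightarrow> x + t *\<^sub>R \<nu> \<in> closure \<Omega>"
      using first_exit[OF \<Omega> x(1), of "d/2" \<nu>] d by (metis half_gt_zero less_imp_le)
    have mvt: "\<exists>y. y \<in> closure \<Omega> \<and> y \<in> ball x0 d \<and> f x = - s * (E y \<bullet> \<nu>)" if f: "C1_closure \<Omega> f E" "\<forall>x\<in>frontier \<Omega>. f x = 0" for f E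
    proof -
      have der: "DERIV (\<lambda>t. f (x + t *\<^sub>R \<nu>)) t :> E (x + t *\<^sub>R \<nu>) \<bullet> \<nu>" if t: "0 < t" "t < s" for t
      proof -
        have "GDERIV f (x + t *\<^sub>R \<nu>) :> E (x + t *\<^sub>R \<nu>)" using f(1) s(4)[of t] t by (simp add: C1_closure_def)
        then have a: "(f has_derivative (\<lambda>h. h \<bullet> E (x + t *\<^sub>R \<nu>))) (at (x + t *\<^sub>R \<nu>))" by (simp add: gderiv_def)
        have "((\<lambda>t. x + t *\<^sub>R \<nu>) has_derivative (\<lambda>h. 0 + h *\<^sub>R \<nu>)) (at t)"
          by (intro has_derivative_add has_derivative_const has_derivative_scaleR_left has_derivative_ident)
        then have b: "((\<lambda>t. x + t *\<^sub>R \<nu>) has_derivative (\<lambda>h. h *\<^sub>R \<nu>)) (at t)" by simp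
        show ?thesis unfolding has_field_derivative_def
          using has_derivative_compose[OF b a] by (simp add: mult_commute_abs inner_commute)
      qed
      have cf: "continuous_on {0..s} (\<lambda>t. f (x + t *\<^sub>R \<nu>))"
      proof (rule continuous_on_compose2[of "closure \<Omega>" f "{0..s}" "\<lambda>t. x + t *\<^sub>R \<nu>"])
        show "continuous_on (closure \<Omega>) f" using f(1) unfolding C1_closure_def by (elim conjE)
        show "continuous_on {0..s} (\<lambda>t. x + t *\<^sub>R \<nu>)" by (intro continuous_intros)
        show "(\<lambda>t. x + t *\<^sub>R \<nu>) ` {0..s} \<subseteq> closure \<Omega>" by (intro image_subsetI s(5))
      qed
      have dd: "(\<lambda>t. f (x + t *\<^sub>R \<nu>)) differentiable (at t)" if "0 < t" "t < s" for t
        using der[OF that] real_differentiable_def by blast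
      have "\<exists>l t. 0 < t \<and> t < s \<and> DERIV (\<lambda>t. f (x + t *\<^sub>R \<nu>)) t :> l \<and> f (x + s *\<^sub>R \<nu>) - f (x + 0 *\<^sub>R \<nu>) = (s - 0) * l"
        by (rule MVT[OF s(1) cf dd])
      then obtain l t where t: "0 < t" "t < s" "DERIV (\<lambda>t. f (x + t *\<^sub>R \<nu>)) t :> l"
        "f (x + s *\<^sub>R \<nu>) - f (x + 0 *\<^sub>R \<nu>) = (s - 0) * l" by (elim exE conjE)
      have "l = E (x + t *\<^sub>R \<nu>) \<bullet> \<nu>" using DERIV_unique[OF t(3) der[OF t(1,2)]] .
      then have "f x = - s * (E (x + t *\<^sub>R \<nu>) \<bullet> \<nu>)" using t(4) f(2) s(3) by simp
      moreover have "x + t *\<^sub>R \<nu> \<in> closure \<Omega>" "x + t *\<^sub>R \<nu> \<in> ball x0 d" using s(5)[of t] seg[of t] t(1,2) s(2) by auto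
      ultimately show ?thesis by blast
    qed
    obtain y where y: "y \<in> closure \<Omega>" "y \<in> ball x0 d" "u x = - s * (Du y \<bullet> \<nu>)" using mvt[OF u] by blast
    obtain z where z: "z \<in> closure \<Omega>" "z \<in> ball x0 d" "v x = - s * (Dv z \<bullet> \<nu>)" using mvt[OF v] by blast
    have "v x = s * (- (Dv z \<bullet> \<nu>))" using z by simp
    also have "\<dots> \<le> s * B" using DV[OF z(1,2)] s(1) by (intro mult_left_mono) auto
    also have "\<dots> = (B / c) * (s * c)" using c by simp
    also have "\<dots> \<le> (B / c) * u x"
    proof (rule mult_left_mono)
      have "s * c \<le> s * (- (Du y \<bullet> \<nu>))" using DU[OF y(1,2)] s(1) by (intro mult_left_mono) auto
      then show "s * c \<le> u x" using y(3) by simp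
    qed (use c in \<open>simp add: B_def\<close>)
    finally show ?thesis .
  qed
  then show ?thesis using d d5(1) by (intro exI[of _ "B / c"] exI[of _ "min (d / 2) d5"]) auto
qed

lemma strongly_positive_W01p_comparable:
  assumes \<Omega>: "open \<Omega>" "bounded \<Omega>" and bd: "\<forall>x\<in>frontier \<Omega>. \<exists>U \<rho>. x \<in> U \<and> local_defining_function \<Omega> U \<rho>"
    and u: "u \<in> strongly_positive_W01p \<Omega>" and v: "v \<in> strongly_positive_W01p \<Omega>"
  shows "\<exists>D\<ge>1. \<forall>x\<in>\<Omega>. v x \<le> D * u x"
proof -
  obtain Du where Du: "C1_closure \<Omega> u Du" "\<forall>x\<in>frontier \<Omega>. u x = 0" "\<forall>x\<in>\<Omega>. 0 < u x" "\<forall>x\<in>frontier \<Omega>. Du x \<bullet> outward_normal \<Omega> x < 0"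
    using u by (auto simp: strongly_positive_W01p_def)
  obtain Dv where Dv: "C1_closure \<Omega> v Dv" "\<forall>x\<in>frontier \<Omega>. v x = 0" using v by (auto simp: strongly_positive_W01p_def)
  have sub: "\<Omega> \<subseteq> closure \<Omega>" by (rule closure_subset)
  have c: "continuous_on \<Omega> u" "continuous_on \<Omega> v"
    using Du(1) Dv(1) continuous_on_subset[OF _ sub] unfolding C1_closure_def by blast+
  show ?thesis
  proof (rule bounded_local_ratio[OF \<Omega>(2)])
    fix x0 assume x0: "x0 \<in> closure \<Omega>"
    show "\<exists>D e. e > 0 \<and> (\<forall>x\<in>\<Omega>. dist x x0 < e \<longrightarrow> v x \<le> D * u x)"
    proof (cases "x0 \<in> \<Omega>")
      case True
      then show ?thesis using local_ratio_interior[OF c True] Du(3) by blast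
    next
      case False
      then have f: "x0 \<in> frontier \<Omega>" using x0 \<Omega> by (simp add: frontier_def interior_open)
      show ?thesis by (rule local_ratio_boundary[OF \<Omega>(1) bd Du(1,2) Dv f bspec[OF Du(4) f]])
    qed
  qed (use Du(3) in \<open>auto intro: less_imp_le\<close>)
qed

lemma strongly_positive_W1p_comparable:
  assumes \<Omega>: "bounded \<Omega>" and u: "u \<in> strongly_positive_W1p \<Omega>" and v: "v \<in> strongly_positive_W1p \<Omega>"
  shows "\<exists>D\<ge>1. \<forall>x\<in>\<Omega>. v x \<le> D * u x"
proof -
  have c: "continuous_on (closure \<Omega>) u" "continuous_on (closure \<Omega>) v" and pos: "\<And>x. x \<in> closure \<Omega> \<Longrightarrow> 0 < u x"
    using u v by (auto simp: strongly_positive_W1p_def C1_closure_def)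
  have sub: "\<And>x. x \<in> \<Omega> \<Longrightarrow> x \<in> closure \<Omega>" using closure_subset by blast
  show ?thesis
  proof (rule bounded_local_ratio[OF \<Omega>])
    fix x0 assume x0: "x0 \<in> closure \<Omega>"
    show "\<exists>D e. e > 0 \<and> (\<forall>x\<in>\<Omega>. dist x x0 < e \<longrightarrow> v x \<le> D * u x)"
      using local_ratio_interior[OF c x0 pos[OF x0]] sub by blast
  qed (use pos sub in \<open>auto intro: less_imp_le\<close>)
qed

section \<open>Critical points\<close>

text \<open>By homogeneity everything is governed by the ratio \<open>r = b / a\<close>, which is at
  most \<open>D\<close>, through the weighted mean \<open>m\<close> of 1 and
  \<open>r powr q\<close>. This mean is within \<open>s * D powr q\<close> of 1 and at least
  \<open>1/2\<close>, so all deviations are of order \<open>s\<close>. The bound on the ratio is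
  what makes the initial speed of the path finite.\<close>

lemma pth_estimates:
  assumes q: "1 < q" and D: "1 \<le> D" and s: "0 < s" "s \<le> 1/2" and ab: "0 < a" "0 \<le> b" "b \<le> D * a"
  shows "\<bar>pth q s a b - a\<bar> \<le> D powr q * s * a" "\<bar>pA q s a b - 1\<bar> \<le> 3 * D powr q * s" "\<bar>pB q s a b\<bar> \<le> 3 * D powr q * s"
proof -
  define r where "r = b / a"
  have r: "0 \<le> r" "r \<le> D" "b = a * r" using ab by (auto simp: r_def pos_divide_le_eq)
  define E where "E = D powr q"
  have E: "1 \<le> E" using D q by (auto simp: E_def intro: ge_one_powr_ge_zero)
  define m where "m = 1 + s * (r powr q - 1)"
  have rq: "0 \<le> r powr q" "r powr q \<le> E" using r q by (auto simp: E_def intro: powr_mono2)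
  have m1: "\<bar>m - 1\<bar> \<le> s * E"
  proof -
    have "\<bar>m - 1\<bar> = s * \<bar>r powr q - 1\<bar>" using s by (simp add: m_def abs_mult)
    also have "\<dots> \<le> s * E"
    proof (rule mult_left_mono)
      show "\<bar>r powr q - 1\<bar> \<le> E" using rq E by linarith
    qed (use s in simp)
    finally show ?thesis .
  qed
  have mh: "1/2 \<le> m"
  proof -
    have "s * (- 1) \<le> s * (r powr q - 1)" using s rq by (intro mult_left_mono) auto
    then show ?thesis using s by (simp add: m_def)
  qed
  define \<theta> where "\<theta> = 1 / q"
  have \<theta>: "0 < \<theta>" "\<theta> < 1" using q by (auto simp: \<theta>_def)
  \<comment> \<open>A power \<open>\<theta> < 1\<close> moves \<open>m\<close> towards 1 from either
    side, so the distance of \<open>m powr \<theta>\<close> to 1 and to \<open>m\<close> is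
    controlled by that of \<open>m\<close> to 1.\<close>
  have between: "1 \<le> m powr \<theta> \<and> m powr \<theta> \<le> m \<or> m \<le> m powr \<theta> \<and> m powr \<theta> \<le> 1"
  proof (cases "1 \<le> m")
    case True
    then show ?thesis using powr_mono[of \<theta> 1 m] \<theta> by (auto intro: ge_one_powr_ge_zero)
  next
    case False
    have "m powr \<theta> \<le> 1" using False mh \<theta> by (intro powr_le1) auto
    moreover have "m = m powr \<theta> * m powr (1 - \<theta>)" using mh by (simp flip: powr_add)
    moreover have "m powr (1 - \<theta>) \<le> 1" using False mh \<theta> by (intro powr_le1) auto
    ultimately show ?thesis by (metis mult.right_neutral mult_left_mono powr_ge_zero)
  qed
  have sum: "(1 - s) * max 0 a powr q + s * max 0 b powr q = a powr q * m"
    using ab r by (simp add: m_def powr_mult max_def algebra_simps)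
  have P: "pth q s a b = a * m powr \<theta>" unfolding pth_def sum using ab q by (simp add: powr_mult powr_powr \<theta>_def)
  have m\<theta>: "m powr (\<theta> - 1) = m powr \<theta> / m" using mh by (simp add: powr_diff)
  have am: "(a powr q * m) powr (1 / q - 1) = a powr (1 - q) * (m powr \<theta> / m)"
  proof -
    have "q * (1 / q - 1) = 1 - q" using q by (simp add: algebra_simps)
    then show ?thesis unfolding powr_mult powr_powr m\<theta>[symmetric] by (simp add: \<theta>_def)
  qed
  have a1: "a powr (1 - q) * a powr (q - 1) = 1" using ab by (simp flip: powr_add)
  have A: "pA q s a b = (m powr \<theta> / m) * (1 - s)"
  proof -
    have "pA q s a b = (a powr (1 - q) * a powr (q - 1)) * ((m powr \<theta> / m) * (1 - s))"
      unfolding pA_def sum am using ab by (simp add: max_def)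
    then show ?thesis unfolding a1 by simp
  qed
  have B: "pB q s a b = (m powr \<theta> / m) * (s * r powr (q - 1))"
  proof -
    have "pB q s a b = (a powr (1 - q) * a powr (q - 1)) * ((m powr \<theta> / m) * (s * r powr (q - 1)))"
      unfolding pB_def sum am using ab r by (simp add: max_def powr_mult)
    then show ?thesis unfolding a1 by simp
  qed
  have "\<bar>m powr \<theta> - 1\<bar> \<le> s * E" using between m1 by auto
  then have "a * \<bar>m powr \<theta> - 1\<bar> \<le> a * (s * E)" using ab by (intro mult_left_mono) auto
  moreover have "\<bar>pth q s a b - a\<bar> = a * \<bar>m powr \<theta> - 1\<bar>"
  proof -
    have "pth q s a b - a = a * (m powr \<theta> - 1)" by (simp add: P algebra_simps)
    then show ?thesis using ab by (simp add: abs_mult)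
  qed
  ultimately show "\<bar>pth q s a b - a\<bar> \<le> D powr q * s * a" by (simp add: E_def mult_ac)
  have d1: "\<bar>m powr \<theta> / m - 1\<bar> \<le> 2 * (s * E)"
  proof -
    have "\<bar>m powr \<theta> - m\<bar> \<le> s * E" using between m1 by auto
    then have "\<bar>m powr \<theta> - m\<bar> \<le> (s * E) * 1" by simp
    also have "\<dots> \<le> (s * E) * (2 * m)" using mh s E by (intro mult_left_mono) auto
    finally have "\<bar>m powr \<theta> - m\<bar> / m \<le> 2 * (s * E)" using mh by (simp add: pos_divide_le_eq mult_ac)
    moreover have "\<bar>m powr \<theta> / m - 1\<bar> = \<bar>m powr \<theta> - m\<bar> / m"
    proof -
      have "m powr \<theta> / m - 1 = (m powr \<theta> - m) / m" using mh by (simp add: diff_divide_distrib)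
      then show ?thesis using mh by simp
    qed
    ultimately show ?thesis by simp
  qed
  have "\<bar>pA q s a b - 1\<bar> = \<bar>(m powr \<theta> / m - 1) * (1 - s) - s\<bar>" unfolding A by (simp add: algebra_simps)
  also have "\<dots> \<le> \<bar>m powr \<theta> / m - 1\<bar> * (1 - s) + s"
    using abs_triangle_ineq4[of "(m powr \<theta> / m - 1) * (1 - s)" s] s by (simp add: abs_mult)
  also have "\<dots> \<le> 2 * (s * E) * 1 + s * E" using d1 s E by (intro add_mono mult_mono) auto
  finally show "\<bar>pA q s a b - 1\<bar> \<le> 3 * D powr q * s" by (simp add: E_def mult_ac)
  have "m powr \<theta> / m \<le> 2" using between mh by (auto simp: pos_divide_le_eq)
  moreover have "r powr (q - 1) \<le> E"
  proof -
    have "r powr (q - 1) \<le> D powr (q - 1)" using r q by (intro powr_mono2) auto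
    also have "\<dots> \<le> E" unfolding E_def using D by (intro powr_mono) auto
    finally show ?thesis .
  qed
  ultimately have "(m powr \<theta> / m) * (s * r powr (q - 1)) \<le> 2 * (s * E)" using s mh by (intro mult_mono) auto
  moreover have "0 \<le> (m powr \<theta> / m) * (s * r powr (q - 1))" using s mh by simp
  moreover have "0 \<le> s * E" using s E by simp
  moreover have "\<bar>X\<bar> \<le> 3 * Y" if "X \<le> 2 * Y" "0 \<le> X" "0 \<le> Y" for X Y :: real using that by linarith
  ultimately have "\<bar>pB q s a b\<bar> \<le> 3 * (s * E)" unfolding B by blast
  also have "3 * (s * E) = 3 * D powr q * s" by (simp add: E_def)
  finally show "\<bar>pB q s a b\<bar> \<le> 3 * D powr q * s" .
qed

lemma pth_le:
  assumes "1 < q" "0 \<le> a" "a \<le> c" "0 \<le> b" "b \<le> c"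
  shows "pth q (1/2) a b \<le> c"
proof -
  have "a powr q \<le> c powr q" "b powr q \<le> c powr q" using assms by (auto intro!: powr_mono2)
  then have "((1 - 1/2) * max 0 a powr q + 1/2 * max 0 b powr q) powr (1 / q) \<le> (c powr q) powr (1 / q)"
    using assms by (intro powr_mono2) auto
  then show ?thesis using assms by (simp add: pth_def powr_powr)
qed

context energy_domain
begin

lemma pth_mem:
  assumes X: "X = W01p \<Omega> p \<or> X = W1p \<Omega> p" and t: "0 < t" "t < 1" and u: "sob u U" "u \<in> X" and v: "sob v V" "v \<in> X"
  shows "(\<lambda>x. pth q t (u x) (v x)) \<in> X"
  using X
proof
  assume "X = W01p \<Omega> p"
  then show ?thesis using sob_pth(2)[OF q(1) t u(1) v(1)] u(2) v(2) by simp
next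
  assume X: "X = W1p \<Omega> p"
  show ?thesis unfolding X W1p_iff using sob_pth(1)[OF q(1) t u(1) v(1)] by blast
qed

lemma diff_mem:
  assumes X: "X = W01p \<Omega> p \<or> X = W1p \<Omega> p" and u: "sob u U" "u \<in> X" and v: "sob v V" "v \<in> X"
  shows "(\<lambda>x. u x - v x) \<in> X"
  using X
proof
  assume X: "X = W01p \<Omega> p"
  show ?thesis using W01p_C1_two[OF C1_two_diff _ u(1) _ v(1)] u(2) v(2) unfolding X by simp
next
  assume X: "X = W1p \<Omega> p"
  show ?thesis unfolding X W1p_iff using sob_diff[OF u(1) v(1)] by blast
qed

text \<open>The path from \<open>u\<close> to \<open>z\<close> leaves \<open>u\<close> with finite speed because \<open>z \<le> D * u\<close>, and the energy is
  convex along it.\<close>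

lemma critical_le:
  assumes X: "X = W01p \<Omega> p \<or> X = W1p \<Omega> p"
    and crit: "critical_point X (W1p_norm \<Omega> p) (energy \<Omega> p h g) u" and u: "sob u U" "AE x in M. 0 < u x"
    and z: "sob z Z" "z \<in> X" "AE x in M. 0 \<le> z x \<and> z x \<le> D * u x" and D: "1 \<le> D"
  shows "energy \<Omega> p h g u \<le> energy \<Omega> p h g z"
proof (rule ccontr)
  assume neg: "\<not> ?thesis"
  define J where "J = energy \<Omega> p h g"
  define \<delta> where "\<delta> = J u - J z"
  have \<delta>: "\<delta> > 0" using neg by (simp add: \<delta>_def J_def)
  have uX: "u \<in> X" using crit by (simp add: critical_point_def)
  have u0: "AE x in M. 0 \<le> u x" using u(2) by eventually_elim simp
  have z0: "AE x in M. 0 \<le> z x" using z(3) by eventually_elim simp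
  define E where "E = D powr q"
  have E: "1 \<le> E" using D q by (auto simp: E_def intro: ge_one_powr_ge_zero)
  have LUZ: "Lp_fun \<Omega> p U" "Lp_fun \<Omega> p Z" "Lp_fun \<Omega> p u" using u(1) z(1) by (auto simp: sob_def)
  \<comment> \<open>The gradient of the path differs from \<open>U\<close> by small multiples of
    both \<open>U\<close> and \<open>Z\<close>, so both enter the majorant.\<close>
  define Y where "Y x = norm (U x) + norm (Z x)" for x
  have mY: "Y \<in> borel_measurable M" unfolding Y_def using Lp_meas[OF LUZ(1)] Lp_meas[OF LUZ(2)] by measurable
  have LY: "Lp_fun \<Omega> p Y" by (rule Lp_bound(1)[OF LUZ(1,2) mY zero_le_one]) (simp add: Y_def)
  define R where "R = ps u + ps Y"
  have R: "R \<ge> 0" unfolding R_def using ps_nonneg[of u] ps_nonneg[of Y] by simp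
  \<comment> \<open>Bounds the speed of the path in the Sobolev norm: at parameter \<open>s\<close>
    the distance from \<open>u\<close> is below \<open>K * s\<close>. Adding 1 to \<open>R\<close>
    makes this strict and \<open>K\<close> positive.\<close>
  define K where "K = 3 * E * (R + 1) powr (1 / p)"
  have K: "K > 0" using E R by (simp add: K_def)
  have ps_le: "ps f \<le> c powr p * ps y"
    if "f \<in> borel_measurable M" "Lp_fun \<Omega> p y" "AE x in M. norm (f x) \<le> c * norm (y x)" "c \<ge> 0"
    for f :: "'a \<Rightarrow> 'b::euclidean_space" and y :: "'a \<Rightarrow> 'c::euclidean_space" and c
  proof -
    have ae: "AE x in M. norm (f x) powr p \<le> c powr p * norm (y x) powr p" using that(3)
    proof eventually_elim
      case (elim x)
      have "norm (f x) powr p \<le> (c * norm (y x)) powr p" using elim p by (intro powr_mono2) auto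
      then show ?case by (simp add: powr_mult)
    qed
    have i: "integrable M (\<lambda>x. c powr p * norm (y x) powr p)" using Lp_int[OF that(2)] by simp
    have j: "integrable M (\<lambda>x. norm (f x) powr p)"
      by (rule Bochner_Integration.integrable_bound[OF i]) (use that(1) ae in \<open>auto elim: eventually_mono\<close>)
    have "ps f \<le> (LINT x|M. c powr p * norm (y x) powr p)" unfolding ps_def by (rule integral_mono_AE[OF j i ae])
    then show ?thesis by (simp add: ps_def)
  qed
  \<comment> \<open>With this \<open>\<epsilon>\<close> the Frechet remainder at distance
    \<open>K * s\<close> is at most half of the drop \<open>\<delta> * s\<close> that convexity
    forces.\<close>
  define \<epsilon> where "\<epsilon> = \<delta> / (2 * K)"
  have \<epsilon>: "\<epsilon> > 0" using \<delta> K by (simp add: \<epsilon>_def)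
  have "\<exists>d>0. \<forall>v\<in>X. W1p_norm \<Omega> p v < d \<longrightarrow> \<bar>J (\<lambda>x. u x + v x) - J u - 0\<bar> \<le> \<epsilon> * W1p_norm \<Omega> p v"
    using crit \<epsilon> unfolding critical_point_def has_frechet_derivative_on_def J_def by blast
  then obtain d where d: "d > 0" "\<And>v. v \<in> X \<Longrightarrow> W1p_norm \<Omega> p v < d \<Longrightarrow> \<bar>J (\<lambda>x. u x + v x) - J u - 0\<bar> \<le> \<epsilon> * W1p_norm \<Omega> p v"
    by blast
  \<comment> \<open>The bound \<open>1/2\<close> is for \<open>pth_estimates\<close>, and
    \<open>d / K\<close> keeps the step inside the neighbourhood where the Frechet estimate
    holds.\<close>
  define s where "s = min (1/2) (d / K)"
  have s: "0 < s" "s \<le> 1/2" "K * s \<le> d" using d(1) K by (auto simp: s_def min_def field_simps)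
  have s1: "s < 1" using s by simp
  define w where "w x = pth q s (u x) (z x)" for x
  define W where "W x = pA q s (u x) (z x) *\<^sub>R U x + pB q s (u x) (z x) *\<^sub>R Z x" for x
  have sw: "sob w W" unfolding w_def[abs_def] W_def[abs_def] by (rule sob_pth(1)[OF q(1) s(1) s1 u(1) z(1)])
  have wX: "w \<in> X" unfolding w_def[abs_def] by (rule pth_mem[OF X s(1) s1 u(1) uX z(1,2)])
  define v where "v x = w x - u x" for x
  have sv: "sob v (\<lambda>x. W x - U x)" unfolding v_def[abs_def] by (rule sob_diff[OF sw u(1)])
  have vX: "v \<in> X" unfolding v_def[abs_def] by (rule diff_mem[OF X sw wX u(1) uX])
  define c where "c = 3 * E * s"
  have c: "c > 0" using E s by (simp add: c_def)
  have est: "AE x in M. norm (v x) \<le> c * norm (u x) \<and> norm (W x - U x) \<le> c * norm (Y x)"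
    using u(2) z(3)
  proof eventually_elim
    case (elim x)
    note e = pth_estimates[OF q(1) D s(1,2) elim(1) conjunct1[OF elim(2)] conjunct2[OF elim(2)], folded E_def, folded c_def]
    have "E * s * u x \<le> c * u x" using E s elim(1) unfolding c_def by (intro mult_right_mono) auto
    then have "\<bar>pth q s (u x) (z x) - u x\<bar> \<le> c * u x" using e(1) by linarith
    moreover have "norm (v x) = \<bar>pth q s (u x) (z x) - u x\<bar>" "norm (u x) = u x" using elim(1) by (simp_all add: v_def w_def)
    ultimately have 1: "norm (v x) \<le> c * norm (u x)" by simp
    have "W x - U x = (pA q s (u x) (z x) - 1) *\<^sub>R U x + pB q s (u x) (z x) *\<^sub>R Z x" by (simp add: W_def algebra_simps)
    also have "norm \<dots> \<le> c * norm (U x) + c * norm (Z x)"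
      by (intro norm_triangle_le add_mono) (auto intro!: mult_right_mono e)
    finally show ?case using 1 by (simp add: Y_def distrib_left)
  qed
  have "ps v \<le> c powr p * ps u" "ps (\<lambda>x. W x - U x) \<le> c powr p * ps Y"
    by (rule ps_le, use sob_meas[OF sv] LUZ LY est c in \<open>auto elim: eventually_mono\<close>)+
  then have "ps v + ps (\<lambda>x. W x - U x) \<le> c powr p * R" by (simp add: R_def distrib_left)
  also have "\<dots> < c powr p * (R + 1)" using c by simp
  also have "\<dots> = (K * s) powr p"
  proof -
    have "K * s = c * (R + 1) powr (1 / p)" by (simp add: K_def c_def)
    then show ?thesis using R p by (simp add: powr_mult powr_powr)
  qed
  finally have N: "W1p_norm \<Omega> p v < K * s" using norm_less[OF sv, of "K * s"] K s by simp
  have uv: "(\<lambda>x. u x + v x) = w" by (simp add: v_def)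
  have "\<bar>J w - J u\<bar> \<le> \<epsilon> * W1p_norm \<Omega> p v" using d(2)[OF vX] N s(3) uv by simp
  also have "\<dots> \<le> \<epsilon> * (K * s)" using N \<epsilon> by (intro mult_left_mono) auto
  also have "\<dots> = \<delta> * s / 2" using K by (simp add: \<epsilon>_def)
  finally have 1: "J u - J w \<le> \<delta> * s / 2" by linarith
  have "J w \<le> (1 - s) * J u + s * J z"
    unfolding J_def w_def[abs_def] by (rule energy_pth(1)[OF u(1) u0 z(1) z0 s(1) s1])
  then have "\<delta> * s \<le> J u - J w" by (simp add: \<delta>_def algebra_simps)
  then show False using 1 mult_pos_pos[OF \<delta> s(1)] by linarith
qed

text \<open>Each critical point is compared with the midpoint \<open>w\<close> instead of the other
  critical point. Since \<open>w\<close> is bounded by a multiple of either function,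
  \<open>critical_le\<close> applies twice and gives both energy hypotheses of
  \<open>rigidity\<close>.\<close>

lemma critical_rigidity:
  assumes X: "X = W01p \<Omega> p \<or> X = W1p \<Omega> p"
    and u: "u \<in> nonneg_critical_points \<Omega> p h g X" "\<And>x. x \<in> \<Omega> \<Longrightarrow> 0 < u x"
    and v: "v \<in> nonneg_critical_points \<Omega> p h g X" "\<And>x. x \<in> \<Omega> \<Longrightarrow> 0 < v x"
    and D: "\<exists>D\<ge>1. \<forall>x\<in>\<Omega>. v x \<le> D * u x" "\<exists>D\<ge>1. \<forall>x\<in>\<Omega>. u x \<le> D * v x"
  shows "same_class \<Omega> u v \<or> (\<exists>c d. (AE x in M. u x = c) \<and> (AE x in M. v x = d))"
proof -
  have cu: "critical_point X (W1p_norm \<Omega> p) (energy \<Omega> p h g) u" and cv: "critical_point X (W1p_norm \<Omega> p) (energy \<Omega> p h g) v"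
    using u v by (auto simp: nonneg_critical_points_def)
  have mem: "u \<in> X" "v \<in> X" using cu cv by (auto simp: critical_point_def)
  then have "u \<in> W1p \<Omega> p" "v \<in> W1p \<Omega> p" using X by (auto simp: W01p_def)
  then obtain U V where su: "sob u U" and sv: "sob v V" by (auto simp: W1p_iff)
  obtain D1 D2 where D1: "1 \<le> D1" "\<And>x. x \<in> \<Omega> \<Longrightarrow> v x \<le> D1 * u x" and D2: "1 \<le> D2" "\<And>x. x \<in> \<Omega> \<Longrightarrow> u x \<le> D2 * v x"
    using D by blast
  have sp: "AE x in M. x \<in> \<Omega>" using AE_space[of M] by simp
  have pos: "AE x in M. 0 < u x" "AE x in M. 0 < v x" using sp by (eventually_elim, simp add: u v)+
  have nn: "AE x in M. 0 \<le> u x" "AE x in M. 0 \<le> v x" using pos by (eventually_elim, simp)+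
  define w where "w x = pth q (1/2) (u x) (v x)" for x
  have half: "0 < (1/2::real)" "(1/2::real) < 1" by simp_all
  obtain W where sw: "sob w W" unfolding w_def[abs_def] using sob_pth(1)[OF q(1) half su sv] by blast
  have wX: "w \<in> X" unfolding w_def[abs_def] by (rule pth_mem[OF X half su mem(1) sv mem(2)])
  have wu: "0 \<le> w x \<and> w x \<le> D1 * u x" "0 \<le> w x \<and> w x \<le> D2 * v x" if x: "x \<in> \<Omega>" for x
  proof -
    have "0 < u x" "0 < v x" using u v x by auto
    then have "1 * u x \<le> D1 * u x" "1 * v x \<le> D2 * v x" using D1(1) D2(1) by (intro mult_right_mono; simp)+
    then show "0 \<le> w x \<and> w x \<le> D1 * u x" "0 \<le> w x \<and> w x \<le> D2 * v x"
      unfolding w_def using \<open>0 < u x\<close> \<open>0 < v x\<close> D1(2)[OF x] D2(2)[OF x] by (auto simp: pth_nonneg intro!: pth_le q)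
  qed
  have aw: "AE x in M. 0 \<le> w x \<and> w x \<le> D1 * u x" "AE x in M. 0 \<le> w x \<and> w x \<le> D2 * v x"
    using sp by (eventually_elim, use wu in blast)+
  have "energy \<Omega> p h g u \<le> energy \<Omega> p h g w" by (rule critical_le[OF X cu su pos(1) sw wX aw(1) D1(1)])
  moreover have "energy \<Omega> p h g v \<le> energy \<Omega> p h g w" by (rule critical_le[OF X cv sv pos(2) sw wX aw(2) D2(1)])
  ultimately show ?thesis unfolding w_def[abs_def] by (rule rigidity[OF su nn(1) sv nn(2)])
qed

text \<open>The midpoint of the path lies in \<open>X\<close>, so it competes with both minimizers,
  and no comparability of the two is required.\<close>

lemma minimizer_rigidity:
  assumes X: "X = W01p \<Omega> p \<or> X = W1p \<Omega> p"
    and u: "u \<in> nonneg_global_minimizers \<Omega> p h g X" and v: "v \<in> nonneg_global_minimizers \<Omega> p h g X"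
  shows "same_class \<Omega> u v \<or> (\<exists>c d. (AE x in M. u x = c) \<and> (AE x in M. v x = d))"
proof -
  have mem: "u \<in> X" "v \<in> X" and nn: "AE x in M. 0 \<le> u x" "AE x in M. 0 \<le> v x"
    and mn: "\<And>w. w \<in> X \<Longrightarrow> energy \<Omega> p h g u \<le> energy \<Omega> p h g w" "\<And>w. w \<in> X \<Longrightarrow> energy \<Omega> p h g v \<le> energy \<Omega> p h g w"
    using u v by (auto simp: nonneg_global_minimizers_def)
  have "u \<in> W1p \<Omega> p" "v \<in> W1p \<Omega> p" using mem X by (auto simp: W01p_def)
  then obtain U V where su: "sob u U" and sv: "sob v V" by (auto simp: W1p_iff)
  have wX: "(\<lambda>x. pth q (1/2) (u x) (v x)) \<in> X" by (rule pth_mem[OF X _ _ su mem(1) sv mem(2)]) simp_all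
  show ?thesis by (rule rigidity[OF su nn(1) sv nn(2) mn(1)[OF wX] mn(2)[OF wX]])
qed

lemma W01p_rigidity:
  assumes u: "u \<in> W01p \<Omega> p" and v: "v \<in> W01p \<Omega> p"
    and r: "same_class \<Omega> u v \<or> (\<exists>c d. (AE x in M. u x = c) \<and> (AE x in M. v x = d))"
  shows "same_class \<Omega> u v"
  using r
proof (elim disjE exE conjE)
  fix c d assume c: "AE x in M. u x = c" and d: "AE x in M. v x = d"
  have "u \<in> W1p \<Omega> p" "v \<in> W1p \<Omega> p" using u v by (auto simp: W01p_def)
  then obtain U V where su: "sob u U" and sv: "sob v V" by (auto simp: W1p_iff)
  have "c = 0" "d = 0" using W01p_constant[OF su u c ne] W01p_constant[OF sv v d ne] by auto
  moreover have "AE x in M. c = d \<longrightarrow> u x = v x" using c d by eventually_elim simp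
  ultimately show ?thesis by (simp add: same_class_def)
qed

end

theorem theorem1p3:
  fixes \<Omega> :: "(real ^ 'n) set"
    and p :: real
    and h :: "real \<Rightarrow> real"
    and g :: "real ^ 'n \<Rightarrow> real \<Rightarrow> real"
  assumes domain: "bounded \<Omega>" "smooth_domain \<Omega>"
    and p: "1 < p"
    and h_nonneg: "\<forall>t\<ge>0. 0 \<le> h t"
    and h_continuous: "continuous_on {0..} h"
    and h_bounded: "bounded (h ` {0..})"
    and h_mono: "mono_on {0..} h"
    and h_pos: "\<forall>t>0. 0 < h t"
    and g_caratheodory: "caratheodory \<Omega> g"
    and g_growth: "\<exists>C \<sigma>. 0 < C \<and> 0 < \<sigma> \<and>
          \<sigma> * (real CARD('n) - p) \<le> (p - 1) * real CARD('n) + p \<and>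
          (\<forall>x\<in>\<Omega>. \<forall>t. \<bar>g x t\<bar> \<le> C * (1 + \<bar>t\<bar> powr \<sigma>))"
    and g_antimono: "\<exists>q. 1 < q \<and> q < p \<and>
          (AE x in lebesgue_on \<Omega>. antimono_on {0<..} (\<lambda>t. g x t / t powr (q - 1)))"
  shows
    "(let A = nonneg_critical_points \<Omega> p h g (W01p \<Omega> p);
          B = nonneg_global_minimizers \<Omega> p h g (W01p \<Omega> p);
          P = strongly_positive_W01p \<Omega>
      in at_most_one_class \<Omega> (A \<inter> P) \<and> at_most_one_class \<Omega> B)
     \<and>
     (let A = nonneg_critical_points \<Omega> p h g (W1p \<Omega> p);
          B = nonneg_global_minimizers \<Omega> p h g (W1p \<Omega> p);
          P = strongly_positive_W1p \<Omega>
      in ((\<exists>u\<in>A \<inter> P. nonconstant \<Omega> u) \<longrightarrow> singleton_class \<Omega> (A \<inter> P)) \<and>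
         ((\<exists>u\<in>B. nonconstant \<Omega> u) \<longrightarrow> singleton_class \<Omega> B))"
proof -
  have dom: "\<Omega> \<noteq> {}" "open \<Omega>" "connected \<Omega>" and bd: "\<forall>x\<in>frontier \<Omega>. \<exists>U \<rho>. x \<in> U \<and> local_defining_function \<Omega> U \<rho>"
    using domain(2) by (auto simp: smooth_domain_def)
  obtain C \<sigma> where C: "0 < C" "0 < \<sigma>" "\<sigma> * (real CARD('n) - p) \<le> (p - 1) * real CARD('n) + p"
    "\<And>x t. x \<in> \<Omega> \<Longrightarrow> \<bar>g x t\<bar> \<le> C * (1 + \<bar>t\<bar> powr \<sigma>)" using g_growth by blast
  obtain q where q: "1 < q" "q < p" "AE x in lebesgue_on \<Omega>. antimono_on {0<..} (\<lambda>t. g x t / t powr (q - 1))"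
    using g_antimono by blast
  interpret energy_domain \<Omega> p h g q C \<sigma>
    by unfold_locales
      (use dom bd domain(1) p h_pos h_continuous h_mono h_bounded g_caratheodory C q in simp_all)
  have W0: "same_class \<Omega> u v"
    if "u \<in> nonneg_critical_points \<Omega> p h g (W01p \<Omega> p)" "u \<in> strongly_positive_W01p \<Omega>"
      "v \<in> nonneg_critical_points \<Omega> p h g (W01p \<Omega> p)" "v \<in> strongly_positive_W01p \<Omega>" for u v
  proof (rule W01p_rigidity)
    show "u \<in> W01p \<Omega> p" "v \<in> W01p \<Omega> p" using that by (auto simp: nonneg_critical_points_def critical_point_def)
    show "same_class \<Omega> u v \<or> (\<exists>c d. (AE x in M. u x = c) \<and> (AE x in M. v x = d))"
      by (rule critical_rigidity[OF _ that(1) _ that(3)])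
        (use that strongly_positive_W01p_comparable[OF \<Omega> bd] in \<open>auto simp: strongly_positive_W01p_def\<close>)
  qed
  have W1: "same_class \<Omega> u v"
    if "u \<in> nonneg_critical_points \<Omega> p h g (W1p \<Omega> p)" "u \<in> strongly_positive_W1p \<Omega>"
      "v \<in> nonneg_critical_points \<Omega> p h g (W1p \<Omega> p)" "v \<in> strongly_positive_W1p \<Omega>" "nonconstant \<Omega> u" for u v
  proof -
    have "same_class \<Omega> u v \<or> (\<exists>c d. (AE x in M. u x = c) \<and> (AE x in M. v x = d))"
    proof (rule critical_rigidity[OF _ that(1) _ that(3)])
      show "0 < u x" "0 < v x" if "x \<in> \<Omega>" for x
        using that \<open>u \<in> strongly_positive_W1p \<Omega>\<close> \<open>v \<in> strongly_positive_W1p \<Omega>\<close> closure_subset[of \<Omega>]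
        by (auto simp: strongly_positive_W1p_def)
    qed (use that strongly_positive_W1p_comparable[OF domain(1)] in auto)
    then show ?thesis using that(5) by (auto simp: nonconstant_def same_class_def)
  qed
  have B0: "same_class \<Omega> u v"
    if "u \<in> nonneg_global_minimizers \<Omega> p h g (W01p \<Omega> p)" "v \<in> nonneg_global_minimizers \<Omega> p h g (W01p \<Omega> p)" for u v
    using that by (intro W01p_rigidity minimizer_rigidity) (auto simp: nonneg_global_minimizers_def)
  have B1: "same_class \<Omega> u v"
    if "u \<in> nonneg_global_minimizers \<Omega> p h g (W1p \<Omega> p)" "v \<in> nonneg_global_minimizers \<Omega> p h g (W1p \<Omega> p)" "nonconstant \<Omega> u" for u v
    using minimizer_rigidity[OF _ that(1,2)] that(3) by (auto simp: nonconstant_def same_class_def)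
  show ?thesis
    unfolding Let_def at_most_one_class_def singleton_class_def using W0 W1 B0 B1 by blast
qed

end
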